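(* Let $A$ be a homologically smooth $\Bbbk$-algebra and let $d\ge 0$ be an integer. Suppose that (1) $\operatorname{Ext}^{i}_{A^e}(A,A^e)=0$ for all $i\neq d$; (2) $\operatorname{Ext}^{d}_{A^e}(A,A^e)$ is a finitely generated projective right $A$-module; (3) $\operatorname{Ext}^{d}_{A^e}(A,A^e)$ is isomorphic to $A$ as a left $A$-module. Then $A$ is a skew Calabi--Yau algebra of dimension $d$.
   Context: $\Bbbk$ is a field, all algebras are associative unital $\Bbbk$-algebras, $\otimes=\otimes_\Bbbk$, and $A^e=A\otimes A^{op}$. Right (or left) $A^e$-modules are identified with $A$-$A$-bimodules on which $\Bbbk$ acts centrally. For an $A^e$-module $M$, $\operatorname{Hom}_{A^e}(M,A^e)$ is an $A$-$A$-bimodule via $(afa')(m)=(a\otimes a')f(m)$ (using left multiplication on $A^e$); this induces $A$-$A$-bimodule structures on $\operatorname{Ext}^i_{A^e}(A,A^e)$ and makes $\mathbf{R}\mathrm{Hom}_{A^e}(A,A^e)$ an object of the derived category $\mathcal D(A^e)$. $A$ is homologically smooth if $A$ is perfect as a complex of $A^e$-modules, i.e. quasi-isomorphic to a bounded complex of finitely generated projective $A^e$-modules. For an algebra endomorphism $\mu$ of $A$, $A_\mu$ is the bimodule $A$ with $a\cdot m\cdot a'=am\mu(a')$. A homologically smooth algebra $A$ is skew Calabi--Yau of dimension $d$ if there is an algebra automorphism $\mu$ of $A$ (called a Nakayama automorphism) with $\mathbf{R}\mathrm{Hom}_{A^e}(A,A^e)\cong A_\mu[-d]$ in $\mathcal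 D^b(A^e)$. *)

theory Defs
  imports "HOL-Algebra.Module" "HOL-Algebra.AbelCoset"
begin

section \<open>Modules over a not necessarily commutative ring\<close>

text \<open>Modules are records of type \<open>('r, 'm) module\<close>; the fields \<open>mult\<close> and \<open>one\<close> that this type
  inherits from rings play no role for a module and are left undefined in the constructions
  below. A right module over \<open>R\<close> is a left module over the opposite ring \<open>opp R\<close>.\<close>

locale left_module = R?: ring R + M?: abelian_group M
  for R :: "('r, 'y) ring_scheme" (structure) and M :: "('r, 'm, 'z) module_scheme" (structure) +
  assumes smult_closed: "\<lbrakk>r \<in> carrier R; x \<in> carrier M\<rbrakk> \<Longrightarrow> r \<odot>\<^bsub>M\<^esub> x \<in> carrier M"
    and smult_l_distr: "\<lbrakk>r \<in> carrier R; s \<in> carrier R; x \<in> carrier M\<rbrakk> \<Longrightarrow>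
      (r \<oplus>\<^bsub>R\<^esub> s) \<odot>\<^bsub>M\<^esub> x = r \<odot>\<^bsub>M\<^esub> x \<oplus>\<^bsub>M\<^esub> s \<odot>\<^bsub>M\<^esub> x"
    and smult_r_distr: "\<lbrakk>r \<in> carrier R; x \<in> carrier M; y \<in> carrier M\<rbrakk> \<Longrightarrow>
      r \<odot>\<^bsub>M\<^esub> (x \<oplus>\<^bsub>M\<^esub> y) = r \<odot>\<^bsub>M\<^esub> x \<oplus>\<^bsub>M\<^esub> r \<odot>\<^bsub>M\<^esub> y"
    and smult_assoc: "\<lbrakk>r \<in> carrier R; s \<in> carrier R; x \<in> carrier M\<rbrakk> \<Longrightarrow>
      (r \<otimes>\<^bsub>R\<^esub> s) \<odot>\<^bsub>M\<^esub> x = r \<odot>\<^bsub>M\<^esub> (s \<odot>\<^bsub>M\<^esub> x)"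
    and smult_one: "x \<in> carrier M \<Longrightarrow> \<one>\<^bsub>R\<^esub> \<odot>\<^bsub>M\<^esub> x = x"

definition opp :: "('r, 'z) ring_scheme \<Rightarrow> ('r, 'z) ring_scheme" where
  "opp R = R\<lparr>mult := (\<lambda>x y. y \<otimes>\<^bsub>R\<^esub> x)\<rparr>"

definition mod_hom ::
  "('r, 'y) ring_scheme \<Rightarrow> ('r, 'm) module \<Rightarrow> ('r, 'n) module \<Rightarrow> ('m \<Rightarrow> 'n) set" where
  "mod_hom R M N = {h. h \<in> carrier M \<rightarrow> carrier N \<and>
     (\<forall>x\<in>carrier M. \<forall>y\<in>carrier M. h (x \<oplus>\<^bsub>M\<^esub> y) = h x \<oplus>\<^bsub>N\<^esub> h y) \<and>
     (\<forall>r\<in>carrier R. \<forall>x\<in>carrier M. h (r \<odot>\<^bsub>M\<^esub> x) = r \<odot>\<^bsub>N\<^esub> h x)}"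

definition mod_isomorphic ::
  "('r, 'y) ring_scheme \<Rightarrow> ('r, 'm) module \<Rightarrow> ('r, 'n) module \<Rightarrow> bool" where
  "mod_isomorphic R M N \<longleftrightarrow> (\<exists>h\<in>mod_hom R M N. bij_betw h (carrier M) (carrier N))"

definition regular_module :: "('r, 'y) ring_scheme \<Rightarrow> ('r, 'r) module" where
  "regular_module R = \<lparr>carrier = carrier R, mult = undefined, one = undefined,
     zero = \<zero>\<^bsub>R\<^esub>, add = add R, smult = mult R\<rparr>"

definition zero_submodule :: "('r, 'm) module \<Rightarrow> ('r, 'm) module" where
  "zero_submodule M = M\<lparr>carrier := {\<zero>\<^bsub>M\<^esub>}\<rparr>"

definition restrict_scalars :: "('s \<Rightarrow> 'r) \<Rightarrow> ('r, 'm) module \<Rightarrow> ('s, 'm) module" where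
  "restrict_scalars \<phi> M = \<lparr>carrier = carrier M, mult = undefined, one = undefined,
     zero = \<zero>\<^bsub>M\<^esub>, add = add M, smult = (\<lambda>s x. \<phi> s \<odot>\<^bsub>M\<^esub> x)\<rparr>"

definition quot_module :: "('r, 'm) module \<Rightarrow> 'm set \<Rightarrow> ('r, 'm set) module" where
  "quot_module M N = \<lparr>carrier = a_rcosets\<^bsub>M\<^esub> N, mult = undefined, one = undefined,
     zero = N, add = set_add M, smult = (\<lambda>r X. \<Union>x\<in>X. N +>\<^bsub>M\<^esub> (r \<odot>\<^bsub>M\<^esub> x))\<rparr>"

definition free_module :: "('r, 'y) ring_scheme \<Rightarrow> 'i set \<Rightarrow> ('r, 'i \<Rightarrow> 'r) module" where
  "free_module R I = \<lparr>carrier = {f. (\<forall>i\<in>I. f i \<in> carrier R) \<and> (\<forall>i. i \<notin> I \<longrightarrow> f i = \<zero>\<^bsub>R\<^esub>) \<and>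
       finite {i. f i \<noteq> \<zero>\<^bsub>R\<^esub>}},
     mult = undefined, one = undefined,
     zero = (\<lambda>i. \<zero>\<^bsub>R\<^esub>), add = (\<lambda>f g i. f i \<oplus>\<^bsub>R\<^esub> g i),
     smult = (\<lambda>r f i. r \<otimes>\<^bsub>R\<^esub> f i)\<rparr>"

definition finitely_generated :: "('r, 'y) ring_scheme \<Rightarrow> ('r, 'm) module \<Rightarrow> bool" where
  "finitely_generated R M \<longleftrightarrow> left_module R M \<and>
     (\<exists>S. finite S \<and> S \<subseteq> carrier M \<and>
       (\<forall>x\<in>carrier M. \<exists>c\<in>S \<rightarrow> carrier R. x = (\<Oplus>\<^bsub>M\<^esub>s\<in>S. c s \<odot>\<^bsub>M\<^esub> s)))"

text \<open>A module is projective if it is a direct summand of a free module. It is no restriction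
  that the basis is taken from the type of elements of \<open>M\<close>: a direct summand of any free module
  is also one of the free module on the set \<open>carrier M\<close>, which maps onto \<open>M\<close>.\<close>

definition projective :: "('r, 'y) ring_scheme \<Rightarrow> ('r, 'm) module \<Rightarrow> bool" where
  "projective R M \<longleftrightarrow> left_module R M \<and>
     (\<exists>I :: 'm set. \<exists>s\<in>mod_hom R M (free_module R I). \<exists>p\<in>mod_hom R (free_module R I) M.
       \<forall>x\<in>carrier M. p (s x) = x)"


section \<open>Cochain complexes and the derived category\<close>

record ('r, 'm) cochain =
  obj :: "int \<Rightarrow> ('r, 'm) module"
  diff :: "int \<Rightarrow> 'm \<Rightarrow> 'm"

definition cochain_complex :: "('r, 'y) ring_scheme \<Rightarrow> ('r, 'm) cochain \<Rightarrow> bool" where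
  "cochain_complex R C \<longleftrightarrow>
     (\<forall>i. left_module R (obj C i)) \<and>
     (\<forall>i. diff C i \<in> mod_hom R (obj C i) (obj C (i + 1))) \<and>
     (\<forall>i. \<forall>x\<in>carrier (obj C i). diff C (i + 1) (diff C i x) = \<zero>\<^bsub>obj C (i + 1 + 1)\<^esub>)"

definition cocycles :: "('r, 'm) cochain \<Rightarrow> int \<Rightarrow> 'm set" where
  "cocycles C i = {x \<in> carrier (obj C i). diff C i x = \<zero>\<^bsub>obj C (i + 1)\<^esub>}"

definition coboundaries :: "('r, 'm) cochain \<Rightarrow> int \<Rightarrow> 'm set" where
  "coboundaries C i = diff C (i - 1) ` carrier (obj C (i - 1))"

definition cohomology :: "('r, 'm) cochain \<Rightarrow> int \<Rightarrow> ('r, 'm set) module" where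
  "cohomology C i = quot_module ((obj C i)\<lparr>carrier := cocycles C i\<rparr>) (coboundaries C i)"

definition chain_map ::
  "('r, 'y) ring_scheme \<Rightarrow> ('r, 'm) cochain \<Rightarrow> ('r, 'n) cochain \<Rightarrow> (int \<Rightarrow> 'm \<Rightarrow> 'n) \<Rightarrow> bool" where
  "chain_map R C D f \<longleftrightarrow>
     (\<forall>i. f i \<in> mod_hom R (obj C i) (obj D i)) \<and>
     (\<forall>i. \<forall>x\<in>carrier (obj C i). f (i + 1) (diff C i x) = diff D i (f i x))"

definition cohomology_map ::
  "('r, 'n) cochain \<Rightarrow> (int \<Rightarrow> 'm \<Rightarrow> 'n) \<Rightarrow> int \<Rightarrow> 'm set \<Rightarrow> 'n set" where
  "cohomology_map D f i X = (\<Union>x\<in>X. coboundaries D i +>\<^bsub>obj D i\<^esub> f i x)"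

definition quasi_iso ::
  "('r, 'y) ring_scheme \<Rightarrow> ('r, 'm) cochain \<Rightarrow> ('r, 'n) cochain \<Rightarrow> (int \<Rightarrow> 'm \<Rightarrow> 'n) \<Rightarrow> bool" where
  "quasi_iso R C D f \<longleftrightarrow> cochain_complex R C \<and> cochain_complex R D \<and> chain_map R C D f \<and>
     (\<forall>i. bij_betw (cohomology_map D f i) (carrier (cohomology C i)) (carrier (cohomology D i)))"

text \<open>Two complexes are isomorphic in the derived category iff they are joined by a roof
  \<open>C \<leftarrow> X \<rightarrow> D\<close> of quasi-isomorphisms. The type of the elements of \<open>X\<close> is no restriction: by a
  Loewenheim-Skolem argument an arbitrary roof \<open>X\<close> contains a subcomplex which is still a
  roof and whose terms have cardinality at most that of \<open>R\<close>, \<open>C\<close>, \<open>D\<close> or \<open>nat\<close>, and such a complex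
  has a copy with elements in \<open>nat \<Rightarrow> 'r \<times> 'm \<times> 'n\<close>.\<close>

definition derived_isomorphic ::
  "('r, 'y) ring_scheme \<Rightarrow> ('r, 'm) cochain \<Rightarrow> ('r, 'n) cochain \<Rightarrow> bool" where
  "derived_isomorphic R C D \<longleftrightarrow>
     (\<exists>(X :: ('r, nat \<Rightarrow> 'r \<times> 'm \<times> 'n) cochain) f g. quasi_iso R X C f \<and> quasi_iso R X D g)"

text \<open>The module \<open>M\<close> as a complex in degree \<open>d\<close>, i.e. \<open>M[-d]\<close>.\<close>

definition concentrated :: "int \<Rightarrow> ('r, 'm) module \<Rightarrow> ('r, 'm) cochain" where
  "concentrated d M = \<lparr>obj = (\<lambda>i. if i = d then M else zero_submodule M),
     diff = (\<lambda>i x. \<zero>\<^bsub>M\<^esub>)\<rparr>"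

text \<open>Every finitely generated projective module is isomorphic to a submodule of some
  \<open>R^n\<close>, hence to one with elements in \<open>nat \<Rightarrow> 'r\<close>.\<close>

definition perfect :: "('r, 'y) ring_scheme \<Rightarrow> ('r, 'm) cochain \<Rightarrow> bool" where
  "perfect R C \<longleftrightarrow>
     (\<exists>P :: ('r, nat \<Rightarrow> 'r) cochain. cochain_complex R P \<and>
       (\<exists>a b. \<forall>i. i < a \<or> b < i \<longrightarrow> carrier (obj P i) = {\<zero>\<^bsub>obj P i\<^esub>}) \<and>
       (\<forall>i. finitely_generated R (obj P i) \<and> projective R (obj P i)) \<and>
       derived_isomorphic R P C)"

definition projective_resolution ::
  "('r, 'y) ring_scheme \<Rightarrow> ('r, 'p) cochain \<Rightarrow> ('r, 'm) cochain \<Rightarrow> bool" where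
  "projective_resolution R P C \<longleftrightarrow>
     (\<exists>b. \<forall>i>b. carrier (obj P i) = {\<zero>\<^bsub>obj P i\<^esub>}) \<and>
     (\<forall>i. projective R (obj P i)) \<and>
     (\<exists>f. quasi_iso R P C f)"

text \<open>For a right \<open>R\<close>-module \<open>M\<close>, the left \<open>R\<close>-module \<open>Hom\<^sub>R(M, R)\<close> with \<open>(r f)(m) = r f(m)\<close>.\<close>

definition dual_module :: "('r, 'y) ring_scheme \<Rightarrow> ('r, 'm) module \<Rightarrow> ('r, 'm \<Rightarrow> 'r) module" where
  "dual_module R M = \<lparr>carrier = mod_hom (opp R) M (regular_module (opp R)) \<inter> extensional (carrier M),
     mult = undefined, one = undefined,
     zero = (\<lambda>m\<in>carrier M. \<zero>\<^bsub>R\<^esub>),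
     add = (\<lambda>f g. \<lambda>m\<in>carrier M. f m \<oplus>\<^bsub>R\<^esub> g m),
     smult = (\<lambda>r f. \<lambda>m\<in>carrier M. r \<otimes>\<^bsub>R\<^esub> f m)\<rparr>"

text \<open>\<open>Hom\<^sub>R(P, R)\<close> for a complex \<open>P\<close> of right \<open>R\<close>-modules, obtained by applying the contravariant
  functor \<open>Hom\<^sub>R(-, R)\<close> degreewise; with the sign convention \<open>d f = (-1)^(i+1) f \<circ> d\<close> in degree \<open>i\<close>
  one gets an isomorphic complex.\<close>

definition dual_complex :: "('r, 'y) ring_scheme \<Rightarrow> ('r, 'm) cochain \<Rightarrow> ('r, 'm \<Rightarrow> 'r) cochain" where
  "dual_complex R P = \<lparr>obj = (\<lambda>i. dual_module R (obj P (- i))),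
     diff = (\<lambda>i f. \<lambda>m\<in>carrier (obj P (- i - 1)). f (diff P (- i - 1) m))\<rparr>"

text \<open>\<open>RHom\<^sub>R(C, R)\<close> for a bounded above complex \<open>C\<close> of right \<open>R\<close>-modules, computed by a chosen
  projective resolution. For cardinality reasons there is a resolution by free modules whose
  elements live in \<open>nat \<Rightarrow> 'r \<times> 'm\<close>.\<close>

definition RHom_dual ::
  "('r, 'y) ring_scheme \<Rightarrow> ('r, 'm) cochain \<Rightarrow> ('r, (nat \<Rightarrow> 'r \<times> 'm) \<Rightarrow> 'r) cochain" where
  "RHom_dual R C = dual_complex R (SOME P. projective_resolution (opp R) P C)"



section \<open>Algebras and enveloping algebras\<close>

text \<open>An associative unital \<open>K\<close>-algebra; the zero algebra is not excluded.\<close>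

locale assoc_algebra = K?: field K + module K A + A?: ring A
  for K :: "('k, 'y) ring_scheme" (structure) and A :: "('k, 'a, 'z) module_scheme" (structure) +
  assumes smult_mult_left: "\<lbrakk>c \<in> carrier K; x \<in> carrier A; y \<in> carrier A\<rbrakk> \<Longrightarrow>
      (c \<odot>\<^bsub>A\<^esub> x) \<otimes>\<^bsub>A\<^esub> y = c \<odot>\<^bsub>A\<^esub> (x \<otimes>\<^bsub>A\<^esub> y)"
    and smult_mult_right: "\<lbrakk>c \<in> carrier K; x \<in> carrier A; y \<in> carrier A\<rbrakk> \<Longrightarrow>
      x \<otimes>\<^bsub>A\<^esub> (c \<odot>\<^bsub>A\<^esub> y) = c \<odot>\<^bsub>A\<^esub> (x \<otimes>\<^bsub>A\<^esub> y)"

definition algebra_automorphism :: "('k, 'y) ring_scheme \<Rightarrow> ('k, 'a) module \<Rightarrow> ('a \<Rightarrow> 'a) \<Rightarrow> bool" where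
  "algebra_automorphism K A \<mu> \<longleftrightarrow> \<mu> \<in> ring_hom A A \<and> bij_betw \<mu> (carrier A) (carrier A) \<and>
     (\<forall>c\<in>carrier K. \<forall>x\<in>carrier A. \<mu> (c \<odot>\<^bsub>A\<^esub> x) = c \<odot>\<^bsub>A\<^esub> \<mu> x)"

text \<open>The tensor product of two \<open>K\<close>-algebras. A list \<open>[(a1, b1), ..., (an, bn)]\<close> stands for the
  sum of the \<open>ai \<otimes> bi\<close>, and \<open>tensor_eq\<close> is the congruence presenting the tensor product as a
  commutative monoid with concatenation as addition. The rule \<open>zero\<close> ensures that
  \<open>(- a) \<otimes> b\<close> is an inverse of \<open>a \<otimes> b\<close>, so that the quotient is a group.\<close>

inductive tensor_eq ::
  "('k, 'y) ring_scheme \<Rightarrow> ('k, 'a) module \<Rightarrow> ('k, 'b) module \<Rightarrow>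
   ('a \<times> 'b) list \<Rightarrow> ('a \<times> 'b) list \<Rightarrow> bool"
  for K A B where
  refl: "set xs \<subseteq> carrier A \<times> carrier B \<Longrightarrow> tensor_eq K A B xs xs"
| sym: "tensor_eq K A B xs ys \<Longrightarrow> tensor_eq K A B ys xs"
| trans: "\<lbrakk>tensor_eq K A B xs ys; tensor_eq K A B ys zs\<rbrakk> \<Longrightarrow> tensor_eq K A B xs zs"
| append: "\<lbrakk>tensor_eq K A B xs xs'; tensor_eq K A B ys ys'\<rbrakk> \<Longrightarrow>
    tensor_eq K A B (xs @ ys) (xs' @ ys')"
| comm: "\<lbrakk>set xs \<subseteq> carrier A \<times> carrier B; set ys \<subseteq> carrier A \<times> carrier B\<rbrakk> \<Longrightarrow>
    tensor_eq K A B (xs @ ys) (ys @ xs)"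
| add_left: "\<lbrakk>a \<in> carrier A; a' \<in> carrier A; b \<in> carrier B\<rbrakk> \<Longrightarrow>
    tensor_eq K A B [(a \<oplus>\<^bsub>A\<^esub> a', b)] [(a, b), (a', b)]"
| add_right: "\<lbrakk>a \<in> carrier A; b \<in> carrier B; b' \<in> carrier B\<rbrakk> \<Longrightarrow>
    tensor_eq K A B [(a, b \<oplus>\<^bsub>B\<^esub> b')] [(a, b), (a, b')]"
| zero: "b \<in> carrier B \<Longrightarrow> tensor_eq K A B [(\<zero>\<^bsub>A\<^esub>, b)] []"
| balanced: "\<lbrakk>c \<in> carrier K; a \<in> carrier A; b \<in> carrier B\<rbrakk> \<Longrightarrow>
    tensor_eq K A B [(c \<odot>\<^bsub>A\<^esub> a, b)] [(a, c \<odot>\<^bsub>B\<^esub> b)]"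

definition tensor_class ::
  "('k, 'y) ring_scheme \<Rightarrow> ('k, 'a) module \<Rightarrow> ('k, 'b) module \<Rightarrow>
   ('a \<times> 'b) list \<Rightarrow> ('a \<times> 'b) list set" where
  "tensor_class K A B xs = {ys. tensor_eq K A B xs ys}"

definition tensor_ring ::
  "('k, 'y) ring_scheme \<Rightarrow> ('k, 'a) module \<Rightarrow> ('k, 'b) module \<Rightarrow> ('a \<times> 'b) list set ring" where
  "tensor_ring K A B =
    \<lparr>carrier = tensor_class K A B ` {xs. set xs \<subseteq> carrier A \<times> carrier B},
     mult = (\<lambda>X Y. \<Union>xs\<in>X. \<Union>ys\<in>Y.
       tensor_class K A B [(a \<otimes>\<^bsub>A\<^esub> a', b \<otimes>\<^bsub>B\<^esub> b'). (a, b) \<leftarrow> xs, (a', b') \<leftarrow> ys]),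
     one = tensor_class K A B [(\<one>\<^bsub>A\<^esub>, \<one>\<^bsub>B\<^esub>)],
     zero = tensor_class K A B [],
     add = (\<lambda>X Y. \<Union>xs\<in>X. \<Union>ys\<in>Y. tensor_class K A B (xs @ ys))\<rparr>"

definition env :: "('k, 'y) ring_scheme \<Rightarrow> ('k, 'a) module \<Rightarrow> ('a \<times> 'a) list set ring" where
  "env K A = tensor_ring K A (opp A)"

definition list_sum :: "('a, 'z) ring_scheme \<Rightarrow> 'a list \<Rightarrow> 'a" where
  "list_sum A xs = foldr (add A) xs \<zero>\<^bsub>A\<^esub>"

text \<open>The bimodule \<open>A\<close> as a right module over \<open>env K A\<close>: the sum of the \<open>a \<otimes> b\<close> acts on \<open>m\<close> by
  \<open>m \<cdot> (a \<otimes> b) = b m a\<close>. Here and below the image under \<open>the_elem\<close> is a singleton as the sum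
  depends only on the class \<open>X\<close>.\<close>

definition diagonal_bimodule :: "('k, 'a) module \<Rightarrow> (('a \<times> 'a) list set, 'a) module" where
  "diagonal_bimodule A = \<lparr>carrier = carrier A, mult = undefined, one = undefined,
     zero = \<zero>\<^bsub>A\<^esub>, add = add A,
     smult = (\<lambda>X m. the_elem ((\<lambda>xs. list_sum A [b \<otimes>\<^bsub>A\<^esub> m \<otimes>\<^bsub>A\<^esub> a. (a, b) \<leftarrow> xs]) ` X))\<rparr>"

text \<open>The bimodule \<open>A\<^sub>\<mu>\<close> as a left module over \<open>env K A\<close>: \<open>(a \<otimes> b) \<cdot> m = a m \<mu>(b)\<close>.\<close>

definition twisted_bimodule ::
  "('k, 'a) module \<Rightarrow> ('a \<Rightarrow> 'a) \<Rightarrow> (('a \<times> 'a) list set, 'a) module" where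
  "twisted_bimodule A \<mu> = \<lparr>carrier = carrier A, mult = undefined, one = undefined,
     zero = \<zero>\<^bsub>A\<^esub>, add = add A,
     smult = (\<lambda>X m. the_elem ((\<lambda>xs. list_sum A [a \<otimes>\<^bsub>A\<^esub> m \<otimes>\<^bsub>A\<^esub> \<mu> b. (a, b) \<leftarrow> xs]) ` X))\<rparr>"

text \<open>The left and the right \<open>A\<close>-module underlying a left module over \<open>env K A\<close>, via
  \<open>a \<mapsto> a \<otimes> 1\<close> and \<open>a \<mapsto> 1 \<otimes> a\<close>; the latter is a left module over \<open>opp A\<close>.\<close>

definition left_part ::
  "('k, 'y) ring_scheme \<Rightarrow> ('k, 'a) module \<Rightarrow> (('a \<times> 'a) list set, 'm) module \<Rightarrow> ('a, 'm) module" where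
  "left_part K A M = restrict_scalars (\<lambda>a. tensor_class K A (opp A) [(a, \<one>\<^bsub>A\<^esub>)]) M"

definition right_part ::
  "('k, 'y) ring_scheme \<Rightarrow> ('k, 'a) module \<Rightarrow> (('a \<times> 'a) list set, 'm) module \<Rightarrow> ('a, 'm) module" where
  "right_part K A M = restrict_scalars (\<lambda>a. tensor_class K A (opp A) [(\<one>\<^bsub>A\<^esub>, a)]) M"

definition homologically_smooth :: "('k, 'y) ring_scheme \<Rightarrow> ('k, 'a) module \<Rightarrow> bool" where
  "homologically_smooth K A \<longleftrightarrow> perfect (opp (env K A)) (concentrated 0 (diagonal_bimodule A))"

text \<open>\<open>RHom(A, A\<^sup>e)\<close> and \<open>Ext\<^sup>i(A, A\<^sup>e)\<close> over \<open>A\<^sup>e\<close>, with the bimodule structure induced by left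
  multiplication on \<open>A\<^sup>e\<close>.\<close>

definition RHom_env where
  "RHom_env K A = RHom_dual (env K A) (concentrated 0 (diagonal_bimodule A))"

definition Ext_env where
  "Ext_env K A i = cohomology (RHom_env K A) i"

definition skew_Calabi_Yau :: "('k, 'y) ring_scheme \<Rightarrow> ('k, 'a) module \<Rightarrow> nat \<Rightarrow> bool" where
  "skew_Calabi_Yau K A d \<longleftrightarrow> homologically_smooth K A \<and>
     (\<exists>\<mu>. algebra_automorphism K A \<mu> \<and>
       derived_isomorphic (env K A) (RHom_env K A) (concentrated (int d) (twisted_bimodule A \<mu>)))"

end

theory Submission
  imports Defs
begin

text \<open>
  A generator of the left module \<open>U = Ext\<^sup>d(A, A\<^sup>e)\<close> identifies \<open>U\<close> with \<open>A\<^sub>\<phi>\<close> for an algebra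
  endomorphism \<open>\<phi>\<close>, and the point is that \<open>\<phi>\<close> is bijective. If \<open>P\<close> is a bounded resolution of \<open>A\<close> by
  finitely generated projective bimodules, then \<open>Q = Hom(P, A\<^sup>e)\<close> is up to a shift a projective
  resolution of \<open>U\<close> with \<open>Hom(Q, A\<^sup>e) = P\<close>. As \<open>A\<^sub>\<phi>\<close> is finitely generated projective on the right,
  restricting one of the two actions on \<open>P\<close> along \<open>\<phi>\<close> gives a second projective resolution \<open>X\<close> of
  \<open>U\<close>. Comparing the duals of \<open>Q\<close> and \<open>X\<close> shows that the zeroth cohomology of \<open>Hom(X, A\<^sup>e)\<close> is
  isomorphic to \<open>A\<close> as a bimodule, with a generating cocycle \<open>h\<^sub>0\<close>.

  Call an additive \<open>f : A \<rightarrow> A\<close> semilinear if \<open>f(x \<phi>(b)) = f(x) b\<close>. Every such \<open>f\<close> can be read off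
  from the class of a cocycle in \<open>Hom(X, A\<^sup>e)\<close>. Hence if \<open>g\<close> is the form belonging to \<open>h\<^sub>0\<close>, then
  every \<open>f\<close> equals \<open>a g\<close> for some \<open>a\<close>, and \<open>g(\<phi>(a) x) = a g(x)\<close>. For \<open>y\<close> in \<open>A\<close> the form \<open>x \<mapsto> g(y x)\<close>
  is \<open>r g\<close> for some \<open>r\<close>, so that \<open>g(y) = r g(1) = g(\<phi>(r))\<close>. Since the semilinear forms separate
  points, \<open>y = \<phi>(r)\<close>. For injectivity, \<open>h\<^sub>0\<close> is cohomologous to a sum of maps
  \<open>p \<mapsto> hat f (q\<^sub>0 p) n\<close>, where \<open>f\<close> is semilinear, \<open>hat f (x \<otimes> y) = y \<otimes> f(x)\<close>, and \<open>q\<^sub>0\<close> is a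
  cocycle of \<open>Q\<close> in the class of \<open>1\<close>. If \<open>\<phi>(b) = 0\<close>, these become coboundaries when multiplied by
  \<open>b \<otimes> 1\<close>. Then \<open>b\<close> annihilates the class of \<open>h\<^sub>0\<close>, whence \<open>b = 0\<close>.
\<close>

section \<open>Additive and linear maps\<close>

text \<open>No chain condition is imposed on \<open>A\<close>, so a one-sided property of an
  endomorphism does not give the other, and the two halves of bijectivity need separate arguments.
  Both exploit that the semilinear forms are the dual of A_\<phi> as a right module, which is
  finitely generated projective by hypothesis. A complex returns from its second dual only if its
  terms are finitely generated projective. The resolution chosen inside RHom is merely projective
  and bounded above, so the work is done with the finite resolution that smoothness provides, and
  the class map is carried over to it. The class map of Hom(P, A^e) is given on cocycles only. A map
  onto the truncation that is homotopic to the identity extends it to all cochains of degree d. A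
  linear map from the dual of a finitely generated projective module to A_\<phi> is an element of
  the module tensored with A_\<phi>; this is the origin of \<open>p\<^sub>1\<close>, the element at
  which cocycles are evaluated to obtain forms, and the reason why that evaluation does not see
  coboundaries.\<close>

definition add_hom :: "('a, 'x) ring_scheme \<Rightarrow> ('b, 'y) ring_scheme \<Rightarrow> ('a \<Rightarrow> 'b) \<Rightarrow> bool" where
  "add_hom G H h \<longleftrightarrow> h \<in> carrier G \<rightarrow> carrier H \<and>
     (\<forall>x\<in>carrier G. \<forall>y\<in>carrier G. h (x \<oplus>\<^bsub>G\<^esub> y) = h x \<oplus>\<^bsub>H\<^esub> h y)"

lemma add_homI:
  assumes "\<And>x. x \<in> carrier G \<Longrightarrow> h x \<in> carrier H"
    and "\<And>x y. x \<in> carrier G \<Longrightarrow> y \<in> carrier G \<Longrightarrow> h (x \<oplus>\<^bsub>G\<^esub> y) = h x \<oplus>\<^bsub>H\<^esub> h y"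
  shows "add_hom G H h"
  using assms by (auto simp: add_hom_def)

lemma add_homD:
  assumes "add_hom G H h" "x \<in> carrier G"
  shows add_hom_closed: "h x \<in> carrier H"
    and add_hom_add: "y \<in> carrier G \<Longrightarrow> h (x \<oplus>\<^bsub>G\<^esub> y) = h x \<oplus>\<^bsub>H\<^esub> h y"
  using assms by (auto simp: add_hom_def)

lemma add_hom_comp: "add_hom G H f \<Longrightarrow> add_hom H L g \<Longrightarrow> add_hom G L (\<lambda>x. g (f x))"
  by (auto simp: add_hom_def Pi_iff)

lemma add_hom_ident: "add_hom G G (\<lambda>x. x)"
  by (simp add: add_hom_def)

lemma (in abelian_group) double_eq_self:
  assumes "x \<in> carrier G" "x \<oplus> x = x" shows "x = \<zero>"
  using assms by (metis add.l_cancel_one)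

lemma add_hom_zero:
  assumes "abelian_group G" "abelian_group H" "add_hom G H h"
  shows "h \<zero>\<^bsub>G\<^esub> = \<zero>\<^bsub>H\<^esub>"
proof -
  interpret G: abelian_group G by fact
  interpret H: abelian_group H by fact
  have "h \<zero>\<^bsub>G\<^esub> \<oplus>\<^bsub>H\<^esub> h \<zero>\<^bsub>G\<^esub> = h \<zero>\<^bsub>G\<^esub>"
    using add_hom_add[OF assms(3) G.zero_closed G.zero_closed] by simp
  then show ?thesis using add_hom_closed[OF assms(3) G.zero_closed] H.double_eq_self by blast
qed

lemma add_hom_minus:
  assumes "abelian_group G" "abelian_group H" "add_hom G H h" "x \<in> carrier G"
  shows "h (\<ominus>\<^bsub>G\<^esub> x) = \<ominus>\<^bsub>H\<^esub> h x"
proof -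
  interpret G: abelian_group G by fact
  interpret H: abelian_group H by fact
  have "h (\<ominus>\<^bsub>G\<^esub> x) \<oplus>\<^bsub>H\<^esub> h x = \<zero>\<^bsub>H\<^esub>"
    using add_hom_add[OF assms(3), of "\<ominus>\<^bsub>G\<^esub> x" x] add_hom_zero[OF assms(1-3)] assms(4)
    by (simp add: G.l_neg)
  then show ?thesis
    using add_hom_closed[OF assms(3)] assms(4) by (metis G.a_inv_closed H.minus_equality)
qed

lemma add_hom_finsum:
  assumes "abelian_group G" "abelian_group H" "add_hom G H h" "f \<in> I \<rightarrow> carrier G"
  shows "h (finsum G f I) = finsum H (\<lambda>i. h (f i)) I"
proof -
  interpret G: abelian_group G by fact
  interpret H: abelian_group H by fact
  show ?thesis
  proof (cases "finite I")
    case True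
    then show ?thesis using assms(4)
    proof (induction I)
      case empty
      then show ?case by (simp add: add_hom_zero[OF assms(1-3)])
    next
      case (insert i I)
      have "f \<in> I \<rightarrow> carrier G" "f i \<in> carrier G" using insert.prems by auto
      moreover have "(\<lambda>i. h (f i)) \<in> I \<rightarrow> carrier H" "h (f i) \<in> carrier H"
        using insert.prems add_hom_closed[OF assms(3)] by auto
      ultimately show ?case using insert by (simp add: add_hom_add[OF assms(3)])
    qed
  next
    case False
    then show ?thesis by (simp add: G.finsum_infinite H.finsum_infinite add_hom_zero[OF assms(1-3)])
  qed
qed

lemma left_moduleD:
  assumes "left_module R M"
  shows left_module_ring: "ring R" and left_module_group: "abelian_group M"
  using assms by (auto simp: left_module_def)

lemma left_moduleI:
  assumes "ring R" "abelian_group M"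
    and "\<And>r x. \<lbrakk>r \<in> carrier R; x \<in> carrier M\<rbrakk> \<Longrightarrow> r \<odot>\<^bsub>M\<^esub> x \<in> carrier M"
    and "\<And>r s x. \<lbrakk>r \<in> carrier R; s \<in> carrier R; x \<in> carrier M\<rbrakk> \<Longrightarrow>
      (r \<oplus>\<^bsub>R\<^esub> s) \<odot>\<^bsub>M\<^esub> x = r \<odot>\<^bsub>M\<^esub> x \<oplus>\<^bsub>M\<^esub> s \<odot>\<^bsub>M\<^esub> x"
    and "\<And>r x y. \<lbrakk>r \<in> carrier R; x \<in> carrier M; y \<in> carrier M\<rbrakk> \<Longrightarrow>
      r \<odot>\<^bsub>M\<^esub> (x \<oplus>\<^bsub>M\<^esub> y) = r \<odot>\<^bsub>M\<^esub> x \<oplus>\<^bsub>M\<^esub> r \<odot>\<^bsub>M\<^esub> y"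
    and "\<And>r s x. \<lbrakk>r \<in> carrier R; s \<in> carrier R; x \<in> carrier M\<rbrakk> \<Longrightarrow>
      (r \<otimes>\<^bsub>R\<^esub> s) \<odot>\<^bsub>M\<^esub> x = r \<odot>\<^bsub>M\<^esub> (s \<odot>\<^bsub>M\<^esub> x)"
    and "\<And>x. x \<in> carrier M \<Longrightarrow> \<one>\<^bsub>R\<^esub> \<odot>\<^bsub>M\<^esub> x = x"
  shows "left_module R M"
  using assms unfolding left_module_def left_module_axioms_def by blast

lemma (in left_module)
  shows add_hom_smult_right: "r \<in> carrier R \<Longrightarrow> add_hom M M (\<lambda>x. r \<odot>\<^bsub>M\<^esub> x)"
    and add_hom_smult_left: "x \<in> carrier M \<Longrightarrow> add_hom R M (\<lambda>r. r \<odot>\<^bsub>M\<^esub> x)"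
  by (auto intro!: add_homI simp: smult_closed smult_l_distr smult_r_distr)

lemma (in left_module)
  shows smult_r_null: "r \<in> carrier R \<Longrightarrow> r \<odot>\<^bsub>M\<^esub> \<zero>\<^bsub>M\<^esub> = \<zero>\<^bsub>M\<^esub>"
    and smult_l_null: "x \<in> carrier M \<Longrightarrow> \<zero>\<^bsub>R\<^esub> \<odot>\<^bsub>M\<^esub> x = \<zero>\<^bsub>M\<^esub>"
    and smult_r_minus: "r \<in> carrier R \<Longrightarrow> x \<in> carrier M \<Longrightarrow> r \<odot>\<^bsub>M\<^esub> (\<ominus>\<^bsub>M\<^esub> x) = \<ominus>\<^bsub>M\<^esub> (r \<odot>\<^bsub>M\<^esub> x)"
    and smult_finsum_right: "r \<in> carrier R \<Longrightarrow> f \<in> I \<rightarrow> carrier M \<Longrightarrow>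
        r \<odot>\<^bsub>M\<^esub> finsum M f I = finsum M (\<lambda>i. r \<odot>\<^bsub>M\<^esub> f i) I"
  using add_hom_zero[OF M.abelian_group_axioms M.abelian_group_axioms add_hom_smult_right]
    add_hom_zero[OF R.abelian_group_axioms M.abelian_group_axioms add_hom_smult_left]
    add_hom_minus[OF M.abelian_group_axioms M.abelian_group_axioms add_hom_smult_right]
    add_hom_finsum[OF M.abelian_group_axioms M.abelian_group_axioms add_hom_smult_right]
  by auto

lemma mod_homI:
  assumes "\<And>x. x \<in> carrier M \<Longrightarrow> h x \<in> carrier N"
    and "\<And>x y. x \<in> carrier M \<Longrightarrow> y \<in> carrier M \<Longrightarrow> h (x \<oplus>\<^bsub>M\<^esub> y) = h x \<oplus>\<^bsub>N\<^esub> h y"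
    and "\<And>r x. r \<in> carrier R \<Longrightarrow> x \<in> carrier M \<Longrightarrow> h (r \<odot>\<^bsub>M\<^esub> x) = r \<odot>\<^bsub>N\<^esub> h x"
  shows "h \<in> mod_hom R M N"
  using assms by (auto simp: mod_hom_def)

lemma
  assumes "h \<in> mod_hom R M N" "x \<in> carrier M"
  shows mod_hom_closed: "h x \<in> carrier N"
    and mod_hom_add: "y \<in> carrier M \<Longrightarrow> h (x \<oplus>\<^bsub>M\<^esub> y) = h x \<oplus>\<^bsub>N\<^esub> h y"
    and mod_hom_smult: "r \<in> carrier R \<Longrightarrow> h (r \<odot>\<^bsub>M\<^esub> x) = r \<odot>\<^bsub>N\<^esub> h x"
  using assms by (auto simp: mod_hom_def)

lemma mod_hom_add_hom: "h \<in> mod_hom R M N \<Longrightarrow> add_hom M N h"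
  by (auto simp: mod_hom_def add_hom_def)

lemma
  assumes "abelian_group M" "abelian_group N" "h \<in> mod_hom R M N"
  shows mod_hom_zero: "h \<zero>\<^bsub>M\<^esub> = \<zero>\<^bsub>N\<^esub>"
    and mod_hom_minus: "x \<in> carrier M \<Longrightarrow> h (\<ominus>\<^bsub>M\<^esub> x) = \<ominus>\<^bsub>N\<^esub> h x"
    and mod_hom_finsum: "f \<in> I \<rightarrow> carrier M \<Longrightarrow> h (finsum M f I) = finsum N (\<lambda>i. h (f i)) I"
  using add_hom_zero add_hom_minus add_hom_finsum mod_hom_add_hom[OF assms(3)] assms(1,2) by metis+

lemma mod_hom_comp:
  "f \<in> mod_hom R L M \<Longrightarrow> g \<in> mod_hom R M N \<Longrightarrow> (\<lambda>x. g (f x)) \<in> mod_hom R L N"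
  by (auto simp: mod_hom_def Pi_iff)

lemma mod_hom_plus:
  assumes "left_module R N" "f \<in> mod_hom R M N" "g \<in> mod_hom R M N"
  shows "(\<lambda>x. f x \<oplus>\<^bsub>N\<^esub> g x) \<in> mod_hom R M N"
proof -
  interpret left_module R N by fact
  show ?thesis
    by (intro mod_homI)
      (auto simp: mod_hom_closed[OF assms(2)] mod_hom_closed[OF assms(3)] mod_hom_add[OF assms(2)]
        mod_hom_add[OF assms(3)] mod_hom_smult[OF assms(2)] mod_hom_smult[OF assms(3)]
        smult_r_distr M.a_ac)
qed

lemma mod_hom_uminus:
  assumes "left_module R N" "f \<in> mod_hom R M N"
  shows "(\<lambda>x. \<ominus>\<^bsub>N\<^esub> f x) \<in> mod_hom R M N"
proof -
  interpret left_module R N by fact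
  show ?thesis
    by (intro mod_homI)
      (auto simp: mod_hom_closed[OF assms(2)] mod_hom_add[OF assms(2)] mod_hom_smult[OF assms(2)]
        smult_r_minus M.minus_add)
qed

lemma mod_hom_const_zero: "left_module R N \<Longrightarrow> (\<lambda>x. \<zero>\<^bsub>N\<^esub>) \<in> mod_hom R M N"
proof -
  assume "left_module R N"
  then interpret left_module R N .
  show ?thesis by (intro mod_homI) (auto simp: smult_r_null)
qed

lemma mod_hom_id: "(\<lambda>x. x) \<in> mod_hom R M M"
  by (auto simp: mod_hom_def)

section \<open>Finite sums, and coordinates on projective modules\<close>

lemma (in abelian_monoid) finsum_superset:
  assumes "finite J" "I \<subseteq> J" "f \<in> I \<rightarrow> carrier G" "\<And>j. j \<in> J - I \<Longrightarrow> f j = \<zero>"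
  shows "finsum G f J = finsum G f I"
proof -
  have "f \<in> J \<rightarrow> carrier G" using assms by (metis Diff_iff Pi_iff zero_closed)
  then show ?thesis using add.finprod_mono_neutral_cong_right[OF assms(1,2), of f f] assms(4) by auto
qed

lemma (in abelian_monoid) finsum_swap:
  assumes "finite I" "finite J" "\<And>i j. i \<in> I \<Longrightarrow> j \<in> J \<Longrightarrow> f i j \<in> carrier G"
  shows "finsum G (\<lambda>i. finsum G (f i) J) I = finsum G (\<lambda>j. finsum G (\<lambda>i. f i j) I) J"
  using assms(1,3)
proof (induction I)
  case empty
  then show ?case by simp
next
  case (insert i I)
  have "finsum G (\<lambda>i. finsum G (f i) J) (insert i I)
      = finsum G (f i) J \<oplus> finsum G (\<lambda>i. finsum G (f i) J) I"
    using insert by (intro finsum_insert) (auto intro!: finsum_closed)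
  also have "\<dots> = finsum G (f i) J \<oplus> finsum G (\<lambda>j. finsum G (\<lambda>i. f i j) I) J"
    using insert by simp
  also have "\<dots> = finsum G (\<lambda>j. f i j \<oplus> finsum G (\<lambda>i. f i j) I) J"
    using insert.prems by (intro finsum_addf[symmetric]) (auto intro!: finsum_closed)
  also have "\<dots> = finsum G (\<lambda>j. finsum G (\<lambda>i. f i j) (insert i I)) J"
    using insert by (intro finsum_cong') (auto intro!: finsum_closed finsum_insert[symmetric])
  finally show ?case .
qed

text \<open>Projectivity by coordinates; in contrast to \<open>projective\<close> the index type is arbitrary.\<close>

definition dual_basis ::
  "('r, 'y) ring_scheme \<Rightarrow> ('r, 'm) module \<Rightarrow> 'i set \<Rightarrow> ('i \<Rightarrow> 'm) \<Rightarrow> ('i \<Rightarrow> 'm \<Rightarrow> 'r) \<Rightarrow> bool" where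
  "dual_basis R M I e c \<longleftrightarrow> e \<in> I \<rightarrow> carrier M \<and>
     (\<forall>i\<in>I. c i \<in> mod_hom R M (regular_module R)) \<and>
     (\<forall>x\<in>carrier M. finite {i \<in> I. c i x \<noteq> \<zero>\<^bsub>R\<^esub>} \<and>
        x = (\<Oplus>\<^bsub>M\<^esub>i\<in>{i \<in> I. c i x \<noteq> \<zero>\<^bsub>R\<^esub>}. c i x \<odot>\<^bsub>M\<^esub> e i))"

lemma regular_module_simps [simp]:
  "carrier (regular_module R) = carrier R" "zero (regular_module R) = \<zero>\<^bsub>R\<^esub>"
  "add (regular_module R) = add R" "smult (regular_module R) = mult R"
  by (simp_all add: regular_module_def)

text \<open>A term outside the support has coefficient zero, so for finite \<open>I\<close> the sum
  may run over all of \<open>I\<close>, and the finiteness clause of \<open>dual_basis\<close>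
  disappears.\<close>

lemma finite_dual_basis_iff:
  assumes "left_module R M" "finite I"
  shows "dual_basis R M I e c \<longleftrightarrow> e \<in> I \<rightarrow> carrier M \<and>
     (\<forall>i\<in>I. c i \<in> mod_hom R M (regular_module R)) \<and>
     (\<forall>x\<in>carrier M. x = (\<Oplus>\<^bsub>M\<^esub>i\<in>I. c i x \<odot>\<^bsub>M\<^esub> e i))"
proof -
  interpret left_module R M by fact
  have "(\<Oplus>\<^bsub>M\<^esub>i\<in>I. c i x \<odot>\<^bsub>M\<^esub> e i) = (\<Oplus>\<^bsub>M\<^esub>i\<in>{i \<in> I. c i x \<noteq> \<zero>\<^bsub>R\<^esub>}. c i x \<odot>\<^bsub>M\<^esub> e i)"
    if "e \<in> I \<rightarrow> carrier M" "\<forall>i\<in>I. c i \<in> mod_hom R M (regular_module R)" "x \<in> carrier M" for x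
    by (rule M.finsum_superset[OF assms(2)])
      (use that mod_hom_closed in \<open>fastforce intro!: smult_closed simp: Pi_iff smult_l_null\<close>)+
  then show ?thesis
    unfolding dual_basis_def using assms(2) by (auto 0 3)
qed

text \<open>A total relation closed under sums and multiples contains a linear map as soon as its
  source has a dual basis: related elements are chosen for the \<open>e i\<close> and combined with
  the coordinates. This is the form in which projectivity enters the lifting of maps.\<close>

lemma linear_selection:
  fixes T :: "'m \<Rightarrow> 'x \<Rightarrow> bool"
  assumes M: "left_module R M" and X: "left_module R X" and db: "dual_basis R M I e c"
    and ex: "\<And>m. m \<in> carrier M \<Longrightarrow> \<exists>x\<in>carrier X. T m x"
    and add: "\<And>m m' x x'. \<lbrakk>m \<in> carrier M; m' \<in> carrier M; x \<in> carrier X; x' \<in> carrier X; T m x; T m' x'\<rbrakk>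
      \<Longrightarrow> T (m \<oplus>\<^bsub>M\<^esub> m') (x \<oplus>\<^bsub>X\<^esub> x')"
    and smult: "\<And>r m x. \<lbrakk>r \<in> carrier R; m \<in> carrier M; x \<in> carrier X; T m x\<rbrakk>
      \<Longrightarrow> T (r \<odot>\<^bsub>M\<^esub> m) (r \<odot>\<^bsub>X\<^esub> x)"
  obtains s where "s \<in> mod_hom R M X" "\<And>m. m \<in> carrier M \<Longrightarrow> T m (s m)"
proof -
  interpret M: left_module R M by fact
  interpret X: left_module R X by fact
  have e: "\<And>i. i \<in> I \<Longrightarrow> e i \<in> carrier M"
    and c: "\<And>i. i \<in> I \<Longrightarrow> c i \<in> mod_hom R M (regular_module R)"
    and fin: "\<And>x. x \<in> carrier M \<Longrightarrow> finite {i \<in> I. c i x \<noteq> \<zero>\<^bsub>R\<^esub>}"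
    and dec: "\<And>x. x \<in> carrier M \<Longrightarrow> x = (\<Oplus>\<^bsub>M\<^esub>i\<in>{i \<in> I. c i x \<noteq> \<zero>\<^bsub>R\<^esub>}. c i x \<odot>\<^bsub>M\<^esub> e i)"
    using db by (auto simp: dual_basis_def)
  have c_closed: "c i m \<in> carrier R" if "i \<in> I" "m \<in> carrier M" for i m
    using mod_hom_closed[OF c] that by fastforce
  have "\<forall>i\<in>I. \<exists>x\<in>carrier X. T (e i) x" using ex e by blast
  then obtain y where y: "\<And>i. i \<in> I \<Longrightarrow> y i \<in> carrier X" "\<And>i. i \<in> I \<Longrightarrow> T (e i) (y i)" by metis
  \<comment> \<open>Totality at zero, followed by multiplication with the scalar zero, relates zero
    to zero; this starts the induction over sums.\<close>
  have T0: "T \<zero>\<^bsub>M\<^esub> \<zero>\<^bsub>X\<^esub>"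
    using ex[of "\<zero>\<^bsub>M\<^esub>"] smult[of "\<zero>\<^bsub>R\<^esub>" "\<zero>\<^bsub>M\<^esub>"] by (auto simp: M.smult_l_null X.smult_l_null)
  define s where "s m = (\<Oplus>\<^bsub>X\<^esub>i\<in>{i \<in> I. c i m \<noteq> \<zero>\<^bsub>R\<^esub>}. c i m \<odot>\<^bsub>X\<^esub> y i)" for m
  have T_sum: "T (\<Oplus>\<^bsub>M\<^esub>i\<in>J. r i \<odot>\<^bsub>M\<^esub> e i) (\<Oplus>\<^bsub>X\<^esub>i\<in>J. r i \<odot>\<^bsub>X\<^esub> y i)"
    if "finite J" "J \<subseteq> I" "r \<in> J \<rightarrow> carrier R" for J r
    using that
  proof (induction J)
    case empty
    then show ?case using T0 by simp
  next
    case (insert j J)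
    have 1: "(\<lambda>i. r i \<odot>\<^bsub>M\<^esub> e i) \<in> J \<rightarrow> carrier M" "(\<lambda>i. r i \<odot>\<^bsub>X\<^esub> y i) \<in> J \<rightarrow> carrier X"
      and 2: "r j \<odot>\<^bsub>M\<^esub> e j \<in> carrier M" "r j \<odot>\<^bsub>X\<^esub> y j \<in> carrier X"
      using insert.prems e y by (auto intro!: M.smult_closed X.smult_closed simp: Pi_iff subset_iff)
    have "T (r j \<odot>\<^bsub>M\<^esub> e j \<oplus>\<^bsub>M\<^esub> (\<Oplus>\<^bsub>M\<^esub>i\<in>J. r i \<odot>\<^bsub>M\<^esub> e i)) (r j \<odot>\<^bsub>X\<^esub> y j \<oplus>\<^bsub>X\<^esub> (\<Oplus>\<^bsub>X\<^esub>i\<in>J. r i \<odot>\<^bsub>X\<^esub> y i))"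
      using insert e y 1 2
      by (intro add smult M.finsum_closed X.finsum_closed) auto
    then show ?case using insert 1 2 by simp
  qed
  have s_J: "s m = (\<Oplus>\<^bsub>X\<^esub>i\<in>J. c i m \<odot>\<^bsub>X\<^esub> y i)"
    if "m \<in> carrier M" "finite J" "{i \<in> I. c i m \<noteq> \<zero>\<^bsub>R\<^esub>} \<subseteq> J" "J \<subseteq> I" for m J
    unfolding s_def
    by (rule X.finsum_superset[symmetric, OF that(2,3)])
      (use that y c_closed in \<open>auto intro!: X.smult_closed simp: X.smult_l_null subset_iff\<close>)
  have s_closed: "s m \<in> carrier X" if "m \<in> carrier M" for m
    unfolding s_def using that y c_closed by (intro X.finsum_closed) (auto intro!: X.smult_closed)
  have "s \<in> mod_hom R M X"
  proof (rule mod_homI)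
    show "s m \<in> carrier X" if "m \<in> carrier M" for m using s_closed that .
  next
    fix m n assume m: "m \<in> carrier M" and n: "n \<in> carrier M"
    \<comment> \<open>The supports of \<open>m\<close>, \<open>n\<close> and their sum may differ,
      so the three coordinate sums are compared over one finite set that contains them all.\<close>
    define J where "J = {i \<in> I. c i m \<noteq> \<zero>\<^bsub>R\<^esub>} \<union> {i \<in> I. c i n \<noteq> \<zero>\<^bsub>R\<^esub>}
      \<union> {i \<in> I. c i (m \<oplus>\<^bsub>M\<^esub> n) \<noteq> \<zero>\<^bsub>R\<^esub>}"
    have J: "finite J" "J \<subseteq> I" using fin m n by (auto simp: J_def)
    have cl: "c i m \<in> carrier R" "c i n \<in> carrier R" "y i \<in> carrier X" if "i \<in> J" for i
      using that J m n c_closed y by auto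
    have "s (m \<oplus>\<^bsub>M\<^esub> n) = (\<Oplus>\<^bsub>X\<^esub>i\<in>J. c i (m \<oplus>\<^bsub>M\<^esub> n) \<odot>\<^bsub>X\<^esub> y i)"
      using m n J by (intro s_J) (auto simp: J_def)
    also have "\<dots> = (\<Oplus>\<^bsub>X\<^esub>i\<in>J. c i m \<odot>\<^bsub>X\<^esub> y i \<oplus>\<^bsub>X\<^esub> c i n \<odot>\<^bsub>X\<^esub> y i)"
    proof (rule X.finsum_cong'[OF HOL.refl])
      fix i assume i: "i \<in> J"
      show "c i (m \<oplus>\<^bsub>M\<^esub> n) \<odot>\<^bsub>X\<^esub> y i = c i m \<odot>\<^bsub>X\<^esub> y i \<oplus>\<^bsub>X\<^esub> c i n \<odot>\<^bsub>X\<^esub> y i"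
        using mod_hom_add[OF c m n, of i] i J cl by (auto simp: X.smult_l_distr subset_iff)
    qed (use cl in \<open>auto intro!: X.smult_closed\<close>)
    also have "\<dots> = s m \<oplus>\<^bsub>X\<^esub> s n"
      using m n J cl
      by (subst X.finsum_addf)
        (auto intro!: X.smult_closed arg_cong2[where f = "add X"] s_J[symmetric] simp: J_def)
    finally show "s (m \<oplus>\<^bsub>M\<^esub> n) = s m \<oplus>\<^bsub>X\<^esub> s n" .
  next
    fix r m assume r: "r \<in> carrier R" and m: "m \<in> carrier M"
    define J where "J = {i \<in> I. c i m \<noteq> \<zero>\<^bsub>R\<^esub>} \<union> {i \<in> I. c i (r \<odot>\<^bsub>M\<^esub> m) \<noteq> \<zero>\<^bsub>R\<^esub>}"
    have J: "finite J" "J \<subseteq> I" using fin m r M.smult_closed by (auto simp: J_def)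
    have cl: "c i m \<in> carrier R" "y i \<in> carrier X" if "i \<in> J" for i
      using that J m c_closed y by auto
    have "s (r \<odot>\<^bsub>M\<^esub> m) = (\<Oplus>\<^bsub>X\<^esub>i\<in>J. c i (r \<odot>\<^bsub>M\<^esub> m) \<odot>\<^bsub>X\<^esub> y i)"
      using m r J M.smult_closed by (intro s_J) (auto simp: J_def)
    also have "\<dots> = (\<Oplus>\<^bsub>X\<^esub>i\<in>J. r \<odot>\<^bsub>X\<^esub> (c i m \<odot>\<^bsub>X\<^esub> y i))"
    proof (rule X.finsum_cong'[OF HOL.refl])
      fix i assume i: "i \<in> J"
      show "c i (r \<odot>\<^bsub>M\<^esub> m) \<odot>\<^bsub>X\<^esub> y i = r \<odot>\<^bsub>X\<^esub> (c i m \<odot>\<^bsub>X\<^esub> y i)"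
        using mod_hom_smult[OF c m r, of i] i J cl r by (auto simp: X.smult_assoc subset_iff)
    qed (use cl r in \<open>auto intro!: X.smult_closed\<close>)
    also have "\<dots> = r \<odot>\<^bsub>X\<^esub> s m"
      using m r J cl
      by (subst X.smult_finsum_right[symmetric])
        (auto intro!: X.smult_closed arg_cong[where f = "smult X r"] s_J[symmetric] simp: J_def)
    finally show "s (r \<odot>\<^bsub>M\<^esub> m) = r \<odot>\<^bsub>X\<^esub> s m" .
  qed
  moreover have "T m (s m)" if "m \<in> carrier M" for m
  proof -
    have "T (\<Oplus>\<^bsub>M\<^esub>i\<in>{i \<in> I. c i m \<noteq> \<zero>\<^bsub>R\<^esub>}. c i m \<odot>\<^bsub>M\<^esub> e i) (s m)"
      unfolding s_def by (rule T_sum) (use that fin c_closed in auto)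
    then show ?thesis using dec[OF that] by simp
  qed
  ultimately show ?thesis by (rule that)
qed

section \<open>Complexes and lifting through quasi-isomorphisms\<close>

lemma
  assumes "cochain_complex R C"
  shows complex_module: "left_module R (obj C i)"
    and complex_diff_hom: "diff C i \<in> mod_hom R (obj C i) (obj C (i + 1))"
    and complex_diff_hom': "diff C (i - 1) \<in> mod_hom R (obj C (i - 1)) (obj C i)"
    and complex_diff: "x \<in> carrier (obj C i) \<Longrightarrow> diff C i x \<in> carrier (obj C (i + 1))"
    and complex_diff': "x \<in> carrier (obj C (i - 1)) \<Longrightarrow> diff C (i - 1) x \<in> carrier (obj C i)"
    and complex_diff_diff: "x \<in> carrier (obj C i) \<Longrightarrow> diff C (i + 1) (diff C i x) = \<zero>\<^bsub>obj C (i + 2)\<^esub>"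
    and complex_diff_diff': "x \<in> carrier (obj C (i - 1)) \<Longrightarrow> diff C i (diff C (i - 1) x) = \<zero>\<^bsub>obj C (i + 1)\<^esub>"
proof -
  have M: "left_module R (obj C i)" and d: "diff C i \<in> mod_hom R (obj C i) (obj C (i + 1))"
    and dd: "x \<in> carrier (obj C i) \<Longrightarrow> diff C (i + 1) (diff C i x) = \<zero>\<^bsub>obj C (i + 1 + 1)\<^esub>" for i x
    using assms by (auto simp: cochain_complex_def)
  show "left_module R (obj C i)" "diff C i \<in> mod_hom R (obj C i) (obj C (i + 1))" by (fact M d)+
  show *: "diff C (i - 1) \<in> mod_hom R (obj C (i - 1)) (obj C i)" using d[of "i - 1"] by simp
  show "x \<in> carrier (obj C i) \<Longrightarrow> diff C i x \<in> carrier (obj C (i + 1))" using mod_hom_closed[OF d] .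
  show "x \<in> carrier (obj C (i - 1)) \<Longrightarrow> diff C (i - 1) x \<in> carrier (obj C i)" using mod_hom_closed[OF *] .
  show "x \<in> carrier (obj C i) \<Longrightarrow> diff C (i + 1) (diff C i x) = \<zero>\<^bsub>obj C (i + 2)\<^esub>"
    using dd[of x i] by (simp add: add.assoc)
  show "x \<in> carrier (obj C (i - 1)) \<Longrightarrow> diff C i (diff C (i - 1) x) = \<zero>\<^bsub>obj C (i + 1)\<^esub>"
    using dd[of x "i - 1"] by simp
qed

lemma complex_group: "cochain_complex R C \<Longrightarrow> abelian_group (obj C i)"
  using complex_module left_module_group by blast

lemma complex_diff_zero: "cochain_complex R C \<Longrightarrow> diff C i \<zero>\<^bsub>obj C i\<^esub> = \<zero>\<^bsub>obj C (i + 1)\<^esub>"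
  by (rule mod_hom_zero[OF complex_group complex_group complex_diff_hom])

lemma cocyclesI: "x \<in> carrier (obj C i) \<Longrightarrow> diff C i x = \<zero>\<^bsub>obj C (i + 1)\<^esub> \<Longrightarrow> x \<in> cocycles C i"
  and cocycles_carrier: "x \<in> cocycles C i \<Longrightarrow> x \<in> carrier (obj C i)"
  and cocycles_diff: "x \<in> cocycles C i \<Longrightarrow> diff C i x = \<zero>\<^bsub>obj C (i + 1)\<^esub>"
  by (auto simp: cocycles_def)

lemma coboundariesI: "x \<in> carrier (obj C (i - 1)) \<Longrightarrow> diff C (i - 1) x \<in> coboundaries C i"
  and coboundariesE: "b \<in> coboundaries C i \<Longrightarrow>
    (\<And>x. x \<in> carrier (obj C (i - 1)) \<Longrightarrow> b = diff C (i - 1) x \<Longrightarrow> thesis) \<Longrightarrow> thesis"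
  by (auto simp: coboundaries_def)

lemma coboundaries_subset_cocycles: "cochain_complex R C \<Longrightarrow> coboundaries C i \<subseteq> cocycles C i"
  using complex_diff' complex_diff_diff' by (fastforce intro: cocyclesI elim!: coboundariesE)

lemma coboundaries_carrier: "cochain_complex R C \<Longrightarrow> b \<in> coboundaries C i \<Longrightarrow> b \<in> carrier (obj C i)"
  by (rule cocycles_carrier[OF subsetD[OF coboundaries_subset_cocycles]])

lemma
  assumes C: "cochain_complex R C"
  shows cocycles_add: "x \<in> cocycles C i \<Longrightarrow> y \<in> cocycles C i \<Longrightarrow> x \<oplus>\<^bsub>obj C i\<^esub> y \<in> cocycles C i"
    and cocycles_minus: "x \<in> cocycles C i \<Longrightarrow> \<ominus>\<^bsub>obj C i\<^esub> x \<in> cocycles C i"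
    and cocycles_smult: "r \<in> carrier R \<Longrightarrow> x \<in> cocycles C i \<Longrightarrow> r \<odot>\<^bsub>obj C i\<^esub> x \<in> cocycles C i"
    and cocycles_zero: "\<zero>\<^bsub>obj C i\<^esub> \<in> cocycles C i"
proof -
  interpret M: left_module R "obj C i" by (rule complex_module[OF C])
  interpret N: left_module R "obj C (i + 1)" by (rule complex_module[OF C])
  note d = complex_diff_hom[OF C, of i]
  show "x \<in> cocycles C i \<Longrightarrow> y \<in> cocycles C i \<Longrightarrow> x \<oplus>\<^bsub>obj C i\<^esub> y \<in> cocycles C i"
    by (intro cocyclesI) (auto simp: cocycles_carrier cocycles_diff mod_hom_add[OF d])
  show "x \<in> cocycles C i \<Longrightarrow> \<ominus>\<^bsub>obj C i\<^esub> x \<in> cocycles C i"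
    using mod_hom_minus[OF M.M.abelian_group_axioms N.M.abelian_group_axioms d, of x]
    by (intro cocyclesI) (auto simp: cocycles_carrier cocycles_diff)
  show "r \<in> carrier R \<Longrightarrow> x \<in> cocycles C i \<Longrightarrow> r \<odot>\<^bsub>obj C i\<^esub> x \<in> cocycles C i"
    by (intro cocyclesI)
      (auto simp: cocycles_carrier cocycles_diff mod_hom_smult[OF d] M.smult_closed N.smult_r_null)
  show "\<zero>\<^bsub>obj C i\<^esub> \<in> cocycles C i"
    by (intro cocyclesI) (auto simp: complex_diff_zero[OF C])
qed

lemma
  assumes C: "cochain_complex R C"
  shows coboundaries_add: "x \<in> coboundaries C i \<Longrightarrow> y \<in> coboundaries C i \<Longrightarrow>
      x \<oplus>\<^bsub>obj C i\<^esub> y \<in> coboundaries C i"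
    and coboundaries_minus: "x \<in> coboundaries C i \<Longrightarrow> \<ominus>\<^bsub>obj C i\<^esub> x \<in> coboundaries C i"
    and coboundaries_smult: "r \<in> carrier R \<Longrightarrow> x \<in> coboundaries C i \<Longrightarrow>
      r \<odot>\<^bsub>obj C i\<^esub> x \<in> coboundaries C i"
    and coboundaries_zero: "\<zero>\<^bsub>obj C i\<^esub> \<in> coboundaries C i"
proof -
  interpret M: left_module R "obj C (i - 1)" by (rule complex_module[OF C])
  interpret N: left_module R "obj C i" by (rule complex_module[OF C])
  note d = complex_diff_hom'[OF C, of i]
  show "x \<in> coboundaries C i \<Longrightarrow> y \<in> coboundaries C i \<Longrightarrow> x \<oplus>\<^bsub>obj C i\<^esub> y \<in> coboundaries C i"
    unfolding coboundaries_def using mod_hom_add[OF d] by (force intro!: image_eqI[OF _ M.M.a_closed])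
  show "x \<in> coboundaries C i \<Longrightarrow> \<ominus>\<^bsub>obj C i\<^esub> x \<in> coboundaries C i"
    unfolding coboundaries_def
    using mod_hom_minus[OF M.M.abelian_group_axioms N.M.abelian_group_axioms d]
    by (force intro!: image_eqI[OF _ M.M.a_inv_closed])
  show "r \<in> carrier R \<Longrightarrow> x \<in> coboundaries C i \<Longrightarrow> r \<odot>\<^bsub>obj C i\<^esub> x \<in> coboundaries C i"
    unfolding coboundaries_def using mod_hom_smult[OF d] by (force intro!: image_eqI[OF _ M.smult_closed])
  show "\<zero>\<^bsub>obj C i\<^esub> \<in> coboundaries C i"
    using coboundariesI[OF M.M.zero_closed] mod_hom_zero[OF M.M.abelian_group_axioms N.M.abelian_group_axioms d]
    by simp
qed

lemma
  assumes "chain_map R C D f"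
  shows chain_map_hom: "f i \<in> mod_hom R (obj C i) (obj D i)"
    and chain_map_closed: "x \<in> carrier (obj C i) \<Longrightarrow> f i x \<in> carrier (obj D i)"
    and chain_map_comm: "x \<in> carrier (obj C i) \<Longrightarrow> f (i + 1) (diff C i x) = diff D i (f i x)"
    and chain_map_comm': "x \<in> carrier (obj C (i - 1)) \<Longrightarrow> f i (diff C (i - 1) x) = diff D (i - 1) (f (i - 1) x)"
proof -
  have h: "f i \<in> mod_hom R (obj C i) (obj D i)"
    and c: "x \<in> carrier (obj C i) \<Longrightarrow> f (i + 1) (diff C i x) = diff D i (f i x)" for i x
    using assms by (auto simp: chain_map_def)
  show "f i \<in> mod_hom R (obj C i) (obj D i)" by (fact h)
  show "x \<in> carrier (obj C i) \<Longrightarrow> f i x \<in> carrier (obj D i)" using mod_hom_closed[OF h] .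
  show "x \<in> carrier (obj C i) \<Longrightarrow> f (i + 1) (diff C i x) = diff D i (f i x)" using c .
  show "x \<in> carrier (obj C (i - 1)) \<Longrightarrow> f i (diff C (i - 1) x) = diff D (i - 1) (f (i - 1) x)"
    using c[of x "i - 1"] by simp
qed

lemma
  assumes C: "cochain_complex R C" and D: "cochain_complex R D" and f: "chain_map R C D f"
  shows chain_map_cocycles: "x \<in> cocycles C i \<Longrightarrow> f i x \<in> cocycles D i"
    and chain_map_coboundaries: "x \<in> coboundaries C i \<Longrightarrow> f i x \<in> coboundaries D i"
proof -
  show "x \<in> cocycles C i \<Longrightarrow> f i x \<in> cocycles D i"
    using chain_map_comm[OF f, of x i] chain_map_closed[OF f, of x i]
      mod_hom_zero[OF complex_group[OF C] complex_group[OF D] chain_map_hom[OF f], of "i + 1"]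
    by (intro cocyclesI) (auto simp: cocycles_carrier cocycles_diff)
  show "x \<in> coboundaries C i \<Longrightarrow> f i x \<in> coboundaries D i"
    by (auto elim!: coboundariesE simp: chain_map_comm'[OF f] chain_map_closed[OF f] intro!: coboundariesI)
qed

lemma chain_map_compose:
  assumes f: "chain_map R C D f" and g: "chain_map R D B g"
  shows "chain_map R C B (\<lambda>i x. g i (f i x))"
  using mod_hom_comp[OF chain_map_hom[OF f] chain_map_hom[OF g]]
  by (auto simp: chain_map_def[of R C B] chain_map_comm[OF f] chain_map_comm[OF g] chain_map_closed[OF f])

lemma chain_map_ident: "chain_map R C C (\<lambda>i x. x)"
  by (simp add: chain_map_def mod_hom_id)

text \<open>The kernel and image conditions on representatives, in place of a bijection between sets
  of cosets. Constructions with elements, such as liftings, use and produce exactly these two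
  conditions.\<close>

definition qis ::
  "('r, 'y) ring_scheme \<Rightarrow> ('r, 'm) cochain \<Rightarrow> ('r, 'n) cochain \<Rightarrow> (int \<Rightarrow> 'm \<Rightarrow> 'n) \<Rightarrow> bool" where
  "qis R C D f \<longleftrightarrow> cochain_complex R C \<and> cochain_complex R D \<and> chain_map R C D f \<and>
     (\<forall>i. \<forall>x\<in>cocycles C i. f i x \<in> coboundaries D i \<longrightarrow> x \<in> coboundaries C i) \<and>
     (\<forall>i. \<forall>y\<in>cocycles D i. \<exists>x\<in>cocycles C i. \<exists>b\<in>coboundaries D i. f i x = y \<oplus>\<^bsub>obj D i\<^esub> b)"

lemma qisI:
  assumes "cochain_complex R C" "cochain_complex R D" "chain_map R C D f"
    and "\<And>i x. x \<in> cocycles C i \<Longrightarrow> f i x \<in> coboundaries D i \<Longrightarrow> x \<in> coboundaries C i"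
    and "\<And>i y. y \<in> cocycles D i \<Longrightarrow> \<exists>x\<in>cocycles C i. \<exists>b\<in>coboundaries D i. f i x = y \<oplus>\<^bsub>obj D i\<^esub> b"
  shows "qis R C D f"
  using assms by (simp add: qis_def)

lemma
  assumes "qis R C D f"
  shows qis_source: "cochain_complex R C" and qis_target: "cochain_complex R D"
    and qis_chain_map: "chain_map R C D f"
    and qis_inj: "x \<in> cocycles C i \<Longrightarrow> f i x \<in> coboundaries D i \<Longrightarrow> x \<in> coboundaries C i"
    and qis_surj: "y \<in> cocycles D i \<Longrightarrow>
      (\<And>x b. x \<in> cocycles C i \<Longrightarrow> b \<in> coboundaries D i \<Longrightarrow> f i x = y \<oplus>\<^bsub>obj D i\<^esub> b \<Longrightarrow> thesis) \<Longrightarrow> thesis"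
  using assms unfolding qis_def by blast+

section \<open>Cohomology classes and their representatives\<close>

lemma a_r_coset_eq: "B +>\<^bsub>G\<^esub> x = {b \<oplus>\<^bsub>G\<^esub> x | b. b \<in> B}"
  by (auto simp: a_r_coset_def r_coset_def)

lemma cohomology_carrier:
  "carrier (cohomology C i) = (\<lambda>x. coboundaries C i +>\<^bsub>obj C i\<^esub> x) ` cocycles C i"
  by (auto simp: cohomology_def quot_module_def A_RCOSETS_def RCOSETS_def a_r_coset_def r_coset_def)

lemma (in abelian_group) eq_add_minus:
  "x \<in> carrier G \<Longrightarrow> y \<in> carrier G \<Longrightarrow> x = y \<oplus> (x \<oplus> \<ominus> y)"
  by (simp add: a_lcomm r_neg)

lemma (in abelian_group) add_minus_eq:
  "x \<in> carrier G \<Longrightarrow> y \<in> carrier G \<Longrightarrow> y \<oplus> x \<oplus> \<ominus> y = x"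
  using a_comm[of y x] by (simp add: a_assoc r_neg)

lemma (in abelian_group) add_minus_cancel:
  "x \<in> carrier G \<Longrightarrow> y \<in> carrier G \<Longrightarrow> x \<oplus> y \<oplus> \<ominus> y = x"
  by (simp add: a_assoc r_neg)

lemma coboundary_coset_eq_iff:
  assumes C: "cochain_complex R C" and x: "x \<in> carrier (obj C i)" and y: "y \<in> carrier (obj C i)"
  shows "coboundaries C i +>\<^bsub>obj C i\<^esub> x = coboundaries C i +>\<^bsub>obj C i\<^esub> y
     \<longleftrightarrow> (\<exists>b\<in>coboundaries C i. x = y \<oplus>\<^bsub>obj C i\<^esub> b)" (is "?L \<longleftrightarrow> ?R")
proof -
  interpret M: abelian_group "obj C i" by (rule complex_group[OF C])
  note cl = coboundaries_carrier[OF C, of _ i]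
  have sub: "coboundaries C i +>\<^bsub>obj C i\<^esub> x \<subseteq> coboundaries C i +>\<^bsub>obj C i\<^esub> y"
    if b: "b \<in> coboundaries C i" "x = y \<oplus>\<^bsub>obj C i\<^esub> b" and y: "y \<in> carrier (obj C i)" for b x y
  proof
    fix z assume "z \<in> coboundaries C i +>\<^bsub>obj C i\<^esub> x"
    then obtain b' where b': "b' \<in> coboundaries C i" "z = b' \<oplus>\<^bsub>obj C i\<^esub> x" by (auto simp: a_r_coset_eq)
    have "z = (b' \<oplus>\<^bsub>obj C i\<^esub> b) \<oplus>\<^bsub>obj C i\<^esub> y"
      using b b' y cl by (simp add: M.a_ac)
    then show "z \<in> coboundaries C i +>\<^bsub>obj C i\<^esub> y"
      using coboundaries_add[OF C b'(1) b(1)] by (auto simp: a_r_coset_eq)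
  qed
  show ?thesis
  proof
    assume eq: ?L
    have "\<zero>\<^bsub>obj C i\<^esub> \<oplus>\<^bsub>obj C i\<^esub> x \<in> coboundaries C i +>\<^bsub>obj C i\<^esub> x"
      using coboundaries_zero[OF C, of i] unfolding a_r_coset_eq by blast
    then obtain b where "b \<in> coboundaries C i" "x = b \<oplus>\<^bsub>obj C i\<^esub> y"
      unfolding eq using x by (auto simp: a_r_coset_eq)
    then show ?R using cl y M.a_comm by blast
  next
    assume ?R
    then obtain b where b: "b \<in> coboundaries C i" "x = y \<oplus>\<^bsub>obj C i\<^esub> b" by blast
    have "y = x \<oplus>\<^bsub>obj C i\<^esub> \<ominus>\<^bsub>obj C i\<^esub> b" using b y cl by (simp add: M.add_minus_cancel)
    then show ?L using sub[OF b y] sub[OF coboundaries_minus[OF C b(1)] _ x] by blast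
  qed
qed

text \<open>Two cosets agree iff their representatives differ by a coboundary. Hence injectivity on
  cosets is the kernel condition on cocycles, and surjectivity is the existence of a preimage up to
  a coboundary.\<close>

lemma quasi_iso_iff_qis: "quasi_iso R C D f \<longleftrightarrow> qis R C D f"
proof (cases "cochain_complex R C \<and> cochain_complex R D \<and> chain_map R C D f")
  case True
  then have C: "cochain_complex R C" and D: "cochain_complex R D" and f: "chain_map R C D f" by auto
  note fZ = chain_map_cocycles[OF C D f] and fB = chain_map_coboundaries[OF C D f]
  \<comment> \<open>\<open>cohomology_map\<close> is a union over all representatives of a class.
    They give one and the same coset, because \<open>f\<close> takes coboundaries to
    coboundaries.\<close>
  have map: "cohomology_map D f i (coboundaries C i +>\<^bsub>obj C i\<^esub> x) = coboundaries D i +>\<^bsub>obj D i\<^esub> f i x"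
    if x: "x \<in> cocycles C i" for i x
  proof -
    have "coboundaries D i +>\<^bsub>obj D i\<^esub> f i x' = coboundaries D i +>\<^bsub>obj D i\<^esub> f i x"
      if x': "x' \<in> coboundaries C i +>\<^bsub>obj C i\<^esub> x" for x'
    proof -
      interpret M: abelian_group "obj C i" by (rule complex_group[OF C])
      interpret N: abelian_group "obj D i" by (rule complex_group[OF D])
      obtain b where b: "b \<in> coboundaries C i" "x' = b \<oplus>\<^bsub>obj C i\<^esub> x"
        using x' by (auto simp: a_r_coset_eq)
      have cl: "b \<in> carrier (obj C i)" "x \<in> carrier (obj C i)"
        using b x coboundaries_carrier[OF C] cocycles_carrier by auto
      have "f i x' = f i x \<oplus>\<^bsub>obj D i\<^esub> f i b"
        using cl mod_hom_add[OF chain_map_hom[OF f], of b i x] chain_map_closed[OF f]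
        by (simp add: b N.a_comm)
      then show ?thesis
        using cl fB[OF b(1)] coboundary_coset_eq_iff[OF D, of "f i x'" i "f i x"] chain_map_closed[OF f]
        by (auto simp: b)
    qed
    moreover have "x \<in> coboundaries C i +>\<^bsub>obj C i\<^esub> x"
    proof -
      interpret M: abelian_group "obj C i" by (rule complex_group[OF C])
      show ?thesis using coboundaries_zero[OF C, of i] cocycles_carrier[OF x] by (force simp: a_r_coset_eq)
    qed
    ultimately show ?thesis unfolding cohomology_map_def by blast
  qed
  have "bij_betw (cohomology_map D f i) (carrier (cohomology C i)) (carrier (cohomology D i)) \<longleftrightarrow>
     (\<forall>x\<in>cocycles C i. f i x \<in> coboundaries D i \<longrightarrow> x \<in> coboundaries C i) \<and>
     (\<forall>y\<in>cocycles D i. \<exists>x\<in>cocycles C i. \<exists>b\<in>coboundaries D i. f i x = y \<oplus>\<^bsub>obj D i\<^esub> b)" (is "?L \<longleftrightarrow> ?I \<and> ?S") for i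
  proof -
    interpret M: abelian_group "obj C i" by (rule complex_group[OF C])
    interpret N: abelian_group "obj D i" by (rule complex_group[OF D])
    note clC = cocycles_carrier[of _ C i] and clD = cocycles_carrier[of _ D i]
    have eqD: "coboundaries D i +>\<^bsub>obj D i\<^esub> f i x = coboundaries D i +>\<^bsub>obj D i\<^esub> f i y
        \<longleftrightarrow> f i (x \<oplus>\<^bsub>obj C i\<^esub> \<ominus>\<^bsub>obj C i\<^esub> y) \<in> coboundaries D i"
      if "x \<in> cocycles C i" "y \<in> cocycles C i" for x y
    proof -
      have fx: "f i x \<in> carrier (obj D i)" "f i y \<in> carrier (obj D i)"
        using fZ that clD by auto
      have "f i (x \<oplus>\<^bsub>obj C i\<^esub> \<ominus>\<^bsub>obj C i\<^esub> y) = f i x \<oplus>\<^bsub>obj D i\<^esub> \<ominus>\<^bsub>obj D i\<^esub> f i y"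
        using that clC mod_hom_add[OF chain_map_hom[OF f]]
          mod_hom_minus[OF complex_group[OF C] complex_group[OF D] chain_map_hom[OF f]]
        by simp
      then show ?thesis
        using fx coboundaries_carrier[OF D] N.eq_add_minus[of "f i x" "f i y"]
        by (auto simp: coboundary_coset_eq_iff[OF D] N.add_minus_eq)
    qed
    have eqC: "coboundaries C i +>\<^bsub>obj C i\<^esub> x = coboundaries C i +>\<^bsub>obj C i\<^esub> y
        \<longleftrightarrow> x \<oplus>\<^bsub>obj C i\<^esub> \<ominus>\<^bsub>obj C i\<^esub> y \<in> coboundaries C i"
      if "x \<in> cocycles C i" "y \<in> cocycles C i" for x y
      using that clC coboundaries_carrier[OF C] M.eq_add_minus[of x y]
      by (auto simp: coboundary_coset_eq_iff[OF C] M.add_minus_eq)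
    have inj: "inj_on (cohomology_map D f i) (carrier (cohomology C i)) \<longleftrightarrow> ?I"
    proof
      assume inj: "inj_on (cohomology_map D f i) (carrier (cohomology C i))"
      show ?I
      proof (intro ballI impI)
        fix x assume x: "x \<in> cocycles C i" "f i x \<in> coboundaries D i"
        note z = cocycles_zero[OF C, of i]
        have m: "x \<oplus>\<^bsub>obj C i\<^esub> \<ominus>\<^bsub>obj C i\<^esub> \<zero>\<^bsub>obj C i\<^esub> = x"
          using M.add_minus_cancel[of x "\<zero>\<^bsub>obj C i\<^esub>"] clC[OF x(1)] by simp
        have "coboundaries D i +>\<^bsub>obj D i\<^esub> f i x = coboundaries D i +>\<^bsub>obj D i\<^esub> f i \<zero>\<^bsub>obj C i\<^esub>"
          using eqD[OF x(1) z] x(2) m by simp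
        then have "coboundaries C i +>\<^bsub>obj C i\<^esub> x = coboundaries C i +>\<^bsub>obj C i\<^esub> \<zero>\<^bsub>obj C i\<^esub>"
          using inj_onD[OF inj, of "coboundaries C i +>\<^bsub>obj C i\<^esub> x" "coboundaries C i +>\<^bsub>obj C i\<^esub> \<zero>\<^bsub>obj C i\<^esub>"]
          by (simp add: map[OF x(1)] map[OF z] cohomology_carrier x(1) z)
        then show "x \<in> coboundaries C i" using eqC[OF x(1) z] m by simp
      qed
    next
      assume I: ?I
      have "coboundaries C i +>\<^bsub>obj C i\<^esub> x = coboundaries C i +>\<^bsub>obj C i\<^esub> y"
        if "x \<in> cocycles C i" "y \<in> cocycles C i"
          "cohomology_map D f i (coboundaries C i +>\<^bsub>obj C i\<^esub> x)
            = cohomology_map D f i (coboundaries C i +>\<^bsub>obj C i\<^esub> y)" for x y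
        using that I cocycles_add[OF C that(1) cocycles_minus[OF C that(2)]]
        by (simp add: map eqD eqC)
      then show "inj_on (cohomology_map D f i) (carrier (cohomology C i))"
        unfolding inj_on_def cohomology_carrier by simp
    qed
    have "cohomology_map D f i ` carrier (cohomology C i)
        = (\<lambda>x. coboundaries D i +>\<^bsub>obj D i\<^esub> f i x) ` cocycles C i"
      unfolding cohomology_carrier image_image by (rule image_cong) (simp_all add: map)
    also have "\<dots> = carrier (cohomology D i) \<longleftrightarrow>
      (\<forall>y\<in>cocycles D i. \<exists>x\<in>cocycles C i. coboundaries D i +>\<^bsub>obj D i\<^esub> f i x = coboundaries D i +>\<^bsub>obj D i\<^esub> y)"
    proof
      assume eq: "(\<lambda>x. coboundaries D i +>\<^bsub>obj D i\<^esub> f i x) ` cocycles C i = carrier (cohomology D i)"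
      have "coboundaries D i +>\<^bsub>obj D i\<^esub> y \<in> (\<lambda>x. coboundaries D i +>\<^bsub>obj D i\<^esub> f i x) ` cocycles C i"
        if "y \<in> cocycles D i" for y
        unfolding eq cohomology_carrier using that by (rule imageI)
      then show "\<forall>y\<in>cocycles D i. \<exists>x\<in>cocycles C i.
          coboundaries D i +>\<^bsub>obj D i\<^esub> f i x = coboundaries D i +>\<^bsub>obj D i\<^esub> y"
        by fastforce
    next
      assume "\<forall>y\<in>cocycles D i. \<exists>x\<in>cocycles C i.
          coboundaries D i +>\<^bsub>obj D i\<^esub> f i x = coboundaries D i +>\<^bsub>obj D i\<^esub> y"
      then show "(\<lambda>x. coboundaries D i +>\<^bsub>obj D i\<^esub> f i x) ` cocycles C i = carrier (cohomology D i)"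
        unfolding cohomology_carrier using fZ by (fastforce intro!: subset_antisym)
    qed
    also have "\<dots> \<longleftrightarrow> ?S"
      using coboundary_coset_eq_iff[OF D chain_map_closed[OF f clC] clD] by (simp cong: ball_cong bex_cong)
    finally show ?thesis unfolding bij_betw_def using inj by blast
  qed
  then show ?thesis using True by (simp add: quasi_iso_def qis_def all_conj_distrib)
qed (auto simp: quasi_iso_def qis_def)

section \<open>Lifting up to homotopy\<close>

definition bounded_above :: "('r, 'm) cochain \<Rightarrow> bool" where
  "bounded_above C \<longleftrightarrow> (\<exists>b. \<forall>i>b. carrier (obj C i) = {\<zero>\<^bsub>obj C i\<^esub>})"

definition homotopy ::
  "('r, 'y) ring_scheme \<Rightarrow> ('r, 'm) cochain \<Rightarrow> ('r, 'n) cochain \<Rightarrow> (int \<Rightarrow> 'm \<Rightarrow> 'n) \<Rightarrow>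
   (int \<Rightarrow> 'm \<Rightarrow> 'n) \<Rightarrow> (int \<Rightarrow> 'm \<Rightarrow> 'n) \<Rightarrow> bool" where
  "homotopy R C D f g k \<longleftrightarrow> (\<forall>i. k i \<in> mod_hom R (obj C i) (obj D (i - 1))) \<and>
     (\<forall>i. \<forall>x\<in>carrier (obj C i).
        f i x = g i x \<oplus>\<^bsub>obj D i\<^esub> (diff D (i - 1) (k i x) \<oplus>\<^bsub>obj D i\<^esub> k (i + 1) (diff C i x)))"

lemma
  assumes "homotopy R C D f g k"
  shows homotopy_hom: "k i \<in> mod_hom R (obj C i) (obj D (i - 1))"
    and homotopy_closed: "x \<in> carrier (obj C i) \<Longrightarrow> k i x \<in> carrier (obj D (i - 1))"
    and homotopy_eq: "x \<in> carrier (obj C i) \<Longrightarrow>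
      f i x = g i x \<oplus>\<^bsub>obj D i\<^esub> (diff D (i - 1) (k i x) \<oplus>\<^bsub>obj D i\<^esub> k (i + 1) (diff C i x))"
proof -
  show h: "k i \<in> mod_hom R (obj C i) (obj D (i - 1))" for i using assms by (simp add: homotopy_def)
  show "x \<in> carrier (obj C i) \<Longrightarrow> k i x \<in> carrier (obj D (i - 1))" using mod_hom_closed[OF h] .
  show "x \<in> carrier (obj C i) \<Longrightarrow>
      f i x = g i x \<oplus>\<^bsub>obj D i\<^esub> (diff D (i - 1) (k i x) \<oplus>\<^bsub>obj D i\<^esub> k (i + 1) (diff C i x))"
    using assms by (simp add: homotopy_def)
qed

lemma homotopy_hom_next: "homotopy R C D f g k \<Longrightarrow> k (i + 1) \<in> mod_hom R (obj C (i + 1)) (obj D i)"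
  using homotopy_hom[of R C D f g k "i + 1"] by simp

lemma homotopic_cocycle:
  assumes C: "cochain_complex R C" and D: "cochain_complex R D" and h: "homotopy R C D f g k"
    and g: "chain_map R C D g" and x: "x \<in> cocycles C i"
  obtains b where "b \<in> coboundaries D i" "f i x = g i x \<oplus>\<^bsub>obj D i\<^esub> b"
proof -
  interpret D: abelian_group "obj D i" by (rule complex_group[OF D])
  have "k (i + 1) (diff C i x) = \<zero>\<^bsub>obj D i\<^esub>"
    using mod_hom_zero[OF complex_group[OF C] complex_group[OF D] homotopy_hom_next[OF h]]
    by (simp add: cocycles_diff[OF x])
  moreover have "diff D (i - 1) (k i x) \<in> coboundaries D i"
    using homotopy_closed[OF h cocycles_carrier[OF x]] by (rule coboundariesI)
  ultimately show ?thesis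
    using that[of "diff D (i - 1) (k i x)"] homotopy_eq[OF h cocycles_carrier[OF x]]
      coboundaries_carrier[OF D] by simp
qed

text \<open>The dual bases are data, one in each degree, and the type of their indices is
  independent of the type of the elements: the dual of a complex and its restriction along a ring
  map inherit dual bases whose index sets live elsewhere.\<close>

definition proj_complex ::
  "('r, 'y) ring_scheme \<Rightarrow> ('r, 'm) cochain \<Rightarrow> (int \<Rightarrow> 'j set) \<Rightarrow> (int \<Rightarrow> 'j \<Rightarrow> 'm) \<Rightarrow>
   (int \<Rightarrow> 'j \<Rightarrow> 'm \<Rightarrow> 'r) \<Rightarrow> bool" where
  "proj_complex R P I e c \<longleftrightarrow> cochain_complex R P \<and> bounded_above P \<and>
     (\<forall>i. dual_basis R (obj P i) (I i) (e i) (c i))"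

text \<open>The step from degree \<open>i + 1\<close> down to degree \<open>i\<close>. The
  hypothesis \<open>good\<close> concerns cocycles of degree \<open>i + 1\<close>, because
  \<open>s'\<close> and \<open>k'\<close> are applied to boundaries alone.\<close>

lemma lift_step:
  assumes P: "cochain_complex R P" and db: "dual_basis R (obj P i) I e c"
    and q: "qis R X Y q" and f: "chain_map R P Y f"
    and s': "s' \<in> mod_hom R (obj P (i + 1)) (obj X (i + 1))"
    and k': "k' \<in> mod_hom R (obj P (i + 1)) (obj Y i)"
    and good: "\<And>p. p \<in> carrier (obj P (i + 1)) \<Longrightarrow> diff P (i + 1) p = \<zero>\<^bsub>obj P (i + 2)\<^esub> \<Longrightarrow>
      diff X (i + 1) (s' p) = \<zero>\<^bsub>obj X (i + 2)\<^esub> \<and>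
      q (i + 1) (s' p) = f (i + 1) p \<oplus>\<^bsub>obj Y (i + 1)\<^esub> diff Y i (k' p)"
  obtains s k where "s \<in> mod_hom R (obj P i) (obj X i)" "k \<in> mod_hom R (obj P i) (obj Y (i - 1))"
    "\<And>p. p \<in> carrier (obj P i) \<Longrightarrow> diff X i (s p) = s' (diff P i p)"
    "\<And>p. p \<in> carrier (obj P i) \<Longrightarrow>
      q i (s p) = f i p \<oplus>\<^bsub>obj Y i\<^esub> (diff Y (i - 1) (k p) \<oplus>\<^bsub>obj Y i\<^esub> k' (diff P i p))"
proof -
  note X = qis_source[OF q] and Y = qis_target[OF q] and qc = qis_chain_map[OF q]
  interpret P: left_module R "obj P i" by (rule complex_module[OF P])
  interpret P1: left_module R "obj P (i + 1)" by (rule complex_module[OF P])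
  interpret X: left_module R "obj X i" by (rule complex_module[OF X])
  interpret X1: left_module R "obj X (i + 1)" by (rule complex_module[OF X])
  interpret Y: left_module R "obj Y i" by (rule complex_module[OF Y])
  interpret Y1: left_module R "obj Y (i + 1)" by (rule complex_module[OF Y])
  interpret Y0: left_module R "obj Y (i - 1)" by (rule complex_module[OF Y])
  note dP = complex_diff_hom[OF P, of i] and dX = complex_diff_hom[OF X, of i]
    and dY = complex_diff_hom[OF Y, of i] and dY0 = complex_diff_hom'[OF Y, of i]
    and hq = chain_map_hom[OF qc, of i] and hf = chain_map_hom[OF f, of i]
  note cl [simp] = mod_hom_closed[OF dP] mod_hom_closed[OF dX] mod_hom_closed[OF dY]
    mod_hom_closed[OF dY0] mod_hom_closed[OF hq] mod_hom_closed[OF hf]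
    mod_hom_closed[OF s'] mod_hom_closed[OF k']
  note ad = mod_hom_add[OF dP] mod_hom_add[OF dX] mod_hom_add[OF dY]
    mod_hom_add[OF dY0] mod_hom_add[OF hq] mod_hom_add[OF hf] mod_hom_add[OF s'] mod_hom_add[OF k']
  note sm = mod_hom_smult[OF dP] mod_hom_smult[OF dX] mod_hom_smult[OF dY]
    mod_hom_smult[OF dY0] mod_hom_smult[OF hq] mod_hom_smult[OF hf] mod_hom_smult[OF s'] mod_hom_smult[OF k']
  note groups = P.M.abelian_group_axioms X.M.abelian_group_axioms Y.M.abelian_group_axioms
    Y0.M.abelian_group_axioms Y1.M.abelian_group_axioms X1.M.abelian_group_axioms
  define T where "T p x w \<longleftrightarrow> q i x = f i p \<oplus>\<^bsub>obj Y i\<^esub> (diff Y (i - 1) w \<oplus>\<^bsub>obj Y i\<^esub> k' (diff P i p))" for p x w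
  have T_add: "T (p \<oplus>\<^bsub>obj P i\<^esub> p') (x \<oplus>\<^bsub>obj X i\<^esub> x') (w \<oplus>\<^bsub>obj Y (i - 1)\<^esub> w')"
    if "p \<in> carrier (obj P i)" "p' \<in> carrier (obj P i)" "x \<in> carrier (obj X i)" "x' \<in> carrier (obj X i)"
      "w \<in> carrier (obj Y (i - 1))" "w' \<in> carrier (obj Y (i - 1))" "T p x w" "T p' x' w'" for p p' x x' w w'
    using that unfolding T_def by (simp add: ad Y.M.a_ac)
  have T_smult: "T (r \<odot>\<^bsub>obj P i\<^esub> p) (r \<odot>\<^bsub>obj X i\<^esub> x) (r \<odot>\<^bsub>obj Y (i - 1)\<^esub> w)"
    if "r \<in> carrier R" "p \<in> carrier (obj P i)" "x \<in> carrier (obj X i)"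
      "w \<in> carrier (obj Y (i - 1))" "T p x w" for r p x w
    using that unfolding T_def by (simp add: sm Y.smult_r_distr)
  have ex: "\<exists>x\<in>carrier (obj X i). diff X i x = s' (diff P i p) \<and> (\<exists>w\<in>carrier (obj Y (i - 1)). T p x w)"
    if p: "p \<in> carrier (obj P i)" for p
  proof -
    let ?z = "s' (diff P i p)" and ?y = "f i p \<oplus>\<^bsub>obj Y i\<^esub> k' (diff P i p)"
    have y: "?y \<in> carrier (obj Y i)" and z: "?z \<in> carrier (obj X (i + 1))" using p by auto
    have "diff P (i + 1) (diff P i p) = \<zero>\<^bsub>obj P (i + 2)\<^esub>" by (rule complex_diff_diff[OF P p])
    then have dz: "diff X (i + 1) ?z = \<zero>\<^bsub>obj X (i + 2)\<^esub>"
      and qz: "q (i + 1) ?z = f (i + 1) (diff P i p) \<oplus>\<^bsub>obj Y (i + 1)\<^esub> diff Y i (k' (diff P i p))"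
      using good[of "diff P i p"] p by auto
    have qz': "q (i + 1) ?z = diff Y i ?y"
      using qz p by (simp add: chain_map_comm[OF f p] ad)
    \<comment> \<open>The element \<open>?z\<close> is a cocycle whose image under \<open>q\<close>
      is a coboundary, so injectivity of \<open>q\<close> on classes provides a first candidate
      \<open>x'\<close>.\<close>
    have "?z \<in> cocycles X (i + 1)" using z dz by (intro cocyclesI) (auto simp: add.assoc)
    moreover have "q (i + 1) ?z \<in> coboundaries Y (i + 1)"
      using coboundariesI[of ?y Y "i + 1"] y qz' by simp
    ultimately have "?z \<in> coboundaries X (i + 1)" by (rule qis_inj[OF q])
    then obtain x' where x': "x' \<in> carrier (obj X i)" "diff X i x' = ?z"
      by (auto elim!: coboundariesE)
    \<comment> \<open>\<open>?u\<close> measures how far \<open>q i x'\<close> is from the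
      prescribed value. It is a cocycle, hence up to a coboundary \<open>b\<close> the image of some
      cocycle \<open>x''\<close>; subtracting \<open>x''\<close> from \<open>x'\<close> leaves only
      the error \<open>- b\<close>.\<close>
    let ?u = "q i x' \<oplus>\<^bsub>obj Y i\<^esub> \<ominus>\<^bsub>obj Y i\<^esub> ?y"
    have "diff Y i (q i x') = diff Y i ?y"
      using chain_map_comm[OF qc x'(1)] x' qz' by simp
    then have "diff Y i ?u = \<zero>\<^bsub>obj Y (i + 1)\<^esub>"
      using x' y mod_hom_add[OF dY] mod_hom_minus[OF Y.M.abelian_group_axioms Y1.M.abelian_group_axioms dY y]
      by (simp del: Y.M.a_closed add: Y1.M.r_neg Y.M.a_inv_closed)
    then have "?u \<in> cocycles Y i" using x' y by (intro cocyclesI) auto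
    then obtain x'' b where x'': "x'' \<in> cocycles X i" and b: "b \<in> coboundaries Y i"
      and eq: "q i x'' = ?u \<oplus>\<^bsub>obj Y i\<^esub> b" by (rule qis_surj[OF q])
    obtain w where w: "w \<in> carrier (obj Y (i - 1))" "b = diff Y (i - 1) w"
      using b by (rule coboundariesE)
    note cx'' = cocycles_carrier[OF x'']
    let ?x = "x' \<oplus>\<^bsub>obj X i\<^esub> \<ominus>\<^bsub>obj X i\<^esub> x''"
    have "diff X i ?x = ?z"
      using x' cx'' cocycles_diff[OF x''] mod_hom_minus[OF X.M.abelian_group_axioms X1.M.abelian_group_axioms dX cx'']
        z X1.M.add_minus_cancel[of ?z "\<zero>\<^bsub>obj X (i + 1)\<^esub>"]
      by (simp add: mod_hom_add[OF dX])
    moreover have "T p ?x (\<ominus>\<^bsub>obj Y (i - 1)\<^esub> w)"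
    proof -
      have bc: "b \<in> carrier (obj Y i)" using w by simp
      have "q i ?x = q i x' \<oplus>\<^bsub>obj Y i\<^esub> \<ominus>\<^bsub>obj Y i\<^esub> (?u \<oplus>\<^bsub>obj Y i\<^esub> b)"
        using x' cx'' mod_hom_minus[OF X.M.abelian_group_axioms Y.M.abelian_group_axioms hq cx''] eq
        by (simp add: mod_hom_add[OF hq])
      also have "\<dots> = q i x' \<oplus>\<^bsub>obj Y i\<^esub> (\<ominus>\<^bsub>obj Y i\<^esub> q i x' \<oplus>\<^bsub>obj Y i\<^esub> ?y \<oplus>\<^bsub>obj Y i\<^esub> \<ominus>\<^bsub>obj Y i\<^esub> b)"
        using x' y bc by (simp del: Y.M.a_closed add: Y.M.minus_add Y.M.a_inv_closed Y.M.add.m_closed)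
      also have "\<dots> = ?y \<oplus>\<^bsub>obj Y i\<^esub> \<ominus>\<^bsub>obj Y i\<^esub> b"
      proof -
        have "q i x' \<oplus>\<^bsub>obj Y i\<^esub> (\<ominus>\<^bsub>obj Y i\<^esub> q i x' \<oplus>\<^bsub>obj Y i\<^esub> v \<oplus>\<^bsub>obj Y i\<^esub> \<ominus>\<^bsub>obj Y i\<^esub> b) = v \<oplus>\<^bsub>obj Y i\<^esub> \<ominus>\<^bsub>obj Y i\<^esub> b"
          if "v \<in> carrier (obj Y i)" for v
          using that x' bc Y.M.r_neg2[of "q i x'" "v \<oplus>\<^bsub>obj Y i\<^esub> \<ominus>\<^bsub>obj Y i\<^esub> b"] by (simp add: Y.M.a_assoc)
        from this[OF y] show ?thesis .
      qed
      also have "\<ominus>\<^bsub>obj Y i\<^esub> b = diff Y (i - 1) (\<ominus>\<^bsub>obj Y (i - 1)\<^esub> w)"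
        using mod_hom_minus[OF Y0.M.abelian_group_axioms Y.M.abelian_group_axioms dY0 w(1)] w(2) by simp
      finally show ?thesis unfolding T_def using p w(1) by (simp add: Y.M.a_ac)
    qed
    ultimately show ?thesis using x'(1) cx'' w(1)
      by (intro bexI[of _ ?x] conjI bexI[of _ "\<ominus>\<^bsub>obj Y (i - 1)\<^esub> w"]) auto
  qed
  \<comment> \<open>The relation for \<open>s\<close> keeps the homotopy value \<open>w\<close>
    under an existential quantifier. A linear \<open>k\<close> is selected afterwards, from the
    relation in which the linear map \<open>s\<close> is already fixed.\<close>
  obtain s where s: "s \<in> mod_hom R (obj P i) (obj X i)"
    and s_eq: "\<And>p. p \<in> carrier (obj P i) \<Longrightarrow>
        diff X i (s p) = s' (diff P i p) \<and> (\<exists>w\<in>carrier (obj Y (i - 1)). T p (s p) w)"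
  proof (rule linear_selection[OF complex_module[OF P] complex_module[OF X] db,
        where T = "\<lambda>p x. diff X i x = s' (diff P i p) \<and> (\<exists>w\<in>carrier (obj Y (i - 1)). T p x w)"])
    show "\<exists>x\<in>carrier (obj X i). diff X i x = s' (diff P i p) \<and> (\<exists>w\<in>carrier (obj Y (i - 1)). T p x w)"
      if "p \<in> carrier (obj P i)" for p by (rule ex[OF that])
  next
    fix m m' x x'
    assume a: "m \<in> carrier (obj P i)" "m' \<in> carrier (obj P i)" "x \<in> carrier (obj X i)" "x' \<in> carrier (obj X i)"
      "diff X i x = s' (diff P i m) \<and> (\<exists>w\<in>carrier (obj Y (i - 1)). T m x w)"
      "diff X i x' = s' (diff P i m') \<and> (\<exists>w\<in>carrier (obj Y (i - 1)). T m' x' w)"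
    show "diff X i (x \<oplus>\<^bsub>obj X i\<^esub> x') = s' (diff P i (m \<oplus>\<^bsub>obj P i\<^esub> m')) \<and>
       (\<exists>w\<in>carrier (obj Y (i - 1)). T (m \<oplus>\<^bsub>obj P i\<^esub> m') (x \<oplus>\<^bsub>obj X i\<^esub> x') w)"
    proof (intro conjI)
      show "diff X i (x \<oplus>\<^bsub>obj X i\<^esub> x') = s' (diff P i (m \<oplus>\<^bsub>obj P i\<^esub> m'))" using a by (simp add: ad)
      show "\<exists>w\<in>carrier (obj Y (i - 1)). T (m \<oplus>\<^bsub>obj P i\<^esub> m') (x \<oplus>\<^bsub>obj X i\<^esub> x') w"
        using a T_add Y0.M.a_closed by blast
    qed
  next
    fix r m x
    assume a: "r \<in> carrier R" "m \<in> carrier (obj P i)" "x \<in> carrier (obj X i)"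
      "diff X i x = s' (diff P i m) \<and> (\<exists>w\<in>carrier (obj Y (i - 1)). T m x w)"
    show "diff X i (r \<odot>\<^bsub>obj X i\<^esub> x) = s' (diff P i (r \<odot>\<^bsub>obj P i\<^esub> m)) \<and>
       (\<exists>w\<in>carrier (obj Y (i - 1)). T (r \<odot>\<^bsub>obj P i\<^esub> m) (r \<odot>\<^bsub>obj X i\<^esub> x) w)"
    proof (intro conjI)
      show "diff X i (r \<odot>\<^bsub>obj X i\<^esub> x) = s' (diff P i (r \<odot>\<^bsub>obj P i\<^esub> m))" using a by (simp add: sm)
      show "\<exists>w\<in>carrier (obj Y (i - 1)). T (r \<odot>\<^bsub>obj P i\<^esub> m) (r \<odot>\<^bsub>obj X i\<^esub> x) w"
        using a T_smult Y0.smult_closed by blast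
    qed
  qed blast
  obtain k where k: "k \<in> mod_hom R (obj P i) (obj Y (i - 1))"
    and k_eq: "\<And>p. p \<in> carrier (obj P i) \<Longrightarrow> T p (s p) (k p)"
  proof (rule linear_selection[OF complex_module[OF P] complex_module[OF Y] db,
        where T = "\<lambda>p w. T p (s p) w"])
    show "\<exists>w\<in>carrier (obj Y (i - 1)). T p (s p) w" if "p \<in> carrier (obj P i)" for p
      using s_eq[OF that] by blast
    show "T (m \<oplus>\<^bsub>obj P i\<^esub> m') (s (m \<oplus>\<^bsub>obj P i\<^esub> m')) (w \<oplus>\<^bsub>obj Y (i - 1)\<^esub> w')"
      if "m \<in> carrier (obj P i)" "m' \<in> carrier (obj P i)" "w \<in> carrier (obj Y (i - 1))"
        "w' \<in> carrier (obj Y (i - 1))" "T m (s m) w" "T m' (s m') w'" for m m' w w'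
      using T_add[OF that(1,2) mod_hom_closed[OF s that(1)] mod_hom_closed[OF s that(2)] that(3-6)] that
      by (simp add: mod_hom_add[OF s])
    show "T (r \<odot>\<^bsub>obj P i\<^esub> m) (s (r \<odot>\<^bsub>obj P i\<^esub> m)) (r \<odot>\<^bsub>obj Y (i - 1)\<^esub> w)"
      if "r \<in> carrier R" "m \<in> carrier (obj P i)" "w \<in> carrier (obj Y (i - 1))" "T m (s m) w" for r m w
      using T_smult[OF that(1,2) mod_hom_closed[OF s that(2)] that(3,4)] that
      by (simp add: mod_hom_smult[OF s])
  qed blast
  show ?thesis
    using s_eq k_eq by (intro that[OF s k]) (auto simp: T_def)
qed

text \<open>Each degree needs the maps of the next higher one, so the construction descends from a
  bound above which \<open>P\<close> vanishes. The maps come from a dependent choice along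
  \<open>n\<close>, which stands for the degree \<open>b - int n + 1\<close>.\<close>

theorem lift_through_qis:
  assumes pc: "proj_complex R P I e c" and q: "qis R X Y q" and f: "chain_map R P Y f"
  obtains s k where "chain_map R P X s" "homotopy R P Y (\<lambda>i x. q i (s i x)) f k"
proof -
  have P: "cochain_complex R P" and db: "\<And>i. dual_basis R (obj P i) (I i) (e i) (c i)"
    using pc by (auto simp: proj_complex_def)
  obtain b where b: "\<And>i. i > b \<Longrightarrow> carrier (obj P i) = {\<zero>\<^bsub>obj P i\<^esub>}"
    using pc by (auto simp: proj_complex_def bounded_above_def)
  note X = qis_source[OF q] and Y = qis_target[OF q] and qc = qis_chain_map[OF q]
  \<comment> \<open>\<open>good\<close> is the invariant handed down to the next lower degree;
    \<open>eqn\<close> relates two neighbouring degrees and is what makes \<open>s\<close> a chain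
    map and \<open>k\<close> a homotopy.\<close>
  define good where "good j s k \<longleftrightarrow> s \<in> mod_hom R (obj P j) (obj X j) \<and> k \<in> mod_hom R (obj P j) (obj Y (j - 1)) \<and>
      (\<forall>p\<in>carrier (obj P j). diff P j p = \<zero>\<^bsub>obj P (j + 1)\<^esub> \<longrightarrow> diff X j (s p) = \<zero>\<^bsub>obj X (j + 1)\<^esub> \<and>
        q j (s p) = f j p \<oplus>\<^bsub>obj Y j\<^esub> diff Y (j - 1) (k p))" for j s k
  define eqn where "eqn i s' k' s k \<longleftrightarrow> (\<forall>p\<in>carrier (obj P i). diff X i (s p) = s' (diff P i p) \<and>
      q i (s p) = f i p \<oplus>\<^bsub>obj Y i\<^esub> (diff Y (i - 1) (k p) \<oplus>\<^bsub>obj Y i\<^esub> k' (diff P i p)))" for i s' k' s k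
  have zX: "h \<zero>\<^bsub>obj P i\<^esub> = \<zero>\<^bsub>obj X j\<^esub>" if "h \<in> mod_hom R (obj P i) (obj X j)" for h i j
    using mod_hom_zero[OF complex_group[OF P] complex_group[OF X] that] .
  have zY: "h \<zero>\<^bsub>obj P i\<^esub> = \<zero>\<^bsub>obj Y j\<^esub>" if "h \<in> mod_hom R (obj P i) (obj Y j)" for h i j
    using mod_hom_zero[OF complex_group[OF P] complex_group[OF Y] that] .
  have qz: "q i \<zero>\<^bsub>obj X i\<^esub> = \<zero>\<^bsub>obj Y i\<^esub>" for i
    by (rule mod_hom_zero[OF complex_group[OF X] complex_group[OF Y] chain_map_hom[OF qc]])
  have step: "\<exists>s k. good i s k \<and> eqn i s' k' s k" if g: "good (i + 1) s' k'" for i s' k'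
  proof -
    have s': "s' \<in> mod_hom R (obj P (i + 1)) (obj X (i + 1))"
      and k': "k' \<in> mod_hom R (obj P (i + 1)) (obj Y i)" using g by (auto simp: good_def)
    obtain s k where s: "s \<in> mod_hom R (obj P i) (obj X i)" and k: "k \<in> mod_hom R (obj P i) (obj Y (i - 1))"
      and e1: "\<And>p. p \<in> carrier (obj P i) \<Longrightarrow> diff X i (s p) = s' (diff P i p)"
      and e2: "\<And>p. p \<in> carrier (obj P i) \<Longrightarrow>
        q i (s p) = f i p \<oplus>\<^bsub>obj Y i\<^esub> (diff Y (i - 1) (k p) \<oplus>\<^bsub>obj Y i\<^esub> k' (diff P i p))"
      by (rule lift_step[OF P db q f s' k']) (use g in \<open>auto simp: good_def add.assoc\<close>)
    have "good i s k"
      unfolding good_def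
    proof (intro conjI ballI impI s k)
      fix p assume p: "p \<in> carrier (obj P i)" and d: "diff P i p = \<zero>\<^bsub>obj P (i + 1)\<^esub>"
      show "diff X i (s p) = \<zero>\<^bsub>obj X (i + 1)\<^esub>" using e1[OF p] zX[OF s'] d by simp
      interpret Y: abelian_group "obj Y i" by (rule complex_group[OF Y])
      show "q i (s p) = f i p \<oplus>\<^bsub>obj Y i\<^esub> diff Y (i - 1) (k p)"
        using e2[OF p] zY[OF k'] d complex_diff'[OF Y mod_hom_closed[OF k p]] by simp
    qed
    then show ?thesis using e1 e2 by (auto simp: eqn_def)
  qed
  have "\<exists>F. \<forall>n. good (b - int n + 1) (fst (F n)) (snd (F n)) \<and>
      eqn (b - int n) (fst (F n)) (snd (F n)) (fst (F (Suc n))) (snd (F (Suc n)))"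
  proof (rule dependent_nat_choice)
    \<comment> \<open>In degree \<open>b + 1\<close> the module of \<open>P\<close> is zero, so zero
      maps start the construction.\<close>
    have "good (b + 1) (\<lambda>_. \<zero>\<^bsub>obj X (b + 1)\<^esub>) (\<lambda>_. \<zero>\<^bsub>obj Y b\<^esub>)"
    proof -
      interpret Y: abelian_group "obj Y (b + 1)" by (rule complex_group[OF Y])
      have "diff Y b \<zero>\<^bsub>obj Y b\<^esub> = \<zero>\<^bsub>obj Y (b + 1)\<^esub>" by (rule complex_diff_zero[OF Y])
      then show ?thesis
        unfolding good_def
        using b[of "b + 1"] complex_diff_zero[OF X, of "b + 1"] qz zY[OF chain_map_hom[OF f]]
        by (simp add: mod_hom_const_zero[OF complex_module[OF X]] mod_hom_const_zero[OF complex_module[OF Y]])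
    qed
    then show "\<exists>sk. good (b - int 0 + 1) (fst sk) (snd sk)"
      by (intro exI[of _ "(\<lambda>_. \<zero>\<^bsub>obj X (b + 1)\<^esub>, \<lambda>_. \<zero>\<^bsub>obj Y b\<^esub>)"]) simp
  next
    fix sk n assume "good (b - int n + 1) (fst sk) (snd sk)"
    then obtain s k where "good (b - int n) s k" "eqn (b - int n) (fst sk) (snd sk) s k"
      using step by blast
    then show "\<exists>sk'. good (b - int (Suc n) + 1) (fst sk') (snd sk') \<and>
        eqn (b - int n) (fst sk) (snd sk) (fst sk') (snd sk')"
      by (intro exI[of _ "(s, k)"]) simp
  qed
  then obtain F where F: "\<And>n. good (b - int n + 1) (fst (F n)) (snd (F n))"
    and F_eqn: "\<And>n. eqn (b - int n) (fst (F n)) (snd (F n)) (fst (F (Suc n))) (snd (F (Suc n)))"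
    by blast
  \<comment> \<open>Degree \<open>i\<close> is reached after \<open>nat (b + 1 - i)\<close> steps;
    above \<open>b + 1\<close> both maps are zero.\<close>
  define s where "s i = (if i > b + 1 then (\<lambda>_. \<zero>\<^bsub>obj X i\<^esub>) else fst (F (nat (b + 1 - i))))" for i
  define k where "k i = (if i > b + 1 then (\<lambda>_. \<zero>\<^bsub>obj Y (i - 1)\<^esub>) else snd (F (nat (b + 1 - i))))" for i
  have s_hom: "s i \<in> mod_hom R (obj P i) (obj X i)" and k_hom: "k i \<in> mod_hom R (obj P i) (obj Y (i - 1))" for i
    using F[of "nat (b + 1 - i)"]
    by (auto simp: s_def k_def good_def mod_hom_const_zero[OF complex_module[OF X]]
        mod_hom_const_zero[OF complex_module[OF Y]])
  have eqn: "eqn i (s (i + 1)) (k (i + 1)) (s i) (k i)" for i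
  proof (cases "i \<le> b")
    case True
    then have "nat (b + 1 - i) = Suc (nat (b - i))" "b - int (nat (b - i)) = i" by auto
    then show ?thesis using F_eqn[of "nat (b - i)"] True by (simp add: s_def k_def)
  next
    case False
    interpret Y: abelian_group "obj Y i" by (rule complex_group[OF Y])
    have k1: "k (i + 1) \<in> mod_hom R (obj P (i + 1)) (obj Y i)" using k_hom[of "i + 1"] by simp
    have "diff Y (i - 1) \<zero>\<^bsub>obj Y (i - 1)\<^esub> = \<zero>\<^bsub>obj Y i\<^esub>" using complex_diff_zero[OF Y, of "i - 1"] by simp
    then show ?thesis using b[of i] False
      unfolding eqn_def
      by (simp add: complex_diff_zero[OF P] zX[OF s_hom] zY[OF k_hom] zY[OF k1] zY[OF chain_map_hom[OF f]] qz
          complex_diff_zero[OF X])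
  qed
  show ?thesis
  proof (rule that)
    show "chain_map R P X s" using s_hom eqn by (auto simp: chain_map_def eqn_def)
    show "homotopy R P Y (\<lambda>i x. q i (s i x)) f k" using k_hom eqn by (auto simp: homotopy_def eqn_def)
  qed
qed

text \<open>On cohomology \<open>q\<close> is bijective, and so is \<open>s\<close> followed by
  \<open>q\<close>, being homotopic to \<open>f\<close>; therefore \<open>s\<close> is bijective as
  well.\<close>

lemma qis_lift:
  assumes pc: "proj_complex R P I e c" and q: "qis R X Y q" and f: "qis R P Y f"
  obtains s k where "qis R P X s" "homotopy R P Y (\<lambda>i x. q i (s i x)) f k"
proof -
  note P = qis_source[OF f] and X = qis_source[OF q] and Y = qis_target[OF q]
    and fc = qis_chain_map[OF f] and qc = qis_chain_map[OF q]
  obtain s k where s: "chain_map R P X s" and k: "homotopy R P Y (\<lambda>i x. q i (s i x)) f k"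
    by (rule lift_through_qis[OF pc q fc])
  have "qis R P X s"
  proof (rule qisI[OF P X s])
    fix i x assume x: "x \<in> cocycles P i" and sx: "s i x \<in> coboundaries X i"
    interpret Y: abelian_group "obj Y i" by (rule complex_group[OF Y])
    obtain b where b: "b \<in> coboundaries Y i" "q i (s i x) = f i x \<oplus>\<^bsub>obj Y i\<^esub> b"
      by (rule homotopic_cocycle[OF P Y k fc x])
    have cl: "f i x \<in> carrier (obj Y i)" "b \<in> carrier (obj Y i)"
      using b chain_map_closed[OF fc cocycles_carrier[OF x]] coboundaries_carrier[OF Y] by auto
    have "f i x = q i (s i x) \<oplus>\<^bsub>obj Y i\<^esub> \<ominus>\<^bsub>obj Y i\<^esub> b" using cl b(2) by (simp add: Y.add_minus_cancel)
    then have "f i x \<in> coboundaries Y i"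
      using coboundaries_add[OF Y chain_map_coboundaries[OF X Y qc sx] coboundaries_minus[OF Y b(1)]] by simp
    then show "x \<in> coboundaries P i" by (rule qis_inj[OF f x])
  next
    fix i y assume y: "y \<in> cocycles X i"
    interpret X: abelian_group "obj X i" by (rule complex_group[OF X])
    interpret Y: abelian_group "obj Y i" by (rule complex_group[OF Y])
    have qy: "q i y \<in> cocycles Y i" by (rule chain_map_cocycles[OF X Y qc y])
    obtain x b where x: "x \<in> cocycles P i" and b: "b \<in> coboundaries Y i" "f i x = q i y \<oplus>\<^bsub>obj Y i\<^esub> b"
      by (rule qis_surj[OF f qy])
    obtain b' where b': "b' \<in> coboundaries Y i" "q i (s i x) = f i x \<oplus>\<^bsub>obj Y i\<^esub> b'"
      by (rule homotopic_cocycle[OF P Y k fc x])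
    have sx: "s i x \<in> cocycles X i" by (rule chain_map_cocycles[OF P X s x])
    let ?u = "s i x \<oplus>\<^bsub>obj X i\<^esub> \<ominus>\<^bsub>obj X i\<^esub> y"
    have u: "?u \<in> cocycles X i" using cocycles_add[OF X sx cocycles_minus[OF X y]] .
    have cl: "y \<in> carrier (obj X i)" "s i x \<in> carrier (obj X i)" "q i y \<in> carrier (obj Y i)"
      "b \<in> carrier (obj Y i)" "b' \<in> carrier (obj Y i)"
      using y sx qy b b' coboundaries_carrier[OF Y] cocycles_carrier by auto
    have "q i ?u = q i (s i x) \<oplus>\<^bsub>obj Y i\<^esub> \<ominus>\<^bsub>obj Y i\<^esub> q i y"
      using cl mod_hom_minus[OF complex_group[OF X] complex_group[OF Y] chain_map_hom[OF qc]]
      by (simp add: mod_hom_add[OF chain_map_hom[OF qc]])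
    also have "\<dots> = b \<oplus>\<^bsub>obj Y i\<^esub> b'"
      using cl b(2) b'(2) Y.add_minus_eq[of "b \<oplus>\<^bsub>obj Y i\<^esub> b'" "q i y"] by (simp add: Y.a_assoc)
    finally have "?u \<in> coboundaries X i" using qis_inj[OF q u] coboundaries_add[OF Y b(1) b'(1)] by simp
    moreover have "s i x = y \<oplus>\<^bsub>obj X i\<^esub> ?u" using cl by (intro X.eq_add_minus)
    ultimately show "\<exists>x\<in>cocycles P i. \<exists>b\<in>coboundaries X i. s i x = y \<oplus>\<^bsub>obj X i\<^esub> b" using x by blast
  qed
  then show ?thesis using k that by blast
qed

lemma qis_ident:
  assumes C: "cochain_complex R C" shows "qis R C C (\<lambda>i x. x)"
proof (rule qisI[OF C C chain_map_ident])
  fix i y assume y: "y \<in> cocycles C i"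
  interpret abelian_group "obj C i" by (rule complex_group[OF C])
  show "\<exists>x\<in>cocycles C i. \<exists>b\<in>coboundaries C i. x = y \<oplus>\<^bsub>obj C i\<^esub> b"
    using y cocycles_carrier[OF y] coboundaries_zero[OF C, of i]
    by (intro bexI[of _ y] bexI[of _ "\<zero>\<^bsub>obj C i\<^esub>"]) simp_all
qed

text \<open>The identity of \<open>D\<close> is lifted through \<open>f\<close>. The inverse is
  one-sided, but it is again a quasi-isomorphism, so over projective terms it has a one-sided
  inverse in turn.\<close>

lemma right_homotopy_inverse:
  assumes pD: "proj_complex R D I e c" and q: "qis R C D f"
  obtains r k where "qis R D C r" "homotopy R D D (\<lambda>i x. f i (r i x)) (\<lambda>i x. x) k"
  using qis_lift[OF pD q qis_ident[OF qis_target[OF q]]] by blast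

section \<open>Duality\<close>

lemma opp_simps [simp]:
  "carrier (opp R) = carrier R" "zero (opp R) = \<zero>\<^bsub>R\<^esub>" "one (opp R) = \<one>\<^bsub>R\<^esub>"
  "add (opp R) = add R" "x \<otimes>\<^bsub>opp R\<^esub> y = y \<otimes>\<^bsub>R\<^esub> x"
  by (simp_all add: opp_def)

lemma opp_opp [simp]: "opp (opp R) = R"
  by (simp add: opp_def)

lemma abelian_group_cong:
  assumes "abelian_group G" "carrier H = carrier G" "add H = add G" "zero H = zero G"
  shows "abelian_group H"
proof -
  interpret abelian_group G by fact
  have "\<exists>y\<in>carrier G. y \<oplus>\<^bsub>G\<^esub> x = \<zero>\<^bsub>G\<^esub>" if "x \<in> carrier G" for x
    using that l_neg by blast
  then show ?thesis
    by (intro abelian_groupI) (auto simp: assms a_ac)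
qed

lemma ring_opp [simp]: "ring (opp R) \<longleftrightarrow> ring R"
proof -
  have "ring (opp R)" if "ring R" for R :: "('a, 'b) ring_scheme"
  proof -
    interpret ring R by fact
    have "abelian_group (opp R)" by (rule abelian_group_cong[OF abelian_group_axioms]) simp_all
    moreover have "monoid (opp R)" by (rule monoidI) (auto simp: m_assoc)
    ultimately show ?thesis by (intro ringI) (auto simp: l_distr r_distr)
  qed
  from this[of R] this[of "opp R"] show ?thesis by auto
qed

lemma left_module_regular: "ring R \<Longrightarrow> left_module R (regular_module R)"
proof -
  assume "ring R"
  then interpret ring R .
  have "abelian_group (regular_module R)"
    by (rule abelian_group_cong[OF abelian_group_axioms]) simp_all
  then show ?thesis by (intro left_moduleI) (auto simp: \<open>ring R\<close> l_distr r_distr m_assoc)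
qed

lemma submodule_left_module:
  assumes M: "left_module R M" and N: "N \<subseteq> carrier M" "\<zero>\<^bsub>M\<^esub> \<in> N"
    and add: "\<And>x y. x \<in> N \<Longrightarrow> y \<in> N \<Longrightarrow> x \<oplus>\<^bsub>M\<^esub> y \<in> N"
    and smult: "\<And>r x. r \<in> carrier R \<Longrightarrow> x \<in> N \<Longrightarrow> r \<odot>\<^bsub>M\<^esub> x \<in> N"
  shows "left_module R (M\<lparr>carrier := N\<rparr>)"
proof -
  interpret left_module R M by fact
  \<comment> \<open>Additive inverses come from closure under multiplication by minus one.\<close>
  have neg: "\<exists>y\<in>N. y \<oplus>\<^bsub>M\<^esub> x = \<zero>\<^bsub>M\<^esub>" if x: "x \<in> N" for x
  proof (rule bexI)
    have xM: "x \<in> carrier M" using x N by auto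
    show "(\<ominus>\<^bsub>R\<^esub> \<one>\<^bsub>R\<^esub>) \<odot>\<^bsub>M\<^esub> x \<in> N" using x by (intro smult) auto
    have "(\<ominus>\<^bsub>R\<^esub> \<one>\<^bsub>R\<^esub>) \<odot>\<^bsub>M\<^esub> x \<oplus>\<^bsub>M\<^esub> \<one>\<^bsub>R\<^esub> \<odot>\<^bsub>M\<^esub> x = (\<ominus>\<^bsub>R\<^esub> \<one>\<^bsub>R\<^esub> \<oplus>\<^bsub>R\<^esub> \<one>\<^bsub>R\<^esub>) \<odot>\<^bsub>M\<^esub> x"
      using xM by (intro smult_l_distr[symmetric]) auto
    then show "(\<ominus>\<^bsub>R\<^esub> \<one>\<^bsub>R\<^esub>) \<odot>\<^bsub>M\<^esub> x \<oplus>\<^bsub>M\<^esub> x = \<zero>\<^bsub>M\<^esub>"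
      using xM by (simp add: R.l_neg smult_l_null smult_one)
  qed
  have sub: "x \<in> N \<Longrightarrow> x \<in> carrier M" for x using N by auto
  have "abelian_group (M\<lparr>carrier := N\<rparr>)"
    by (rule abelian_groupI) (use neg in \<open>auto simp: add N(2) M.a_ac sub\<close>)
  then show ?thesis
    by (intro left_moduleI)
      (auto simp: sub add smult smult_l_distr smult_r_distr smult_assoc smult_one R.ring_axioms)
qed

lemma left_module_restrict_scalars:
  assumes M: "left_module R M" and S: "ring S" and h: "h \<in> ring_hom S R"
  shows "left_module S (restrict_scalars h M)"
proof -
  interpret left_module R M by fact
  note [simp] = ring_hom_closed[OF h] ring_hom_add[OF h] ring_hom_mult[OF h] ring_hom_one[OF h]
  have "abelian_group (restrict_scalars h M)"
    by (rule abelian_group_cong[OF M.abelian_group_axioms]) (simp_all add: restrict_scalars_def)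
  then show ?thesis
    by (intro left_moduleI)
      (auto simp: S restrict_scalars_def smult_closed smult_l_distr smult_r_distr smult_assoc smult_one)
qed

lemma restrict_scalars_simps [simp]:
  "carrier (restrict_scalars h M) = carrier M" "zero (restrict_scalars h M) = \<zero>\<^bsub>M\<^esub>"
  "add (restrict_scalars h M) = add M" "r \<odot>\<^bsub>restrict_scalars h M\<^esub> x = h r \<odot>\<^bsub>M\<^esub> x"
  by (simp_all add: restrict_scalars_def)

lemma dual_module_simps [simp]:
  "carrier (dual_module R M) = mod_hom (opp R) M (regular_module (opp R)) \<inter> extensional (carrier M)"
  "zero (dual_module R M) = (\<lambda>m\<in>carrier M. \<zero>\<^bsub>R\<^esub>)"
  "f \<oplus>\<^bsub>dual_module R M\<^esub> g = (\<lambda>m\<in>carrier M. f m \<oplus>\<^bsub>R\<^esub> g m)"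
  "r \<odot>\<^bsub>dual_module R M\<^esub> f = (\<lambda>m\<in>carrier M. r \<otimes>\<^bsub>R\<^esub> f m)"
  by (simp_all add: dual_module_def)

lemma mod_hom_restrict:
  assumes "left_module R M" "h \<in> mod_hom R M N"
  shows "restrict h (carrier M) \<in> mod_hom R M N"
proof -
  interpret left_module R M by fact
  show ?thesis
    using mod_hom_closed[OF assms(2)] mod_hom_add[OF assms(2)] mod_hom_smult[OF assms(2)]
    by (intro mod_homI) (auto simp: smult_closed)
qed

lemma mod_hom_regular_opp:
  assumes "ring R"
  shows mod_hom_regular_mult: "r \<in> carrier R \<Longrightarrow> f \<in> mod_hom (opp R) M (regular_module (opp R)) \<Longrightarrow>
    (\<lambda>m. r \<otimes>\<^bsub>R\<^esub> f m) \<in> mod_hom (opp R) M (regular_module (opp R))"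
proof -
  interpret ring R by fact
  assume r: "r \<in> carrier R" and f: "f \<in> mod_hom (opp R) M (regular_module (opp R))"
  show ?thesis
    using mod_hom_closed[OF f] mod_hom_add[OF f] mod_hom_smult[OF f] r
    by (intro mod_homI) (auto simp: r_distr m_assoc)
qed

lemma left_module_dual:
  assumes M: "left_module (opp R) M"
  shows "left_module R (dual_module R M)"
proof -
  interpret M: left_module "opp R" M by fact
  interpret ring R using left_module_ring[OF M] by simp
  have regO: "left_module (opp R) (regular_module (opp R))"
    by (rule left_module_regular) (simp add: ring_axioms)
  let ?D = "dual_module R M"
  have cl: "f m \<in> carrier R" if "f \<in> carrier ?D" "m \<in> carrier M" for f m
    using that mod_hom_closed[of f] by fastforce
  have plus: "f \<oplus>\<^bsub>?D\<^esub> g \<in> carrier ?D" if "f \<in> carrier ?D" "g \<in> carrier ?D" for f g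
    using mod_hom_restrict[OF M mod_hom_plus[OF regO, of f M g]] that by auto
  have zero: "\<zero>\<^bsub>?D\<^esub> \<in> carrier ?D"
    using mod_hom_restrict[OF M mod_hom_const_zero[OF regO]] by auto
  have smult: "r \<odot>\<^bsub>?D\<^esub> f \<in> carrier ?D" if "r \<in> carrier R" "f \<in> carrier ?D" for r f
    using mod_hom_restrict[OF M mod_hom_regular_mult[OF ring_axioms that(1), of f]] that by auto
  have neg: "\<exists>g\<in>carrier ?D. g \<oplus>\<^bsub>?D\<^esub> f = \<zero>\<^bsub>?D\<^esub>" if f: "f \<in> carrier ?D" for f
  proof (rule bexI)
    show "(\<ominus>\<^bsub>R\<^esub> \<one>\<^bsub>R\<^esub>) \<odot>\<^bsub>?D\<^esub> f \<in> carrier ?D" by (rule smult) (use f in auto)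
    have "\<ominus>\<^bsub>R\<^esub> \<one>\<^bsub>R\<^esub> \<otimes>\<^bsub>R\<^esub> f m \<oplus>\<^bsub>R\<^esub> f m = \<zero>\<^bsub>R\<^esub>" if "m \<in> carrier M" for m
      using cl[OF f that] by (simp add: l_minus l_neg)
    then show "(\<ominus>\<^bsub>R\<^esub> \<one>\<^bsub>R\<^esub>) \<odot>\<^bsub>?D\<^esub> f \<oplus>\<^bsub>?D\<^esub> f = \<zero>\<^bsub>?D\<^esub>"
      by (simp cong: restrict_cong)
  qed
  have eqI: "f = g" if "f \<in> carrier ?D" "g \<in> carrier ?D" "\<And>m. m \<in> carrier M \<Longrightarrow> f m = g m" for f g
    using that by (auto intro: extensionalityI)
  have "abelian_group ?D"
  proof (rule abelian_groupI)
    show "(f \<oplus>\<^bsub>?D\<^esub> g) \<oplus>\<^bsub>?D\<^esub> h = f \<oplus>\<^bsub>?D\<^esub> (g \<oplus>\<^bsub>?D\<^esub> h)"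
      if "f \<in> carrier ?D" "g \<in> carrier ?D" "h \<in> carrier ?D" for f g h
      using that by (intro eqI plus) (auto simp: cl a_assoc simp del: dual_module_simps(1))
    show "f \<oplus>\<^bsub>?D\<^esub> g = g \<oplus>\<^bsub>?D\<^esub> f" if "f \<in> carrier ?D" "g \<in> carrier ?D" for f g
      using that by (intro eqI plus) (auto simp: cl a_comm simp del: dual_module_simps(1))
    show "\<zero>\<^bsub>?D\<^esub> \<oplus>\<^bsub>?D\<^esub> f = f" if "f \<in> carrier ?D" for f
      using that by (intro eqI plus zero) (auto simp: cl simp del: dual_module_simps(1))
  qed (fact plus zero neg)+
  with ring_axioms show ?thesis
  proof (rule left_moduleI)
    show "r \<odot>\<^bsub>?D\<^esub> f \<in> carrier ?D" if "r \<in> carrier R" "f \<in> carrier ?D" for r f by (rule smult[OF that])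
    show "(r \<oplus>\<^bsub>R\<^esub> s) \<odot>\<^bsub>?D\<^esub> f = r \<odot>\<^bsub>?D\<^esub> f \<oplus>\<^bsub>?D\<^esub> s \<odot>\<^bsub>?D\<^esub> f"
      if "r \<in> carrier R" "s \<in> carrier R" "f \<in> carrier ?D" for r s f
      using that by (intro eqI plus smult) (auto simp: cl l_distr simp del: dual_module_simps(1))
    show "r \<odot>\<^bsub>?D\<^esub> (f \<oplus>\<^bsub>?D\<^esub> g) = r \<odot>\<^bsub>?D\<^esub> f \<oplus>\<^bsub>?D\<^esub> r \<odot>\<^bsub>?D\<^esub> g"
      if "r \<in> carrier R" "f \<in> carrier ?D" "g \<in> carrier ?D" for r f g
      using that by (intro eqI plus smult) (auto simp: cl r_distr simp del: dual_module_simps(1))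
    show "(r \<otimes>\<^bsub>R\<^esub> s) \<odot>\<^bsub>?D\<^esub> f = r \<odot>\<^bsub>?D\<^esub> (s \<odot>\<^bsub>?D\<^esub> f)"
      if "r \<in> carrier R" "s \<in> carrier R" "f \<in> carrier ?D" for r s f
      using that by (intro eqI plus smult) (auto simp: cl m_assoc simp del: dual_module_simps(1))
    show "\<one>\<^bsub>R\<^esub> \<odot>\<^bsub>?D\<^esub> f = f" if "f \<in> carrier ?D" for f
      using that by (intro eqI smult) (auto simp: cl simp del: dual_module_simps(1))
  qed
qed

lemma dual_complex_simps [simp]:
  "obj (dual_complex R P) i = dual_module R (obj P (- i))"
  "diff (dual_complex R P) i g = (\<lambda>m\<in>carrier (obj P (- i - 1)). g (diff P (- i - 1) m))"
  by (simp_all add: dual_complex_def)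

lemma cochain_complex_dual:
  assumes P: "cochain_complex (opp R) P"
  shows "cochain_complex R (dual_complex R P)"
proof -
  have ri: "ring R" using left_module_ring[OF complex_module[OF P]] by simp
  have regO: "left_module (opp R) (regular_module (opp R))"
    by (rule left_module_regular) (simp add: ri)
  have d: "diff P (- i - 1) \<in> mod_hom (opp R) (obj P (- i - 1)) (obj P (- i))" for i
    using complex_diff_hom'[OF P, of "- i"] by simp
  have idx: "- (i + 1) = - i - (1::int)" for i by simp
  have mem: "diff (dual_complex R P) i g \<in> carrier (dual_module R (obj P (- i - 1)))"
    if "g \<in> carrier (dual_module R (obj P (- i)))" for i g
    using mod_hom_restrict[OF complex_module[OF P] mod_hom_comp[OF d]] that by auto
  have "diff (dual_complex R P) i \<in> mod_hom R (obj (dual_complex R P) i) (obj (dual_complex R P) (i + 1))" for i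
  proof (rule mod_homI)
    show "diff (dual_complex R P) i g \<in> carrier (obj (dual_complex R P) (i + 1))"
      if "g \<in> carrier (obj (dual_complex R P) i)" for g
      using mem[of g i] that unfolding dual_complex_simps(1) idx .
    show "diff (dual_complex R P) i (f \<oplus>\<^bsub>obj (dual_complex R P) i\<^esub> g)
        = diff (dual_complex R P) i f \<oplus>\<^bsub>obj (dual_complex R P) (i + 1)\<^esub> diff (dual_complex R P) i g" for f g
      unfolding dual_complex_simps dual_module_simps idx
      by (rule ext) (simp add: restrict_def mod_hom_closed[OF d])
    show "diff (dual_complex R P) i (r \<odot>\<^bsub>obj (dual_complex R P) i\<^esub> f)
        = r \<odot>\<^bsub>obj (dual_complex R P) (i + 1)\<^esub> diff (dual_complex R P) i f" for r f
      unfolding dual_complex_simps dual_module_simps idx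
      by (rule ext) (simp add: restrict_def mod_hom_closed[OF d])
  qed
  moreover have "diff (dual_complex R P) (i + 1) (diff (dual_complex R P) i g)
      = \<zero>\<^bsub>obj (dual_complex R P) (i + 1 + 1)\<^esub>" if g: "g \<in> carrier (obj (dual_complex R P) i)" for i g
  proof -
    have "g \<in> mod_hom (opp R) (obj P (- i)) (regular_module (opp R))" using g by simp
    then have g0: "g \<zero>\<^bsub>obj P (- i)\<^esub> = \<zero>\<^bsub>R\<^esub>"
      using mod_hom_zero[OF complex_group[OF P] left_module_group[OF regO]] by fastforce
    have "diff P (- i - 1) (diff P (- i - 1 - 1) m) = \<zero>\<^bsub>obj P (- i)\<^esub>"
      if "m \<in> carrier (obj P (- i - 1 - 1))" for m
      using complex_diff_diff'[OF P, of m "- i - 1"] that by simp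
    moreover have "diff P (- i - 1 - 1) m \<in> carrier (obj P (- i - 1))"
      if "m \<in> carrier (obj P (- i - 1 - 1))" for m
      using complex_diff'[OF P, of m "- i - 1"] that by simp
    ultimately show ?thesis
      unfolding dual_complex_simps dual_module_simps idx
      by (intro ext) (simp add: restrict_def g0)
  qed
  ultimately show ?thesis
    unfolding cochain_complex_def using left_module_dual[OF complex_module[OF P]] by simp
qed

section \<open>Cohomology of dual complexes and its homotopy invariance\<close>

lemma dual_cocycles_iff:
  "g \<in> cocycles (dual_complex R C) i \<longleftrightarrow> g \<in> carrier (dual_module R (obj C (- i))) \<and>
     (\<forall>m\<in>carrier (obj C (- i - 1)). g (diff C (- i - 1) m) = \<zero>\<^bsub>R\<^esub>)"
proof -
  have idx: "- (i + 1) = - i - (1::int)" by simp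
  show ?thesis
    unfolding cocycles_def dual_complex_simps idx dual_module_simps(2)
    by (auto simp: restrict_def fun_eq_iff)
qed

text \<open>The witness \<open>h\<close> may be any linear map, so that composites can be given as
  they stand; cutting it down to the carrier makes it an element of the dual module.\<close>

lemma dual_coboundaries_iff:
  assumes C: "cochain_complex (opp R) C"
  shows "g \<in> coboundaries (dual_complex R C) i \<longleftrightarrow> g \<in> carrier (dual_module R (obj C (- i))) \<and>
     (\<exists>h\<in>mod_hom (opp R) (obj C (- i + 1)) (regular_module (opp R)).
        \<forall>m\<in>carrier (obj C (- i)). g m = h (diff C (- i) m))" (is "?L \<longleftrightarrow> ?R")
proof
  have idx: "- (i - 1) = - i + (1::int)" "- i + 1 - 1 = - i" "- (i - 1) - 1 = - i" by simp_all
  {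
    assume L: ?L
    then obtain h where h: "h \<in> carrier (dual_module R (obj C (- i + 1)))"
      and g: "g = (\<lambda>m\<in>carrier (obj C (- i)). h (diff C (- i) m))"
      unfolding coboundaries_def dual_complex_simps idx by auto
    have "g \<in> carrier (obj (dual_complex R C) i)"
      by (rule coboundaries_carrier[OF cochain_complex_dual[OF C] L])
    then show ?R using h g by auto
  }
  assume ?R
  then obtain h where g: "g \<in> extensional (carrier (obj C (- i)))"
    and h: "h \<in> mod_hom (opp R) (obj C (- i + 1)) (regular_module (opp R))"
    and gh: "\<And>m. m \<in> carrier (obj C (- i)) \<Longrightarrow> g m = h (diff C (- i) m)" by auto
  let ?h = "restrict h (carrier (obj C (- i + 1)))"
  have "?h \<in> carrier (dual_module R (obj C (- i + 1)))"
    using mod_hom_restrict[OF complex_module[OF C] h] by simp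
  moreover have "g = (\<lambda>m\<in>carrier (obj C (- i)). ?h (diff C (- i) m))"
    using g gh complex_diff[OF C, of _ "- i"] by (intro extensionalityI[OF g]) auto
  ultimately show ?L unfolding coboundaries_def dual_complex_simps idx by blast
qed

text \<open>Up to homotopy \<open>g\<close> is \<open>g\<close> after \<open>f\<close> after
  \<open>r\<close>, that is, \<open>h\<close> after the differential after \<open>r\<close>, and
  \<open>r\<close> commutes with the differential. The homotopy contributes a second coboundary,
  whose witness is \<open>g\<close> after \<open>k\<close>.\<close>

lemma hom_inj_on_cohomology:
  assumes C: "cochain_complex S C" and D: "cochain_complex S D" and N: "left_module S N"
    and f: "chain_map S C D f" and r: "chain_map S D C r"
    and k: "homotopy S D D (\<lambda>i x. f i (r i x)) (\<lambda>i x. x) k"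
    and g: "g \<in> mod_hom S (obj D j) N" and gd: "\<And>x. x \<in> carrier (obj D (j - 1)) \<Longrightarrow> g (diff D (j - 1) x) = \<zero>\<^bsub>N\<^esub>"
    and h: "h \<in> mod_hom S (obj C (j + 1)) N" and gf: "\<And>x. x \<in> carrier (obj C j) \<Longrightarrow> g (f j x) = h (diff C j x)"
  shows "\<exists>l\<in>mod_hom S (obj D (j + 1)) N. \<forall>x\<in>carrier (obj D j). g x = l (diff D j x)"
proof
  interpret N: left_module S N by fact
  interpret Dj: left_module S "obj D j" by (rule complex_module[OF D])
  let ?l = "\<lambda>y. h (r (j + 1) y) \<oplus>\<^bsub>N\<^esub> \<ominus>\<^bsub>N\<^esub> g (k (j + 1) y)"
  note k1 = homotopy_hom_next[OF k, of j]
  show "?l \<in> mod_hom S (obj D (j + 1)) N"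
    by (intro mod_hom_plus[OF N] mod_hom_uminus[OF N] mod_hom_comp[OF chain_map_hom[OF r] h] mod_hom_comp[OF k1 g])
  show "\<forall>x\<in>carrier (obj D j). g x = ?l (diff D j x)"
  proof
    fix x assume x: "x \<in> carrier (obj D j)"
    have rx: "r j x \<in> carrier (obj C j)" by (rule chain_map_closed[OF r x])
    have kx: "k j x \<in> carrier (obj D (j - 1))" by (rule homotopy_closed[OF k x])
    have dk: "diff D (j - 1) (k j x) \<in> carrier (obj D j)" by (rule complex_diff'[OF D kx])
    have kd: "k (j + 1) (diff D j x) \<in> carrier (obj D j)" by (rule mod_hom_closed[OF k1 complex_diff[OF D x]])
    have gx: "g x \<in> carrier N" "g (k (j + 1) (diff D j x)) \<in> carrier N" using mod_hom_closed[OF g] x kd by auto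
    have "h (r (j + 1) (diff D j x)) = g (f j (r j x))"
      using gf[OF rx] chain_map_comm[OF r x] by simp
    also have "\<dots> = g x \<oplus>\<^bsub>N\<^esub> g (k (j + 1) (diff D j x))"
      using homotopy_eq[OF k x] x dk kd gx gd[OF kx] by (simp add: mod_hom_add[OF g])
    finally show "g x = ?l (diff D j x)" using gx by (simp add: N.M.add_minus_cancel)
  qed
qed

text \<open>The candidate is \<open>g\<close> after \<open>r\<close>. Its pullback along
  \<open>f\<close> differs from \<open>g\<close> by a map \<open>?u\<close> that becomes a
  coboundary after composition with \<open>r\<close>. Since \<open>r\<close> has the right inverse
  \<open>r'\<close> up to homotopy, the injectivity statement for \<open>r\<close> makes
  \<open>?u\<close> itself a coboundary.\<close>

lemma hom_surj_on_cohomology: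
  assumes C: "cochain_complex S C" and D: "cochain_complex S D" and N: "left_module S N"
    and f: "chain_map S C D f" and r: "chain_map S D C r" and r': "chain_map S C D r'"
    and k: "homotopy S D D (\<lambda>i x. f i (r i x)) (\<lambda>i x. x) k"
    and k': "homotopy S C C (\<lambda>i x. r i (r' i x)) (\<lambda>i x. x) k'"
    and g: "g \<in> mod_hom S (obj C j) N" and gd: "\<And>x. x \<in> carrier (obj C (j - 1)) \<Longrightarrow> g (diff C (j - 1) x) = \<zero>\<^bsub>N\<^esub>"
  obtains g' l where "g' \<in> mod_hom S (obj D j) N"
    "\<And>x. x \<in> carrier (obj D (j - 1)) \<Longrightarrow> g' (diff D (j - 1) x) = \<zero>\<^bsub>N\<^esub>"
    "l \<in> mod_hom S (obj C (j + 1)) N"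
    "\<And>x. x \<in> carrier (obj C j) \<Longrightarrow> g' (f j x) = g x \<oplus>\<^bsub>N\<^esub> l (diff C j x)"
proof -
  interpret N: left_module S N by fact
  let ?g' = "\<lambda>x. g (r j x)"
  let ?u = "\<lambda>x. g (r j (f j x)) \<oplus>\<^bsub>N\<^esub> \<ominus>\<^bsub>N\<^esub> g x"
  have g': "?g' \<in> mod_hom S (obj D j) N" by (rule mod_hom_comp[OF chain_map_hom[OF r] g])
  have g'd: "?g' (diff D (j - 1) x) = \<zero>\<^bsub>N\<^esub>" if "x \<in> carrier (obj D (j - 1))" for x
    using that by (simp add: chain_map_comm'[OF r] gd chain_map_closed[OF r])
  have u: "?u \<in> mod_hom S (obj C j) N"
    by (intro mod_hom_plus[OF N] mod_hom_uminus[OF N] g mod_hom_comp[OF chain_map_hom[OF f] g'])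
  have ud: "?u (diff C (j - 1) x) = \<zero>\<^bsub>N\<^esub>" if x: "x \<in> carrier (obj C (j - 1))" for x
  proof -
    have "r j (f j (diff C (j - 1) x)) = diff C (j - 1) (r (j - 1) (f (j - 1) x))"
      using x by (simp add: chain_map_comm'[OF f] chain_map_comm'[OF r] chain_map_closed[OF f])
    then show ?thesis
      using x N.M.add_minus_cancel[of "\<zero>\<^bsub>N\<^esub>" "\<zero>\<^bsub>N\<^esub>"] chain_map_closed[OF r chain_map_closed[OF f x]] by (simp add: gd)
  qed
  \<comment> \<open>Composed with \<open>r\<close>, the map \<open>?u\<close> is \<open>?g'\<close>
    applied to the difference of \<open>f r\<close> and the identity, and this difference is given
    by the homotopy \<open>k\<close>.\<close>
  have "\<exists>h\<in>mod_hom S (obj D (j + 1)) N. \<forall>x\<in>carrier (obj D j). ?u (r j x) = h (diff D j x)"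
  proof
    show "(\<lambda>y. g (r j (k (j + 1) y))) \<in> mod_hom S (obj D (j + 1)) N"
      by (rule mod_hom_comp[OF homotopy_hom_next[OF k] g'])
    show "\<forall>x\<in>carrier (obj D j). ?u (r j x) = g (r j (k (j + 1) (diff D j x)))"
    proof
      fix x assume x: "x \<in> carrier (obj D j)"
      interpret Dj: left_module S "obj D j" by (rule complex_module[OF D])
      have kx: "k j x \<in> carrier (obj D (j - 1))" by (rule homotopy_closed[OF k x])
      have dk: "diff D (j - 1) (k j x) \<in> carrier (obj D j)" by (rule complex_diff'[OF D kx])
      have kd: "k (j + 1) (diff D j x) \<in> carrier (obj D j)"
        by (rule mod_hom_closed[OF homotopy_hom_next[OF k] complex_diff[OF D x]])
      have "?g' (f j (r j x)) = ?g' x \<oplus>\<^bsub>N\<^esub> ?g' (k (j + 1) (diff D j x))"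
        using homotopy_eq[OF k x] x dk kd mod_hom_closed[OF g' x] mod_hom_closed[OF g' kd] g'd[OF kx] mod_hom_add[OF g']
        by simp
      then show "?u (r j x) = g (r j (k (j + 1) (diff D j x)))"
        using mod_hom_closed[OF g' x] mod_hom_closed[OF g' kd] by (simp add: N.M.add_minus_eq)
    qed
  qed
  then obtain h where h: "h \<in> mod_hom S (obj D (j + 1)) N"
    "\<And>x. x \<in> carrier (obj D j) \<Longrightarrow> ?u (r j x) = h (diff D j x)" by blast
  have "\<exists>l\<in>mod_hom S (obj C (j + 1)) N. \<forall>x\<in>carrier (obj C j). ?u x = l (diff C j x)"
    by (rule hom_inj_on_cohomology[OF D C N r r' k' u ud h(1)]) (simp_all add: h(2))
  then obtain l where l: "l \<in> mod_hom S (obj C (j + 1)) N"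
    "\<And>x. x \<in> carrier (obj C j) \<Longrightarrow> ?u x = l (diff C j x)" by blast
  show ?thesis
  proof (rule that[OF g' g'd l(1)])
    fix x assume x: "x \<in> carrier (obj C j)"
    have "g (r j (f j x)) = g x \<oplus>\<^bsub>N\<^esub> ?u x"
      using mod_hom_closed[OF g x] mod_hom_closed[OF g' chain_map_closed[OF f x]] by (rule N.M.eq_add_minus[rotated])
    then show "?g' (f j x) = g x \<oplus>\<^bsub>N\<^esub> l (diff C j x)" by (simp add: l(2)[OF x])
  qed
qed

definition dual_map :: "('r, 'm) cochain \<Rightarrow> (int \<Rightarrow> 'm \<Rightarrow> 'n) \<Rightarrow> int \<Rightarrow> ('n \<Rightarrow> 'r) \<Rightarrow> 'm \<Rightarrow> 'r" where
  "dual_map C f i g = (\<lambda>m\<in>carrier (obj C (- i)). g (f (- i) m))"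

text \<open>Between bounded above complexes of projectives a quasi-isomorphism is invertible up to
  homotopy, and homotopies survive the functor Hom(-, R). The argument runs with one-sided inverses:
  \<open>r\<close> inverts \<open>f\<close>, and \<open>r'\<close> inverts \<open>r\<close>.\<close>

theorem qis_dual:
  assumes pC: "proj_complex (opp R) C I e c" and pD: "proj_complex (opp R) D I' e' c'"
    and q: "qis (opp R) C D f"
  shows "qis R (dual_complex R D) (dual_complex R C) (dual_map C f)"
proof -
  note C = qis_source[OF q] and D = qis_target[OF q] and f = qis_chain_map[OF q]
  obtain r k where r: "qis (opp R) D C r" and k: "homotopy (opp R) D D (\<lambda>i x. f i (r i x)) (\<lambda>i x. x) k"
    by (rule right_homotopy_inverse[OF pD q])
  obtain r' k' where r': "qis (opp R) C D r'" and k': "homotopy (opp R) C C (\<lambda>i x. r i (r' i x)) (\<lambda>i x. x) k'"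
    by (rule right_homotopy_inverse[OF pC r])
  have ri: "ring R" using left_module_ring[OF complex_module[OF C]] by simp
  interpret ring R by fact
  let ?N = "regular_module (opp R)"
  have N: "left_module (opp R) ?N" by (rule left_module_regular) (simp add: ri)
  have mem: "dual_map C f i g \<in> carrier (dual_module R (obj C (- i)))"
    if "g \<in> carrier (dual_module R (obj D (- i)))" for i g
    using mod_hom_restrict[OF complex_module[OF C] mod_hom_comp[OF chain_map_hom[OF f]], of _ "- i"] that
    by (auto simp: dual_map_def)
  note closed = chain_map_closed[OF f] complex_diff'[OF C]
  have cm: "chain_map R (dual_complex R D) (dual_complex R C) (dual_map C f)"
    unfolding chain_map_def
  proof (intro conjI allI ballI)
    fix i
    show "dual_map C f i \<in> mod_hom R (obj (dual_complex R D) i) (obj (dual_complex R C) i)"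
    proof (rule mod_homI)
      show "dual_map C f i g \<in> carrier (obj (dual_complex R C) i)"
        if "g \<in> carrier (obj (dual_complex R D) i)" for g using mem that by simp
      show "dual_map C f i (g \<oplus>\<^bsub>obj (dual_complex R D) i\<^esub> h)
          = dual_map C f i g \<oplus>\<^bsub>obj (dual_complex R C) i\<^esub> dual_map C f i h" for g h
        by (rule ext) (simp add: dual_map_def restrict_def closed)
      show "dual_map C f i (s \<odot>\<^bsub>obj (dual_complex R D) i\<^esub> h)
          = s \<odot>\<^bsub>obj (dual_complex R C) i\<^esub> dual_map C f i h" for s h
        by (rule ext) (simp add: dual_map_def restrict_def closed)
    qed
    fix g
    have idx: "- (i + 1) = - i - (1::int)" by simp
    have "diff C (- i - 1) m \<in> carrier (obj C (- i))"
      "f (- i) (diff C (- i - 1) m) = diff D (- i - 1) (f (- i - 1) m)"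
      if "m \<in> carrier (obj C (- i - 1))" for m
      using complex_diff'[OF C, of m "- i"] chain_map_comm'[OF f, of m "- i"] that by simp_all
    then show "dual_map C f (i + 1) (diff (dual_complex R D) i g) = diff (dual_complex R C) i (dual_map C f i g)"
      unfolding dual_complex_simps dual_map_def idx
      by (intro ext) (simp add: restrict_def closed)
  qed
  show ?thesis
  proof (rule qisI[OF cochain_complex_dual[OF D] cochain_complex_dual[OF C] cm])
    fix i g assume g: "g \<in> cocycles (dual_complex R D) i"
      and b: "dual_map C f i g \<in> coboundaries (dual_complex R C) i"
    obtain h where h: "h \<in> mod_hom (opp R) (obj C (- i + 1)) ?N"
      "\<And>m. m \<in> carrier (obj C (- i)) \<Longrightarrow> g (f (- i) m) = h (diff C (- i) m)"
      using b unfolding dual_coboundaries_iff[OF C] dual_map_def by auto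
    have gh: "g \<in> mod_hom (opp R) (obj D (- i)) ?N"
      and gd: "\<And>m. m \<in> carrier (obj D (- i - 1)) \<Longrightarrow> g (diff D (- i - 1) m) = \<zero>\<^bsub>?N\<^esub>"
      using g unfolding dual_cocycles_iff by auto
    show "g \<in> coboundaries (dual_complex R D) i"
      using hom_inj_on_cohomology[OF C D N f qis_chain_map[OF r] k gh gd h] g
      unfolding dual_coboundaries_iff[OF D] dual_cocycles_iff by blast
  next
    fix i g assume g: "g \<in> cocycles (dual_complex R C) i"
    have gh: "g \<in> mod_hom (opp R) (obj C (- i)) ?N"
      and gd: "\<And>m. m \<in> carrier (obj C (- i - 1)) \<Longrightarrow> g (diff C (- i - 1) m) = \<zero>\<^bsub>?N\<^esub>"
      using g unfolding dual_cocycles_iff by auto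
    obtain g' l where g': "g' \<in> mod_hom (opp R) (obj D (- i)) ?N"
      "\<And>x. x \<in> carrier (obj D (- i - 1)) \<Longrightarrow> g' (diff D (- i - 1) x) = \<zero>\<^bsub>?N\<^esub>"
      and l: "l \<in> mod_hom (opp R) (obj C (- i + 1)) ?N"
      and gl: "\<And>x. x \<in> carrier (obj C (- i)) \<Longrightarrow> g' (f (- i) x) = g x \<oplus>\<^bsub>?N\<^esub> l (diff C (- i) x)"
      by (rule hom_surj_on_cohomology[OF C D N f qis_chain_map[OF r] qis_chain_map[OF r'] k k' gh gd]) (assumption, rule that)
    let ?g' = "restrict g' (carrier (obj D (- i)))"
    let ?b = "\<lambda>x\<in>carrier (obj C (- i)). l (diff C (- i) x)"
    have "?b \<in> carrier (dual_module R (obj C (- i)))"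
      using mod_hom_restrict[OF complex_module[OF C] mod_hom_comp[OF complex_diff_hom[OF C] l]] by simp
    then have "?b \<in> coboundaries (dual_complex R C) i"
      unfolding dual_coboundaries_iff[OF C] using l by auto
    moreover have "?g' \<in> cocycles (dual_complex R D) i"
      unfolding dual_cocycles_iff
      using mod_hom_restrict[OF complex_module[OF D] g'(1)] g'(2) complex_diff'[OF D, of _ "- i"] by auto
    moreover have "dual_map C f i ?g' = g \<oplus>\<^bsub>obj (dual_complex R C) i\<^esub> ?b"
      by (rule ext) (simp add: dual_map_def restrict_def closed gl)
    ultimately show "\<exists>x\<in>cocycles (dual_complex R D) i. \<exists>b\<in>coboundaries (dual_complex R C) i.
        dual_map C f i x = g \<oplus>\<^bsub>obj (dual_complex R C) i\<^esub> b" by blast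
  qed
qed

section \<open>Dual bases of projective modules\<close>

text \<open>The coordinates of the section \<open>s\<close> into a free module are the linear forms,
  and the retraction \<open>p\<close> sends the standard basis vectors to the elements
  \<open>e i\<close>.\<close>

lemma projective_imp_dual_basis:
  fixes M :: "('r, 'm) module"
  assumes "projective R M"
  obtains I :: "'m set" and e c where "dual_basis R M I e c"
proof -
  have M: "left_module R M" using assms by (simp add: projective_def)
  interpret left_module R M by fact
  obtain I :: "'m set" and s p where s: "s \<in> mod_hom R M (free_module R I)"
    and p: "p \<in> mod_hom R (free_module R I) M" and ps: "\<And>x. x \<in> carrier M \<Longrightarrow> p (s x) = x"
    using assms by (auto simp: projective_def)
  let ?F = "free_module R I"
  define \<delta> where "\<delta> i = (\<lambda>j. if j = i then \<one>\<^bsub>R\<^esub> else \<zero>\<^bsub>R\<^esub>)" for i :: 'm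
  have \<delta>: "\<delta> i \<in> carrier ?F" if "i \<in> I" for i
  proof -
    have "finite {j. \<delta> i j \<noteq> \<zero>\<^bsub>R\<^esub>}" by (rule finite_subset[of _ "{i}"]) (auto simp: \<delta>_def)
    then show ?thesis using that by (auto simp: free_module_def \<delta>_def)
  qed
  have F0: "(\<lambda>i. \<zero>\<^bsub>R\<^esub>) \<in> carrier ?F" by (simp add: free_module_def)
  have p0: "p (\<lambda>i. \<zero>\<^bsub>R\<^esub>) = \<zero>\<^bsub>M\<^esub>"
  proof -
    have "(\<lambda>i. \<zero>\<^bsub>R\<^esub>) \<oplus>\<^bsub>?F\<^esub> (\<lambda>i. \<zero>\<^bsub>R\<^esub>) = (\<lambda>i. \<zero>\<^bsub>R\<^esub>)" by (simp add: free_module_def)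
    then show ?thesis
      using mod_hom_add[OF p F0 F0] mod_hom_closed[OF p F0] M.double_eq_self by metis
  qed
  \<comment> \<open>Removing one point of the support at a time reduces the value of
    \<open>p\<close> at a finitely supported function to its values at standard basis
    vectors.\<close>
  have expand: "p f = (\<Oplus>\<^bsub>M\<^esub>i\<in>J. f i \<odot>\<^bsub>M\<^esub> p (\<delta> i))"
    if "finite J" "J \<subseteq> I" "f \<in> carrier ?F" "{i. f i \<noteq> \<zero>\<^bsub>R\<^esub>} \<subseteq> J" for J f
    using that
  proof (induction J arbitrary: f)
    case empty
    then have "f = (\<lambda>i. \<zero>\<^bsub>R\<^esub>)" by auto
    then show ?case using p0 by simp
  next
    case (insert j J)
    have fR: "f i \<in> carrier R" if "i \<in> I" for i using insert.prems that by (auto simp: free_module_def)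
    have j: "j \<in> I" using insert.prems by auto
    have pd: "p (\<delta> i) \<in> carrier M" if "i \<in> I" for i using mod_hom_closed[OF p \<delta>[OF that]] .
    let ?g = "f(j := \<zero>\<^bsub>R\<^esub>)"
    have "finite {i. ?g i \<noteq> \<zero>\<^bsub>R\<^esub>}"
      by (rule finite_subset[of _ J]) (use insert in \<open>auto split: if_splits\<close>)
    then have g: "?g \<in> carrier ?F" using insert.prems(2) by (auto simp: free_module_def)
    have dj: "f j \<odot>\<^bsub>?F\<^esub> \<delta> j \<in> carrier ?F"
    proof -
      have "finite {i. f j \<otimes>\<^bsub>R\<^esub> \<delta> j i \<noteq> \<zero>\<^bsub>R\<^esub>}"
        by (rule finite_subset[of _ "{j}"]) (use fR[OF j] in \<open>auto simp: \<delta>_def\<close>)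
      then show ?thesis using fR[OF j] j by (auto simp: free_module_def \<delta>_def)
    qed
    have "f i = ?g i \<oplus>\<^bsub>R\<^esub> f j \<otimes>\<^bsub>R\<^esub> \<delta> j i" for i
      using fR[of i] fR[OF j] insert.prems by (cases "i \<in> I") (auto simp: \<delta>_def free_module_def)
    then have "f = ?g \<oplus>\<^bsub>?F\<^esub> f j \<odot>\<^bsub>?F\<^esub> \<delta> j"
      by (intro ext) (simp add: free_module_def)
    then have "p f = p ?g \<oplus>\<^bsub>M\<^esub> f j \<odot>\<^bsub>M\<^esub> p (\<delta> j)"
      using mod_hom_add[OF p g dj] mod_hom_smult[OF p \<delta>[OF j] fR[OF j]] by simp
    also have "p ?g = (\<Oplus>\<^bsub>M\<^esub>i\<in>J. ?g i \<odot>\<^bsub>M\<^esub> p (\<delta> i))"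
    proof (rule insert.IH[OF _ g])
      show "J \<subseteq> I" "{i. ?g i \<noteq> \<zero>\<^bsub>R\<^esub>} \<subseteq> J" using insert.prems by auto
    qed
    also have "\<dots> = (\<Oplus>\<^bsub>M\<^esub>i\<in>J. f i \<odot>\<^bsub>M\<^esub> p (\<delta> i))"
      using insert fR pd by (intro M.finsum_cong') (auto intro!: smult_closed)
    finally show ?case
      using insert fR pd by (simp add: M.a_comm smult_closed Pi_iff subset_iff)
  qed
  have c: "(\<lambda>x. s x i) \<in> mod_hom R M (regular_module R)" if "i \<in> I" for i
    using mod_hom_closed[OF s] mod_hom_add[OF s] mod_hom_smult[OF s] that
    by (intro mod_homI) (auto simp: free_module_def)
  have "dual_basis R M I (\<lambda>i. p (\<delta> i)) (\<lambda>i x. s x i)"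
    unfolding dual_basis_def
  proof (intro conjI ballI c)
    show "(\<lambda>i. p (\<delta> i)) \<in> I \<rightarrow> carrier M" using mod_hom_closed[OF p \<delta>] by auto
    fix x assume x: "x \<in> carrier M"
    have sx: "s x \<in> carrier ?F" by (rule mod_hom_closed[OF s x])
    then have fin: "finite {i. s x i \<noteq> \<zero>\<^bsub>R\<^esub>}" and sub: "{i. s x i \<noteq> \<zero>\<^bsub>R\<^esub>} \<subseteq> I"
      by (auto simp: free_module_def)
    from sub have eq: "{i \<in> I. s x i \<noteq> \<zero>\<^bsub>R\<^esub>} = {i. s x i \<noteq> \<zero>\<^bsub>R\<^esub>}" by auto
    show "finite {i \<in> I. s x i \<noteq> \<zero>\<^bsub>R\<^esub>}" using fin eq by simp
    show "x = (\<Oplus>\<^bsub>M\<^esub>i\<in>{i \<in> I. s x i \<noteq> \<zero>\<^bsub>R\<^esub>}. s x i \<odot>\<^bsub>M\<^esub> p (\<delta> i))"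
      unfolding eq using expand[OF fin sub sx] ps[OF x] by simp
  qed
  then show ?thesis by (rule that)
qed

text \<open>The indices are taken from the type of elements because \<open>projective\<close> asks
  for a free module on such a set; a dual basis with other indices is first moved by
  \<open>dual_basis_reindex\<close>.\<close>

lemma dual_basis_imp_projective:
  fixes M :: "('r, 'm) module" and I :: "'m set"
  assumes M: "left_module R M" and db: "dual_basis R M I e c"
  shows "projective R M"
proof -
  interpret left_module R M by fact
  let ?F = "free_module R I"
  have e: "\<And>i. i \<in> I \<Longrightarrow> e i \<in> carrier M"
    and c: "\<And>i. i \<in> I \<Longrightarrow> c i \<in> mod_hom R M (regular_module R)"
    and fin: "\<And>x. x \<in> carrier M \<Longrightarrow> finite {i \<in> I. c i x \<noteq> \<zero>\<^bsub>R\<^esub>}"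
    and dec: "\<And>x. x \<in> carrier M \<Longrightarrow> x = (\<Oplus>\<^bsub>M\<^esub>i\<in>{i \<in> I. c i x \<noteq> \<zero>\<^bsub>R\<^esub>}. c i x \<odot>\<^bsub>M\<^esub> e i)"
    using db by (auto simp: dual_basis_def)
  have cR: "c i x \<in> carrier R" if "i \<in> I" "x \<in> carrier M" for i x
    using mod_hom_closed[OF c] that by fastforce
  define s where "s x = (\<lambda>i. if i \<in> I then c i x else \<zero>\<^bsub>R\<^esub>)" for x
  define p where "p f = (\<Oplus>\<^bsub>M\<^esub>i\<in>{i. f i \<noteq> \<zero>\<^bsub>R\<^esub>}. f i \<odot>\<^bsub>M\<^esub> e i)" for f
  have supp: "{i. s x i \<noteq> \<zero>\<^bsub>R\<^esub>} = {i \<in> I. c i x \<noteq> \<zero>\<^bsub>R\<^esub>}" for x by (auto simp: s_def)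
  have s: "s \<in> mod_hom R M ?F"
  proof (rule mod_homI)
    show "s x \<in> carrier ?F" if "x \<in> carrier M" for x
    proof -
      have "finite {i. s x i \<noteq> \<zero>\<^bsub>R\<^esub>}" unfolding supp by (rule fin[OF that])
      moreover have "s x i \<in> carrier R" if "i \<in> I" for i using cR[OF that \<open>x \<in> carrier M\<close>] that by (simp add: s_def)
      ultimately show ?thesis unfolding free_module_def by (simp add: s_def)
    qed
    show "s (x \<oplus>\<^bsub>M\<^esub> y) = s x \<oplus>\<^bsub>?F\<^esub> s y" if "x \<in> carrier M" "y \<in> carrier M" for x y
      using mod_hom_add[OF c that] by (auto simp: s_def free_module_def)
    show "s (r \<odot>\<^bsub>M\<^esub> x) = r \<odot>\<^bsub>?F\<^esub> s x" if "r \<in> carrier R" "x \<in> carrier M" for r x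
      using mod_hom_smult[OF c that(2,1)] that by (auto simp: s_def free_module_def)
  qed
  have F: "\<And>i. i \<in> I \<Longrightarrow> f i \<in> carrier R" "finite {i. f i \<noteq> \<zero>\<^bsub>R\<^esub>}" "{i. f i \<noteq> \<zero>\<^bsub>R\<^esub>} \<subseteq> I"
    if "f \<in> carrier ?F" for f using that by (auto simp: free_module_def)
  have p_J: "p f = (\<Oplus>\<^bsub>M\<^esub>i\<in>J. f i \<odot>\<^bsub>M\<^esub> e i)"
    if "f \<in> carrier ?F" "finite J" "{i. f i \<noteq> \<zero>\<^bsub>R\<^esub>} \<subseteq> J" "J \<subseteq> I" for f J
    unfolding p_def
    by (rule M.finsum_superset[symmetric, OF that(2,3)])
      (use that F[OF that(1)] e in \<open>auto intro!: smult_closed simp: smult_l_null subset_iff\<close>)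
  have p: "p \<in> mod_hom R ?F M"
  proof (rule mod_homI)
    show "p f \<in> carrier M" if "f \<in> carrier ?F" for f
      unfolding p_def using F[OF that] e by (intro M.finsum_closed) (auto intro!: smult_closed)
  next
    fix f g assume f: "f \<in> carrier ?F" and g: "g \<in> carrier ?F"
    let ?J = "{i. f i \<noteq> \<zero>\<^bsub>R\<^esub>} \<union> {i. g i \<noteq> \<zero>\<^bsub>R\<^esub>}"
    have J: "finite ?J" "?J \<subseteq> I" using F[OF f] F[OF g] by auto
    have sub: "{i. (f \<oplus>\<^bsub>?F\<^esub> g) i \<noteq> \<zero>\<^bsub>R\<^esub>} \<subseteq> ?J" by (auto simp: free_module_def)
    have fg: "f \<oplus>\<^bsub>?F\<^esub> g \<in> carrier ?F"
      using f g finite_subset[OF sub J(1)] by (auto simp: free_module_def)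
    have cl: "f i \<in> carrier R" "g i \<in> carrier R" "e i \<in> carrier M" if "i \<in> ?J" for i
      using F[OF f] F[OF g] e J that by blast+
    have "p (f \<oplus>\<^bsub>?F\<^esub> g) = (\<Oplus>\<^bsub>M\<^esub>i\<in>?J. (f \<oplus>\<^bsub>?F\<^esub> g) i \<odot>\<^bsub>M\<^esub> e i)" by (rule p_J[OF fg J(1) sub J(2)])
    also have "\<dots> = (\<Oplus>\<^bsub>M\<^esub>i\<in>?J. f i \<odot>\<^bsub>M\<^esub> e i \<oplus>\<^bsub>M\<^esub> g i \<odot>\<^bsub>M\<^esub> e i)"
      using cl by (intro M.finsum_cong'[OF HOL.refl]) (auto intro!: smult_closed simp: free_module_def smult_l_distr)
    also have "\<dots> = p f \<oplus>\<^bsub>M\<^esub> p g"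
      using cl p_J[OF f J(1) _ J(2)] p_J[OF g J(1) _ J(2)] by (subst M.finsum_addf) (auto intro!: smult_closed)
    finally show "p (f \<oplus>\<^bsub>?F\<^esub> g) = p f \<oplus>\<^bsub>M\<^esub> p g" .
  next
    fix r f assume r: "r \<in> carrier R" and f: "f \<in> carrier ?F"
    let ?J = "{i. f i \<noteq> \<zero>\<^bsub>R\<^esub>}"
    have J: "finite ?J" "?J \<subseteq> I" using F[OF f] by auto
    have sub: "{i. (r \<odot>\<^bsub>?F\<^esub> f) i \<noteq> \<zero>\<^bsub>R\<^esub>} \<subseteq> ?J" using r by (auto simp: free_module_def)
    have rf: "r \<odot>\<^bsub>?F\<^esub> f \<in> carrier ?F"
      using f r finite_subset[OF sub J(1)] by (auto simp: free_module_def)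
    have cl: "f i \<in> carrier R" "e i \<in> carrier M" if "i \<in> ?J" for i
      using F[OF f] e J that by blast+
    have "p (r \<odot>\<^bsub>?F\<^esub> f) = (\<Oplus>\<^bsub>M\<^esub>i\<in>?J. (r \<odot>\<^bsub>?F\<^esub> f) i \<odot>\<^bsub>M\<^esub> e i)" by (rule p_J[OF rf J(1) sub J(2)])
    also have "\<dots> = (\<Oplus>\<^bsub>M\<^esub>i\<in>?J. r \<odot>\<^bsub>M\<^esub> (f i \<odot>\<^bsub>M\<^esub> e i))"
      using cl r by (intro M.finsum_cong'[OF HOL.refl]) (auto intro!: smult_closed simp: free_module_def smult_assoc)
    also have "\<dots> = r \<odot>\<^bsub>M\<^esub> p f"
      using cl r unfolding p_def by (subst smult_finsum_right) (auto intro!: smult_closed)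
    finally show "p (r \<odot>\<^bsub>?F\<^esub> f) = r \<odot>\<^bsub>M\<^esub> p f" .
  qed
  have "p (s x) = x" if x: "x \<in> carrier M" for x
  proof -
    have "p (s x) = (\<Oplus>\<^bsub>M\<^esub>i\<in>{i \<in> I. c i x \<noteq> \<zero>\<^bsub>R\<^esub>}. c i x \<odot>\<^bsub>M\<^esub> e i)"
      unfolding p_def supp using x cR e
      by (intro M.finsum_cong'[OF HOL.refl]) (auto simp: s_def intro!: smult_closed)
    then show ?thesis using dec[OF x] by simp
  qed
  then show ?thesis using M s p unfolding projective_def by blast
qed

lemma dual_basis_reindex:
  assumes M: "left_module R M" and db: "dual_basis R M I e c" and h: "bij_betw h J I"
  shows "dual_basis R M J (\<lambda>j. e (h j)) (\<lambda>j. c (h j))"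
proof -
  interpret left_module R M by fact
  have hJ: "h j \<in> I" if "j \<in> J" for j using h that by (auto simp: bij_betw_def)
  have inj: "inj_on h J" using h by (simp add: bij_betw_def)
  have cR: "c i x \<in> carrier R" "e i \<in> carrier M" if "i \<in> I" "x \<in> carrier M" for i x
    using db mod_hom_closed[of "c i"] that by (fastforce simp: dual_basis_def)+
  show ?thesis
    unfolding dual_basis_def
  proof (intro conjI ballI)
    show "(\<lambda>j. e (h j)) \<in> J \<rightarrow> carrier M" using db hJ by (auto simp: dual_basis_def)
    show "c (h j) \<in> mod_hom R M (regular_module R)" if "j \<in> J" for j
      using db hJ[OF that] by (auto simp: dual_basis_def)
    fix x assume x: "x \<in> carrier M"
    let ?J = "{j \<in> J. c (h j) x \<noteq> \<zero>\<^bsub>R\<^esub>}"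
    have im: "h ` ?J = {i \<in> I. c i x \<noteq> \<zero>\<^bsub>R\<^esub>}" using h by (auto simp: bij_betw_def)
    have injJ: "inj_on h ?J" using inj by (rule inj_on_subset) auto
    show "finite ?J"
      by (rule finite_imageD[OF _ injJ]) (use db x in \<open>simp add: im dual_basis_def\<close>)
    have "x = (\<Oplus>\<^bsub>M\<^esub>i\<in>h ` ?J. c i x \<odot>\<^bsub>M\<^esub> e i)"
      unfolding im using db x by (simp add: dual_basis_def)
    also have "\<dots> = (\<Oplus>\<^bsub>M\<^esub>j\<in>?J. c (h j) x \<odot>\<^bsub>M\<^esub> e (h j))"
      using injJ x hJ cR by (intro M.finsum_reindex) (auto intro!: smult_closed)
    finally show "x = (\<Oplus>\<^bsub>M\<^esub>j\<in>?J. c (h j) x \<odot>\<^bsub>M\<^esub> e (h j))" .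
  qed
qed

text \<open>A coordinate that vanishes on all generators vanishes everywhere. Each of the finitely
  many generators has finitely many nonzero coordinates, and these are the ones kept.\<close>

lemma finite_dual_basis:
  fixes M :: "('r, 'm) module"
  assumes fg: "finitely_generated R M" and pr: "projective R M"
  obtains I :: "'m set" and e c where "finite I" "dual_basis R M I e c"
proof -
  obtain I :: "'m set" and e c where db: "dual_basis R M I e c" by (rule projective_imp_dual_basis[OF pr])
  have M: "left_module R M" using fg by (simp add: finitely_generated_def)
  interpret left_module R M by fact
  have reg: "left_module R (regular_module R)" by (rule left_module_regular[OF R.ring_axioms])
  obtain S where S: "finite S" "S \<subseteq> carrier M"
    and gen: "\<And>x. x \<in> carrier M \<Longrightarrow> \<exists>r\<in>S \<rightarrow> carrier R. x = (\<Oplus>\<^bsub>M\<^esub>s\<in>S. r s \<odot>\<^bsub>M\<^esub> s)"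
    using fg unfolding finitely_generated_def by blast
  have c: "c i \<in> mod_hom R M (regular_module R)" if "i \<in> I" for i
    using db that by (auto simp: dual_basis_def)
  define J where "J = (\<Union>s\<in>S. {i \<in> I. c i s \<noteq> \<zero>\<^bsub>R\<^esub>})"
  have J: "finite J" using S db unfolding J_def dual_basis_def by (auto simp: subset_iff)
  have supp: "{i \<in> J. c i x \<noteq> \<zero>\<^bsub>R\<^esub>} = {i \<in> I. c i x \<noteq> \<zero>\<^bsub>R\<^esub>}" if x: "x \<in> carrier M" for x
  proof -
    have "c i x = \<zero>\<^bsub>R\<^esub>" if i: "i \<in> I" "i \<notin> J" for i
    proof -
      obtain r where r: "r \<in> S \<rightarrow> carrier R" "x = (\<Oplus>\<^bsub>M\<^esub>s\<in>S. r s \<odot>\<^bsub>M\<^esub> s)" using gen[OF x] by blast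
      have "c i x = (\<Oplus>\<^bsub>regular_module R\<^esub>s\<in>S. c i (r s \<odot>\<^bsub>M\<^esub> s))"
        unfolding r(2) using r(1) S(2)
        by (intro mod_hom_finsum[OF M.abelian_group_axioms left_module_group[OF reg] c[OF i(1)]])
          (auto intro!: smult_closed)
      also have "\<dots> = (\<Oplus>\<^bsub>regular_module R\<^esub>s\<in>S. \<zero>\<^bsub>regular_module R\<^esub>)"
      proof (rule abelian_monoid.finsum_cong'[OF _ HOL.refl])
        show "abelian_monoid (regular_module R)" using left_module_group[OF reg] by (simp add: abelian_group_def)
        show "c i (r s \<odot>\<^bsub>M\<^esub> s) = \<zero>\<^bsub>regular_module R\<^esub>" if "s \<in> S" for s
          using that S(2) r(1) i mod_hom_smult[OF c[OF i(1)], of s "r s"]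
          by (auto simp: J_def Pi_iff subset_iff)
      qed auto
      also have "\<dots> = \<zero>\<^bsub>R\<^esub>"
        using abelian_monoid.finsum_zero[of "regular_module R" S] left_module_group[OF reg]
        by (simp add: abelian_group_def)
      finally show ?thesis .
    qed
    then show ?thesis by (auto simp: J_def)
  qed
  have "dual_basis R M J e c"
    using db unfolding dual_basis_def by (auto simp: supp) (auto simp: J_def)
  then show ?thesis using that J by blast
qed

text \<open>Linear forms and basis elements exchange roles: applying \<open>q\<close> to the
  expansion of an element in the \<open>e i\<close> exhibits \<open>q\<close> as the combination of
  the \<open>c i\<close> with coefficients \<open>q (e i)\<close>.\<close>

lemma dual_basis_dual_module:
  assumes M: "left_module (opp R) M" and fin: "finite I" and db: "dual_basis (opp R) M I e c"
  shows "dual_basis R (dual_module R M) I (\<lambda>i. restrict (c i) (carrier M)) (\<lambda>i q. q (e i))"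
proof -
  interpret M: left_module "opp R" M by fact
  interpret R: ring R using left_module_ring[OF M] by simp
  let ?Q = "dual_module R M"
  interpret Q: left_module R ?Q by (rule left_module_dual[OF M])
  have regO: "left_module (opp R) (regular_module (opp R))"
    by (rule left_module_regular) (simp add: R.ring_axioms)
  have e: "\<And>i. i \<in> I \<Longrightarrow> e i \<in> carrier M"
    and c: "\<And>i. i \<in> I \<Longrightarrow> c i \<in> mod_hom (opp R) M (regular_module (opp R))"
    and dec: "\<And>x. x \<in> carrier M \<Longrightarrow> x = (\<Oplus>\<^bsub>M\<^esub>i\<in>I. c i x \<odot>\<^bsub>M\<^esub> e i)"
    using db unfolding finite_dual_basis_iff[OF M fin] by auto
  have cR: "c i x \<in> carrier R" if "i \<in> I" "x \<in> carrier M" for i x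
    using mod_hom_closed[OF c] that by fastforce
  have cQ: "restrict (c i) (carrier M) \<in> carrier ?Q" if "i \<in> I" for i
    using mod_hom_restrict[OF M c[OF that]] by simp
  have ev: "add_hom ?Q R (\<lambda>q. q m)" if "m \<in> carrier M" for m
    using that mod_hom_closed[of _ "opp R" M "regular_module (opp R)" m] by (intro add_homI) auto
  have qR: "q m \<in> carrier R" if "q \<in> carrier ?Q" "m \<in> carrier M" for q m
    by (rule add_hom_closed[OF ev[OF that(2)] that(1)])
  show ?thesis
    unfolding finite_dual_basis_iff[OF Q.left_module_axioms fin]
  proof (intro conjI ballI)
    show "(\<lambda>i. restrict (c i) (carrier M)) \<in> I \<rightarrow> carrier ?Q" using cQ by auto
    show "(\<lambda>q. q (e i)) \<in> mod_hom R ?Q (regular_module R)" if "i \<in> I" for i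
      using e[OF that] qR by (intro mod_homI) (auto simp del: dual_module_simps(1))
    fix q assume q: "q \<in> carrier ?Q"
    have qh: "q \<in> mod_hom (opp R) M (regular_module (opp R))" using q by simp
    let ?s = "\<Oplus>\<^bsub>?Q\<^esub>i\<in>I. q (e i) \<odot>\<^bsub>?Q\<^esub> restrict (c i) (carrier M)"
    have mem: "(\<lambda>i. q (e i) \<odot>\<^bsub>?Q\<^esub> restrict (c i) (carrier M)) \<in> I \<rightarrow> carrier ?Q"
      using cQ q e qR Q.smult_closed by blast
    have sQ: "?s \<in> carrier ?Q" by (rule Q.M.finsum_closed[OF mem])
    show "q = ?s"
    proof (rule extensionalityI[of _ "carrier M"])
      show "q \<in> extensional (carrier M)" "?s \<in> extensional (carrier M)" using q sQ by auto
      fix m assume m: "m \<in> carrier M"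
      have "?s m = (\<Oplus>\<^bsub>R\<^esub>i\<in>I. (q (e i) \<odot>\<^bsub>?Q\<^esub> restrict (c i) (carrier M)) m)"
        by (rule add_hom_finsum[OF Q.M.abelian_group_axioms R.abelian_group_axioms ev[OF m] mem])
      also have "\<dots> = (\<Oplus>\<^bsub>R\<^esub>i\<in>I. q (c i m \<odot>\<^bsub>M\<^esub> e i))"
        using m q e cR qR mod_hom_smult[OF qh e] M.smult_closed
        by (intro R.finsum_cong'[OF HOL.refl]) (auto simp del: dual_module_simps(1))
      also have "\<dots> = q (\<Oplus>\<^bsub>M\<^esub>i\<in>I. c i m \<odot>\<^bsub>M\<^esub> e i)"
      proof (rule add_hom_finsum[OF M.M.abelian_group_axioms R.abelian_group_axioms, symmetric])
        show "add_hom M R q" using qR[OF q] mod_hom_add[OF qh] by (intro add_homI) auto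
        show "(\<lambda>i. c i m \<odot>\<^bsub>M\<^esub> e i) \<in> I \<rightarrow> carrier M" using m cR e M.smult_closed by auto
      qed
      also have "\<dots> = q m" using dec[OF m] by simp
      finally show "q m = ?s m" by simp
    qed
  qed
qed

section \<open>Truncation\<close>

lemma qis_compose:
  assumes f: "qis R C D f" and g: "qis R D B g"
  shows "qis R C B (\<lambda>i x. g i (f i x))"
proof -
  note C = qis_source[OF f] and D = qis_target[OF f] and B = qis_target[OF g]
    and fc = qis_chain_map[OF f] and gc = qis_chain_map[OF g]
  show ?thesis
  proof (rule qisI[OF C B chain_map_compose[OF fc gc]])
    show "x \<in> coboundaries C i" if "x \<in> cocycles C i" "g i (f i x) \<in> coboundaries B i" for i x
      using qis_inj[OF f that(1)] qis_inj[OF g chain_map_cocycles[OF C D fc that(1)] that(2)] by blast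
  next
    fix i y assume y: "y \<in> cocycles B i"
    interpret B: abelian_group "obj B i" by (rule complex_group[OF B])
    obtain x b where x: "x \<in> cocycles D i" and b: "b \<in> coboundaries B i" "g i x = y \<oplus>\<^bsub>obj B i\<^esub> b"
      by (rule qis_surj[OF g y])
    obtain w b' where w: "w \<in> cocycles C i" and b': "b' \<in> coboundaries D i" "f i w = x \<oplus>\<^bsub>obj D i\<^esub> b'"
      by (rule qis_surj[OF f x])
    have gb': "g i b' \<in> coboundaries B i" by (rule chain_map_coboundaries[OF D B gc b'(1)])
    have "g i (f i w) = y \<oplus>\<^bsub>obj B i\<^esub> (b \<oplus>\<^bsub>obj B i\<^esub> g i b')"
      using mod_hom_add[OF chain_map_hom[OF gc] cocycles_carrier[OF x] coboundaries_carrier[OF D b'(1)]]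
        b(2) b'(2) cocycles_carrier[OF y] coboundaries_carrier[OF B b(1)] coboundaries_carrier[OF B gb']
      by (simp add: B.a_assoc)
    then show "\<exists>x\<in>cocycles C i. \<exists>b\<in>coboundaries B i. g i (f i x) = y \<oplus>\<^bsub>obj B i\<^esub> b"
      using w coboundaries_add[OF B b(1) gb'] by blast
  qed
qed

lemma zero_submodule_simps [simp]:
  "carrier (zero_submodule M) = {\<zero>\<^bsub>M\<^esub>}" "zero (zero_submodule M) = \<zero>\<^bsub>M\<^esub>"
  "add (zero_submodule M) = add M" "smult (zero_submodule M) = smult M"
  by (simp_all add: zero_submodule_def)

lemma left_module_zero_submodule:
  assumes "left_module R M" shows "left_module R (zero_submodule M)"
proof -
  interpret left_module R M by fact
  show ?thesis
    unfolding zero_submodule_def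
    by (rule submodule_left_module[OF assms]) (auto simp: smult_r_null)
qed

lemma cochain_complex_concentrated:
  assumes "left_module R M" shows "cochain_complex R (concentrated d M)"
proof -
  interpret left_module R M by fact
  show ?thesis
    unfolding cochain_complex_def concentrated_def
    by (auto simp: assms left_module_zero_submodule intro!: mod_homI smult_r_null[symmetric])
qed

lemma concentrated_cocycles: "cocycles (concentrated d M) i = (if i = d then carrier M else {\<zero>\<^bsub>M\<^esub>})"
  by (auto simp: cocycles_def concentrated_def)

lemma concentrated_coboundaries:
  "left_module R M \<Longrightarrow> coboundaries (concentrated d M) i = {\<zero>\<^bsub>M\<^esub>}"
proof -
  assume "left_module R M"
  then interpret left_module R M .
  show ?thesis using M.zero_closed by (force simp: coboundaries_def concentrated_def)
qed

lemma concentrated_obj: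
  "zero (obj (concentrated d M) i) = \<zero>\<^bsub>M\<^esub>" "add (obj (concentrated d M) i) = add M"
  "smult (obj (concentrated d M) i) = smult M"
  "carrier (obj (concentrated d M) i) = (if i = d then carrier M else {\<zero>\<^bsub>M\<^esub>})"
  by (auto simp: concentrated_def)

text \<open>The subcomplex that stops at the cocycles of degree \<open>d\<close>. It includes into
  \<open>C\<close>, and under vanishing below \<open>d\<close> it projects onto the cohomology in
  degree \<open>d\<close>, so it can serve as the middle of a roof.\<close>

definition truncation :: "int \<Rightarrow> ('r, 'm) cochain \<Rightarrow> ('r, 'm) cochain" where
  "truncation d C = \<lparr>obj = (\<lambda>i. if i < d then obj C i
      else if i = d then (obj C d)\<lparr>carrier := cocycles C d\<rparr> else zero_submodule (obj C i)),
    diff = diff C\<rparr>"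

lemma truncation_simps [simp]:
  "zero (obj (truncation d C) i) = \<zero>\<^bsub>obj C i\<^esub>" "add (obj (truncation d C) i) = add (obj C i)"
  "smult (obj (truncation d C) i) = smult (obj C i)" "diff (truncation d C) = diff C"
  "carrier (obj (truncation d C) i) =
     (if i < d then carrier (obj C i) else if i = d then cocycles C d else {\<zero>\<^bsub>obj C i\<^esub>})"
  by (auto simp: truncation_def)

lemma truncation_carrier_subset:
  "cochain_complex R C \<Longrightarrow> x \<in> carrier (obj (truncation d C) i) \<Longrightarrow> x \<in> carrier (obj C i)"
  using cocycles_carrier[of x C d] abelian_monoid.zero_closed[of "obj C i"] complex_group[of R C i]
  by (auto simp: abelian_group_def split: if_splits)

lemma cochain_complex_truncation:
  assumes C: "cochain_complex R C" shows "cochain_complex R (truncation d C)"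
  unfolding cochain_complex_def
proof (intro conjI allI ballI)
  fix i
  show "left_module R (obj (truncation d C) i)"
    using complex_module[OF C] left_module_zero_submodule[OF complex_module[OF C]]
      submodule_left_module[OF complex_module[OF C], of "cocycles C d" d]
      cocycles_carrier[of _ C d]
    by (auto simp: truncation_def subset_iff cocycles_zero[OF C] cocycles_add[OF C] cocycles_smult[OF C])
  note d = complex_diff_hom[OF C, of i]
  show "diff (truncation d C) i \<in> mod_hom R (obj (truncation d C) i) (obj (truncation d C) (i + 1))"
  proof (rule mod_homI)
    show "diff (truncation d C) i x \<in> carrier (obj (truncation d C) (i + 1))"
      if x: "x \<in> carrier (obj (truncation d C) i)" for x
    proof -
      consider "i + 1 < d" | "i + 1 = d" | "i = d" | "i > d" by linarith
      then show ?thesis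
      proof cases
        case 1
        then show ?thesis using x complex_diff[OF C] by simp
      next
        case 2
        then have "diff C i x \<in> coboundaries C d"
          using x coboundariesI[of x C d] by (auto simp: algebra_simps)
        then show ?thesis using 2 coboundaries_subset_cocycles[OF C, of d] by auto
      next
        case 3
        then show ?thesis using x cocycles_diff by auto
      next
        case 4
        then show ?thesis using x complex_diff_zero[OF C] by simp
      qed
    qed
    fix x assume x: "x \<in> carrier (obj (truncation d C) i)"
    note x' = truncation_carrier_subset[OF C x]
    show "diff (truncation d C) i (x \<oplus>\<^bsub>obj (truncation d C) i\<^esub> y) =
        diff (truncation d C) i x \<oplus>\<^bsub>obj (truncation d C) (i + 1)\<^esub> diff (truncation d C) i y"
      if "y \<in> carrier (obj (truncation d C) i)" for y
      using mod_hom_add[OF d x' truncation_carrier_subset[OF C that]] by simp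
    show "diff (truncation d C) i (r \<odot>\<^bsub>obj (truncation d C) i\<^esub> x)
        = r \<odot>\<^bsub>obj (truncation d C) (i + 1)\<^esub> diff (truncation d C) i x" if "r \<in> carrier R" for r
      using mod_hom_smult[OF d x' that] by simp
  qed
  fix x assume "x \<in> carrier (obj (truncation d C) i)"
  from complex_diff_diff[OF C truncation_carrier_subset[OF C this]]
  show "diff (truncation d C) (i + 1) (diff (truncation d C) i x) = \<zero>\<^bsub>obj (truncation d C) (i + 1 + 1)\<^esub>"
    by (simp add: add.assoc)
qed

lemma truncation_cocycles:
  assumes "cochain_complex R C"
  shows "cocycles (truncation d C) i = (if i \<le> d then cocycles C i else {\<zero>\<^bsub>obj C i\<^esub>})"
  using complex_diff_zero[OF assms] by (auto simp: cocycles_def)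

lemma truncation_coboundaries:
  assumes "cochain_complex R C"
  shows "coboundaries (truncation d C) i = (if i \<le> d then coboundaries C i else {\<zero>\<^bsub>obj C i\<^esub>})"
proof -
  consider "i \<le> d" | "i - 1 = d" | "i - 1 > d" by linarith
  then show ?thesis
  proof cases
    \<comment> \<open>Here \<open>i = d + 1\<close>: the term in degree \<open>d\<close> consists of
      cocycles, so zero is the only boundary in degree \<open>i\<close>.\<close>
    case 2
    then have "i = d + 1" by simp
    then show ?thesis using cocycles_zero[OF assms, of d] complex_diff_zero[OF assms, of d] cocycles_diff[of _ C d]
      by (force simp: coboundaries_def)
  next
    case 3
    then show ?thesis using complex_diff_zero[OF assms, of "i - 1"] by (auto simp: coboundaries_def)
  qed (auto simp: coboundaries_def)
qed

text \<open>Above degree \<open>d\<close> a cocycle of \<open>C\<close> is a coboundary by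
  hypothesis, so its class is represented by zero; up to degree \<open>d\<close> both complexes have
  the same cocycles and coboundaries.\<close>

lemma qis_truncation_inclusion:
  assumes C: "cochain_complex R C" and ex: "\<And>i. i > d \<Longrightarrow> cocycles C i \<subseteq> coboundaries C i"
  shows "qis R (truncation d C) C (\<lambda>i x. x)"
proof (rule qisI[OF cochain_complex_truncation[OF C] C])
  show "chain_map R (truncation d C) C (\<lambda>i x. x)"
    unfolding chain_map_def
    using truncation_carrier_subset[OF C] by (auto intro!: mod_homI simp del: truncation_simps(5))
  fix i
  interpret abelian_group "obj C i" by (rule complex_group[OF C])
  show "x \<in> coboundaries (truncation d C) i" if "x \<in> cocycles (truncation d C) i" "x \<in> coboundaries C i" for x
    using that by (auto simp: truncation_cocycles[OF C] truncation_coboundaries[OF C] split: if_splits)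
  fix y assume y: "y \<in> cocycles C i"
  note yc = cocycles_carrier[OF y]
  show "\<exists>x\<in>cocycles (truncation d C) i. \<exists>b\<in>coboundaries C i. x = y \<oplus>\<^bsub>obj C i\<^esub> b"
  proof (cases "i \<le> d")
    case True
    then show ?thesis
      using y yc coboundaries_zero[OF C, of i]
      by (intro bexI[of _ y] bexI[of _ "\<zero>\<^bsub>obj C i\<^esub>"]) (auto simp: truncation_cocycles[OF C])
  next
    case False
    then have "\<ominus>\<^bsub>obj C i\<^esub> y \<in> coboundaries C i" using ex[of i] y coboundaries_minus[OF C] by auto
    then show ?thesis using False yc
      by (intro bexI[of _ "\<zero>\<^bsub>obj C i\<^esub>"] bexI[of _ "\<ominus>\<^bsub>obj C i\<^esub> y"])
        (auto simp: truncation_cocycles[OF C] r_neg)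
  qed
qed

text \<open>A class map \<open>h\<close> is defined on the cocycles of degree \<open>d\<close> only
  and need not extend to a chain map on \<open>C\<close>. On the truncation these cocycles are the
  whole top term.\<close>

lemma qis_truncation_projection:
  assumes C: "cochain_complex R C" and M: "left_module R M"
    and ex: "\<And>i. i < d \<Longrightarrow> cocycles C i \<subseteq> coboundaries C i"
    and h: "h \<in> mod_hom R ((obj C d)\<lparr>carrier := cocycles C d\<rparr>) M"
    and ker: "\<And>x. x \<in> cocycles C d \<Longrightarrow> h x = \<zero>\<^bsub>M\<^esub> \<longleftrightarrow> x \<in> coboundaries C d"
    and surj: "carrier M \<subseteq> h ` cocycles C d"
  shows "qis R (truncation d C) (concentrated d M) (\<lambda>i x. if i = d then h x else \<zero>\<^bsub>M\<^esub>)"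
proof -
  interpret M: left_module R M by fact
  have hc: "h x \<in> carrier M" if "x \<in> cocycles C d" for x using mod_hom_closed[OF h] that by simp
  have ha: "h (x \<oplus>\<^bsub>obj C d\<^esub> y) = h x \<oplus>\<^bsub>M\<^esub> h y" if "x \<in> cocycles C d" "y \<in> cocycles C d" for x y
    using mod_hom_add[OF h, of x y] that by simp
  have hs: "h (r \<odot>\<^bsub>obj C d\<^esub> x) = r \<odot>\<^bsub>M\<^esub> h x" if "r \<in> carrier R" "x \<in> cocycles C d" for r x
    using mod_hom_smult[OF h, of x r] that by simp
  let ?f = "\<lambda>i x. if i = d then h x else \<zero>\<^bsub>M\<^esub>"
  show ?thesis
  proof (rule qisI[OF cochain_complex_truncation[OF C] cochain_complex_concentrated[OF M]])
    show "chain_map R (truncation d C) (concentrated d M) ?f"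
      unfolding chain_map_def
    proof (intro conjI allI ballI)
      fix i
      show "?f i \<in> mod_hom R (obj (truncation d C) i) (obj (concentrated d M) i)"
        by (intro mod_homI) (auto simp: concentrated_obj hc ha hs M.smult_r_null)
      fix x assume x: "x \<in> carrier (obj (truncation d C) i)"
      have "h (diff C i x) = \<zero>\<^bsub>M\<^esub>" if "i + 1 = d"
      proof -
        have i: "i = d - 1" using that by simp
        have "diff C i x \<in> coboundaries C d" using x coboundariesI[of x C d] by (simp add: i)
        then show ?thesis using ker coboundaries_subset_cocycles[OF C, of d] by blast
      qed
      then show "?f (i + 1) (diff (truncation d C) i x) = diff (concentrated d M) i (?f i x)"
        by (simp add: concentrated_def)
    qed
  next
    fix i x assume x: "x \<in> cocycles (truncation d C) i" "?f i x \<in> coboundaries (concentrated d M) i"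
    then show "x \<in> coboundaries (truncation d C) i"
      using ex[of i] ker[of x]
      by (auto simp: truncation_cocycles[OF C] truncation_coboundaries[OF C] concentrated_coboundaries[OF M]
          split: if_splits)
  next
    fix i y assume y: "y \<in> cocycles (concentrated d M) i"
    have "\<exists>x\<in>cocycles (truncation d C) i. ?f i x = y"
    proof (cases "i = d")
      case True
      then show ?thesis using y surj
        by (auto simp: concentrated_cocycles truncation_cocycles[OF C])
    next
      case False
      then show ?thesis using y cocycles_zero[OF C, of i]
        by (intro bexI[of _ "\<zero>\<^bsub>obj C i\<^esub>"]) (auto simp: concentrated_cocycles truncation_cocycles[OF C])
    qed
    moreover have "y \<in> carrier M" using y M.M.zero_closed by (auto simp: concentrated_cocycles split: if_splits)
    ultimately show "\<exists>x\<in>cocycles (truncation d C) i. \<exists>b\<in>coboundaries (concentrated d M) i.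
        ?f i x = y \<oplus>\<^bsub>obj (concentrated d M) i\<^esub> b"
      by (simp add: concentrated_coboundaries[OF M] concentrated_obj)
  qed
qed

text \<open>Roofs and resolutions are required to have elements in prescribed types. A module is
  moved to another type along an injection \<iota>, inverted on its image by
  \<open>inv_into UNIV \<iota>\<close>.\<close>

definition embed_module :: "('m \<Rightarrow> 'n) \<Rightarrow> ('r, 'm) module \<Rightarrow> ('r, 'n) module" where
  "embed_module \<iota> M = \<lparr>carrier = \<iota> ` carrier M, mult = undefined, one = undefined, zero = \<iota> \<zero>\<^bsub>M\<^esub>,
     add = (\<lambda>x y. \<iota> (inv_into UNIV \<iota> x \<oplus>\<^bsub>M\<^esub> inv_into UNIV \<iota> y)), smult = (\<lambda>r x. \<iota> (r \<odot>\<^bsub>M\<^esub> inv_into UNIV \<iota> x))\<rparr>"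

definition embed_complex :: "('m \<Rightarrow> 'n) \<Rightarrow> ('r, 'm) cochain \<Rightarrow> ('r, 'n) cochain" where
  "embed_complex \<iota> C = \<lparr>obj = (\<lambda>i. embed_module \<iota> (obj C i)), diff = (\<lambda>i x. \<iota> (diff C i (inv_into UNIV \<iota> x)))\<rparr>"

lemma embed_module_simps [simp]:
  "carrier (embed_module \<iota> M) = \<iota> ` carrier M" "zero (embed_module \<iota> M) = \<iota> \<zero>\<^bsub>M\<^esub>"
  "x \<oplus>\<^bsub>embed_module \<iota> M\<^esub> y = \<iota> (inv_into UNIV \<iota> x \<oplus>\<^bsub>M\<^esub> inv_into UNIV \<iota> y)"
  "r \<odot>\<^bsub>embed_module \<iota> M\<^esub> x = \<iota> (r \<odot>\<^bsub>M\<^esub> inv_into UNIV \<iota> x)"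
  by (simp_all add: embed_module_def)

lemma embed_complex_simps [simp]:
  "obj (embed_complex \<iota> C) i = embed_module \<iota> (obj C i)"
  "diff (embed_complex \<iota> C) i x = \<iota> (diff C i (inv_into UNIV \<iota> x))"
  by (simp_all add: embed_complex_def)

lemma left_module_embed:
  assumes M: "left_module R M" and \<iota>: "inj \<iota>"
  shows "left_module R (embed_module \<iota> M)"
proof -
  interpret left_module R M by fact
  note [simp] = inv_f_f[OF \<iota>]
  have "abelian_group (embed_module \<iota> M)"
  proof (rule abelian_groupI)
    show "\<exists>y\<in>carrier (embed_module \<iota> M). y \<oplus>\<^bsub>embed_module \<iota> M\<^esub> x = \<zero>\<^bsub>embed_module \<iota> M\<^esub>"
      if x: "x \<in> carrier (embed_module \<iota> M)" for x
    proof -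
      obtain m where m: "m \<in> carrier M" "x = \<iota> m" using x by auto
      then show ?thesis by (intro bexI[of _ "\<iota> (\<ominus>\<^bsub>M\<^esub> m)"]) (auto simp: M.l_neg)
    qed
  qed (auto simp: M.a_ac)
  then show ?thesis
    by (intro left_moduleI)
      (auto simp: R.ring_axioms smult_closed smult_l_distr smult_r_distr smult_assoc smult_one)
qed

lemma
  assumes C: "cochain_complex R C" and \<iota>: "inj \<iota>"
  shows cochain_complex_embed: "cochain_complex R (embed_complex \<iota> C)"
    and qis_embed: "qis R (embed_complex \<iota> C) C (\<lambda>i. inv_into UNIV \<iota>)"
proof -
  note [simp] = inv_f_f[OF \<iota>]
  show E: "cochain_complex R (embed_complex \<iota> C)"
    using mod_hom_closed[OF complex_diff_hom[OF C]] mod_hom_add[OF complex_diff_hom[OF C]]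
      mod_hom_smult[OF complex_diff_hom[OF C]] complex_diff_diff[OF C]
    by (auto simp: cochain_complex_def left_module_embed[OF complex_module[OF C] \<iota>] add.assoc intro!: mod_homI)
  have Z: "cocycles (embed_complex \<iota> C) i = \<iota> ` cocycles C i" for i
    by (auto simp: cocycles_def inj_eq[OF \<iota>])
  have B: "coboundaries (embed_complex \<iota> C) i = \<iota> ` coboundaries C i" for i
    by (auto simp: coboundaries_def image_image)
  show "qis R (embed_complex \<iota> C) C (\<lambda>i. inv_into UNIV \<iota>)"
  proof (rule qisI[OF E C])
    show "chain_map R (embed_complex \<iota> C) C (\<lambda>i. inv_into UNIV \<iota>)"
      by (auto simp: chain_map_def intro!: mod_homI)
    show "x \<in> coboundaries (embed_complex \<iota> C) i"
      if "x \<in> cocycles (embed_complex \<iota> C) i" "inv_into UNIV \<iota> x \<in> coboundaries C i" for x i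
      using that unfolding Z B by auto
    fix i y assume y: "y \<in> cocycles C i"
    interpret abelian_group "obj C i" by (rule complex_group[OF C])
    show "\<exists>x\<in>cocycles (embed_complex \<iota> C) i. \<exists>b\<in>coboundaries C i. inv_into UNIV \<iota> x = y \<oplus>\<^bsub>obj C i\<^esub> b"
      unfolding Z using y cocycles_carrier[OF y] coboundaries_zero[OF C, of i]
      by (intro bexI[of _ "\<iota> y"] bexI[of _ "\<zero>\<^bsub>obj C i\<^esub>"]) auto
  qed
qed

lemma projective_embed:
  fixes M :: "('r, 'm) module" and \<iota> :: "'m \<Rightarrow> 'n"
  assumes pr: "projective R M" and \<iota>: "inj \<iota>"
  shows "projective R (embed_module \<iota> M)"
proof -
  obtain I :: "'m set" and e c where db: "dual_basis R M I e c" by (rule projective_imp_dual_basis[OF pr])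
  have M: "left_module R M" using pr by (simp add: projective_def)
  interpret M: left_module R M by fact
  note E = left_module_embed[OF M \<iota>]
  interpret E: left_module R "embed_module \<iota> M" by fact
  note [simp] = inv_f_f[OF \<iota>]
  have \<iota>_hom: "add_hom M (embed_module \<iota> M) \<iota>" by (intro add_homI) auto
  have c: "c i \<in> mod_hom R M (regular_module R)" "e i \<in> carrier M" if "i \<in> I" for i
    using db that by (auto simp: dual_basis_def)
  have "dual_basis R (embed_module \<iota> M) I (\<lambda>i. \<iota> (e i)) (\<lambda>i x. c i (inv_into UNIV \<iota> x))"
    unfolding dual_basis_def
  proof (intro conjI ballI)
    show "(\<lambda>i. \<iota> (e i)) \<in> I \<rightarrow> carrier (embed_module \<iota> M)" using c by auto
    show "(\<lambda>x. c i (inv_into UNIV \<iota> x)) \<in> mod_hom R (embed_module \<iota> M) (regular_module R)" if "i \<in> I" for i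
      using mod_hom_closed[OF c(1)[OF that]] mod_hom_add[OF c(1)[OF that]] mod_hom_smult[OF c(1)[OF that]]
      by (intro mod_homI) auto
    fix x assume "x \<in> carrier (embed_module \<iota> M)"
    then obtain m where m: "m \<in> carrier M" "x = \<iota> m" by auto
    have mi: "inv_into UNIV \<iota> x = m" by (simp add: m)
    let ?J = "{i \<in> I. c i m \<noteq> \<zero>\<^bsub>R\<^esub>}"
    have dec: "m = (\<Oplus>\<^bsub>M\<^esub>i\<in>?J. c i m \<odot>\<^bsub>M\<^esub> e i)" and fin: "finite ?J"
      using db m(1) by (auto simp: dual_basis_def)
    show "finite {i \<in> I. c i (inv_into UNIV \<iota> x) \<noteq> \<zero>\<^bsub>R\<^esub>}" using fin by (simp add: m)
    have "\<iota> m = \<iota> (\<Oplus>\<^bsub>M\<^esub>i\<in>?J. c i m \<odot>\<^bsub>M\<^esub> e i)" using dec by simp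
    also have "\<dots> = (\<Oplus>\<^bsub>embed_module \<iota> M\<^esub>i\<in>?J. \<iota> (c i m \<odot>\<^bsub>M\<^esub> e i))"
      using mod_hom_closed[OF c(1) m(1)] c(2)
      by (intro add_hom_finsum[OF M.M.abelian_group_axioms E.M.abelian_group_axioms \<iota>_hom])
        (auto intro!: M.smult_closed)
    finally have "x = (\<Oplus>\<^bsub>embed_module \<iota> M\<^esub>i\<in>?J. \<iota> (c i m \<odot>\<^bsub>M\<^esub> e i))" by (simp only: m(2))
    then show "x = (\<Oplus>\<^bsub>embed_module \<iota> M\<^esub>i\<in>{i \<in> I. c i (inv_into UNIV \<iota> x) \<noteq> \<zero>\<^bsub>R\<^esub>}.
        c i (inv_into UNIV \<iota> x) \<odot>\<^bsub>embed_module \<iota> M\<^esub> \<iota> (e i))"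
      unfolding mi embed_module_simps inv_f_f[OF \<iota>] .
  qed
  \<comment> \<open>The index set is moved along \<iota> too, since \<open>projective\<close> wants
    indices in the type of elements of the new module.\<close>
  moreover have "bij_betw (inv_into UNIV \<iota>) (\<iota> ` I) I"
    by (rule bij_betwI[where g = \<iota>]) auto
  ultimately have "dual_basis R (embed_module \<iota> M) (\<iota> ` I) (\<lambda>j. \<iota> (e (inv_into UNIV \<iota> j))) (\<lambda>j x. c (inv_into UNIV \<iota> j) (inv_into UNIV \<iota> x))"
    using dual_basis_reindex[OF E] by blast
  then show ?thesis by (rule dual_basis_imp_projective[OF E])
qed

text \<open>The roof is the truncation with its inclusion into \<open>C\<close> and its projection
  to the cohomology in degree \<open>d\<close>. Vanishing above \<open>d\<close> serves the first
  leg, vanishing below \<open>d\<close> the second.\<close>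

lemma derived_isomorphic_concentrated:
  assumes C: "cochain_complex R C" and M: "left_module R M"
    and ex: "\<And>i. i \<noteq> d \<Longrightarrow> cocycles C i \<subseteq> coboundaries C i"
    and h: "h \<in> mod_hom R ((obj C d)\<lparr>carrier := cocycles C d\<rparr>) M"
    and ker: "\<And>x. x \<in> cocycles C d \<Longrightarrow> h x = \<zero>\<^bsub>M\<^esub> \<longleftrightarrow> x \<in> coboundaries C d"
    and surj: "carrier M \<subseteq> h ` cocycles C d"
  shows "derived_isomorphic R C (concentrated d M)"
proof -
  \<comment> \<open>A copy of the truncation in the type prescribed for roofs: \<open>m\<close> is
    repeated as a constant function, and the other two components are arbitrary constants.\<close>
  let ?\<iota> = "\<lambda>m n. (undefined, m, undefined)"
  have \<iota>: "inj ?\<iota>" by (auto simp: inj_def fun_eq_iff)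
  have T: "cochain_complex R (truncation d C)" by (rule cochain_complex_truncation[OF C])
  have incl: "qis R (truncation d C) C (\<lambda>i x. x)" by (rule qis_truncation_inclusion[OF C]) (rule ex, simp)
  have proj: "qis R (truncation d C) (concentrated d M) (\<lambda>i x. if i = d then h x else \<zero>\<^bsub>M\<^esub>)"
    by (rule qis_truncation_projection[OF C M _ h ker surj]) (rule ex, simp)
  show ?thesis
    unfolding derived_isomorphic_def quasi_iso_iff_qis
    using qis_compose[OF qis_embed[OF T \<iota>] incl] qis_compose[OF qis_embed[OF T \<iota>] proj] by blast
qed

section \<open>Tensor products of algebras\<close>

lemma list_sum_simps [simp]:
  "list_sum G [] = \<zero>\<^bsub>G\<^esub>" "list_sum G (x # xs) = x \<oplus>\<^bsub>G\<^esub> list_sum G xs"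
  by (simp_all add: list_sum_def)

context abelian_monoid
begin

lemma list_sum_closed: "set xs \<subseteq> carrier G \<Longrightarrow> list_sum G xs \<in> carrier G"
  by (induction xs) auto

lemma list_sum_append:
  "set xs \<subseteq> carrier G \<Longrightarrow> set ys \<subseteq> carrier G \<Longrightarrow> list_sum G (xs @ ys) = list_sum G xs \<oplus> list_sum G ys"
  by (induction xs) (auto simp: a_assoc list_sum_closed)

lemma list_sum_map_add:
  assumes "\<And>x. x \<in> set xs \<Longrightarrow> f x \<in> carrier G" "\<And>x. x \<in> set xs \<Longrightarrow> g x \<in> carrier G"
  shows "list_sum G (map (\<lambda>x. f x \<oplus> g x) xs) = list_sum G (map f xs) \<oplus> list_sum G (map g xs)"
  using assms
proof (induction xs)
  case (Cons x xs)
  then have "list_sum G (map f xs) \<in> carrier G" "list_sum G (map g xs) \<in> carrier G"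
    by (auto intro!: list_sum_closed)
  then show ?case using Cons by (simp add: a_ac)
qed simp

end

text \<open>The functions from which additive maps on the tensor product arise. The rule
  \<open>zero\<close> of \<open>tensor_eq\<close> is respected automatically, because f(0, b) + f(0,
  b) = f(0, b).\<close>

definition balanced_map ::
  "('k, 'y) ring_scheme \<Rightarrow> ('k, 'a) module \<Rightarrow> ('k, 'b) module \<Rightarrow> ('g, 'z) ring_scheme \<Rightarrow> ('a \<times> 'b \<Rightarrow> 'g) \<Rightarrow> bool" where
  "balanced_map K A B G f \<longleftrightarrow>
     (\<forall>a\<in>carrier A. \<forall>b\<in>carrier B. f (a, b) \<in> carrier G) \<and>
     (\<forall>a\<in>carrier A. \<forall>a'\<in>carrier A. \<forall>b\<in>carrier B. f (a \<oplus>\<^bsub>A\<^esub> a', b) = f (a, b) \<oplus>\<^bsub>G\<^esub> f (a', b)) \<and>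
     (\<forall>a\<in>carrier A. \<forall>b\<in>carrier B. \<forall>b'\<in>carrier B. f (a, b \<oplus>\<^bsub>B\<^esub> b') = f (a, b) \<oplus>\<^bsub>G\<^esub> f (a, b')) \<and>
     (\<forall>c\<in>carrier K. \<forall>a\<in>carrier A. \<forall>b\<in>carrier B. f (c \<odot>\<^bsub>A\<^esub> a, b) = f (a, c \<odot>\<^bsub>B\<^esub> b))"

lemma balanced_mapI:
  assumes "\<And>a b. a \<in> carrier A \<Longrightarrow> b \<in> carrier B \<Longrightarrow> f (a, b) \<in> carrier G"
    and "\<And>a a' b. a \<in> carrier A \<Longrightarrow> a' \<in> carrier A \<Longrightarrow> b \<in> carrier B \<Longrightarrow>
      f (a \<oplus>\<^bsub>A\<^esub> a', b) = f (a, b) \<oplus>\<^bsub>G\<^esub> f (a', b)"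
    and "\<And>a b b'. a \<in> carrier A \<Longrightarrow> b \<in> carrier B \<Longrightarrow> b' \<in> carrier B \<Longrightarrow>
      f (a, b \<oplus>\<^bsub>B\<^esub> b') = f (a, b) \<oplus>\<^bsub>G\<^esub> f (a, b')"
    and "\<And>c a b. c \<in> carrier K \<Longrightarrow> a \<in> carrier A \<Longrightarrow> b \<in> carrier B \<Longrightarrow>
      f (c \<odot>\<^bsub>A\<^esub> a, b) = f (a, c \<odot>\<^bsub>B\<^esub> b)"
  shows "balanced_map K A B G f"
  using assms by (auto simp: balanced_map_def)

lemma
  assumes "balanced_map K A B G f"
  shows balanced_closed: "a \<in> carrier A \<Longrightarrow> b \<in> carrier B \<Longrightarrow> f (a, b) \<in> carrier G"
    and balanced_add_left: "a \<in> carrier A \<Longrightarrow> a' \<in> carrier A \<Longrightarrow> b \<in> carrier B \<Longrightarrow>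
      f (a \<oplus>\<^bsub>A\<^esub> a', b) = f (a, b) \<oplus>\<^bsub>G\<^esub> f (a', b)"
    and balanced_add_right: "a \<in> carrier A \<Longrightarrow> b \<in> carrier B \<Longrightarrow> b' \<in> carrier B \<Longrightarrow>
      f (a, b \<oplus>\<^bsub>B\<^esub> b') = f (a, b) \<oplus>\<^bsub>G\<^esub> f (a, b')"
    and balanced_smult: "c \<in> carrier K \<Longrightarrow> a \<in> carrier A \<Longrightarrow> b \<in> carrier B \<Longrightarrow>
      f (c \<odot>\<^bsub>A\<^esub> a, b) = f (a, c \<odot>\<^bsub>B\<^esub> b)"
  using assms by (auto simp: balanced_map_def)

locale algebra_pair =
  fixes K :: "('k, 'y) ring_scheme" and A :: "('k, 'a) module" and B :: "('k, 'b) module"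
  assumes algA: "assoc_algebra K A" and algB: "assoc_algebra K B"
begin

sublocale A: assoc_algebra K A by (fact algA)
sublocale B: assoc_algebra K B by (fact algB)

abbreviation "T \<equiv> tensor_ring K A B"
abbreviation "cls \<equiv> tensor_class K A B"
abbreviation "t a b \<equiv> tensor_class K A B [(a, b)]"
abbreviation "valid xs \<equiv> set xs \<subseteq> carrier A \<times> carrier B"

lemma tensor_eq_valid: "tensor_eq K A B xs ys \<Longrightarrow> valid xs \<and> valid ys"
  by (induction rule: tensor_eq.induct) auto

lemma cls_eq_iff: "valid xs \<Longrightarrow> cls xs = cls ys \<longleftrightarrow> tensor_eq K A B xs ys"
  unfolding tensor_class_def
  by (auto intro: tensor_eq.refl tensor_eq.sym tensor_eq.trans)

lemma cls_self: "valid xs \<Longrightarrow> xs \<in> cls xs"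
  by (simp add: tensor_class_def tensor_eq.refl)

lemma T_carrier: "carrier T = cls ` {xs. valid xs}"
  by (simp add: tensor_ring_def)

lemma cls_closed: "valid xs \<Longrightarrow> cls xs \<in> carrier T"
  by (auto simp: T_carrier)

lemma cls_add: "valid xs \<Longrightarrow> valid ys \<Longrightarrow> cls xs \<oplus>\<^bsub>T\<^esub> cls ys = cls (xs @ ys)"
proof -
  assume v: "valid xs" "valid ys"
  have "cls (xs' @ ys') = cls (xs @ ys)" if "xs' \<in> cls xs" "ys' \<in> cls ys" for xs' ys'
  proof -
    have "tensor_eq K A B (xs @ ys) (xs' @ ys')"
      using that by (intro tensor_eq.append) (auto simp: tensor_class_def)
    then have "cls (xs @ ys) = cls (xs' @ ys')" using v cls_eq_iff[of "xs @ ys"] by simp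
    then show ?thesis by (rule HOL.sym)
  qed
  then have "(\<Union>xs'\<in>cls xs. \<Union>ys'\<in>cls ys. cls (xs' @ ys')) = cls (xs @ ys)"
    using cls_self[OF v(1)] cls_self[OF v(2)] by blast
  then show ?thesis by (simp add: tensor_ring_def)
qed

lemma T_zero: "\<zero>\<^bsub>T\<^esub> = cls []"
  by (simp add: tensor_ring_def)

lemma t_neg: "a \<in> carrier A \<Longrightarrow> b \<in> carrier B \<Longrightarrow> tensor_eq K A B [(\<ominus>\<^bsub>A\<^esub> a, b), (a, b)] []"
  using tensor_eq.sym[OF tensor_eq.add_left[of "\<ominus>\<^bsub>A\<^esub> a" A a b B K]] tensor_eq.zero[of b B K A]
  by (auto simp: A.M.l_neg intro: tensor_eq.trans)

lemma T_group: "abelian_group T"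
proof (rule abelian_groupI)
  show "x \<oplus>\<^bsub>T\<^esub> y \<in> carrier T" if "x \<in> carrier T" "y \<in> carrier T" for x y
    using that by (auto simp: T_carrier cls_add)
  show "\<zero>\<^bsub>T\<^esub> \<in> carrier T" by (auto simp: T_zero intro: cls_closed)
  show "x \<oplus>\<^bsub>T\<^esub> y \<oplus>\<^bsub>T\<^esub> z = x \<oplus>\<^bsub>T\<^esub> (y \<oplus>\<^bsub>T\<^esub> z)"
    if "x \<in> carrier T" "y \<in> carrier T" "z \<in> carrier T" for x y z
    using that by (auto simp: T_carrier cls_add)
  show "x \<oplus>\<^bsub>T\<^esub> y = y \<oplus>\<^bsub>T\<^esub> x" if xy: "x \<in> carrier T" "y \<in> carrier T" for x y
  proof -
    obtain xs ys where v: "valid xs" "x = cls xs" "valid ys" "y = cls ys" using xy by (auto simp: T_carrier)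
    have "cls (xs @ ys) = cls (ys @ xs)" using v by (subst cls_eq_iff) (auto intro: tensor_eq.comm)
    then show ?thesis using v by (simp add: cls_add)
  qed
  show "\<zero>\<^bsub>T\<^esub> \<oplus>\<^bsub>T\<^esub> x = x" if "x \<in> carrier T" for x
    using that by (auto simp: T_carrier T_zero cls_add)
  \<comment> \<open>Inverses are built along the list. The negative of the head is appended to the
    inverse of the tail, so that it meets the head first and the rest cancels afterwards.\<close>
  have "\<exists>ys. valid ys \<and> tensor_eq K A B (ys @ xs) []" if "valid xs" for xs
    using that
  proof (induction xs)
    case Nil
    then show ?case by (auto intro!: exI[of _ "[]"] tensor_eq.refl)
  next
    case (Cons p xs)
    then obtain ys where ys: "valid ys" "tensor_eq K A B (ys @ xs) []" by auto
    obtain a b where p: "p = (a, b)" "a \<in> carrier A" "b \<in> carrier B" using Cons.prems by (cases p) auto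
    have "tensor_eq K A B ((ys @ [(\<ominus>\<^bsub>A\<^esub> a, b), (a, b)]) @ xs) ((ys @ []) @ xs)"
      using ys Cons.prems p by (intro tensor_eq.append tensor_eq.refl t_neg) auto
    then have "tensor_eq K A B ((ys @ [(\<ominus>\<^bsub>A\<^esub> a, b)]) @ p # xs) []"
      using ys(2) by (auto simp: p intro: tensor_eq.trans)
    then show ?case using ys p by (intro exI[of _ "ys @ [(\<ominus>\<^bsub>A\<^esub> a, b)]"]) auto
  qed
  then show "\<exists>y\<in>carrier T. y \<oplus>\<^bsub>T\<^esub> x = \<zero>\<^bsub>T\<^esub>" if "x \<in> carrier T" for x
  proof -
    obtain xs where xs: "valid xs" "x = cls xs" using \<open>x \<in> carrier T\<close> by (auto simp: T_carrier)
    obtain ys where ys: "valid ys" "tensor_eq K A B (ys @ xs) []"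
      using \<open>\<And>xs. valid xs \<Longrightarrow> \<exists>ys. valid ys \<and> tensor_eq K A B (ys @ xs) []\<close>[OF xs(1)] by blast
    show ?thesis
      using xs ys cls_eq_iff[of "ys @ xs" "[]"] by (intro bexI[of _ "cls ys"]) (auto simp: cls_add T_zero cls_closed)
  qed
qed

sublocale T: abelian_group T by (fact T_group)

lemma t_closed: "a \<in> carrier A \<Longrightarrow> b \<in> carrier B \<Longrightarrow> t a b \<in> carrier T"
  by (auto intro: cls_closed)

lemma t_balanced: "balanced_map K A B T (\<lambda>(a, b). t a b)"
proof (rule balanced_mapI)
  show "(case (a \<oplus>\<^bsub>A\<^esub> a', b) of (a, b) \<Rightarrow> t a b) = (case (a, b) of (a, b) \<Rightarrow> t a b) \<oplus>\<^bsub>T\<^esub> (case (a', b) of (a, b) \<Rightarrow> t a b)"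
    if "a \<in> carrier A" "a' \<in> carrier A" "b \<in> carrier B" for a a' b
    using that by (auto simp: cls_add cls_eq_iff intro: tensor_eq.add_left)
  show "(case (a, b \<oplus>\<^bsub>B\<^esub> b') of (a, b) \<Rightarrow> t a b) = (case (a, b) of (a, b) \<Rightarrow> t a b) \<oplus>\<^bsub>T\<^esub> (case (a, b') of (a, b) \<Rightarrow> t a b)"
    if "a \<in> carrier A" "b \<in> carrier B" "b' \<in> carrier B" for a b b'
    using that by (auto simp: cls_add cls_eq_iff intro: tensor_eq.add_right)
  show "(case (c \<odot>\<^bsub>A\<^esub> a, b) of (a, b) \<Rightarrow> t a b) = (case (a, c \<odot>\<^bsub>B\<^esub> b) of (a, b) \<Rightarrow> t a b)"
    if "c \<in> carrier K" "a \<in> carrier A" "b \<in> carrier B" for c a b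
    using that A.smult_closed by (auto simp: cls_eq_iff intro: tensor_eq.balanced)
qed (simp add: t_closed)

lemma cls_eq_list_sum: "valid xs \<Longrightarrow> cls xs = list_sum T (map (\<lambda>(a, b). t a b) xs)"
proof (induction xs)
  case (Cons p xs)
  obtain a b where p: "p = (a, b)" by (cases p)
  have "cls (p # xs) = t a b \<oplus>\<^bsub>T\<^esub> cls xs" using Cons.prems p by (subst cls_add) auto
  then show ?case using Cons p by simp
qed (simp add: T_zero)

lemma T_induct [consumes 1, case_names zero add generator]:
  assumes "x \<in> carrier T" "P \<zero>\<^bsub>T\<^esub>"
    and add: "\<And>x y. x \<in> carrier T \<Longrightarrow> y \<in> carrier T \<Longrightarrow> P x \<Longrightarrow> P y \<Longrightarrow> P (x \<oplus>\<^bsub>T\<^esub> y)"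
    and gen: "\<And>a b. a \<in> carrier A \<Longrightarrow> b \<in> carrier B \<Longrightarrow> P (t a b)"
  shows "P x"
proof -
  obtain xs where xs: "valid xs" "x = cls xs" using assms(1) by (auto simp: T_carrier)
  have "P (cls xs)" using xs(1)
  proof (induction xs)
    case Nil
    then show ?case using assms(2) by (simp add: T_zero)
  next
    case (Cons p xs)
    obtain a b where p: "p = (a, b)" by (cases p)
    have "cls (p # xs) = t a b \<oplus>\<^bsub>T\<^esub> cls xs" using Cons.prems p by (subst cls_add) auto
    then show ?case using Cons p by (auto intro!: add gen t_closed cls_closed)
  qed
  then show ?thesis using xs by simp
qed

lemma balanced_list_sum_cong:
  assumes G: "abelian_group G" and f: "balanced_map K A B G f"
  shows "tensor_eq K A B xs ys \<Longrightarrow> list_sum G (map f xs) = list_sum G (map f ys)"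
proof (induction rule: tensor_eq.induct)
  interpret G: abelian_group G by fact
  note cl = balanced_closed[OF f]
  have f_set: "set (map f xs) \<subseteq> carrier G" if "valid xs" for xs using that cl by auto
  {
    case (append xs xs' ys ys')
    then show ?case
      using tensor_eq_valid[OF append.hyps(1)] tensor_eq_valid[OF append.hyps(2)]
      by (simp only: map_append G.list_sum_append f_set)
  next
    case (comm xs ys)
    then show ?case
      by (simp only: map_append G.list_sum_append f_set G.a_comm G.list_sum_closed)
  next
    case (add_left a a' b)
    then show ?case by (simp add: balanced_add_left[OF f] cl)
  next
    case (add_right a b b')
    then show ?case by (simp add: balanced_add_right[OF f] cl)
  next
    case (zero b)
    have "f (\<zero>\<^bsub>A\<^esub>, b) \<oplus>\<^bsub>G\<^esub> f (\<zero>\<^bsub>A\<^esub>, b) = f (\<zero>\<^bsub>A\<^esub>, b)"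
      using balanced_add_left[OF f, of "\<zero>\<^bsub>A\<^esub>" "\<zero>\<^bsub>A\<^esub>" b] zero by simp
    then show ?case using G.double_eq_self cl zero by simp
  next
    case (balanced c a b)
    then show ?case by (simp add: balanced_smult[OF f])
  }
qed auto

text \<open>The map given by the universal property. It has the shape used in the definitions of
  \<open>diagonal_bimodule\<close> and \<open>twisted_bimodule\<close>, which turns both actions
  into instances of it.\<close>

definition lift :: "('g, 'z) ring_scheme \<Rightarrow> ('a \<times> 'b \<Rightarrow> 'g) \<Rightarrow> ('a \<times> 'b) list set \<Rightarrow> 'g" where
  "lift G f X = the_elem ((\<lambda>xs. list_sum G (map f xs)) ` X)"

lemma lift_cls:
  assumes "abelian_group G" "balanced_map K A B G f" "valid xs"
  shows "lift G f (cls xs) = list_sum G (map f xs)"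
proof -
  have "(\<lambda>xs. list_sum G (map f xs)) ` cls xs = {list_sum G (map f xs)}"
  proof -
    have "list_sum G (map f ys) = list_sum G (map f xs)" if "ys \<in> cls xs" for ys
      using balanced_list_sum_cong[OF assms(1,2), of xs ys] that by (simp add: tensor_class_def)
    then show ?thesis using cls_self[OF assms(3)] by blast
  qed
  then show ?thesis by (simp add: lift_def)
qed

lemma
  assumes G: "abelian_group G" and f: "balanced_map K A B G f"
  shows lift_hom: "add_hom T G (lift G f)"
    and lift_t: "a \<in> carrier A \<Longrightarrow> b \<in> carrier B \<Longrightarrow> lift G f (t a b) = f (a, b)"
proof -
  interpret G: abelian_group G by fact
  have f_set: "set (map f xs) \<subseteq> carrier G" if "valid xs" for xs using that balanced_closed[OF f] by auto
  show "add_hom T G (lift G f)"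
  proof (rule add_homI)
    show "lift G f x \<in> carrier G" if "x \<in> carrier T" for x
      using that lift_cls[OF G f] G.list_sum_closed[OF f_set] by (auto simp: T_carrier)
    show "lift G f (x \<oplus>\<^bsub>T\<^esub> y) = lift G f x \<oplus>\<^bsub>G\<^esub> lift G f y" if m: "x \<in> carrier T" "y \<in> carrier T" for x y
    proof -
      obtain xs ys where xy: "valid xs" "x = cls xs" "valid ys" "y = cls ys" using m by (auto simp: T_carrier)
      have "lift G f (cls (xs @ ys)) = list_sum G (map f xs @ map f ys)" using xy by (subst lift_cls[OF G f]) auto
      then show ?thesis
        using xy f_set[of xs] f_set[of ys] by (simp only: cls_add lift_cls[OF G f] G.list_sum_append)
    qed
  qed
  show "lift G f (t a b) = f (a, b)" if "a \<in> carrier A" "b \<in> carrier B"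
    using that balanced_closed[OF f] by (simp add: lift_cls[OF G f])
qed

text \<open>Pure tensors generate the tensor product additively. Identities in several variables are
  proved by applying this to one variable at a time, the others being held fixed.\<close>

lemma add_hom_eq_on_generators:
  assumes "abelian_group G" "add_hom T G f" "add_hom T G g" "x \<in> carrier T"
    "\<And>a b. a \<in> carrier A \<Longrightarrow> b \<in> carrier B \<Longrightarrow> f (t a b) = g (t a b)"
  shows "f x = g x"
  using assms(4)
proof (induction rule: T_induct)
  case zero
  show ?case using add_hom_zero[OF T_group assms(1,2)] add_hom_zero[OF T_group assms(1,3)] by simp
next
  case (add x y)
  then show ?case using add_hom_add[OF assms(2)] add_hom_add[OF assms(3)] by simp
next
  case (generator a b)
  then show ?case by (rule assms(5))
qed

lemma t_add_left: "a \<in> carrier A \<Longrightarrow> a' \<in> carrier A \<Longrightarrow> b \<in> carrier B \<Longrightarrow> t (a \<oplus>\<^bsub>A\<^esub> a') b = t a b \<oplus>\<^bsub>T\<^esub> t a' b"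
  and t_add_right: "a \<in> carrier A \<Longrightarrow> b \<in> carrier B \<Longrightarrow> b' \<in> carrier B \<Longrightarrow> t a (b \<oplus>\<^bsub>B\<^esub> b') = t a b \<oplus>\<^bsub>T\<^esub> t a b'"
  and t_smult: "c \<in> carrier K \<Longrightarrow> a \<in> carrier A \<Longrightarrow> b \<in> carrier B \<Longrightarrow> t (c \<odot>\<^bsub>A\<^esub> a) b = t a (c \<odot>\<^bsub>B\<^esub> b)"
  using balanced_add_left[OF t_balanced] balanced_add_right[OF t_balanced] balanced_smult[OF t_balanced] by simp_all

section \<open>The product of tensors\<close>

abbreviation "mult_list xs ys \<equiv> [(a \<otimes>\<^bsub>A\<^esub> a', b \<otimes>\<^bsub>B\<^esub> b'). (a, b) \<leftarrow> xs, (a', b') \<leftarrow> ys]"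

abbreviation "tt p q \<equiv> t (fst p \<otimes>\<^bsub>A\<^esub> fst q) (snd p \<otimes>\<^bsub>B\<^esub> snd q)"

lemma valid_mult_list: "valid xs \<Longrightarrow> valid ys \<Longrightarrow> valid (mult_list xs ys)"
  by (auto dest!: subsetD)

text \<open>The product list is concatenated from rows. As an iterated sum of pure tensors it
  becomes accessible to \<open>balanced_list_sum_cong\<close> in each of the two factors.\<close>

lemma cls_mult_list:
  assumes "valid xs" "valid ys"
  shows "cls (mult_list xs ys) = list_sum T (map (\<lambda>p. list_sum T (map (tt p) ys)) xs)"
  using assms(1)
proof (induction xs)
  case Nil
  then show ?case by (simp add: T_zero)
next
  case (Cons p xs)
  obtain a b where p: "p = (a, b)" by (cases p)
  have 1: "valid (map (\<lambda>(a', b'). (a \<otimes>\<^bsub>A\<^esub> a', b \<otimes>\<^bsub>B\<^esub> b')) ys)" using Cons.prems assms(2) p by auto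
  have 2: "valid (mult_list xs ys)" using Cons.prems assms(2) by (intro valid_mult_list) auto
  have "cls (mult_list (p # xs) ys) = cls (map (\<lambda>(a', b'). (a \<otimes>\<^bsub>A\<^esub> a', b \<otimes>\<^bsub>B\<^esub> b')) ys) \<oplus>\<^bsub>T\<^esub> cls (mult_list xs ys)"
    using cls_add[OF 1 2] by (simp add: p)
  also have "cls (map (\<lambda>(a', b'). (a \<otimes>\<^bsub>A\<^esub> a', b \<otimes>\<^bsub>B\<^esub> b')) ys) = list_sum T (map (tt p) ys)"
    unfolding cls_eq_list_sum[OF 1] by (simp add: p comp_def case_prod_unfold)
  finally show ?case using Cons by simp
qed

lemma tt_balanced_left:
  "q \<in> carrier A \<times> carrier B \<Longrightarrow> balanced_map K A B T (\<lambda>p. tt p q)"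
  by (rule balanced_mapI)
    (auto simp: A.A.l_distr B.A.l_distr t_add_left t_add_right t_closed A.smult_mult_left B.smult_mult_left t_smult)

lemma tt_balanced_right:
  "p \<in> carrier A \<times> carrier B \<Longrightarrow> balanced_map K A B T (tt p)"
  by (rule balanced_mapI)
    (auto simp: A.A.r_distr B.A.r_distr t_add_left t_add_right t_closed A.smult_mult_right B.smult_mult_right t_smult)

lemma balanced_list_sum:
  assumes "\<And>q. q \<in> set qs \<Longrightarrow> balanced_map K A B T (f q)"
  shows "balanced_map K A B T (\<lambda>p. list_sum T (map (\<lambda>q. f q p) qs))"
proof (rule balanced_mapI)
  note b = balanced_closed[OF assms] balanced_add_left[OF assms] balanced_add_right[OF assms] balanced_smult[OF assms]
  show "list_sum T (map (\<lambda>q. f q (a, b)) qs) \<in> carrier T" if "a \<in> carrier A" "b \<in> carrier B" for a b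
    using that b(1) by (intro T.list_sum_closed) auto
  show "list_sum T (map (\<lambda>q. f q (a \<oplus>\<^bsub>A\<^esub> a', b)) qs) =
      list_sum T (map (\<lambda>q. f q (a, b)) qs) \<oplus>\<^bsub>T\<^esub> list_sum T (map (\<lambda>q. f q (a', b)) qs)"
    if "a \<in> carrier A" "a' \<in> carrier A" "b \<in> carrier B" for a a' b
    using that b by (subst T.list_sum_map_add[symmetric]) (auto intro!: arg_cong[where f = "list_sum T"])
  show "list_sum T (map (\<lambda>q. f q (a, b \<oplus>\<^bsub>B\<^esub> b')) qs) =
      list_sum T (map (\<lambda>q. f q (a, b)) qs) \<oplus>\<^bsub>T\<^esub> list_sum T (map (\<lambda>q. f q (a, b')) qs)"
    if "a \<in> carrier A" "b \<in> carrier B" "b' \<in> carrier B" for a b b'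
    using that b by (subst T.list_sum_map_add[symmetric]) (auto intro!: arg_cong[where f = "list_sum T"])
  show "list_sum T (map (\<lambda>q. f q (c \<odot>\<^bsub>A\<^esub> a, b)) qs) = list_sum T (map (\<lambda>q. f q (a, c \<odot>\<^bsub>B\<^esub> b)) qs)"
    if "c \<in> carrier K" "a \<in> carrier A" "b \<in> carrier B" for c a b
    using that b by (auto intro!: arg_cong[where f = "list_sum T"])
qed

text \<open>One factor is exchanged at a time: for a fixed list \<open>ys\<close> the row sum is a
  balanced function of \<open>p\<close>, and for a fixed pair \<open>p\<close> the entry is a
  balanced function of the other pair.\<close>

lemma cls_mult_list_cong:
  assumes "tensor_eq K A B xs xs'" "tensor_eq K A B ys ys'"
  shows "cls (mult_list xs ys) = cls (mult_list xs' ys')"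
proof -
  have v: "valid xs" "valid xs'" "valid ys" "valid ys'"
    using tensor_eq_valid[OF assms(1)] tensor_eq_valid[OF assms(2)] by auto
  have "list_sum T (map (\<lambda>p. list_sum T (map (tt p) ys)) xs) = list_sum T (map (\<lambda>p. list_sum T (map (tt p) ys)) xs')"
    using v(3) by (intro balanced_list_sum_cong[OF T_group _ assms(1)] balanced_list_sum tt_balanced_left) auto
  also have "\<dots> = list_sum T (map (\<lambda>p. list_sum T (map (tt p) ys')) xs')"
    using v(2)
    by (intro arg_cong[where f = "list_sum T"] list.map_cong HOL.refl
        balanced_list_sum_cong[OF T_group tt_balanced_right assms(2)]) auto
  finally show ?thesis using v by (simp only: cls_mult_list)
qed

lemma cls_mult: "valid xs \<Longrightarrow> valid ys \<Longrightarrow> cls xs \<otimes>\<^bsub>T\<^esub> cls ys = cls (mult_list xs ys)"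
proof -
  assume v: "valid xs" "valid ys"
  have "cls (mult_list xs' ys') = cls (mult_list xs ys)" if "xs' \<in> cls xs" "ys' \<in> cls ys" for xs' ys'
    using that by (intro cls_mult_list_cong[symmetric]) (auto simp: tensor_class_def)
  then have "(\<Union>xs'\<in>cls xs. \<Union>ys'\<in>cls ys. cls (mult_list xs' ys')) = cls (mult_list xs ys)"
    using cls_self[OF v(1)] cls_self[OF v(2)] by blast
  then show ?thesis by (simp add: tensor_ring_def)
qed

lemma t_mult:
  "a \<in> carrier A \<Longrightarrow> b \<in> carrier B \<Longrightarrow> a' \<in> carrier A \<Longrightarrow> b' \<in> carrier B \<Longrightarrow>
    t a b \<otimes>\<^bsub>T\<^esub> t a' b' = t (a \<otimes>\<^bsub>A\<^esub> a') (b \<otimes>\<^bsub>B\<^esub> b')"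
  by (simp add: cls_mult)

lemma T_mult_closed: "x \<in> carrier T \<Longrightarrow> y \<in> carrier T \<Longrightarrow> x \<otimes>\<^bsub>T\<^esub> y \<in> carrier T"
proof -
  assume "x \<in> carrier T" "y \<in> carrier T"
  then obtain xs ys where "valid xs" "x = cls xs" "valid ys" "y = cls ys" by (auto simp: T_carrier)
  then show ?thesis using cls_closed[OF valid_mult_list[of xs ys]] by (simp only: cls_mult)
qed

lemma T_mult_hom_left: "y \<in> carrier T \<Longrightarrow> add_hom T T (\<lambda>x. x \<otimes>\<^bsub>T\<^esub> y)"
proof (rule add_homI)
  fix x x' assume "y \<in> carrier T" "x \<in> carrier T" "x' \<in> carrier T"
  then obtain xs xs' ys where v: "valid xs" "x = cls xs" "valid ys" "y = cls ys" "valid xs'" "x' = cls xs'"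
    by (auto simp: T_carrier)
  have "mult_list (xs @ xs') ys = mult_list xs ys @ mult_list xs' ys" by simp
  then show "(x \<oplus>\<^bsub>T\<^esub> x') \<otimes>\<^bsub>T\<^esub> y = x \<otimes>\<^bsub>T\<^esub> y \<oplus>\<^bsub>T\<^esub> x' \<otimes>\<^bsub>T\<^esub> y"
    using v valid_mult_list[of xs ys] valid_mult_list[of xs' ys] cls_mult[of "xs @ xs'" ys]
    by (simp only: cls_add cls_mult set_append Un_least)
qed (rule T_mult_closed)

lemma T_mult_hom_right: "x \<in> carrier T \<Longrightarrow> add_hom T T (\<lambda>y. x \<otimes>\<^bsub>T\<^esub> y)"
proof (rule add_homI)
  fix y y' assume "x \<in> carrier T" "y \<in> carrier T" "y' \<in> carrier T"
  then obtain xs ys' ys where v: "valid xs" "x = cls xs" "valid ys" "y = cls ys" "valid ys'" "y' = cls ys'"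
    by (auto simp: T_carrier)
  have cl: "set (map (tt p) zs) \<subseteq> carrier T" if "p \<in> set xs" "valid zs" for p zs
  proof -
    have "fst p \<in> carrier A" "snd p \<in> carrier B" using that(1) v(1) by auto
    then show ?thesis using that(2) by (auto intro!: t_closed)
  qed
  have "x \<otimes>\<^bsub>T\<^esub> (y \<oplus>\<^bsub>T\<^esub> y') = list_sum T (map (\<lambda>p. list_sum T (map (tt p) (ys @ ys'))) xs)"
    using v cls_mult[of xs "ys @ ys'"] cls_mult_list[of xs "ys @ ys'"] by (simp only: cls_add set_append Un_least)
  also have "\<dots> = list_sum T (map (\<lambda>p. list_sum T (map (tt p) ys) \<oplus>\<^bsub>T\<^esub> list_sum T (map (tt p) ys')) xs)"
    using v cl by (intro arg_cong[where f = "list_sum T"] map_cong HOL.refl) (simp only: map_append T.list_sum_append)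
  also have "\<dots> = list_sum T (map (\<lambda>p. list_sum T (map (tt p) ys)) xs) \<oplus>\<^bsub>T\<^esub> list_sum T (map (\<lambda>p. list_sum T (map (tt p) ys')) xs)"
    using v cl by (intro T.list_sum_map_add T.list_sum_closed)
  finally show "x \<otimes>\<^bsub>T\<^esub> (y \<oplus>\<^bsub>T\<^esub> y') = x \<otimes>\<^bsub>T\<^esub> y \<oplus>\<^bsub>T\<^esub> x \<otimes>\<^bsub>T\<^esub> y'"
    using v by (simp only: cls_mult cls_mult_list)
qed (rule T_mult_closed)

lemma T_one: "\<one>\<^bsub>T\<^esub> = t \<one>\<^bsub>A\<^esub> \<one>\<^bsub>B\<^esub>"
  by (simp add: tensor_ring_def)

lemma T_ring: "ring T"
proof (rule ringI[OF T_group])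
  have one: "\<one>\<^bsub>T\<^esub> \<in> carrier T" by (simp add: T_one t_closed)
  show "monoid T"
  proof (rule monoidI)
    show "x \<otimes>\<^bsub>T\<^esub> y \<otimes>\<^bsub>T\<^esub> z = x \<otimes>\<^bsub>T\<^esub> (y \<otimes>\<^bsub>T\<^esub> z)"
      if x: "x \<in> carrier T" and y: "y \<in> carrier T" and z: "z \<in> carrier T" for x y z
    \<comment> \<open>The three variables are reduced to pure tensors in turn; there associativity
      is that of \<open>A\<close> and \<open>B\<close>.\<close>
    proof (rule add_hom_eq_on_generators[OF T_group _ _ x])
      show "add_hom T T (\<lambda>x. x \<otimes>\<^bsub>T\<^esub> y \<otimes>\<^bsub>T\<^esub> z)"
        by (rule add_hom_comp[OF T_mult_hom_left[OF y] T_mult_hom_left[OF z]])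
      show "add_hom T T (\<lambda>x. x \<otimes>\<^bsub>T\<^esub> (y \<otimes>\<^bsub>T\<^esub> z))" by (rule T_mult_hom_left[OF T_mult_closed[OF y z]])
      fix a b assume ab: "a \<in> carrier A" "b \<in> carrier B"
      note tab = t_closed[OF ab]
      show "t a b \<otimes>\<^bsub>T\<^esub> y \<otimes>\<^bsub>T\<^esub> z = t a b \<otimes>\<^bsub>T\<^esub> (y \<otimes>\<^bsub>T\<^esub> z)"
      proof (rule add_hom_eq_on_generators[OF T_group _ _ y])
        show "add_hom T T (\<lambda>y. t a b \<otimes>\<^bsub>T\<^esub> y \<otimes>\<^bsub>T\<^esub> z)"
          by (rule add_hom_comp[OF T_mult_hom_right[OF tab] T_mult_hom_left[OF z]])
        show "add_hom T T (\<lambda>y. t a b \<otimes>\<^bsub>T\<^esub> (y \<otimes>\<^bsub>T\<^esub> z))"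
          by (rule add_hom_comp[OF T_mult_hom_left[OF z] T_mult_hom_right[OF tab]])
        fix a' b' assume ab': "a' \<in> carrier A" "b' \<in> carrier B"
        note tab' = t_closed[OF ab']
        show "t a b \<otimes>\<^bsub>T\<^esub> t a' b' \<otimes>\<^bsub>T\<^esub> z = t a b \<otimes>\<^bsub>T\<^esub> (t a' b' \<otimes>\<^bsub>T\<^esub> z)"
        proof (rule add_hom_eq_on_generators[OF T_group _ _ z])
          show "add_hom T T (\<lambda>z. t a b \<otimes>\<^bsub>T\<^esub> t a' b' \<otimes>\<^bsub>T\<^esub> z)"
            by (rule T_mult_hom_right[OF T_mult_closed[OF tab tab']])
          show "add_hom T T (\<lambda>z. t a b \<otimes>\<^bsub>T\<^esub> (t a' b' \<otimes>\<^bsub>T\<^esub> z))"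
            by (rule add_hom_comp[OF T_mult_hom_right[OF tab'] T_mult_hom_right[OF tab]])
        qed (use ab ab' in \<open>simp add: t_mult A.A.m_assoc B.A.m_assoc\<close>)
      qed
    qed
    show "\<one>\<^bsub>T\<^esub> \<otimes>\<^bsub>T\<^esub> x = x" if x: "x \<in> carrier T" for x
      by (rule add_hom_eq_on_generators[OF T_group T_mult_hom_right[OF one] add_hom_ident x])
        (simp add: T_one t_mult)
    show "x \<otimes>\<^bsub>T\<^esub> \<one>\<^bsub>T\<^esub> = x" if x: "x \<in> carrier T" for x
      by (rule add_hom_eq_on_generators[OF T_group T_mult_hom_left[OF one] add_hom_ident x])
        (simp add: T_one t_mult)
  qed (fact T_mult_closed one)+
  show "(x \<oplus>\<^bsub>T\<^esub> y) \<otimes>\<^bsub>T\<^esub> z = x \<otimes>\<^bsub>T\<^esub> z \<oplus>\<^bsub>T\<^esub> y \<otimes>\<^bsub>T\<^esub> z"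
    if "x \<in> carrier T" "y \<in> carrier T" "z \<in> carrier T" for x y z
    using add_hom_add[OF T_mult_hom_left] that by simp
  show "z \<otimes>\<^bsub>T\<^esub> (x \<oplus>\<^bsub>T\<^esub> y) = z \<otimes>\<^bsub>T\<^esub> x \<oplus>\<^bsub>T\<^esub> z \<otimes>\<^bsub>T\<^esub> y"
    if "x \<in> carrier T" "y \<in> carrier T" "z \<in> carrier T" for x y z
    using add_hom_add[OF T_mult_hom_right] that by simp
qed

end

section \<open>Enveloping algebras\<close>

lemma opp_smult [simp]: "smult (opp A) = smult (A :: ('k, 'a) module)"
  by (simp add: opp_def)

lemma assoc_algebra_opp:
  fixes A :: "('k, 'a) module"
  assumes "assoc_algebra K A" shows "assoc_algebra K (opp A)"
proof -
  interpret assoc_algebra K A by fact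
  have r: "ring (opp A)" by (simp add: A.ring_axioms)
  have "abelian_group (opp A)" using r by (simp add: ring_def)
  then have "module K (opp A)"
    by (intro moduleI) (auto simp: K.is_cring smult_l_distr smult_r_distr smult_assoc1)
  then show ?thesis
    using r by (intro assoc_algebra.intro)
      (auto simp: K.field_axioms assoc_algebra_axioms_def smult_mult_left smult_mult_right)
qed

locale env_algebra =
  fixes K :: "('k, 'y) ring_scheme" and A :: "('k, 'a) module"
  assumes alg: "assoc_algebra K A"
begin

sublocale algebra_pair K A "opp A"
  by (rule algebra_pair.intro[OF alg assoc_algebra_opp[OF alg]])

sublocale E: ring T by (fact T_ring)

lemma t_mult_env:
  "a \<in> carrier A \<Longrightarrow> b \<in> carrier A \<Longrightarrow> a' \<in> carrier A \<Longrightarrow> b' \<in> carrier A \<Longrightarrow>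
    t a b \<otimes>\<^bsub>T\<^esub> t a' b' = t (a \<otimes>\<^bsub>A\<^esub> a') (b' \<otimes>\<^bsub>A\<^esub> b)"
  by (simp add: t_mult)

lemma t_in [simp, intro]: "a \<in> carrier A \<Longrightarrow> b \<in> carrier A \<Longrightarrow> t a b \<in> carrier T"
  by (simp add: t_closed)

lemma T_one_env: "\<one>\<^bsub>T\<^esub> = t \<one>\<^bsub>A\<^esub> \<one>\<^bsub>A\<^esub>"
  by (simp add: T_one)

lemma add_hom_t_left: "b \<in> carrier A \<Longrightarrow> add_hom A T (\<lambda>a. t a b)"
  by (intro add_homI) (auto simp: t_add_left)

lemma add_hom_t_right: "a \<in> carrier A \<Longrightarrow> add_hom A T (t a)"
  using t_add_right by (intro add_homI) auto

lemma t_zero_left: "b \<in> carrier A \<Longrightarrow> t \<zero>\<^bsub>A\<^esub> b = \<zero>\<^bsub>T\<^esub>"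
  by (rule add_hom_zero[OF A.M.abelian_group_axioms T_group add_hom_t_left])

text \<open>An endomorphism rather than an automorphism: the twist read off from the cohomology is
  not known to be bijective until the end.\<close>

definition linear_endo :: "('a \<Rightarrow> 'a) \<Rightarrow> bool" where
  "linear_endo \<phi> \<longleftrightarrow> \<phi> \<in> ring_hom A A \<and> (\<forall>c\<in>carrier K. \<forall>x\<in>carrier A. \<phi> (c \<odot>\<^bsub>A\<^esub> x) = c \<odot>\<^bsub>A\<^esub> \<phi> x)"

lemma add_mult_A:
  assumes "x \<in> carrier A"
  shows "add_hom A A (\<lambda>y. x \<otimes>\<^bsub>A\<^esub> y)" "add_hom A A (\<lambda>y. y \<otimes>\<^bsub>A\<^esub> x)"
  using assms by (auto intro!: add_homI simp: A.A.r_distr A.A.l_distr)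

section \<open>Diagonal and twisted bimodules\<close>

lemma diag_smult_lift: "X \<odot>\<^bsub>diagonal_bimodule A\<^esub> m = lift A (\<lambda>(a, b). b \<otimes>\<^bsub>A\<^esub> m \<otimes>\<^bsub>A\<^esub> a) X"
  by (simp add: diagonal_bimodule_def lift_def)

lemma twisted_smult_lift: "X \<odot>\<^bsub>twisted_bimodule A \<mu>\<^esub> m = lift A (\<lambda>(a, b). a \<otimes>\<^bsub>A\<^esub> m \<otimes>\<^bsub>A\<^esub> \<mu> b) X"
  by (simp add: twisted_bimodule_def lift_def)

lemma diag_simps [simp]:
  "carrier (diagonal_bimodule A) = carrier A" "zero (diagonal_bimodule A) = \<zero>\<^bsub>A\<^esub>"
  "add (diagonal_bimodule A) = add A"
  by (simp_all add: diagonal_bimodule_def)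

lemma twisted_simps [simp]:
  "carrier (twisted_bimodule A \<mu>) = carrier A" "zero (twisted_bimodule A \<mu>) = \<zero>\<^bsub>A\<^esub>"
  "add (twisted_bimodule A \<mu>) = add A"
  by (simp_all add: twisted_bimodule_def)

lemma A_group: "abelian_group A"
  by (rule A.M.abelian_group_axioms)

lemma diag_balanced:
  "m \<in> carrier A \<Longrightarrow> balanced_map K A (opp A) A (\<lambda>(a, b). b \<otimes>\<^bsub>A\<^esub> m \<otimes>\<^bsub>A\<^esub> a)"
  by (rule balanced_mapI)
    (auto simp: A.A.l_distr A.A.r_distr A.smult_mult_left A.smult_mult_right)

lemma
  assumes m: "m \<in> carrier A"
  shows diag_add_hom: "add_hom T A (\<lambda>X. X \<odot>\<^bsub>diagonal_bimodule A\<^esub> m)"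
    and diag_t: "a \<in> carrier A \<Longrightarrow> b \<in> carrier A \<Longrightarrow> t a b \<odot>\<^bsub>diagonal_bimodule A\<^esub> m = b \<otimes>\<^bsub>A\<^esub> m \<otimes>\<^bsub>A\<^esub> a"
  unfolding diag_smult_lift
  using lift_hom[OF A_group diag_balanced[OF m]] lift_t[OF A_group diag_balanced[OF m]] by auto

lemma linear_endo_simps:
  assumes "linear_endo \<phi>"
  shows "x \<in> carrier A \<Longrightarrow> \<phi> x \<in> carrier A"
    "x \<in> carrier A \<Longrightarrow> y \<in> carrier A \<Longrightarrow> \<phi> (x \<oplus>\<^bsub>A\<^esub> y) = \<phi> x \<oplus>\<^bsub>A\<^esub> \<phi> y"
    "x \<in> carrier A \<Longrightarrow> y \<in> carrier A \<Longrightarrow> \<phi> (x \<otimes>\<^bsub>A\<^esub> y) = \<phi> x \<otimes>\<^bsub>A\<^esub> \<phi> y"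
    "\<phi> \<one>\<^bsub>A\<^esub> = \<one>\<^bsub>A\<^esub>"
    "c \<in> carrier K \<Longrightarrow> x \<in> carrier A \<Longrightarrow> \<phi> (c \<odot>\<^bsub>A\<^esub> x) = c \<odot>\<^bsub>A\<^esub> \<phi> x"
  using assms ring_hom_closed[of \<phi> A A] ring_hom_add[of \<phi> A A] ring_hom_mult[of \<phi> A A] ring_hom_one[of \<phi> A A]
  by (auto simp: linear_endo_def)

lemma twisted_balanced:
  "linear_endo \<mu> \<Longrightarrow> m \<in> carrier A \<Longrightarrow> balanced_map K A (opp A) A (\<lambda>(a, b). a \<otimes>\<^bsub>A\<^esub> m \<otimes>\<^bsub>A\<^esub> \<mu> b)"
  by (rule balanced_mapI)
    (auto simp: A.A.l_distr A.A.r_distr A.smult_mult_left A.smult_mult_right linear_endo_simps)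

lemma
  assumes \<mu>: "linear_endo \<mu>" and m: "m \<in> carrier A"
  shows twisted_add_hom: "add_hom T A (\<lambda>X. X \<odot>\<^bsub>twisted_bimodule A \<mu>\<^esub> m)"
    and twisted_t: "a \<in> carrier A \<Longrightarrow> b \<in> carrier A \<Longrightarrow> t a b \<odot>\<^bsub>twisted_bimodule A \<mu>\<^esub> m = a \<otimes>\<^bsub>A\<^esub> m \<otimes>\<^bsub>A\<^esub> \<mu> b"
  unfolding twisted_smult_lift
  using lift_hom[OF A_group twisted_balanced[OF \<mu> m]] lift_t[OF A_group twisted_balanced[OF \<mu> m]] by auto

text \<open>The base ring \<open>R\<close> stands for \<open>T\<close> or for its opposite, which
  share carrier and addition. The axioms that are additive in the scalars are checked on pure
  tensors.\<close>

lemma module_from_generators: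
  assumes ring: "ring R" and R: "carrier R = carrier T" "add R = add T" "one R = \<one>\<^bsub>T\<^esub>" "zero R = \<zero>\<^bsub>T\<^esub>"
    and hom: "\<And>r. r \<in> carrier T \<Longrightarrow> add_hom T T (\<lambda>s. r \<otimes>\<^bsub>R\<^esub> s)" "\<And>s. s \<in> carrier T \<Longrightarrow> add_hom T T (\<lambda>r. r \<otimes>\<^bsub>R\<^esub> s)"
    and M: "abelian_group M"
    and left: "\<And>m. m \<in> carrier M \<Longrightarrow> add_hom T M (\<lambda>X. X \<odot>\<^bsub>M\<^esub> m)"
    and right: "\<And>a b m m'. a \<in> carrier A \<Longrightarrow> b \<in> carrier A \<Longrightarrow> m \<in> carrier M \<Longrightarrow> m' \<in> carrier M \<Longrightarrow>
      t a b \<odot>\<^bsub>M\<^esub> (m \<oplus>\<^bsub>M\<^esub> m') = t a b \<odot>\<^bsub>M\<^esub> m \<oplus>\<^bsub>M\<^esub> t a b \<odot>\<^bsub>M\<^esub> m'"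
    and assoc: "\<And>a b a' b' m. a \<in> carrier A \<Longrightarrow> b \<in> carrier A \<Longrightarrow> a' \<in> carrier A \<Longrightarrow> b' \<in> carrier A \<Longrightarrow>
      m \<in> carrier M \<Longrightarrow> (t a b \<otimes>\<^bsub>R\<^esub> t a' b') \<odot>\<^bsub>M\<^esub> m = t a b \<odot>\<^bsub>M\<^esub> (t a' b' \<odot>\<^bsub>M\<^esub> m)"
    and one: "\<And>m. m \<in> carrier M \<Longrightarrow> t \<one>\<^bsub>A\<^esub> \<one>\<^bsub>A\<^esub> \<odot>\<^bsub>M\<^esub> m = m"
  shows "left_module R M"
proof -
  interpret M: abelian_group M by fact
  have closed: "r \<odot>\<^bsub>M\<^esub> m \<in> carrier M" if "r \<in> carrier T" "m \<in> carrier M" for r m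
    using add_hom_closed[OF left[OF that(2)] that(1)] .
  have distr: "r \<odot>\<^bsub>M\<^esub> (m \<oplus>\<^bsub>M\<^esub> m') = r \<odot>\<^bsub>M\<^esub> m \<oplus>\<^bsub>M\<^esub> r \<odot>\<^bsub>M\<^esub> m'"
    if "r \<in> carrier T" "m \<in> carrier M" "m' \<in> carrier M" for r m m'
  proof (rule add_hom_eq_on_generators[OF M _ _ that(1)])
    show "add_hom T M (\<lambda>r. r \<odot>\<^bsub>M\<^esub> (m \<oplus>\<^bsub>M\<^esub> m'))" by (rule left) (use that in auto)
    show "add_hom T M (\<lambda>r. r \<odot>\<^bsub>M\<^esub> m \<oplus>\<^bsub>M\<^esub> r \<odot>\<^bsub>M\<^esub> m')"
      using that add_hom_add[OF left] closed by (intro add_homI) (auto simp: M.a_ac)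
  qed (use right that in auto)
  have assoc_t: "(t a b \<otimes>\<^bsub>R\<^esub> s) \<odot>\<^bsub>M\<^esub> m = t a b \<odot>\<^bsub>M\<^esub> (s \<odot>\<^bsub>M\<^esub> m)"
    if "a \<in> carrier A" "b \<in> carrier A" "s \<in> carrier T" "m \<in> carrier M" for a b s m
  proof (rule add_hom_eq_on_generators[OF M _ _ that(3)])
    show "add_hom T M (\<lambda>s. (t a b \<otimes>\<^bsub>R\<^esub> s) \<odot>\<^bsub>M\<^esub> m)"
      by (rule add_hom_comp[OF hom(1) left]) (use that in auto)
    show "add_hom T M (\<lambda>s. t a b \<odot>\<^bsub>M\<^esub> (s \<odot>\<^bsub>M\<^esub> m))"
      using that add_hom_add[OF left] closed distr by (intro add_homI) auto
  qed (use assoc that in auto)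
  have assoc': "(r \<otimes>\<^bsub>R\<^esub> s) \<odot>\<^bsub>M\<^esub> m = r \<odot>\<^bsub>M\<^esub> (s \<odot>\<^bsub>M\<^esub> m)"
    if "r \<in> carrier T" "s \<in> carrier T" "m \<in> carrier M" for r s m
  proof (rule add_hom_eq_on_generators[OF M _ _ that(1)])
    show "add_hom T M (\<lambda>r. (r \<otimes>\<^bsub>R\<^esub> s) \<odot>\<^bsub>M\<^esub> m)"
      by (rule add_hom_comp[OF hom(2) left]) (use that in auto)
    show "add_hom T M (\<lambda>r. r \<odot>\<^bsub>M\<^esub> (s \<odot>\<^bsub>M\<^esub> m))" by (rule left) (use that closed in auto)
  qed (use assoc_t that in auto)
  show ?thesis
    using add_hom_add[OF left] one
    by (intro left_moduleI) (auto simp: ring M R closed distr assoc' T_one_env)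
qed

lemma left_module_diagonal: "left_module (opp T) (diagonal_bimodule A)"
proof (rule module_from_generators)
  show "abelian_group (diagonal_bimodule A)" by (rule abelian_group_cong[OF A_group]) simp_all
  show "add_hom T (diagonal_bimodule A) (\<lambda>X. X \<odot>\<^bsub>diagonal_bimodule A\<^esub> m)" if "m \<in> carrier (diagonal_bimodule A)" for m
    using diag_add_hom[of m] that by (simp add: add_hom_def)
  show "add_hom T T (\<lambda>s. r \<otimes>\<^bsub>opp T\<^esub> s)" if "r \<in> carrier T" for r using T_mult_hom_left[OF that] by simp
  show "add_hom T T (\<lambda>r. r \<otimes>\<^bsub>opp T\<^esub> s)" if "s \<in> carrier T" for s using T_mult_hom_right[OF that] by simp
qed (auto simp: T_ring diag_t t_mult_env A.A.m_assoc A.A.l_distr A.A.r_distr)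

lemma left_module_twisted: "linear_endo \<mu> \<Longrightarrow> left_module T (twisted_bimodule A \<mu>)"
proof (rule module_from_generators)
  assume \<mu>: "linear_endo \<mu>"
  note [simp] = linear_endo_simps[OF \<mu>] twisted_t[OF \<mu>]
  show "abelian_group (twisted_bimodule A \<mu>)" by (rule abelian_group_cong[OF A_group]) simp_all
  show "add_hom T (twisted_bimodule A \<mu>) (\<lambda>X. X \<odot>\<^bsub>twisted_bimodule A \<mu>\<^esub> m)"
    if "m \<in> carrier (twisted_bimodule A \<mu>)" for m
    using twisted_add_hom[OF \<mu>, of m] that by (simp add: add_hom_def)
  show "t a b \<odot>\<^bsub>twisted_bimodule A \<mu>\<^esub> (m \<oplus>\<^bsub>twisted_bimodule A \<mu>\<^esub> m') = t a b \<odot>\<^bsub>twisted_bimodule A \<mu>\<^esub> m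
      \<oplus>\<^bsub>twisted_bimodule A \<mu>\<^esub> t a b \<odot>\<^bsub>twisted_bimodule A \<mu>\<^esub> m'"
    if "a \<in> carrier A" "b \<in> carrier A" "m \<in> carrier (twisted_bimodule A \<mu>)" "m' \<in> carrier (twisted_bimodule A \<mu>)"
    for a b m m' using that by (simp add: A.A.l_distr A.A.r_distr)
  show "(t a b \<otimes>\<^bsub>T\<^esub> t a' b') \<odot>\<^bsub>twisted_bimodule A \<mu>\<^esub> m
      = t a b \<odot>\<^bsub>twisted_bimodule A \<mu>\<^esub> (t a' b' \<odot>\<^bsub>twisted_bimodule A \<mu>\<^esub> m)"
    if "a \<in> carrier A" "b \<in> carrier A" "a' \<in> carrier A" "b' \<in> carrier A" "m \<in> carrier (twisted_bimodule A \<mu>)"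
    for a b a' b' m using that by (simp add: t_mult_env A.A.m_assoc)
  show "t \<one>\<^bsub>A\<^esub> \<one>\<^bsub>A\<^esub> \<odot>\<^bsub>twisted_bimodule A \<mu>\<^esub> m = m" if "m \<in> carrier (twisted_bimodule A \<mu>)" for m
    using that by simp
  show "add_hom T T (\<lambda>s. r \<otimes>\<^bsub>T\<^esub> s)" if "r \<in> carrier T" for r using T_mult_hom_right[OF that] .
  show "add_hom T T (\<lambda>r. r \<otimes>\<^bsub>T\<^esub> s)" if "s \<in> carrier T" for s using T_mult_hom_left[OF that] .
qed (auto simp: T_ring)

text \<open>Restriction along \<open>twist \<phi>\<close> turns a right module over the enveloping algebra into a left one
  whose right action is precomposed with \<open>\<phi>\<close>.\<close>

definition twist :: "('a \<Rightarrow> 'a) \<Rightarrow> ('a \<times> 'a) list set \<Rightarrow> ('a \<times> 'a) list set" where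
  "twist \<phi> = lift T (\<lambda>(a, b). t (\<phi> b) a)"

lemma
  assumes \<phi>: "linear_endo \<phi>"
  shows twist_add_hom: "add_hom T T (twist \<phi>)"
    and twist_t: "a \<in> carrier A \<Longrightarrow> b \<in> carrier A \<Longrightarrow> twist \<phi> (t a b) = t (\<phi> b) a"
proof -
  note [simp] = linear_endo_simps[OF \<phi>]
  have "balanced_map K A (opp A) T (\<lambda>(a, b). t (\<phi> b) a)"
    by (rule balanced_mapI) (use t_smult t_add_left t_add_right in \<open>auto simp: A.smult_closed\<close>)
  note b = lift_hom[OF T_group this] lift_t[OF T_group this]
  show "add_hom T T (twist \<phi>)" using b(1) by (simp add: twist_def)
  show "a \<in> carrier A \<Longrightarrow> b \<in> carrier A \<Longrightarrow> twist \<phi> (t a b) = t (\<phi> b) a" using b(2) by (simp add: twist_def)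
qed

text \<open>Exchanging the tensor factors reverses products in A^e, and \<phi>, applied to one
  factor, is multiplicative; hence the opposite ring as target.\<close>

lemma twist_ring_hom:
  assumes \<phi>: "linear_endo \<phi>" shows "twist \<phi> \<in> ring_hom T (opp T)"
proof (rule ring_hom_memI)
  note [simp] = linear_endo_simps[OF \<phi>] twist_t[OF \<phi>]
  note hom = twist_add_hom[OF \<phi>]
  show "twist \<phi> x \<in> carrier (opp T)" if "x \<in> carrier T" for x using add_hom_closed[OF hom that] by simp
  show "twist \<phi> (x \<oplus>\<^bsub>T\<^esub> y) = twist \<phi> x \<oplus>\<^bsub>opp T\<^esub> twist \<phi> y" if "x \<in> carrier T" "y \<in> carrier T" for x y
    using add_hom_add[OF hom that] by simp
  show "twist \<phi> \<one>\<^bsub>T\<^esub> = \<one>\<^bsub>opp T\<^esub>" by (simp add: T_one_env)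
  have cl: "twist \<phi> x \<in> carrier T" if "x \<in> carrier T" for x by (rule add_hom_closed[OF hom that])
  have "twist \<phi> (x \<otimes>\<^bsub>T\<^esub> y) = twist \<phi> y \<otimes>\<^bsub>T\<^esub> twist \<phi> x" if x: "x \<in> carrier T" and y: "y \<in> carrier T" for x y
  proof (rule add_hom_eq_on_generators[OF T_group _ _ x])
    show "add_hom T T (\<lambda>x. twist \<phi> (x \<otimes>\<^bsub>T\<^esub> y))" by (rule add_hom_comp[OF T_mult_hom_left[OF y] hom])
    show "add_hom T T (\<lambda>x. twist \<phi> y \<otimes>\<^bsub>T\<^esub> twist \<phi> x)" by (rule add_hom_comp[OF hom T_mult_hom_right[OF cl[OF y]]])
    fix a b assume ab: "a \<in> carrier A" "b \<in> carrier (opp A)"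
    show "twist \<phi> (t a b \<otimes>\<^bsub>T\<^esub> y) = twist \<phi> y \<otimes>\<^bsub>T\<^esub> twist \<phi> (t a b)"
    proof (rule add_hom_eq_on_generators[OF T_group _ _ y])
      show "add_hom T T (\<lambda>y. twist \<phi> (t a b \<otimes>\<^bsub>T\<^esub> y))"
        by (rule add_hom_comp[OF T_mult_hom_right hom]) (use ab in simp)
      show "add_hom T T (\<lambda>y. twist \<phi> y \<otimes>\<^bsub>T\<^esub> twist \<phi> (t a b))"
        by (rule add_hom_comp[OF hom T_mult_hom_left]) (use ab in simp)
    qed (use ab in \<open>simp add: t_mult_env\<close>)
  qed
  then show "twist \<phi> (x \<otimes>\<^bsub>T\<^esub> y) = twist \<phi> x \<otimes>\<^bsub>opp T\<^esub> twist \<phi> y" if "x \<in> carrier T" "y \<in> carrier T" for x y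
    using that by simp
qed

text \<open>The tensor \<phi>(b) \<otimes> a acts on the right of \<open>A\<close> by sending m to a
  m \<phi>(b), which is the left action of a \<otimes> b on A_\<phi>. For this reason a resolution
  of \<open>A\<close> restricts to one of A_\<phi>.\<close>

lemma diag_twist:
  assumes \<phi>: "linear_endo \<phi>" and "r \<in> carrier T" "m \<in> carrier A"
  shows "twist \<phi> r \<odot>\<^bsub>diagonal_bimodule A\<^esub> m = r \<odot>\<^bsub>twisted_bimodule A \<phi>\<^esub> m"
  by (rule add_hom_eq_on_generators[OF A_group add_hom_comp[OF twist_add_hom[OF \<phi>] diag_add_hom[OF assms(3)]]
        twisted_add_hom[OF \<phi> assms(3)] assms(2)])
    (use assms in \<open>simp add: twist_t[OF \<phi>] diag_t twisted_t[OF \<phi>] linear_endo_simps[OF \<phi>]\<close>)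

end

section \<open>Twisting the enveloping algebra by an endomorphism\<close>

lemma (in abelian_monoid) finsum_product:
  assumes "finite I" "finite J" "\<And>i j. i \<in> I \<Longrightarrow> j \<in> J \<Longrightarrow> f i j \<in> carrier G"
  shows "finsum G (\<lambda>p. f (fst p) (snd p)) (I \<times> J) = finsum G (\<lambda>i. finsum G (f i) J) I"
  using assms(1,3)
proof (induction I)
  case (insert i I)
  have "finsum G (\<lambda>p. f (fst p) (snd p)) (insert i I \<times> J)
      = finsum G (\<lambda>p. f (fst p) (snd p)) (Pair i ` J \<union> I \<times> J)"
    by (rule arg_cong[where f = "finsum G _"]) auto
  also have "\<dots> = finsum G (\<lambda>p. f (fst p) (snd p)) (Pair i ` J) \<oplus> finsum G (\<lambda>p. f (fst p) (snd p)) (I \<times> J)"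
    using insert assms(2) by (intro finsum_Un_disjoint) auto
  also have "finsum G (\<lambda>p. f (fst p) (snd p)) (Pair i ` J) = finsum G (f i) J"
    using insert.prems by (subst finsum_reindex) (auto simp: inj_on_def)
  finally show ?case
    using insert by (simp add: Pi_iff finsum_closed)
qed simp

lemma add_hom_finsum_fun:
  assumes H: "abelian_group H" and f: "\<And>j. j \<in> J \<Longrightarrow> add_hom G H (f j)"
  shows "add_hom G H (\<lambda>x. \<Oplus>\<^bsub>H\<^esub>j\<in>J. f j x)"
proof -
  interpret H: abelian_group H by fact
  show ?thesis
  proof (rule add_homI)
    show "(\<Oplus>\<^bsub>H\<^esub>j\<in>J. f j x) \<in> carrier H" if "x \<in> carrier G" for x
      using add_hom_closed[OF f that] by (intro H.finsum_closed) blast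
    fix x y assume xy: "x \<in> carrier G" "y \<in> carrier G"
    have "(\<Oplus>\<^bsub>H\<^esub>j\<in>J. f j (x \<oplus>\<^bsub>G\<^esub> y)) = (\<Oplus>\<^bsub>H\<^esub>j\<in>J. f j x \<oplus>\<^bsub>H\<^esub> f j y)"
      using xy add_hom_closed[OF f] by (intro H.finsum_cong' HOL.refl add_hom_add[OF f]) simp_all
    also have "\<dots> = (\<Oplus>\<^bsub>H\<^esub>j\<in>J. f j x) \<oplus>\<^bsub>H\<^esub> (\<Oplus>\<^bsub>H\<^esub>j\<in>J. f j y)"
      using add_hom_closed[OF f xy(1)] add_hom_closed[OF f xy(2)] by (intro H.finsum_addf) blast+
    finally show "(\<Oplus>\<^bsub>H\<^esub>j\<in>J. f j (x \<oplus>\<^bsub>G\<^esub> y)) = (\<Oplus>\<^bsub>H\<^esub>j\<in>J. f j x) \<oplus>\<^bsub>H\<^esub> (\<Oplus>\<^bsub>H\<^esub>j\<in>J. f j y)" .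
  qed
qed

text \<open>Restriction of scalars and a shift by \<open>n\<close> in one step. The differential
  carries no sign; inserting one gives an isomorphic complex.\<close>

definition shift_restrict :: "('s \<Rightarrow> 'r) \<Rightarrow> int \<Rightarrow> ('r, 'm) cochain \<Rightarrow> ('s, 'm) cochain" where
  "shift_restrict \<omega> n C = \<lparr>obj = (\<lambda>i. restrict_scalars \<omega> (obj C (i - n))), diff = (\<lambda>i. diff C (i - n))\<rparr>"

lemma shift_restrict_simps [simp]:
  "obj (shift_restrict \<omega> n C) i = restrict_scalars \<omega> (obj C (i - n))"
  "diff (shift_restrict \<omega> n C) i = diff C (i - n)"
  by (simp_all add: shift_restrict_def)

lemma mod_hom_restrict_scalars:
  "h \<in> mod_hom S M N \<Longrightarrow> \<omega> \<in> ring_hom R S \<Longrightarrow> h \<in> mod_hom R (restrict_scalars \<omega> M) (restrict_scalars \<omega> N)"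
  by (auto simp: mod_hom_def ring_hom_closed)

lemma
  assumes C: "cochain_complex S C" and R: "ring R" and \<omega>: "\<omega> \<in> ring_hom R S"
  shows cochain_complex_shift_restrict: "cochain_complex R (shift_restrict \<omega> n C)"
    and cocycles_shift_restrict: "cocycles (shift_restrict \<omega> n C) i = cocycles C (i - n)"
    and coboundaries_shift_restrict: "coboundaries (shift_restrict \<omega> n C) i = coboundaries C (i - n)"
proof -
  have idx: "i + 1 - n = i - n + 1" "i - 1 - n = i - n - 1" for i by simp_all
  show "cochain_complex R (shift_restrict \<omega> n C)"
    unfolding cochain_complex_def shift_restrict_simps idx
    using left_module_restrict_scalars[OF complex_module[OF C] R \<omega>]
      mod_hom_restrict_scalars[OF complex_diff_hom[OF C] \<omega>] complex_diff_diff[OF C]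
    by (simp add: add.assoc)
  show "cocycles (shift_restrict \<omega> n C) i = cocycles C (i - n)"
    by (simp add: cocycles_def idx)
  show "coboundaries (shift_restrict \<omega> n C) i = coboundaries C (i - n)"
    by (simp add: coboundaries_def idx)
qed

text \<open>\<open>M\<close> is a right module in disguise: the scalar that acts first is the left
  factor of the product in \<open>R\<close>.\<close>

lemma smult_smult_opp:
  assumes "left_module (opp R) M" "a \<in> carrier R" "b \<in> carrier R" "x \<in> carrier M"
  shows "a \<odot>\<^bsub>M\<^esub> (b \<odot>\<^bsub>M\<^esub> x) = (b \<otimes>\<^bsub>R\<^esub> a) \<odot>\<^bsub>M\<^esub> x"
  using left_module.smult_assoc[OF assms(1), of a b x] assms by simp

lemma finsum_restrict_scalars:
  assumes M: "abelian_group M" and N: "abelian_group (restrict_scalars \<omega> M)" and f: "f \<in> I \<rightarrow> carrier M"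
  shows "finsum (restrict_scalars \<omega> M) f I = finsum M f I"
  using add_hom_finsum[OF M N _ f, of "\<lambda>x. x"] by (simp add: add_hom_def)

text \<open>Dual bases \<open>u\<close>, \<open>v\<close> of \<open>A\<^sub>\<phi>\<close> as a right module.\<close>

locale twisted_env = env_algebra K A
  for K :: "('k, 'y) ring_scheme" and A :: "('k, 'a) module" +
  fixes \<phi> :: "'a \<Rightarrow> 'a" and J :: "'j set" and u :: "'j \<Rightarrow> 'a" and v :: "'j \<Rightarrow> 'a \<Rightarrow> 'a"
  assumes \<phi>: "linear_endo \<phi>" and J: "finite J" and u [simp]: "\<And>j. j \<in> J \<Longrightarrow> u j \<in> carrier A"
    and v_hom: "\<And>j. j \<in> J \<Longrightarrow> add_hom A A (v j)"
    and v_right: "\<And>j x b. j \<in> J \<Longrightarrow> x \<in> carrier A \<Longrightarrow> b \<in> carrier A \<Longrightarrow> v j (x \<otimes>\<^bsub>A\<^esub> \<phi> b) = v j x \<otimes>\<^bsub>A\<^esub> b"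
    and uv: "\<And>x. x \<in> carrier A \<Longrightarrow> (\<Oplus>\<^bsub>A\<^esub>j\<in>J. u j \<otimes>\<^bsub>A\<^esub> \<phi> (v j x)) = x"
begin

lemmas \<phi>_simps [simp] = linear_endo_simps[OF \<phi>]

text \<open>The right \<open>A\<close>-linear maps from A_\<phi> to \<open>A\<close>, that is, the
  dual of the right module with dual basis \<open>u\<close>, \<open>v\<close>.\<close>

definition semi :: "('a \<Rightarrow> 'a) \<Rightarrow> bool" where
  "semi f \<longleftrightarrow> add_hom A A f \<and> (\<forall>x\<in>carrier A. \<forall>b\<in>carrier A. f (x \<otimes>\<^bsub>A\<^esub> \<phi> b) = f x \<otimes>\<^bsub>A\<^esub> b)"

lemma semi_v: "j \<in> J \<Longrightarrow> semi (v j)"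
  by (simp add: semi_def v_hom v_right)

lemma
  assumes f: "semi f"
  shows semi_hom: "add_hom A A f"
    and semi_closed: "x \<in> carrier A \<Longrightarrow> f x \<in> carrier A"
    and semi_add: "x \<in> carrier A \<Longrightarrow> y \<in> carrier A \<Longrightarrow> f (x \<oplus>\<^bsub>A\<^esub> y) = f x \<oplus>\<^bsub>A\<^esub> f y"
    and semi_right: "x \<in> carrier A \<Longrightarrow> b \<in> carrier A \<Longrightarrow> f (x \<otimes>\<^bsub>A\<^esub> \<phi> b) = f x \<otimes>\<^bsub>A\<^esub> b"
    and semi_smult: "k \<in> carrier K \<Longrightarrow> x \<in> carrier A \<Longrightarrow> f (k \<odot>\<^bsub>A\<^esub> x) = k \<odot>\<^bsub>A\<^esub> f x"
proof -
  show h: "add_hom A A f" using f by (simp add: semi_def)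
  show cl: "x \<in> carrier A \<Longrightarrow> f x \<in> carrier A" by (rule add_hom_closed[OF h])
  show "x \<in> carrier A \<Longrightarrow> y \<in> carrier A \<Longrightarrow> f (x \<oplus>\<^bsub>A\<^esub> y) = f x \<oplus>\<^bsub>A\<^esub> f y" by (rule add_hom_add[OF h])
  show r: "x \<in> carrier A \<Longrightarrow> b \<in> carrier A \<Longrightarrow> f (x \<otimes>\<^bsub>A\<^esub> \<phi> b) = f x \<otimes>\<^bsub>A\<^esub> b" for b
    using f by (simp add: semi_def)
  show "f (k \<odot>\<^bsub>A\<^esub> x) = k \<odot>\<^bsub>A\<^esub> f x" if "k \<in> carrier K" "x \<in> carrier A"
  proof -
    \<comment> \<open>A scalar \<open>k\<close> acts as right multiplication by \<phi>(k 1) = k 1,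
      so semilinearity already contains linearity over \<open>K\<close>.\<close>
    have "k \<odot>\<^bsub>A\<^esub> x = x \<otimes>\<^bsub>A\<^esub> \<phi> (k \<odot>\<^bsub>A\<^esub> \<one>\<^bsub>A\<^esub>)" using that by (simp add: A.smult_mult_right)
    moreover have "f (x \<otimes>\<^bsub>A\<^esub> \<phi> (k \<odot>\<^bsub>A\<^esub> \<one>\<^bsub>A\<^esub>)) = f x \<otimes>\<^bsub>A\<^esub> (k \<odot>\<^bsub>A\<^esub> \<one>\<^bsub>A\<^esub>)"
      using that by (intro r) simp_all
    moreover have "f x \<otimes>\<^bsub>A\<^esub> (k \<odot>\<^bsub>A\<^esub> \<one>\<^bsub>A\<^esub>) = k \<odot>\<^bsub>A\<^esub> f x" using that cl by (simp add: A.smult_mult_right)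
    ultimately show ?thesis by simp
  qed
qed

text \<open>The form \<open>f\<close> on the first factor, with the factors exchanged so as to undo
  the exchange made by \<open>twist\<close>. This makes \<open>hat f\<close> a linear map from A^e,
  restricted along the twist, to A^e.\<close>

definition hat :: "('a \<Rightarrow> 'a) \<Rightarrow> ('a \<times> 'a) list set \<Rightarrow> ('a \<times> 'a) list set" where
  "hat f = lift T (\<lambda>(x, y). t y (f x))"

lemma
  assumes f: "semi f"
  shows hat_hom: "add_hom T T (hat f)"
    and hat_closed: "r \<in> carrier T \<Longrightarrow> hat f r \<in> carrier T"
    and hat_t: "x \<in> carrier A \<Longrightarrow> y \<in> carrier A \<Longrightarrow> hat f (t x y) = t y (f x)"
    and hat_twist: "r \<in> carrier T \<Longrightarrow> s \<in> carrier T \<Longrightarrow> hat f (s \<otimes>\<^bsub>T\<^esub> twist \<phi> r) = r \<otimes>\<^bsub>T\<^esub> hat f s"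
proof -
  note [simp] = semi_closed[OF f] semi_add[OF f] semi_smult[OF f] semi_right[OF f]
  have "balanced_map K A (opp A) T (\<lambda>(x, y). t y (f x))"
    by (rule balanced_mapI) (use t_smult[symmetric] t_add_left t_add_right in auto)
  note b = lift_hom[OF T_group this] lift_t[OF T_group this]
  show h: "add_hom T T (hat f)" using b(1) by (simp add: hat_def)
  show hcl: "hat f r \<in> carrier T" if "r \<in> carrier T" for r by (rule add_hom_closed[OF h that])
  show ht: "x \<in> carrier A \<Longrightarrow> y \<in> carrier A \<Longrightarrow> hat f (t x y) = t y (f x)" for x y using b(2) by (simp add: hat_def)
  note tw = twist_add_hom[OF \<phi>]
  show "hat f (s \<otimes>\<^bsub>T\<^esub> twist \<phi> r) = r \<otimes>\<^bsub>T\<^esub> hat f s" if r: "r \<in> carrier T" and s: "s \<in> carrier T"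
  proof (rule add_hom_eq_on_generators[OF T_group _ _ r])
    show "add_hom T T (\<lambda>r. hat f (s \<otimes>\<^bsub>T\<^esub> twist \<phi> r))" by (rule add_hom_comp[OF add_hom_comp[OF tw T_mult_hom_right[OF s]] h])
    show "add_hom T T (\<lambda>r. r \<otimes>\<^bsub>T\<^esub> hat f s)" by (rule T_mult_hom_left[OF hcl[OF s]])
    fix a b assume ab: "a \<in> carrier A" "b \<in> carrier (opp A)"
    show "hat f (s \<otimes>\<^bsub>T\<^esub> twist \<phi> (t a b)) = t a b \<otimes>\<^bsub>T\<^esub> hat f s"
    proof (rule add_hom_eq_on_generators[OF T_group _ _ s])
      show "add_hom T T (\<lambda>s. hat f (s \<otimes>\<^bsub>T\<^esub> twist \<phi> (t a b)))"
        by (rule add_hom_comp[OF T_mult_hom_left h]) (use ab add_hom_closed[OF tw] in simp)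
      show "add_hom T T (\<lambda>s. t a b \<otimes>\<^bsub>T\<^esub> hat f s)"
        by (rule add_hom_comp[OF h T_mult_hom_right]) (use ab in simp)
    qed (use ab in \<open>simp add: twist_t[OF \<phi>] t_mult_env ht\<close>)
  qed
qed

lemma twist_closed: "r \<in> carrier T \<Longrightarrow> twist \<phi> r \<in> carrier T"
  by (rule add_hom_closed[OF twist_add_hom[OF \<phi>]])

text \<open>The elements \<open>u j \<otimes> 1\<close> and the coordinates \<open>hat (v j)\<close> form a dual basis of the enveloping
  algebra over itself via \<open>twist \<phi>\<close>.\<close>

lemma hat_expand:
  assumes r: "r \<in> carrier T"
  shows "(\<Oplus>\<^bsub>T\<^esub>j\<in>J. t (u j) \<one>\<^bsub>A\<^esub> \<otimes>\<^bsub>T\<^esub> twist \<phi> (hat (v j) r)) = r"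
proof (rule add_hom_eq_on_generators[OF T_group _ add_hom_ident r])
  have cl: "t (u j) \<one>\<^bsub>A\<^esub> \<otimes>\<^bsub>T\<^esub> twist \<phi> (hat (v j) r) \<in> carrier T" if "j \<in> J" "r \<in> carrier T" for j r
    using that by (simp add: twist_closed hat_closed[OF semi_v] T_mult_closed)
  have ah: "add_hom T T (\<lambda>r. t (u j) \<one>\<^bsub>A\<^esub> \<otimes>\<^bsub>T\<^esub> twist \<phi> (hat (v j) r))" if "j \<in> J" for j
    using that by (intro add_hom_comp[OF add_hom_comp[OF hat_hom[OF semi_v] twist_add_hom[OF \<phi>]] T_mult_hom_right]) auto
  show "add_hom T T (\<lambda>r. \<Oplus>\<^bsub>T\<^esub>j\<in>J. t (u j) \<one>\<^bsub>A\<^esub> \<otimes>\<^bsub>T\<^esub> twist \<phi> (hat (v j) r))"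
    by (rule add_hom_finsum_fun[OF T_group ah])
  fix x y assume xy: "x \<in> carrier A" "y \<in> carrier (opp A)"
  have "(\<Oplus>\<^bsub>T\<^esub>j\<in>J. t (u j) \<one>\<^bsub>A\<^esub> \<otimes>\<^bsub>T\<^esub> twist \<phi> (hat (v j) (t x y))) = (\<Oplus>\<^bsub>T\<^esub>j\<in>J. t (u j \<otimes>\<^bsub>A\<^esub> \<phi> (v j x)) y)"
    using xy by (intro T.finsum_cong') (simp_all add: hat_t[OF semi_v] twist_t[OF \<phi>] semi_closed[OF semi_v] t_mult_env)
  also have "\<dots> = t (\<Oplus>\<^bsub>A\<^esub>j\<in>J. u j \<otimes>\<^bsub>A\<^esub> \<phi> (v j x)) y"
    using xy by (intro add_hom_finsum[OF A_group T_group add_hom_t_left, symmetric]) (auto simp: semi_closed[OF semi_v])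
  finally show "(\<Oplus>\<^bsub>T\<^esub>j\<in>J. t (u j) \<one>\<^bsub>A\<^esub> \<otimes>\<^bsub>T\<^esub> twist \<phi> (hat (v j) (t x y))) = t x y"
    using xy by (simp add: uv)
qed

lemma hat_expand_smult:
  assumes M: "left_module (opp T) M" and r: "r \<in> carrier T" and m: "m \<in> carrier M"
  shows "r \<odot>\<^bsub>M\<^esub> m = (\<Oplus>\<^bsub>M\<^esub>j\<in>J. twist \<phi> (hat (v j) r) \<odot>\<^bsub>M\<^esub> (t (u j) \<one>\<^bsub>A\<^esub> \<odot>\<^bsub>M\<^esub> m))"
proof -
  interpret M: left_module "opp T" M by fact
  have cl: "twist \<phi> (hat (v j) r) \<in> carrier T" if "j \<in> J" for j
    using that r by (simp add: twist_closed hat_closed[OF semi_v])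
  have "add_hom T M (\<lambda>r. r \<odot>\<^bsub>M\<^esub> m)" using M.add_hom_smult_left[OF m] by (simp add: add_hom_def)
  then have "(\<Oplus>\<^bsub>T\<^esub>j\<in>J. t (u j) \<one>\<^bsub>A\<^esub> \<otimes>\<^bsub>T\<^esub> twist \<phi> (hat (v j) r)) \<odot>\<^bsub>M\<^esub> m
      = (\<Oplus>\<^bsub>M\<^esub>j\<in>J. (t (u j) \<one>\<^bsub>A\<^esub> \<otimes>\<^bsub>T\<^esub> twist \<phi> (hat (v j) r)) \<odot>\<^bsub>M\<^esub> m)"
    using cl by (intro add_hom_finsum[OF T_group M.M.abelian_group_axioms]) (auto intro!: T_mult_closed)
  also have "\<dots> = (\<Oplus>\<^bsub>M\<^esub>j\<in>J. twist \<phi> (hat (v j) r) \<odot>\<^bsub>M\<^esub> (t (u j) \<one>\<^bsub>A\<^esub> \<odot>\<^bsub>M\<^esub> m))"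
    using cl m M.smult_closed
    by (intro M.M.finsum_cong') (auto simp: smult_smult_opp[OF M])
  finally show ?thesis using hat_expand[OF r] by simp
qed

text \<open>Two dual bases are composed: that of \<open>M\<close> over A^e, and that of A^e over
  itself through the twist. Restriction along the twist therefore preserves finitely generated
  projective modules.\<close>

lemma dual_basis_twist:
  assumes M: "left_module (opp T) M" and fin: "finite I" and db: "dual_basis (opp T) M I e c"
  shows "dual_basis T (restrict_scalars (twist \<phi>) M) (I \<times> J)
    (\<lambda>p. t (u (snd p)) \<one>\<^bsub>A\<^esub> \<odot>\<^bsub>M\<^esub> e (fst p)) (\<lambda>p x. hat (v (snd p)) (c (fst p) x))"
proof -
  interpret M: left_module "opp T" M by fact
  note tw = twist_ring_hom[OF \<phi>]
  have MR: "left_module T (restrict_scalars (twist \<phi>) M)"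
    by (rule left_module_restrict_scalars[OF M T_ring tw])
  have e: "\<And>i. i \<in> I \<Longrightarrow> e i \<in> carrier M"
    and c: "\<And>i. i \<in> I \<Longrightarrow> c i \<in> mod_hom (opp T) M (regular_module (opp T))"
    and dec: "\<And>x. x \<in> carrier M \<Longrightarrow> x = (\<Oplus>\<^bsub>M\<^esub>i\<in>I. c i x \<odot>\<^bsub>M\<^esub> e i)"
    using db unfolding finite_dual_basis_iff[OF M fin] by auto
  have cT: "c i x \<in> carrier T" if "i \<in> I" "x \<in> carrier M" for i x
    using mod_hom_closed[OF c] that by fastforce
  show ?thesis
    unfolding finite_dual_basis_iff[OF MR finite_cartesian_product[OF fin J]]
  proof (intro conjI ballI)
    show "(\<lambda>p. t (u (snd p)) \<one>\<^bsub>A\<^esub> \<odot>\<^bsub>M\<^esub> e (fst p)) \<in> I \<times> J \<rightarrow> carrier (restrict_scalars (twist \<phi>) M)"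
      using e by (auto intro!: M.smult_closed)
    show "(\<lambda>x. hat (v (snd p)) (c (fst p) x)) \<in> mod_hom T (restrict_scalars (twist \<phi>) M) (regular_module T)"
      if p: "p \<in> I \<times> J" for p
    proof -
      have ij: "fst p \<in> I" "semi (v (snd p))" using p semi_v by auto
      show ?thesis
        using ij cT mod_hom_add[OF c] mod_hom_smult[OF c] twist_closed
        by (intro mod_homI) (auto simp: hat_closed add_hom_add[OF hat_hom] hat_twist)
    qed
    fix x assume "x \<in> carrier (restrict_scalars (twist \<phi>) M)"
    then have x: "x \<in> carrier M" by simp
    have cl: "twist \<phi> (hat (v j) (c i x)) \<odot>\<^bsub>M\<^esub> (t (u j) \<one>\<^bsub>A\<^esub> \<odot>\<^bsub>M\<^esub> e i) \<in> carrier M" if "i \<in> I" "j \<in> J" for i j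
      using that x e cT by (intro M.smult_closed) (auto simp: twist_closed hat_closed[OF semi_v])
    have "x = (\<Oplus>\<^bsub>M\<^esub>i\<in>I. c i x \<odot>\<^bsub>M\<^esub> e i)" by (rule dec[OF x])
    also have "\<dots> = (\<Oplus>\<^bsub>M\<^esub>i\<in>I. \<Oplus>\<^bsub>M\<^esub>j\<in>J. twist \<phi> (hat (v j) (c i x)) \<odot>\<^bsub>M\<^esub> (t (u j) \<one>\<^bsub>A\<^esub> \<odot>\<^bsub>M\<^esub> e i))"
      using e cT[OF _ x] cl by (intro M.M.finsum_cong' HOL.refl hat_expand_smult[OF M]) (auto intro!: M.M.finsum_closed)
    also have "\<dots> = (\<Oplus>\<^bsub>M\<^esub>p\<in>I \<times> J. twist \<phi> (hat (v (snd p)) (c (fst p) x)) \<odot>\<^bsub>M\<^esub> (t (u (snd p)) \<one>\<^bsub>A\<^esub> \<odot>\<^bsub>M\<^esub> e (fst p)))"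
      using cl by (rule M.M.finsum_product[OF fin J, symmetric])
    also have "\<dots> = (\<Oplus>\<^bsub>restrict_scalars (twist \<phi>) M\<^esub>p\<in>I \<times> J.
        twist \<phi> (hat (v (snd p)) (c (fst p) x)) \<odot>\<^bsub>M\<^esub> (t (u (snd p)) \<one>\<^bsub>A\<^esub> \<odot>\<^bsub>M\<^esub> e (fst p)))"
      using cl by (intro finsum_restrict_scalars[OF M.M.abelian_group_axioms left_module_group[OF MR], symmetric]) auto
    finally show "x = (\<Oplus>\<^bsub>restrict_scalars (twist \<phi>) M\<^esub>p\<in>I \<times> J.
        hat (v (snd p)) (c (fst p) x) \<odot>\<^bsub>restrict_scalars (twist \<phi>) M\<^esub>
        (t (u (snd p)) \<one>\<^bsub>A\<^esub> \<odot>\<^bsub>M\<^esub> e (fst p)))" by simp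
  qed
qed

end

section \<open>Comparing two resolutions of the dualizing bimodule\<close>

lemma dual_module_value:
  "q \<in> carrier (dual_module R M) \<Longrightarrow> m \<in> carrier M \<Longrightarrow> q m \<in> carrier R"
  using mod_hom_closed[of q "opp R" M "regular_module (opp R)" m] by simp

lemma dual_module_smult:
  "q \<in> carrier (dual_module R M) \<Longrightarrow> m \<in> carrier M \<Longrightarrow> r \<in> carrier R \<Longrightarrow> q (r \<odot>\<^bsub>M\<^esub> m) = q m \<otimes>\<^bsub>R\<^esub> r"
  using mod_hom_smult[of q "opp R" M "regular_module (opp R)" m r] by simp

lemma dual_module_add:
  "q \<in> carrier (dual_module R M) \<Longrightarrow> m \<in> carrier M \<Longrightarrow> n \<in> carrier M \<Longrightarrow> q (m \<oplus>\<^bsub>M\<^esub> n) = q m \<oplus>\<^bsub>R\<^esub> q n"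
  using mod_hom_add[of q "opp R" M "regular_module (opp R)" m n] by simp

lemma dual_module_add_hom: "q \<in> carrier (dual_module R M) \<Longrightarrow> add_hom M R q"
  using dual_module_value dual_module_add by (intro add_homI)

lemma eval_hom:
  "m \<in> carrier M \<Longrightarrow> (\<lambda>q. q m) \<in> mod_hom R (dual_module R M) (regular_module R)"
  using dual_module_value[of _ R M m] by (intro mod_homI) (auto simp del: dual_module_simps(1))

text \<open>The coordinates \<open>c i\<close> span the dual, so a functional on it is determined by
  its values there; evaluation at the sum of the \<open>e i\<close> with coefficients
  \<open>f (c i)\<close> is the same functional.\<close>

lemma dual_module_bidual:
  assumes M: "left_module (opp R) M" and fin: "finite I" and db: "dual_basis (opp R) M I e c"
    and f: "f \<in> mod_hom R (dual_module R M) (regular_module R)"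
  obtains p where "p \<in> carrier M" "\<And>q. q \<in> carrier (dual_module R M) \<Longrightarrow> f q = q p"
proof -
  interpret M: left_module "opp R" M by fact
  interpret R: ring R using left_module_ring[OF M] by simp
  interpret Q: left_module R "dual_module R M" by (rule left_module_dual[OF M])
  have reg: "left_module R (regular_module R)" by (rule left_module_regular[OF R.ring_axioms])
  let ?c = "\<lambda>i. restrict (c i) (carrier M)"
  have e: "\<And>i. i \<in> I \<Longrightarrow> e i \<in> carrier M" using db by (auto simp: dual_basis_def)
  note dbQ = dual_basis_dual_module[OF M fin db, unfolded finite_dual_basis_iff[OF Q.left_module_axioms fin]]
  have cQ: "?c i \<in> carrier (dual_module R M)" if "i \<in> I" for i using dbQ that by blast
  have fR: "f q \<in> carrier R" if "q \<in> carrier (dual_module R M)" for q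
    using mod_hom_closed[OF f that] by simp
  let ?p = "\<Oplus>\<^bsub>M\<^esub>i\<in>I. f (?c i) \<odot>\<^bsub>M\<^esub> e i"
  have cl: "f (?c i) \<odot>\<^bsub>M\<^esub> e i \<in> carrier M" if "i \<in> I" for i
    using that e fR cQ by (intro M.smult_closed) simp_all
  have "f q = q ?p" if q: "q \<in> carrier (dual_module R M)" for q
  proof -
    have "f q = f (\<Oplus>\<^bsub>dual_module R M\<^esub>i\<in>I. q (e i) \<odot>\<^bsub>dual_module R M\<^esub> ?c i)"
      using dbQ q by simp
    also have "\<dots> = (\<Oplus>\<^bsub>R\<^esub>i\<in>I. f (q (e i) \<odot>\<^bsub>dual_module R M\<^esub> ?c i))"
    proof (rule add_hom_finsum[OF Q.M.abelian_group_axioms R.abelian_group_axioms])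
      show "add_hom (dual_module R M) R f" using mod_hom_add_hom[OF f] by (simp add: add_hom_def)
      show "(\<lambda>i. q (e i) \<odot>\<^bsub>dual_module R M\<^esub> ?c i) \<in> I \<rightarrow> carrier (dual_module R M)"
        using cQ e dual_module_value[OF q] Q.smult_closed by blast
    qed
    also have "\<dots> = (\<Oplus>\<^bsub>R\<^esub>i\<in>I. q (f (?c i) \<odot>\<^bsub>M\<^esub> e i))"
    proof (rule R.finsum_cong'[OF HOL.refl])
      show "f (q (e i) \<odot>\<^bsub>dual_module R M\<^esub> ?c i) = q (f (?c i) \<odot>\<^bsub>M\<^esub> e i)" if "i \<in> I" for i
        using mod_hom_smult[OF f cQ[OF that] dual_module_value[OF q e[OF that]]]
          dual_module_smult[OF q e[OF that] fR[OF cQ[OF that]]] by simp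
      show "(\<lambda>i. q (f (?c i) \<odot>\<^bsub>M\<^esub> e i)) \<in> I \<rightarrow> carrier R" using cl dual_module_value[OF q] by blast
    qed
    also have "\<dots> = q ?p"
      using cl by (intro add_hom_finsum[OF M.M.abelian_group_axioms R.abelian_group_axioms dual_module_add_hom[OF q], symmetric]) auto
    finally show ?thesis .
  qed
  moreover have "?p \<in> carrier M" using cl by (intro M.M.finsum_closed) auto
  ultimately show ?thesis using that by blast
qed

text \<open>The coordinates of a dual basis are themselves functionals, and they determine an
  element.\<close>

lemma dual_module_separates:
  assumes M: "left_module (opp R) M" and fin: "finite I" and db: "dual_basis (opp R) M I e c"
    and x: "x \<in> carrier M" and y: "y \<in> carrier M"
    and eq: "\<And>q. q \<in> carrier (dual_module R M) \<Longrightarrow> q x = q y"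
  shows "x = y"
proof -
  interpret M: left_module "opp R" M by fact
  have e: "e \<in> I \<rightarrow> carrier M" and c: "\<And>i. i \<in> I \<Longrightarrow> c i \<in> mod_hom (opp R) M (regular_module (opp R))"
    and dec: "\<And>x. x \<in> carrier M \<Longrightarrow> x = (\<Oplus>\<^bsub>M\<^esub>i\<in>I. c i x \<odot>\<^bsub>M\<^esub> e i)"
    using db unfolding finite_dual_basis_iff[OF M fin] by auto
  have "c i x = c i y" if "i \<in> I" for i
    using eq[of "restrict (c i) (carrier M)"] mod_hom_restrict[OF M c[OF that]] x y by simp
  moreover have "(\<lambda>i. c i y \<odot>\<^bsub>M\<^esub> e i) \<in> I \<rightarrow> carrier M"
    using e mod_hom_closed[OF c y] by (auto intro!: M.smult_closed)
  ultimately have "(\<Oplus>\<^bsub>M\<^esub>i\<in>I. c i x \<odot>\<^bsub>M\<^esub> e i) = (\<Oplus>\<^bsub>M\<^esub>i\<in>I. c i y \<odot>\<^bsub>M\<^esub> e i)"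
    by (intro M.M.finsum_cong') simp_all
  then show ?thesis using dec[OF x] dec[OF y] by simp
qed

lemma dual_cocycles_0_iff:
  "g \<in> cocycles (dual_complex (opp R) C) 0 \<longleftrightarrow> g \<in> mod_hom R (obj C 0) (regular_module R) \<and>
     g \<in> extensional (carrier (obj C 0)) \<and> (\<forall>m\<in>carrier (obj C (-1)). g (diff C (-1) m) = \<zero>\<^bsub>R\<^esub>)"
  by (auto simp: dual_cocycles_iff)

lemma dual_coboundaries_0_iff:
  assumes "cochain_complex R C"
  shows "g \<in> coboundaries (dual_complex (opp R) C) 0 \<longleftrightarrow> g \<in> mod_hom R (obj C 0) (regular_module R) \<and>
     g \<in> extensional (carrier (obj C 0)) \<and>
     (\<exists>h\<in>mod_hom R (obj C 1) (regular_module R). \<forall>m\<in>carrier (obj C 0). g m = h (diff C 0 m))"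
  using dual_coboundaries_iff[of "opp R" C g 0] assms by auto

declare shift_restrict_simps [simp del]

text \<open>\<open>P\<close> is a finite resolution of the diagonal bimodule, and \<kappa> induces
  the identification of the only cohomology of Hom(P, A^e) with A_\<phi>. The resolution is a
  parameter because the one inside RHom need not be finite.\<close>

locale smooth_env = twisted_env K A \<phi> J u v
  for K :: "('k, 'y) ring_scheme" and A :: "('k, 'a) module" and \<phi> :: "'a \<Rightarrow> 'a"
    and J :: "'j set" and u :: "'j \<Rightarrow> 'a" and v :: "'j \<Rightarrow> 'a \<Rightarrow> 'a" +
  fixes P :: "(('a \<times> 'a) list set, 'p) cochain" and I :: "int \<Rightarrow> 'i set" and e :: "int \<Rightarrow> 'i \<Rightarrow> 'p"
    and c :: "int \<Rightarrow> 'i \<Rightarrow> 'p \<Rightarrow> ('a \<times> 'a) list set" and \<epsilon> :: "int \<Rightarrow> 'p \<Rightarrow> 'a"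
    and d :: int and \<kappa> :: "('p \<Rightarrow> ('a \<times> 'a) list set) \<Rightarrow> 'a"
  assumes P: "cochain_complex (opp T) P"
    and fin: "\<And>i. finite (I i)"
    and db: "\<And>i. dual_basis (opp T) (obj P i) (I i) (e i) (c i)"
    and bounded: "\<exists>lo hi. \<forall>i. i < lo \<or> hi < i \<longrightarrow> carrier (obj P i) = {\<zero>\<^bsub>obj P i\<^esub>}"
    and \<epsilon>: "qis (opp T) P (concentrated 0 (diagonal_bimodule A)) \<epsilon>"
    and exact: "\<And>i. i \<noteq> d \<Longrightarrow> cocycles (dual_complex T P) i \<subseteq> coboundaries (dual_complex T P) i"
    and \<kappa>: "\<kappa> \<in> mod_hom T ((obj (dual_complex T P) d)\<lparr>carrier := cocycles (dual_complex T P) d\<rparr>)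
      (twisted_bimodule A \<phi>)"
    and \<kappa>_ker: "\<And>x. x \<in> cocycles (dual_complex T P) d \<Longrightarrow>
      \<kappa> x = \<zero>\<^bsub>A\<^esub> \<longleftrightarrow> x \<in> coboundaries (dual_complex T P) d"
    and \<kappa>_surj: "carrier A \<subseteq> \<kappa> ` cocycles (dual_complex T P) d"
begin

abbreviation "Q \<equiv> dual_complex T P"
abbreviation "X \<equiv> shift_restrict (twist \<phi>) d P"
abbreviation "U \<equiv> twisted_bimodule A \<phi>"

section \<open>Two complexes that compute the dualizing bimodule\<close>

lemma Q: "cochain_complex T Q"
  by (rule cochain_complex_dual[OF P])

lemma X: "cochain_complex T X"
  by (rule cochain_complex_shift_restrict[OF P T_ring twist_ring_hom[OF \<phi>]])

lemma U: "left_module T U"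
  by (rule left_module_twisted[OF \<phi>])

text \<open>Finite generation enters through the finite dual bases, which pass to the duals, and the
  lower bound of \<open>P\<close> becomes an upper bound of \<open>Q\<close>.\<close>

lemma pQ: "proj_complex T Q (\<lambda>i. I (- i)) (\<lambda>i l. restrict (c (- i) l) (carrier (obj P (- i)))) (\<lambda>i l q. q (e (- i) l))"
  unfolding proj_complex_def
proof (intro conjI allI Q)
  show "dual_basis T (obj Q i) (I (- i)) (\<lambda>l. restrict (c (- i) l) (carrier (obj P (- i)))) (\<lambda>l q. q (e (- i) l))" for i
    using dual_basis_dual_module[OF complex_module[OF P] fin db, of "- i"] by simp
  obtain lo where lo: "\<And>i. i < lo \<Longrightarrow> carrier (obj P i) = {\<zero>\<^bsub>obj P i\<^esub>}" using bounded by blast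
  have "carrier (obj Q i) = {\<zero>\<^bsub>obj Q i\<^esub>}" if "i > - lo" for i
  proof -
    have i: "carrier (obj P (- i)) = {\<zero>\<^bsub>obj P (- i)\<^esub>}" using that by (intro lo) simp
    interpret Qi: left_module T "obj Q i" by (rule complex_module[OF Q])
    have "q = \<zero>\<^bsub>obj Q i\<^esub>" if q: "q \<in> carrier (obj Q i)" for q
    proof (rule extensionalityI[of _ "carrier (obj P (- i))"])
      show "q \<in> extensional (carrier (obj P (- i)))" "\<zero>\<^bsub>obj Q i\<^esub> \<in> extensional (carrier (obj P (- i)))"
        using q by auto
      fix m assume "m \<in> carrier (obj P (- i))"
      then have m: "m = \<zero>\<^bsub>obj P (- i)\<^esub>" using i by simp
      have "add_hom (obj P (- i)) T q" using q dual_module_add_hom[of q T "obj P (- i)"] by simp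
      from add_hom_zero[OF complex_group[OF P] T_group this]
      show "q m = \<zero>\<^bsub>obj Q i\<^esub> m" by (simp add: m i)
    qed
    then show ?thesis using Qi.M.zero_closed by blast
  qed
  then show "bounded_above Q" unfolding bounded_above_def by blast
qed

lemma pX: "proj_complex T X (\<lambda>i. I (i - d) \<times> J) (\<lambda>i p. t (u (snd p)) \<one>\<^bsub>A\<^esub> \<odot>\<^bsub>obj P (i - d)\<^esub> e (i - d) (fst p))
    (\<lambda>i p x. hat (v (snd p)) (c (i - d) (fst p) x))"
  unfolding proj_complex_def
proof (intro conjI allI X)
  show "dual_basis T (obj X i) (I (i - d) \<times> J) (\<lambda>p. t (u (snd p)) \<one>\<^bsub>A\<^esub> \<odot>\<^bsub>obj P (i - d)\<^esub> e (i - d) (fst p))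
    (\<lambda>p x. hat (v (snd p)) (c (i - d) (fst p) x))" for i
    using dual_basis_twist[OF complex_module[OF P] fin db, of "i - d"] by (simp add: shift_restrict_simps)
  obtain hi where hi: "\<And>i. hi < i \<Longrightarrow> carrier (obj P i) = {\<zero>\<^bsub>obj P i\<^esub>}" using bounded by blast
  show "bounded_above X"
    unfolding bounded_above_def by (rule exI[of _ "hi + d"]) (simp add: hi shift_restrict_simps)
qed

text \<open>The map is the augmentation of \<open>P\<close> with degrees shifted. By
  \<open>diag_twist\<close> it stays linear when \<open>P\<close> is restricted and its target is
  read as A_\<phi>; cocycles and coboundaries are the same sets as before.\<close>

lemma qX: "qis T X (concentrated d U) (\<lambda>i. \<epsilon> (i - d))"
proof -
  note D = qis_target[OF \<epsilon>] and ec = qis_chain_map[OF \<epsilon>]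
  have ZB: "cocycles X i = cocycles P (i - d)" "coboundaries X i = coboundaries P (i - d)" for i
    using cocycles_shift_restrict[OF P T_ring twist_ring_hom[OF \<phi>]]
      coboundaries_shift_restrict[OF P T_ring twist_ring_hom[OF \<phi>]] by auto
  have Z': "cocycles (concentrated d U) i = cocycles (concentrated 0 (diagonal_bimodule A)) (i - d)"
    "coboundaries (concentrated d U) i = coboundaries (concentrated 0 (diagonal_bimodule A)) (i - d)" for i
    using concentrated_coboundaries[OF U] concentrated_coboundaries[OF left_module_diagonal]
    by (auto simp: concentrated_cocycles)
  show ?thesis
  proof (rule qisI[OF X cochain_complex_concentrated[OF U]])
    show "chain_map T X (concentrated d U) (\<lambda>i. \<epsilon> (i - d))"
      unfolding chain_map_def
    proof (intro conjI allI ballI)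
      fix i
      note h = chain_map_hom[OF ec, of "i - d"]
      have cl: "\<epsilon> (i - d) x \<in> carrier A" "i \<noteq> d \<Longrightarrow> \<epsilon> (i - d) x = \<zero>\<^bsub>A\<^esub>" if "x \<in> carrier (obj P (i - d))" for x
        using mod_hom_closed[OF h that] by (auto simp: concentrated_obj split: if_splits)
      show "\<epsilon> (i - d) \<in> mod_hom T (obj X i) (obj (concentrated d U) i)"
      proof (rule mod_homI)
        fix x assume "x \<in> carrier (obj X i)"
        then have x: "x \<in> carrier (obj P (i - d))" by (simp add: shift_restrict_simps)
        show "\<epsilon> (i - d) x \<in> carrier (obj (concentrated d U) i)"
          using cl[OF x] by (cases "i = d") (simp_all add: concentrated_obj)
        show "\<epsilon> (i - d) (x \<oplus>\<^bsub>obj X i\<^esub> y) = \<epsilon> (i - d) x \<oplus>\<^bsub>obj (concentrated d U) i\<^esub> \<epsilon> (i - d) y"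
          if "y \<in> carrier (obj X i)" for y
          using mod_hom_add[OF h x, of y] that by (simp add: concentrated_obj shift_restrict_simps)
        show "\<epsilon> (i - d) (r \<odot>\<^bsub>obj X i\<^esub> x) = r \<odot>\<^bsub>obj (concentrated d U) i\<^esub> \<epsilon> (i - d) x" if "r \<in> carrier T" for r
          using mod_hom_smult[OF h x, of "twist \<phi> r"] that cl[OF x]
          by (simp add: concentrated_obj shift_restrict_simps twist_closed diag_twist[OF \<phi>])
      qed
      fix x assume "x \<in> carrier (obj X i)"
      then have x: "x \<in> carrier (obj P (i - d))" by (simp add: shift_restrict_simps)
      have idx: "i + 1 - d = i - d + 1" by simp
      show "\<epsilon> (i + 1 - d) (diff X i x) = diff (concentrated d U) i (\<epsilon> (i - d) x)"
        unfolding idx using chain_map_comm[OF ec x] by (simp add: shift_restrict_simps concentrated_def)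
    qed
  next
    show "x \<in> coboundaries X i" if "x \<in> cocycles X i" "\<epsilon> (i - d) x \<in> coboundaries (concentrated d U) i" for i x
      using that unfolding ZB Z' by (rule qis_inj[OF \<epsilon>])
    show "\<exists>x\<in>cocycles X i. \<exists>b\<in>coboundaries (concentrated d U) i. \<epsilon> (i - d) x = y \<oplus>\<^bsub>obj (concentrated d U) i\<^esub> b"
      if "y \<in> cocycles (concentrated d U) i" for i y
      using that qis_surj[OF \<epsilon>, of y "i - d"] unfolding ZB Z' concentrated_obj twisted_simps diag_simps by metis
  qed
qed

lemma qT: "qis T (truncation d Q) Q (\<lambda>i x. x)"
  by (rule qis_truncation_inclusion[OF Q]) (rule exact, simp)

lemma qU: "qis T (truncation d Q) (concentrated d U) (\<lambda>i x. if i = d then \<kappa> x else \<zero>\<^bsub>U\<^esub>)"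
  by (rule qis_truncation_projection[OF Q U _ \<kappa>]) (use \<kappa>_ker \<kappa>_surj exact in auto)

text \<open>Both \<open>X\<close> and the truncation of \<open>Q\<close> are quasi-isomorphic to
  A_\<phi> placed in degree \<open>d\<close>. As \<open>X\<close> is projective, its augmentation
  lifts to the truncation, which is then included into \<open>Q\<close>.\<close>

lemma compare: obtains \<beta> where "qis T X Q \<beta>"
  using qis_lift[OF pX qU qX] qis_compose[OF _ qT] by blast

lemma \<epsilon>_zero:
  assumes "p \<in> carrier (obj P 0)"
  shows \<epsilon>_closed: "\<epsilon> 0 p \<in> carrier A"
    and \<epsilon>_add: "p' \<in> carrier (obj P 0) \<Longrightarrow> \<epsilon> 0 (p \<oplus>\<^bsub>obj P 0\<^esub> p') = \<epsilon> 0 p \<oplus>\<^bsub>A\<^esub> \<epsilon> 0 p'"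
    and \<epsilon>_smult: "r \<in> carrier T \<Longrightarrow> \<epsilon> 0 (r \<odot>\<^bsub>obj P 0\<^esub> p) = r \<odot>\<^bsub>diagonal_bimodule A\<^esub> \<epsilon> 0 p"
  using mod_hom_closed[OF chain_map_hom[OF qis_chain_map[OF \<epsilon>]] assms]
    mod_hom_add[OF chain_map_hom[OF qis_chain_map[OF \<epsilon>]] assms, of p']
    mod_hom_smult[OF chain_map_hom[OF qis_chain_map[OF \<epsilon>]] assms, of r]
  by (auto simp: concentrated_obj)

lemma \<epsilon>_boundary:
  assumes "w \<in> carrier (obj P (-1))" shows "\<epsilon> 0 (diff P (-1) w) = \<zero>\<^bsub>A\<^esub>"
  using chain_map_comm[OF qis_chain_map[OF \<epsilon>] assms] by (simp add: concentrated_def)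

lemma \<epsilon>_eq_imp:
  assumes p: "p \<in> cocycles P 0" and p': "p' \<in> cocycles P 0" and eq: "\<epsilon> 0 p = \<epsilon> 0 p'"
  obtains w where "w \<in> carrier (obj P (-1))" "p = p' \<oplus>\<^bsub>obj P 0\<^esub> diff P (-1) w"
proof -
  interpret P0: left_module "opp T" "obj P 0" by (rule complex_module[OF P])
  note cl = cocycles_carrier[OF p] cocycles_carrier[OF p']
  let ?x = "p \<oplus>\<^bsub>obj P 0\<^esub> \<ominus>\<^bsub>obj P 0\<^esub> p'"
  have ah: "add_hom (obj P 0) A (\<epsilon> 0)" by (intro add_homI \<epsilon>_closed \<epsilon>_add)
  have "\<epsilon> 0 ?x = \<zero>\<^bsub>A\<^esub>"
    using cl \<epsilon>_add[of p "\<ominus>\<^bsub>obj P 0\<^esub> p'"] add_hom_minus[OF P0.M.abelian_group_axioms A_group ah cl(2)]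
    by (simp add: eq \<epsilon>_closed A.M.r_neg)
  moreover have "?x \<in> cocycles P 0" by (rule cocycles_add[OF P p cocycles_minus[OF P p']])
  ultimately have "?x \<in> coboundaries P 0"
    using qis_inj[OF \<epsilon>, of ?x 0] by (simp add: concentrated_coboundaries[OF left_module_diagonal])
  then obtain w where "w \<in> carrier (obj P (-1))" "?x = diff P (-1) w" by (auto elim: coboundariesE)
  then show ?thesis using that P0.M.eq_add_minus[OF cl] by metis
qed

text \<open>The dual of the comparison map \<beta> identifies the classes of Hom(X, A^e) in degree
  zero with those of Hom(Q, A^e), which biduality turns into H^0(P) = A. The map
  \<open>h\<^sub>0\<close> is \<beta> followed by evaluation at a cocycle over 1. The last three
  conclusions say that its class generates, that both actions of \<open>A\<close> agree on it, and
  that nothing but zero annihilates it.\<close>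

lemma generator:
  obtains h\<^sub>0 where "h\<^sub>0 \<in> mod_hom T (obj X 0) (regular_module T)"
    and "\<And>m. m \<in> carrier (obj X (-1)) \<Longrightarrow> h\<^sub>0 (diff X (-1) m) = \<zero>\<^bsub>T\<^esub>"
    and "\<And>h. \<lbrakk>h \<in> mod_hom T (obj X 0) (regular_module T);
        \<And>m. m \<in> carrier (obj X (-1)) \<Longrightarrow> h (diff X (-1) m) = \<zero>\<^bsub>T\<^esub>\<rbrakk> \<Longrightarrow>
      \<exists>a\<in>carrier A. \<exists>k\<in>mod_hom T (obj X 1) (regular_module T). \<forall>m\<in>carrier (obj X 0).
        h m = h\<^sub>0 m \<otimes>\<^bsub>T\<^esub> t \<one>\<^bsub>A\<^esub> a \<oplus>\<^bsub>T\<^esub> k (diff X 0 m)"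
    and "\<And>a. a \<in> carrier A \<Longrightarrow> \<exists>k\<in>mod_hom T (obj X 1) (regular_module T). \<forall>m\<in>carrier (obj X 0).
        h\<^sub>0 m \<otimes>\<^bsub>T\<^esub> t a \<one>\<^bsub>A\<^esub> = h\<^sub>0 m \<otimes>\<^bsub>T\<^esub> t \<one>\<^bsub>A\<^esub> a \<oplus>\<^bsub>T\<^esub> k (diff X 0 m)"
    and "\<And>a k. \<lbrakk>a \<in> carrier A; k \<in> mod_hom T (obj X 1) (regular_module T);
        \<And>m. m \<in> carrier (obj X 0) \<Longrightarrow> h\<^sub>0 m \<otimes>\<^bsub>T\<^esub> t a \<one>\<^bsub>A\<^esub> = k (diff X 0 m)\<rbrakk> \<Longrightarrow> a = \<zero>\<^bsub>A\<^esub>"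
proof -
  obtain \<beta> where \<beta>: "qis T X Q \<beta>" by (rule compare)
  note \<beta>c = qis_chain_map[OF \<beta>]
  have pX': "proj_complex (opp (opp T)) X (\<lambda>i. I (i - d) \<times> J) (\<lambda>i p. t (u (snd p)) \<one>\<^bsub>A\<^esub> \<odot>\<^bsub>obj P (i - d)\<^esub> e (i - d) (fst p))
    (\<lambda>i p x. hat (v (snd p)) (c (i - d) (fst p) x))" using pX by simp
  have pQ': "proj_complex (opp (opp T)) Q (\<lambda>i. I (- i)) (\<lambda>i l. restrict (c (- i) l) (carrier (obj P (- i)))) (\<lambda>i l q. q (e (- i) l))"
    using pQ by simp
  have \<beta>': "qis (opp (opp T)) X Q \<beta>" using \<beta> by simp
  have dual: "qis (opp T) (dual_complex (opp T) Q) (dual_complex (opp T) X) (dual_map X \<beta>)"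
    by (rule qis_dual[OF pX' pQ' \<beta>'])
  interpret P0: left_module "opp T" "obj P 0" by (rule complex_module[OF P])
  interpret Pm: left_module "opp T" "obj P (-1)" by (rule complex_module[OF P])
  have regT: "left_module T (regular_module T)" by (rule left_module_regular[OF T_ring])
  have Q0: "obj Q 0 = dual_module T (obj P 0)" and Q1: "obj Q 1 = dual_module T (obj P (-1))"
    and Qm: "obj Q (-1) = dual_module T (obj P 1)" by simp_all
  have dQ0: "(diff Q 0 q) w = q (diff P (-1) w)" if "w \<in> carrier (obj P (-1))" for q w using that by simp
  have dPm: "diff P (-1) w \<in> carrier (obj P 0)" if "w \<in> carrier (obj P (-1))" for w
    using complex_diff[OF P that] by simp
  have \<beta>0: "\<beta> 0 m \<in> carrier (dual_module T (obj P 0))" if "m \<in> carrier (obj X 0)" for m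
    using chain_map_closed[OF \<beta>c that] by (simp only: Q0)
  have \<beta>1: "\<beta> 1 (diff X 0 m) = diff Q 0 (\<beta> 0 m)" if "m \<in> carrier (obj X 0)" for m
    using chain_map_comm[OF \<beta>c that] by simp
  have ev\<beta>: "(\<lambda>m. \<beta> 0 m p) \<in> mod_hom T (obj X 0) (regular_module T)" if "p \<in> carrier (obj P 0)" for p
    using mod_hom_comp[OF chain_map_hom[OF \<beta>c, of 0, unfolded Q0] eval_hom[OF that]] .
  have ev\<beta>1: "(\<lambda>m. \<beta> 1 m w) \<in> mod_hom T (obj X 1) (regular_module T)" if "w \<in> carrier (obj P (-1))" for w
    using mod_hom_comp[OF chain_map_hom[OF \<beta>c, of 1, unfolded Q1] eval_hom[OF that]] .
  have ev_d: "\<beta> 0 m (diff P (-1) w) = \<beta> 1 (diff X 0 m) w" if "w \<in> carrier (obj P (-1))" "m \<in> carrier (obj X 0)" for m w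
    using that by (simp only: \<beta>1 dQ0)
  have \<beta>_smult: "\<beta> 0 m (r \<odot>\<^bsub>obj P 0\<^esub> p) = \<beta> 0 m p \<otimes>\<^bsub>T\<^esub> r"
    if "m \<in> carrier (obj X 0)" "p \<in> carrier (obj P 0)" "r \<in> carrier T" for m p r
    using dual_module_smult[OF \<beta>0[OF that(1)] that(2,3)] .
  have \<beta>_add: "\<beta> 0 m (p \<oplus>\<^bsub>obj P 0\<^esub> p') = \<beta> 0 m p \<oplus>\<^bsub>T\<^esub> \<beta> 0 m p'"
    if "m \<in> carrier (obj X 0)" "p \<in> carrier (obj P 0)" "p' \<in> carrier (obj P 0)" for m p p'
    using dual_module_add[OF \<beta>0[OF that(1)] that(2,3)] .
  \<comment> \<open>Cocycles with equal augmentation differ by the boundary of some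
    \<open>w\<close>, and evaluating \<beta> at that boundary gives the coboundary of
    \<open>\<beta> 1\<close> evaluated at \<open>w\<close>.\<close>
  have shift: "\<exists>k\<in>mod_hom T (obj X 1) (regular_module T). \<forall>m\<in>carrier (obj X 0).
      \<beta> 0 m p = \<beta> 0 m p' \<oplus>\<^bsub>T\<^esub> k (diff X 0 m)"
    if p: "p \<in> cocycles P 0" "p' \<in> cocycles P 0" "\<epsilon> 0 p = \<epsilon> 0 p'" for p p'
  proof -
    obtain w where w: "w \<in> carrier (obj P (-1))" "p = p' \<oplus>\<^bsub>obj P 0\<^esub> diff P (-1) w" by (rule \<epsilon>_eq_imp[OF p])
    then show ?thesis
      using ev\<beta>1[OF w(1)] \<beta>_add ev_d[OF w(1)] cocycles_carrier[OF p(2)] dPm[OF w(1)]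
      by (intro bexI[of _ "\<lambda>m. \<beta> 1 m w"]) simp_all
  qed
  obtain p\<^sub>0 where p0: "p\<^sub>0 \<in> cocycles P 0" "\<epsilon> 0 p\<^sub>0 = \<one>\<^bsub>A\<^esub>"
  proof -
    have "\<one>\<^bsub>A\<^esub> \<in> cocycles (concentrated 0 (diagonal_bimodule A)) 0" by (simp add: concentrated_cocycles)
    then obtain x where "x \<in> cocycles P 0" "\<epsilon> 0 x = \<one>\<^bsub>A\<^esub>"
      using qis_surj[OF \<epsilon>, of "\<one>\<^bsub>A\<^esub>" 0]
      by (auto simp: concentrated_coboundaries[OF left_module_diagonal] concentrated_obj)
    then show ?thesis using that by blast
  qed
  note p0c = cocycles_carrier[OF p0(1)]
  have p0a: "t a b \<odot>\<^bsub>obj P 0\<^esub> p\<^sub>0 \<in> cocycles P 0" "\<epsilon> 0 (t a b \<odot>\<^bsub>obj P 0\<^esub> p\<^sub>0) = b \<otimes>\<^bsub>A\<^esub> a"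
    if "a \<in> carrier A" "b \<in> carrier A" for a b
    using cocycles_smult[OF P _ p0(1), of "t a b"] \<epsilon>_smult[OF p0c, of "t a b"] that
    by (simp_all add: p0(2) diag_t)
  let ?h = "\<lambda>m. \<beta> 0 m p\<^sub>0"
  show ?thesis
  proof (rule that)
    show "?h \<in> mod_hom T (obj X 0) (regular_module T)" by (rule ev\<beta>[OF p0c])
    show "?h (diff X (-1) m) = \<zero>\<^bsub>T\<^esub>" if m: "m \<in> carrier (obj X (-1))" for m
    proof -
      have "\<beta> 0 (diff X (-1) m) = diff Q (-1) (\<beta> (-1) m)" using chain_map_comm[OF \<beta>c m] by simp
      moreover have "\<beta> (-1) m \<in> carrier (dual_module T (obj P 1))"
        using chain_map_closed[OF \<beta>c m] by (simp only: Qm)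
      ultimately show ?thesis
        using p0c cocycles_diff[OF p0(1)] add_hom_zero[OF complex_group[OF P] T_group dual_module_add_hom] by simp
    qed
  next
    fix h assume h: "h \<in> mod_hom T (obj X 0) (regular_module T)"
      and hd: "\<And>m. m \<in> carrier (obj X (-1)) \<Longrightarrow> h (diff X (-1) m) = \<zero>\<^bsub>T\<^esub>"
    let ?y = "restrict h (carrier (obj X 0))"
    have dX: "diff X (-1) m \<in> carrier (obj X 0)" if "m \<in> carrier (obj X (-1))" for m
      using complex_diff[OF X that] by simp
    have "?y \<in> cocycles (dual_complex (opp T) X) 0"
      unfolding dual_cocycles_0_iff using mod_hom_restrict[OF complex_module[OF X] h] hd dX by auto
    then obtain f b where f: "f \<in> cocycles (dual_complex (opp T) Q) 0"
      and b: "b \<in> coboundaries (dual_complex (opp T) X) 0"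
      and fb: "dual_map X \<beta> 0 f = ?y \<oplus>\<^bsub>obj (dual_complex (opp T) X) 0\<^esub> b"
      by (rule qis_surj[OF dual])
    obtain k where k: "k \<in> mod_hom T (obj X 1) (regular_module T)"
      and bk: "\<And>m. m \<in> carrier (obj X 0) \<Longrightarrow> b m = k (diff X 0 m)"
      using b unfolding dual_coboundaries_0_iff[OF X] by blast
    have f': "f \<in> mod_hom T (dual_module T (obj P 0)) (regular_module T)"
      and fd: "\<And>q. q \<in> carrier (dual_module T (obj P 1)) \<Longrightarrow> f (diff Q (-1) q) = \<zero>\<^bsub>T\<^esub>"
      using f unfolding dual_cocycles_0_iff Q0 Qm by blast+
    \<comment> \<open>Biduality: the cocycle \<open>f\<close> on \<open>Q\<close> is evaluation at
      an element \<open>p\<close> of \<open>P\<close> in degree zero.\<close>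
    obtain p where p: "p \<in> carrier (obj P 0)" and fp: "\<And>q. q \<in> carrier (dual_module T (obj P 0)) \<Longrightarrow> f q = q p"
      by (rule dual_module_bidual[OF complex_module[OF P] fin db f']) (rule that)
    have dP: "diff P 0 p \<in> carrier (obj P 1)" using complex_diff[OF P p] by simp
    \<comment> \<open>A functional \<open>q\<close> on the next term has at the boundary of
      \<open>p\<close> the value of \<open>f\<close> at the coboundary of \<open>q\<close>, which is
      zero; and functionals separate points.\<close>
    have "diff P 0 p = \<zero>\<^bsub>obj P 1\<^esub>"
    proof (rule dual_module_separates[OF complex_module[OF P] fin db dP])
      show "\<zero>\<^bsub>obj P 1\<^esub> \<in> carrier (obj P 1)"
        using complex_group[OF P, of 1] by (simp add: abelian_group_def abelian_monoid.zero_closed)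
      fix q assume q: "q \<in> carrier (dual_module T (obj P 1))"
      have dq: "diff Q (-1) q \<in> carrier (dual_module T (obj P 0))"
        using complex_diff[OF Q, of q "-1", unfolded Qm] q unfolding Q0[symmetric] by simp
      have "q (diff P 0 p) = (diff Q (-1) q) p" using p by simp
      also have "\<dots> = \<zero>\<^bsub>T\<^esub>" using fp[OF dq] fd[OF q] by simp
      finally show "q (diff P 0 p) = q \<zero>\<^bsub>obj P 1\<^esub>"
        using add_hom_zero[OF complex_group[OF P] T_group dual_module_add_hom[OF q]] by simp
    qed
    then have pZ: "p \<in> cocycles P 0" using p by (intro cocyclesI) simp_all
    let ?a = "\<epsilon> 0 p"
    have a: "?a \<in> carrier A" by (rule \<epsilon>_closed[OF p])
    \<comment> \<open>The tensor 1 \<otimes> a acts on the right of \<open>A\<close> as left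
      multiplication by a, so this multiple of the cocycle over 1 has the same augmentation as
      \<open>p\<close>.\<close>
    obtain k' where k': "k' \<in> mod_hom T (obj X 1) (regular_module T)"
      and pk': "\<And>m. m \<in> carrier (obj X 0) \<Longrightarrow>
        \<beta> 0 m p = \<beta> 0 m (t \<one>\<^bsub>A\<^esub> ?a \<odot>\<^bsub>obj P 0\<^esub> p\<^sub>0) \<oplus>\<^bsub>T\<^esub> k' (diff X 0 m)"
      using shift[OF pZ p0a(1)[OF A.A.one_closed a]] p0a(2)[OF A.A.one_closed a] a by auto
    let ?k = "\<lambda>x. k' x \<oplus>\<^bsub>regular_module T\<^esub> \<ominus>\<^bsub>regular_module T\<^esub> k x"
    have kh: "?k \<in> mod_hom T (obj X 1) (regular_module T)"
      by (intro mod_hom_plus[OF regT] mod_hom_uminus[OF regT] k k')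
    have neg: "\<ominus>\<^bsub>regular_module T\<^esub> x = \<ominus>\<^bsub>T\<^esub> x" if "x \<in> carrier T" for x
      using add_hom_minus[OF T_group left_module_group[OF regT], of "\<lambda>x. x" x] that by (simp add: add_hom_def)
    have "h m = ?h m \<otimes>\<^bsub>T\<^esub> t \<one>\<^bsub>A\<^esub> ?a \<oplus>\<^bsub>T\<^esub> ?k (diff X 0 m)" if m: "m \<in> carrier (obj X 0)" for m
    proof -
      have dm: "diff X 0 m \<in> carrier (obj X 1)" using complex_diff[OF X m] by simp
      have cl: "h m \<in> carrier T" "k (diff X 0 m) \<in> carrier T" "k' (diff X 0 m) \<in> carrier T" "?h m \<in> carrier T"
        using mod_hom_closed[OF h m] mod_hom_closed[OF k dm] mod_hom_closed[OF k' dm] mod_hom_closed[OF ev\<beta>[OF p0c] m]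
        by simp_all
      have "f (\<beta> 0 m) = h m \<oplus>\<^bsub>T\<^esub> b m"
        using fun_cong[OF fb, of m] m by (simp add: dual_map_def)
      then have "h m \<oplus>\<^bsub>T\<^esub> k (diff X 0 m) = ?h m \<otimes>\<^bsub>T\<^esub> t \<one>\<^bsub>A\<^esub> ?a \<oplus>\<^bsub>T\<^esub> k' (diff X 0 m)"
        using fp[OF \<beta>0[OF m]] bk[OF m] pk'[OF m] \<beta>_smult[OF m p0c] a by simp
      then have "h m = ?h m \<otimes>\<^bsub>T\<^esub> t \<one>\<^bsub>A\<^esub> ?a \<oplus>\<^bsub>T\<^esub> k' (diff X 0 m) \<oplus>\<^bsub>T\<^esub> \<ominus>\<^bsub>T\<^esub> k (diff X 0 m)"
        using T.add_minus_cancel[OF cl(1,2)] by simp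
      then show ?thesis using cl a by (simp add: T.a_assoc T_mult_closed neg)
    qed
    then show "\<exists>a\<in>carrier A. \<exists>k\<in>mod_hom T (obj X 1) (regular_module T). \<forall>m\<in>carrier (obj X 0).
        h m = ?h m \<otimes>\<^bsub>T\<^esub> t \<one>\<^bsub>A\<^esub> a \<oplus>\<^bsub>T\<^esub> k (diff X 0 m)"
      by (intro bexI[OF _ a] bexI[OF _ kh] ballI)
  next
    fix a assume a: "a \<in> carrier A"
    have "\<exists>k\<in>mod_hom T (obj X 1) (regular_module T). \<forall>m\<in>carrier (obj X 0).
      \<beta> 0 m (t a \<one>\<^bsub>A\<^esub> \<odot>\<^bsub>obj P 0\<^esub> p\<^sub>0) = \<beta> 0 m (t \<one>\<^bsub>A\<^esub> a \<odot>\<^bsub>obj P 0\<^esub> p\<^sub>0) \<oplus>\<^bsub>T\<^esub> k (diff X 0 m)"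
      using p0a a by (intro shift) simp_all
    then show "\<exists>k\<in>mod_hom T (obj X 1) (regular_module T). \<forall>m\<in>carrier (obj X 0).
        ?h m \<otimes>\<^bsub>T\<^esub> t a \<one>\<^bsub>A\<^esub> = ?h m \<otimes>\<^bsub>T\<^esub> t \<one>\<^bsub>A\<^esub> a \<oplus>\<^bsub>T\<^esub> k (diff X 0 m)"
      using \<beta>_smult p0c a by simp
  next
    fix a k assume a: "a \<in> carrier A" and k: "k \<in> mod_hom T (obj X 1) (regular_module T)"
      and hk: "\<And>m. m \<in> carrier (obj X 0) \<Longrightarrow> ?h m \<otimes>\<^bsub>T\<^esub> t a \<one>\<^bsub>A\<^esub> = k (diff X 0 m)"
    \<comment> \<open>Evaluation at \<open>?p\<close> pulls back along \<beta> to
      \<open>h\<^sub>0\<close> times a \<otimes> 1, a coboundary by assumption. Injectivity of the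
      dual map and biduality make \<open>?p\<close> a boundary, so its augmentation, which is
      \<open>a\<close>, vanishes.\<close>
    let ?p = "t a \<one>\<^bsub>A\<^esub> \<odot>\<^bsub>obj P 0\<^esub> p\<^sub>0"
    have pZ: "?p \<in> cocycles P 0" and \<epsilon>p: "\<epsilon> 0 ?p = a" using p0a[of a "\<one>\<^bsub>A\<^esub>"] a by simp_all
    note pc = cocycles_carrier[OF pZ]
    let ?f = "\<lambda>q\<in>carrier (obj Q 0). q ?p"
    have f: "?f \<in> cocycles (dual_complex (opp T) Q) 0"
      unfolding dual_cocycles_0_iff
    proof (intro conjI ballI)
      show "?f \<in> mod_hom T (obj Q 0) (regular_module T)"
        using mod_hom_restrict[OF complex_module[OF Q, of 0], unfolded Q0, OF eval_hom[OF pc]] unfolding Q0 .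
      fix q assume q: "q \<in> carrier (obj Q (-1))"
      have dq: "diff Q (-1) q \<in> carrier (obj Q 0)" using complex_diff[OF Q q] by simp
      have "(diff Q (-1) q) ?p = q (diff P 0 ?p)" using pc by simp
      also have "\<dots> = \<zero>\<^bsub>T\<^esub>"
        using cocycles_diff[OF pZ] add_hom_zero[OF complex_group[OF P] T_group dual_module_add_hom[OF q[unfolded Qm]]] by simp
      finally show "?f (diff Q (-1) q) = \<zero>\<^bsub>T\<^esub>" using dq by (simp only: restrict_apply' if_True)
    qed simp
    have "dual_map X \<beta> 0 ?f \<in> coboundaries (dual_complex (opp T) X) 0"
      unfolding dual_coboundaries_0_iff[OF X]
    proof (intro conjI bexI[OF _ k] ballI)
      have fv: "dual_map X \<beta> 0 ?f m = \<beta> 0 m ?p" if "m \<in> carrier (obj X 0)" for m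
        using that chain_map_closed[OF \<beta>c that] by (simp add: dual_map_def del: dual_complex_simps)
      show "dual_map X \<beta> 0 ?f m = k (diff X 0 m)" if "m \<in> carrier (obj X 0)" for m
        using fv[OF that] \<beta>_smult[OF that p0c, of "t a \<one>\<^bsub>A\<^esub>"] hk[OF that] a by simp
      show "dual_map X \<beta> 0 ?f \<in> extensional (carrier (obj X 0))" by (simp add: dual_map_def)
      have "dual_map X \<beta> 0 ?f = restrict (\<lambda>m. \<beta> 0 m ?p) (carrier (obj X 0))"
      proof (rule extensionalityI[of _ "carrier (obj X 0)"])
        show "dual_map X \<beta> 0 ?f m = restrict (\<lambda>m. \<beta> 0 m ?p) (carrier (obj X 0)) m" if "m \<in> carrier (obj X 0)" for m
          using fv[OF that] that by (simp only: restrict_apply' if_True)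
      qed (simp_all add: dual_map_def)
      then show "dual_map X \<beta> 0 ?f \<in> mod_hom T (obj X 0) (regular_module T)"
        using mod_hom_restrict[OF complex_module[OF X] ev\<beta>[OF pc]] by simp
    qed
    then have "?f \<in> coboundaries (dual_complex (opp T) Q) 0" by (rule qis_inj[OF dual f])
    then obtain g where g: "g \<in> mod_hom T (obj Q 1) (regular_module T)"
      and fg: "\<And>q. q \<in> carrier (obj Q 0) \<Longrightarrow> ?f q = g (diff Q 0 q)"
      unfolding dual_coboundaries_0_iff[OF Q] by blast
    obtain w where w: "w \<in> carrier (obj P (-1))" and gw: "\<And>q. q \<in> carrier (dual_module T (obj P (-1))) \<Longrightarrow> g q = q w"
      by (rule dual_module_bidual[OF complex_module[OF P] fin db g[unfolded Q1]]) (rule that)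
    have "?p = diff P (-1) w"
    proof (rule dual_module_separates[OF complex_module[OF P] fin db pc dPm[OF w]])
      fix q assume q: "q \<in> carrier (dual_module T (obj P 0))"
      have dq: "diff Q 0 q \<in> carrier (dual_module T (obj P (-1)))"
        using complex_diff[OF Q, of q 0, unfolded Q0] q unfolding Q1[symmetric] by simp
      have "q ?p = g (diff Q 0 q)" using fg[unfolded Q0, OF q] q by (simp only: restrict_apply' if_True)
      also have "\<dots> = q (diff P (-1) w)" using gw[OF dq] dQ0[OF w] by simp
      finally show "q ?p = q (diff P (-1) w)" .
    qed
    then show "a = \<zero>\<^bsub>A\<^esub>" using \<epsilon>p \<epsilon>_boundary[OF w] by simp
  qed
qed

end

section \<open>Recovering semilinear forms from cocycles\<close>

context twisted_env
begin

abbreviation tlin :: "(('a \<times> 'a) list set, 'm) module \<Rightarrow> ('m \<Rightarrow> ('a \<times> 'a) list set) set" where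
  "tlin M \<equiv> mod_hom T (restrict_scalars (twist \<phi>) M) (regular_module T)"

lemma
  assumes "h \<in> tlin M" "x \<in> carrier M"
  shows tlin_closed: "h x \<in> carrier T"
    and tlin_add: "y \<in> carrier M \<Longrightarrow> h (x \<oplus>\<^bsub>M\<^esub> y) = h x \<oplus>\<^bsub>T\<^esub> h y"
    and tlin_smult: "r \<in> carrier T \<Longrightarrow> h (twist \<phi> r \<odot>\<^bsub>M\<^esub> x) = r \<otimes>\<^bsub>T\<^esub> h x"
  using mod_hom_closed[OF assms(1), of x] mod_hom_add[OF assms(1), of x y] mod_hom_smult[OF assms(1), of x r] assms(2)
  by auto

lemma tlinI:
  assumes "add_hom M T h" "\<And>r x. r \<in> carrier T \<Longrightarrow> x \<in> carrier M \<Longrightarrow> h (twist \<phi> r \<odot>\<^bsub>M\<^esub> x) = r \<otimes>\<^bsub>T\<^esub> h x"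
  shows "h \<in> tlin M"
  using assms add_hom_closed[OF assms(1)] add_hom_add[OF assms(1)] by (intro mod_homI) simp_all

lemma tlin_hom: "h \<in> tlin M \<Longrightarrow> add_hom M T h"
  using tlin_closed tlin_add by (intro add_homI)

lemma hat_tlin: "semi f \<Longrightarrow> hat f \<in> tlin (regular_module (opp T))"
  by (rule tlinI) (simp_all add: hat_twist, simp add: add_hom_def hat_closed add_hom_add[OF hat_hom])

text \<open>A contraction with \<open>z\<close>: the first factor acts on \<open>z\<close> through
  \<phi>, \<open>v j\<close> takes the result to \<open>A\<close>, and the second factor multiplies
  from the left. On the tensors 1 \<otimes> f(u j) that \<open>hat f\<close> produces, the sum over
  \<open>j\<close> is that of f(u j) v j(z), which is f(z).\<close>

definition \<mu> :: "'j \<Rightarrow> 'a \<Rightarrow> ('a \<times> 'a) list set \<Rightarrow> 'a" where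
  "\<mu> j z = lift A (\<lambda>(y, w). w \<otimes>\<^bsub>A\<^esub> v j (\<phi> y \<otimes>\<^bsub>A\<^esub> z))"

lemma
  assumes j: "j \<in> J" and z: "z \<in> carrier A"
  shows \<mu>_hom: "add_hom T A (\<mu> j z)"
    and \<mu>_closed: "r \<in> carrier T \<Longrightarrow> \<mu> j z r \<in> carrier A"
    and \<mu>_t: "y \<in> carrier A \<Longrightarrow> w \<in> carrier A \<Longrightarrow> \<mu> j z (t y w) = w \<otimes>\<^bsub>A\<^esub> v j (\<phi> y \<otimes>\<^bsub>A\<^esub> z)"
proof -
  note [simp] = semi_closed[OF semi_v[OF j]] semi_add[OF semi_v[OF j]] semi_smult[OF semi_v[OF j]]
  have "balanced_map K A (opp A) A (\<lambda>(y, w). w \<otimes>\<^bsub>A\<^esub> v j (\<phi> y \<otimes>\<^bsub>A\<^esub> z))"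
    by (rule balanced_mapI)
      (use z in \<open>auto simp: A.A.l_distr A.A.r_distr A.smult_mult_left A.smult_mult_right\<close>)
  note b = lift_hom[OF A_group this] lift_t[OF A_group this]
  show h: "add_hom T A (\<mu> j z)" using b(1) by (simp add: \<mu>_def)
  show "r \<in> carrier T \<Longrightarrow> \<mu> j z r \<in> carrier A" by (rule add_hom_closed[OF h])
  show "y \<in> carrier A \<Longrightarrow> w \<in> carrier A \<Longrightarrow> \<mu> j z (t y w) = w \<otimes>\<^bsub>A\<^esub> v j (\<phi> y \<otimes>\<^bsub>A\<^esub> z)"
    using b(2) by (simp add: \<mu>_def)
qed

lemma uv_apply:
  assumes g: "add_hom A A g" and x: "x \<in> carrier A"
  shows "(\<Oplus>\<^bsub>A\<^esub>j\<in>J. g (u j \<otimes>\<^bsub>A\<^esub> \<phi> (v j x))) = g x"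
  using add_hom_finsum[OF A_group A_group g, of "\<lambda>j. u j \<otimes>\<^bsub>A\<^esub> \<phi> (v j x)" J] x
  by (simp add: uv semi_closed[OF semi_v])

text \<open>The elements v i(\<phi>(b) u j) are the matrix entries of left multiplication by
  \<phi>(b) on A_\<phi>. Summing over \<open>j\<close> recombines the coordinates of \<phi>(y) z, so
  the matrix is replaced by the multiplication itself.\<close>

lemma \<mu>_swap:
  assumes i: "i \<in> J" and z: "z \<in> carrier A" and b: "b \<in> carrier A" and r: "r \<in> carrier T"
  shows "(\<Oplus>\<^bsub>A\<^esub>j\<in>J. \<mu> j z (t \<one>\<^bsub>A\<^esub> (v i (\<phi> b \<otimes>\<^bsub>A\<^esub> u j)) \<otimes>\<^bsub>T\<^esub> r)) = \<mu> i z (t b \<one>\<^bsub>A\<^esub> \<otimes>\<^bsub>T\<^esub> r)"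
proof (rule add_hom_eq_on_generators[OF A_group _ _ r])
  note vc [simp] = semi_closed[OF semi_v]
  show "add_hom T A (\<lambda>r. \<Oplus>\<^bsub>A\<^esub>j\<in>J. \<mu> j z (t \<one>\<^bsub>A\<^esub> (v i (\<phi> b \<otimes>\<^bsub>A\<^esub> u j)) \<otimes>\<^bsub>T\<^esub> r))"
    by (intro add_hom_finsum_fun[OF A_group] add_hom_comp[OF T_mult_hom_right \<mu>_hom]) (use i z b in simp_all)
  show "add_hom T A (\<lambda>r. \<mu> i z (t b \<one>\<^bsub>A\<^esub> \<otimes>\<^bsub>T\<^esub> r))"
    by (intro add_hom_comp[OF T_mult_hom_right \<mu>_hom]) (use i z b in simp_all)
  fix y w assume yw: "y \<in> carrier A" "w \<in> carrier (opp A)"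
  let ?x = "\<phi> y \<otimes>\<^bsub>A\<^esub> z"
  have g: "add_hom A A (\<lambda>x. w \<otimes>\<^bsub>A\<^esub> v i (\<phi> b \<otimes>\<^bsub>A\<^esub> x))"
    using yw b i by (intro add_hom_comp[OF add_hom_comp[OF add_mult_A(1) semi_hom[OF semi_v]] add_mult_A(1)]) simp_all
  have "(\<Oplus>\<^bsub>A\<^esub>j\<in>J. \<mu> j z (t \<one>\<^bsub>A\<^esub> (v i (\<phi> b \<otimes>\<^bsub>A\<^esub> u j)) \<otimes>\<^bsub>T\<^esub> t y w)) =
      (\<Oplus>\<^bsub>A\<^esub>j\<in>J. w \<otimes>\<^bsub>A\<^esub> v i (\<phi> b \<otimes>\<^bsub>A\<^esub> (u j \<otimes>\<^bsub>A\<^esub> \<phi> (v j ?x))))"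
  proof (rule A.M.finsum_cong'[OF HOL.refl])
    show "(\<lambda>j. w \<otimes>\<^bsub>A\<^esub> v i (\<phi> b \<otimes>\<^bsub>A\<^esub> (u j \<otimes>\<^bsub>A\<^esub> \<phi> (v j ?x)))) \<in> J \<rightarrow> carrier A"
      using yw z b i by simp
    fix j assume j: "j \<in> J"
    have "v i (\<phi> b \<otimes>\<^bsub>A\<^esub> (u j \<otimes>\<^bsub>A\<^esub> \<phi> (v j ?x))) = v i (\<phi> b \<otimes>\<^bsub>A\<^esub> u j) \<otimes>\<^bsub>A\<^esub> v j ?x"
      using yw z b i j semi_right[OF semi_v[OF i], of "\<phi> b \<otimes>\<^bsub>A\<^esub> u j" "v j ?x"] by (simp add: A.A.m_assoc)
    then show "\<mu> j z (t \<one>\<^bsub>A\<^esub> (v i (\<phi> b \<otimes>\<^bsub>A\<^esub> u j)) \<otimes>\<^bsub>T\<^esub> t y w) = w \<otimes>\<^bsub>A\<^esub> v i (\<phi> b \<otimes>\<^bsub>A\<^esub> (u j \<otimes>\<^bsub>A\<^esub> \<phi> (v j ?x)))"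
      using yw z b i j by (simp add: t_mult_env \<mu>_t A.A.m_assoc)
  qed
  also have "\<dots> = w \<otimes>\<^bsub>A\<^esub> v i (\<phi> b \<otimes>\<^bsub>A\<^esub> ?x)" using yw z by (intro uv_apply[OF g]) simp
  also have "\<dots> = \<mu> i z (t b \<one>\<^bsub>A\<^esub> \<otimes>\<^bsub>T\<^esub> t y w)"
    using yw z b i by (simp add: t_mult_env \<mu>_t A.A.m_assoc)
  finally show "(\<Oplus>\<^bsub>A\<^esub>j\<in>J. \<mu> j z (t \<one>\<^bsub>A\<^esub> (v i (\<phi> b \<otimes>\<^bsub>A\<^esub> u j)) \<otimes>\<^bsub>T\<^esub> t y w)) = \<mu> i z (t b \<one>\<^bsub>A\<^esub> \<otimes>\<^bsub>T\<^esub> t y w)" .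
qed

text \<open>For a right module \<open>M\<close> over the enveloping algebra and \<open>h \<in> tlin M\<close>, the map
  \<open>\<lambda>p. \<nu> M z h p\<close> factors through \<open>M \<otimes> A\<^sub>\<phi>\<close> (lemma \<open>\<nu>_reduce\<close>): this is the pairing
  of the coinduced module \<open>Hom(A\<^sub>\<phi>, A \<otimes> A)\<close> with \<open>A\<^sub>\<phi>\<close> that recovers \<open>f\<close> from \<open>hat f\<close>.\<close>

definition \<nu> :: "(('a \<times> 'a) list set, 'm) module \<Rightarrow> 'a \<Rightarrow> ('m \<Rightarrow> ('a \<times> 'a) list set) \<Rightarrow> 'm \<Rightarrow> 'a" where
  "\<nu> M z h p = (\<Oplus>\<^bsub>A\<^esub>j\<in>J. \<mu> j z (h (t (u j) \<one>\<^bsub>A\<^esub> \<odot>\<^bsub>M\<^esub> p)))"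

lemma \<nu>_hom:
  assumes M: "left_module (opp T) M" and h: "h \<in> tlin M" and z: "z \<in> carrier A"
  shows "add_hom M A (\<nu> M z h)"
proof -
  interpret M: left_module "opp T" M by fact
  show ?thesis
    unfolding \<nu>_def
    by (intro add_hom_finsum_fun[OF A_group] add_hom_comp[OF M.add_hom_smult_right add_hom_comp[OF tlin_hom[OF h] \<mu>_hom]])
      (use z in simp_all)
qed

text \<open>On the left, 1 \<otimes> b is the twist of b \<otimes> 1, and linearity of
  \<open>h\<close> moves it out as a left factor. On the right, \<phi>(b) u j is expanded in the
  \<open>u i\<close>; after an exchange of the two sums the resulting matrix is removed by
  \<open>\<mu>_swap\<close>.\<close>

lemma \<nu>_balanced:
  assumes M: "left_module (opp T) M" and h: "h \<in> tlin M" and z: "z \<in> carrier A"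
    and b: "b \<in> carrier A" and p: "p \<in> carrier M"
  shows "\<nu> M z h (t \<one>\<^bsub>A\<^esub> b \<odot>\<^bsub>M\<^esub> p) = \<nu> M z h (t (\<phi> b) \<one>\<^bsub>A\<^esub> \<odot>\<^bsub>M\<^esub> p)"
proof -
  interpret M: left_module "opp T" M by fact
  note vc [simp] = semi_closed[OF semi_v]
  define H where "H j = h (t (u j) \<one>\<^bsub>A\<^esub> \<odot>\<^bsub>M\<^esub> p)" for j
  have upM: "t (u j) \<one>\<^bsub>A\<^esub> \<odot>\<^bsub>M\<^esub> p \<in> carrier M" if "j \<in> J" for j
    using that p by (intro M.smult_closed) simp_all
  have H: "H j \<in> carrier T" if "j \<in> J" for j
    unfolding H_def by (rule tlin_closed[OF h upM[OF that]])
  have left: "h (t (u j) \<one>\<^bsub>A\<^esub> \<odot>\<^bsub>M\<^esub> (t \<one>\<^bsub>A\<^esub> b \<odot>\<^bsub>M\<^esub> p)) = t b \<one>\<^bsub>A\<^esub> \<otimes>\<^bsub>T\<^esub> H j" if j: "j \<in> J" for j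
  proof -
    have "t (u j) \<one>\<^bsub>A\<^esub> \<odot>\<^bsub>M\<^esub> (t \<one>\<^bsub>A\<^esub> b \<odot>\<^bsub>M\<^esub> p) = twist \<phi> (t b \<one>\<^bsub>A\<^esub>) \<odot>\<^bsub>M\<^esub> (t (u j) \<one>\<^bsub>A\<^esub> \<odot>\<^bsub>M\<^esub> p)"
      using j b p by (simp add: smult_smult_opp[OF M] t_mult_env twist_t[OF \<phi>])
    then show ?thesis using tlin_smult[OF h upM[OF j], of "t b \<one>\<^bsub>A\<^esub>"] b by (simp add: H_def)
  qed
  have right: "\<mu> j z (h (t (u j) \<one>\<^bsub>A\<^esub> \<odot>\<^bsub>M\<^esub> (t (\<phi> b) \<one>\<^bsub>A\<^esub> \<odot>\<^bsub>M\<^esub> p)))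
      = (\<Oplus>\<^bsub>A\<^esub>i\<in>J. \<mu> j z (t \<one>\<^bsub>A\<^esub> (v i (\<phi> b \<otimes>\<^bsub>A\<^esub> u j)) \<otimes>\<^bsub>T\<^esub> H i))" if j: "j \<in> J" for j
  proof -
    let ?r = "t (\<phi> b \<otimes>\<^bsub>A\<^esub> u j) \<one>\<^bsub>A\<^esub>"
    have r: "?r \<in> carrier T" using j b by simp
    have "t (u j) \<one>\<^bsub>A\<^esub> \<odot>\<^bsub>M\<^esub> (t (\<phi> b) \<one>\<^bsub>A\<^esub> \<odot>\<^bsub>M\<^esub> p) = ?r \<odot>\<^bsub>M\<^esub> p"
      using j b p by (simp add: smult_smult_opp[OF M] t_mult_env)
    also have "\<dots> = (\<Oplus>\<^bsub>M\<^esub>i\<in>J. twist \<phi> (hat (v i) ?r) \<odot>\<^bsub>M\<^esub> (t (u i) \<one>\<^bsub>A\<^esub> \<odot>\<^bsub>M\<^esub> p))"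
      by (rule hat_expand_smult[OF M r p])
    finally have eq: "t (u j) \<one>\<^bsub>A\<^esub> \<odot>\<^bsub>M\<^esub> (t (\<phi> b) \<one>\<^bsub>A\<^esub> \<odot>\<^bsub>M\<^esub> p)
      = (\<Oplus>\<^bsub>M\<^esub>i\<in>J. twist \<phi> (hat (v i) ?r) \<odot>\<^bsub>M\<^esub> (t (u i) \<one>\<^bsub>A\<^esub> \<odot>\<^bsub>M\<^esub> p))" .
    have cl: "twist \<phi> (hat (v i) ?r) \<odot>\<^bsub>M\<^esub> (t (u i) \<one>\<^bsub>A\<^esub> \<odot>\<^bsub>M\<^esub> p) \<in> carrier M" if "i \<in> J" for i
      using twist_closed[OF hat_closed[OF semi_v[OF that] r]] by (intro M.smult_closed[OF _ upM[OF that]]) simp_all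
    have hi: "h (twist \<phi> (hat (v i) ?r) \<odot>\<^bsub>M\<^esub> (t (u i) \<one>\<^bsub>A\<^esub> \<odot>\<^bsub>M\<^esub> p)) = t \<one>\<^bsub>A\<^esub> (v i (\<phi> b \<otimes>\<^bsub>A\<^esub> u j)) \<otimes>\<^bsub>T\<^esub> H i"
      if "i \<in> J" for i
      using tlin_smult[OF h upM[OF that] hat_closed[OF semi_v[OF that] r]] that j b
      by (simp add: H_def hat_t[OF semi_v])
    have "\<mu> j z (h (\<Oplus>\<^bsub>M\<^esub>i\<in>J. twist \<phi> (hat (v i) ?r) \<odot>\<^bsub>M\<^esub> (t (u i) \<one>\<^bsub>A\<^esub> \<odot>\<^bsub>M\<^esub> p)))
        = (\<Oplus>\<^bsub>A\<^esub>i\<in>J. \<mu> j z (h (twist \<phi> (hat (v i) ?r) \<odot>\<^bsub>M\<^esub> (t (u i) \<one>\<^bsub>A\<^esub> \<odot>\<^bsub>M\<^esub> p))))"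
      using cl by (intro add_hom_finsum[OF M.M.abelian_group_axioms A_group add_hom_comp[OF tlin_hom[OF h] \<mu>_hom[OF j z]]]) simp
    also have "\<dots> = (\<Oplus>\<^bsub>A\<^esub>i\<in>J. \<mu> j z (t \<one>\<^bsub>A\<^esub> (v i (\<phi> b \<otimes>\<^bsub>A\<^esub> u j)) \<otimes>\<^bsub>T\<^esub> H i))"
      using j z b H by (intro A.M.finsum_cong' HOL.refl) (simp_all add: hi \<mu>_closed T_mult_closed)
    finally show ?thesis unfolding eq .
  qed
  have "\<nu> M z h (t (\<phi> b) \<one>\<^bsub>A\<^esub> \<odot>\<^bsub>M\<^esub> p)
      = (\<Oplus>\<^bsub>A\<^esub>j\<in>J. \<Oplus>\<^bsub>A\<^esub>i\<in>J. \<mu> j z (t \<one>\<^bsub>A\<^esub> (v i (\<phi> b \<otimes>\<^bsub>A\<^esub> u j)) \<otimes>\<^bsub>T\<^esub> H i))"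
    unfolding \<nu>_def using z b H
    by (intro A.M.finsum_cong' HOL.refl right) (auto intro!: A.M.finsum_closed \<mu>_closed T_mult_closed)
  also have "\<dots> = (\<Oplus>\<^bsub>A\<^esub>i\<in>J. \<Oplus>\<^bsub>A\<^esub>j\<in>J. \<mu> j z (t \<one>\<^bsub>A\<^esub> (v i (\<phi> b \<otimes>\<^bsub>A\<^esub> u j)) \<otimes>\<^bsub>T\<^esub> H i))"
    using z b H by (intro A.M.finsum_swap[OF J J]) (simp add: \<mu>_closed T_mult_closed)
  also have "\<dots> = (\<Oplus>\<^bsub>A\<^esub>i\<in>J. \<mu> i z (t b \<one>\<^bsub>A\<^esub> \<otimes>\<^bsub>T\<^esub> H i))"
    using z b H by (intro A.M.finsum_cong' HOL.refl \<mu>_swap) (simp_all add: \<mu>_closed T_mult_closed)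
  also have "\<dots> = \<nu> M z h (t \<one>\<^bsub>A\<^esub> b \<odot>\<^bsub>M\<^esub> p)"
    unfolding \<nu>_def using z b H
    by (intro A.M.finsum_cong' HOL.refl) (simp_all add: left \<mu>_closed T_mult_closed)
  finally show ?thesis by simp
qed

abbreviation "act r \<equiv> r \<odot>\<^bsub>twisted_bimodule A \<phi>\<^esub> \<one>\<^bsub>A\<^esub>"

text \<open>A pure tensor x \<otimes> y acts by x \<otimes> 1 and then by 1 \<otimes> y. The second
  action may be replaced by that of \<phi>(y) \<otimes> 1, and together they are x \<phi>(y)
  \<otimes> 1, where x \<phi>(y) is what x \<otimes> y makes of the unit of A_\<phi>.\<close>

lemma \<nu>_reduce:
  assumes M: "left_module (opp T) M" and h: "h \<in> tlin M" and z: "z \<in> carrier A"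
    and r: "r \<in> carrier T" and p: "p \<in> carrier M"
  shows "\<nu> M z h (r \<odot>\<^bsub>M\<^esub> p) = \<nu> M z h (t (act r) \<one>\<^bsub>A\<^esub> \<odot>\<^bsub>M\<^esub> p)"
proof (rule add_hom_eq_on_generators[OF A_group _ _ r])
  interpret M: left_module "opp T" M by fact
  have sm: "add_hom T M (\<lambda>r. r \<odot>\<^bsub>M\<^esub> p)" using M.add_hom_smult_left[OF p] by (simp add: add_hom_def)
  note sm\<nu> = add_hom_comp[OF sm \<nu>_hom[OF M h z]]
  show "add_hom T A (\<lambda>r. \<nu> M z h (r \<odot>\<^bsub>M\<^esub> p))" by (rule sm\<nu>)
  show "add_hom T A (\<lambda>r. \<nu> M z h (t (act r) \<one>\<^bsub>A\<^esub> \<odot>\<^bsub>M\<^esub> p))"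
    by (rule add_hom_comp[OF twisted_add_hom[OF \<phi> A.A.one_closed] add_hom_comp[OF add_hom_t_left[OF A.A.one_closed] sm\<nu>]])
  fix x y assume xy: "x \<in> carrier A" "y \<in> carrier (opp A)"
  have px: "t x \<one>\<^bsub>A\<^esub> \<odot>\<^bsub>M\<^esub> p \<in> carrier M" using xy p by (intro M.smult_closed) simp_all
  have "t x y \<odot>\<^bsub>M\<^esub> p = t \<one>\<^bsub>A\<^esub> y \<odot>\<^bsub>M\<^esub> (t x \<one>\<^bsub>A\<^esub> \<odot>\<^bsub>M\<^esub> p)"
    using xy p by (simp add: smult_smult_opp[OF M] t_mult_env)
  moreover have "t (act (t x y)) \<one>\<^bsub>A\<^esub> \<odot>\<^bsub>M\<^esub> p = t (\<phi> y) \<one>\<^bsub>A\<^esub> \<odot>\<^bsub>M\<^esub> (t x \<one>\<^bsub>A\<^esub> \<odot>\<^bsub>M\<^esub> p)"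
    using xy p by (simp add: smult_smult_opp[OF M] t_mult_env twisted_t[OF \<phi>])
  ultimately show "\<nu> M z h (t x y \<odot>\<^bsub>M\<^esub> p) = \<nu> M z h (t (act (t x y)) \<one>\<^bsub>A\<^esub> \<odot>\<^bsub>M\<^esub> p)"
    using \<nu>_balanced[OF M h z _ px] xy by simp
qed

text \<open>An element that acts on the unit as 1 may be replaced by the unit of A^e. What remains
  is the sum of f(u j) v j(z) = f(u j \<phi>(v j z)), the expansion of f(z).\<close>

lemma \<nu>_hat:
  assumes f: "semi f" and z: "z \<in> carrier A" and r: "r \<in> carrier T" and a: "act r = \<one>\<^bsub>A\<^esub>"
  shows "\<nu> (regular_module (opp T)) z (hat f) r = f z"
proof -
  have reg: "left_module (opp T) (regular_module (opp T))" by (rule left_module_regular) (simp add: T_ring)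
  note [simp] = semi_closed[OF f] semi_closed[OF semi_v]
  have "\<nu> (regular_module (opp T)) z (hat f) r = \<nu> (regular_module (opp T)) z (hat f) (r \<odot>\<^bsub>regular_module (opp T)\<^esub> \<one>\<^bsub>T\<^esub>)"
    using r by simp
  also have "\<dots> = \<nu> (regular_module (opp T)) z (hat f) (t \<one>\<^bsub>A\<^esub> \<one>\<^bsub>A\<^esub> \<odot>\<^bsub>regular_module (opp T)\<^esub> \<one>\<^bsub>T\<^esub>)"
    using \<nu>_reduce[OF reg hat_tlin[OF f] z r, of "\<one>\<^bsub>T\<^esub>"] by (simp add: a)
  also have "\<dots> = (\<Oplus>\<^bsub>A\<^esub>j\<in>J. f (u j \<otimes>\<^bsub>A\<^esub> \<phi> (v j z)))"
    unfolding \<nu>_def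
  proof (rule A.M.finsum_cong'[OF HOL.refl])
    fix j assume j: "j \<in> J"
    show "\<mu> j z (hat f (t (u j) \<one>\<^bsub>A\<^esub> \<odot>\<^bsub>regular_module (opp T)\<^esub>
        (t \<one>\<^bsub>A\<^esub> \<one>\<^bsub>A\<^esub> \<odot>\<^bsub>regular_module (opp T)\<^esub> \<one>\<^bsub>T\<^esub>))) = f (u j \<otimes>\<^bsub>A\<^esub> \<phi> (v j z))"
      using j z by (simp add: T_one_env t_mult_env hat_t[OF f] \<mu>_t semi_right[OF f])
  qed (use z in simp)
  also have "\<dots> = f z" by (rule uv_apply[OF semi_hom[OF f] z])
  finally show ?thesis .
qed

lemma \<nu>_semi:
  assumes M: "left_module (opp T) M" and h: "h \<in> tlin M" and p: "p \<in> carrier M"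
  shows "semi (\<lambda>z. \<nu> M z h p)"
proof -
  interpret M: left_module "opp T" M by fact
  have H: "h (t (u j) \<one>\<^bsub>A\<^esub> \<odot>\<^bsub>M\<^esub> p) \<in> carrier T" if "j \<in> J" for j
    using that p by (intro tlin_closed[OF h] M.smult_closed) simp_all
  note [simp] = semi_closed[OF semi_v] semi_add[OF semi_v]
  have add: "\<mu> j (z \<oplus>\<^bsub>A\<^esub> z') r = \<mu> j z r \<oplus>\<^bsub>A\<^esub> \<mu> j z' r"
    if "j \<in> J" "z \<in> carrier A" "z' \<in> carrier A" "r \<in> carrier T" for j z z' r
  proof (rule add_hom_eq_on_generators[OF A_group _ _ that(4)])
    show "add_hom T A (\<mu> j (z \<oplus>\<^bsub>A\<^esub> z'))" using that by (intro \<mu>_hom) simp_all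
    show "add_hom T A (\<lambda>r. \<mu> j z r \<oplus>\<^bsub>A\<^esub> \<mu> j z' r)"
      using that add_hom_add[OF \<mu>_hom[of j]] by (intro add_homI) (simp_all add: \<mu>_closed A.M.a_ac)
  qed (use that in \<open>simp add: \<mu>_t A.A.r_distr\<close>)
  have right: "\<mu> j (z \<otimes>\<^bsub>A\<^esub> \<phi> b) r = \<mu> j z r \<otimes>\<^bsub>A\<^esub> b"
    if "j \<in> J" "z \<in> carrier A" "b \<in> carrier A" "r \<in> carrier T" for j z b r
  proof (rule add_hom_eq_on_generators[OF A_group _ _ that(4)])
    show "add_hom T A (\<mu> j (z \<otimes>\<^bsub>A\<^esub> \<phi> b))" using that by (intro \<mu>_hom) simp_all
    show "add_hom T A (\<lambda>r. \<mu> j z r \<otimes>\<^bsub>A\<^esub> b)" using that by (intro add_hom_comp[OF \<mu>_hom add_mult_A(2)]) simp_all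
    show "\<mu> j (z \<otimes>\<^bsub>A\<^esub> \<phi> b) (t y w) = \<mu> j z (t y w) \<otimes>\<^bsub>A\<^esub> b" if "y \<in> carrier A" "w \<in> carrier (opp A)" for y w
      using that \<open>j \<in> J\<close> \<open>z \<in> carrier A\<close> \<open>b \<in> carrier A\<close> semi_right[OF semi_v, of j "\<phi> y \<otimes>\<^bsub>A\<^esub> z" b]
      by (simp add: \<mu>_t A.A.m_assoc)
  qed
  show ?thesis
    unfolding semi_def
  proof (intro conjI ballI)
    show "add_hom A A (\<lambda>z. \<nu> M z h p)"
      unfolding \<nu>_def using H by (intro add_hom_finsum_fun[OF A_group] add_homI) (simp_all add: \<mu>_closed add)
    show "\<nu> M (z \<otimes>\<^bsub>A\<^esub> \<phi> b) h p = \<nu> M z h p \<otimes>\<^bsub>A\<^esub> b" if "z \<in> carrier A" "b \<in> carrier A" for z b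
    proof -
      have "\<nu> M z h p \<otimes>\<^bsub>A\<^esub> b = (\<Oplus>\<^bsub>A\<^esub>j\<in>J. \<mu> j z (h (t (u j) \<one>\<^bsub>A\<^esub> \<odot>\<^bsub>M\<^esub> p)) \<otimes>\<^bsub>A\<^esub> b)"
        unfolding \<nu>_def using that H by (intro add_hom_finsum[OF A_group A_group add_mult_A(2)]) (simp_all add: \<mu>_closed)
      also have "\<dots> = \<nu> M (z \<otimes>\<^bsub>A\<^esub> \<phi> b) h p"
        unfolding \<nu>_def using that H by (intro A.M.finsum_cong' HOL.refl) (simp_all add: \<mu>_closed right)
      finally show ?thesis by simp
    qed
  qed
qed

lemma \<mu>_mult_right:
  assumes "j \<in> J" "z \<in> carrier A" "a \<in> carrier A" "r \<in> carrier T"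
  shows "\<mu> j z (r \<otimes>\<^bsub>T\<^esub> t \<one>\<^bsub>A\<^esub> a) = a \<otimes>\<^bsub>A\<^esub> \<mu> j z r"
    and "\<mu> j z (r \<otimes>\<^bsub>T\<^esub> t a \<one>\<^bsub>A\<^esub>) = \<mu> j (\<phi> a \<otimes>\<^bsub>A\<^esub> z) r"
proof -
  note [simp] = semi_closed[OF semi_v]
  show "\<mu> j z (r \<otimes>\<^bsub>T\<^esub> t \<one>\<^bsub>A\<^esub> a) = a \<otimes>\<^bsub>A\<^esub> \<mu> j z r"
  proof (rule add_hom_eq_on_generators[OF A_group _ _ assms(4)])
    show "add_hom T A (\<lambda>r. \<mu> j z (r \<otimes>\<^bsub>T\<^esub> t \<one>\<^bsub>A\<^esub> a))"
      using assms by (intro add_hom_comp[OF T_mult_hom_left \<mu>_hom]) simp_all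
    show "add_hom T A (\<lambda>r. a \<otimes>\<^bsub>A\<^esub> \<mu> j z r)" using assms by (intro add_hom_comp[OF \<mu>_hom add_mult_A(1)])
  qed (use assms in \<open>simp add: t_mult_env \<mu>_t A.A.m_assoc\<close>)
  show "\<mu> j z (r \<otimes>\<^bsub>T\<^esub> t a \<one>\<^bsub>A\<^esub>) = \<mu> j (\<phi> a \<otimes>\<^bsub>A\<^esub> z) r"
  proof (rule add_hom_eq_on_generators[OF A_group _ _ assms(4)])
    show "add_hom T A (\<lambda>r. \<mu> j z (r \<otimes>\<^bsub>T\<^esub> t a \<one>\<^bsub>A\<^esub>))"
      using assms by (intro add_hom_comp[OF T_mult_hom_left \<mu>_hom]) simp_all
    show "add_hom T A (\<mu> j (\<phi> a \<otimes>\<^bsub>A\<^esub> z))" using assms by (intro \<mu>_hom) simp_all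
  qed (use assms in \<open>simp add: t_mult_env \<mu>_t A.A.m_assoc\<close>)
qed

text \<open>The two right multiplications on cochains turn into left multiplication of the form by
  \<open>a\<close> and into precomposition with left multiplication by \<phi>(a). A relation between
  the two actions on classes thus becomes an identity between forms.\<close>

lemma
  assumes M: "left_module (opp T) M" and h: "h \<in> tlin M" and p: "p \<in> carrier M"
    and a: "a \<in> carrier A" and z: "z \<in> carrier A"
  shows \<nu>_mult_left: "\<nu> M z (\<lambda>m. h m \<otimes>\<^bsub>T\<^esub> t \<one>\<^bsub>A\<^esub> a) p = a \<otimes>\<^bsub>A\<^esub> \<nu> M z h p"
    and \<nu>_mult_right: "\<nu> M z (\<lambda>m. h m \<otimes>\<^bsub>T\<^esub> t a \<one>\<^bsub>A\<^esub>) p = \<nu> M (\<phi> a \<otimes>\<^bsub>A\<^esub> z) h p"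
proof -
  interpret M: left_module "opp T" M by fact
  have H: "h (t (u j) \<one>\<^bsub>A\<^esub> \<odot>\<^bsub>M\<^esub> p) \<in> carrier T" if "j \<in> J" for j
    using that p by (intro tlin_closed[OF h] M.smult_closed) simp_all
  have "a \<otimes>\<^bsub>A\<^esub> \<nu> M z h p = (\<Oplus>\<^bsub>A\<^esub>j\<in>J. a \<otimes>\<^bsub>A\<^esub> \<mu> j z (h (t (u j) \<one>\<^bsub>A\<^esub> \<odot>\<^bsub>M\<^esub> p)))"
    unfolding \<nu>_def using a z H by (intro add_hom_finsum[OF A_group A_group add_mult_A(1)]) (simp_all add: \<mu>_closed)
  also have "\<dots> = \<nu> M z (\<lambda>m. h m \<otimes>\<^bsub>T\<^esub> t \<one>\<^bsub>A\<^esub> a) p"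
    unfolding \<nu>_def using a z H
    by (intro A.M.finsum_cong' HOL.refl) (simp_all add: \<mu>_mult_right(1) \<mu>_closed)
  finally show "\<nu> M z (\<lambda>m. h m \<otimes>\<^bsub>T\<^esub> t \<one>\<^bsub>A\<^esub> a) p = a \<otimes>\<^bsub>A\<^esub> \<nu> M z h p" by simp
  show "\<nu> M z (\<lambda>m. h m \<otimes>\<^bsub>T\<^esub> t a \<one>\<^bsub>A\<^esub>) p = \<nu> M (\<phi> a \<otimes>\<^bsub>A\<^esub> z) h p"
    unfolding \<nu>_def using a z H
    by (intro A.M.finsum_cong' HOL.refl) (simp_all add: \<mu>_mult_right(2) \<mu>_closed)
qed

end

section \<open>Bijectivity of the twist\<close>

context smooth_env
begin

text \<open>\<open>M\<close>, \<open>N\<close>, \<open>L\<close> underlie \<open>X\<close> in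
  degrees 0, 1, -1, and their duals are \<open>Q\<close> in degrees d, d - 1, d + 1. So the degree
  zero cocycles of Hom(X, A^e) and the degree d cocycles of \<open>Q\<close> are functions on the
  same module \<open>M\<close>.\<close>

abbreviation "M \<equiv> obj P (- d)"
abbreviation "N \<equiv> obj P (1 - d)"
abbreviation "L \<equiv> obj P (- d - 1)"
abbreviation "dM \<equiv> diff P (- d)"
abbreviation "dL \<equiv> diff P (- d - 1)"

lemma modM: "left_module (opp T) M" and modN: "left_module (opp T) N" and modL: "left_module (opp T) L"
  by (rule complex_module[OF P])+

lemma X_tlin:
  "mod_hom T (obj X 0) (regular_module T) = tlin M" "mod_hom T (obj X 1) (regular_module T) = tlin N"
  "carrier (obj X 0) = carrier M" "diff X 0 = dM" "carrier (obj X (-1)) = carrier L" "diff X (-1) = dL"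
proof -
  have idx: "- 1 - d = - d - 1" by simp
  show "carrier (obj X (-1)) = carrier L" "diff X (-1) = dL"
    unfolding shift_restrict_simps restrict_scalars_simps idx by (rule HOL.refl)+
qed (simp_all add: shift_restrict_simps)

lemma dM: "dM \<in> mod_hom (opp T) M N"
  using complex_diff_hom[OF P, of "- d"] by simp

lemma dL: "dL \<in> mod_hom (opp T) L M"
  using complex_diff_hom'[OF P, of "- d"] by simp

lemma dM_closed: "m \<in> carrier M \<Longrightarrow> dM m \<in> carrier N"
  by (rule mod_hom_closed[OF dM])

lemma dL_closed: "m \<in> carrier L \<Longrightarrow> dL m \<in> carrier M"
  by (rule mod_hom_closed[OF dL])

lemma Q_simps:
  "obj Q d = dual_module T M" "obj Q (d - 1) = dual_module T N" "obj Q (d + 1) = dual_module T L"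
  "m \<in> carrier M \<Longrightarrow> diff Q (d - 1) q m = q (dM m)"
  "l \<in> carrier L \<Longrightarrow> diff Q d q' l = q' (dL l)"
proof -
  have "- (d + 1) = - d - 1" "- (d - 1) = 1 - d" "- (d - 1) - 1 = - d" by simp_all
  then show "obj Q (d - 1) = dual_module T N" "obj Q (d + 1) = dual_module T L"
    "m \<in> carrier M \<Longrightarrow> diff Q (d - 1) q m = q (dM m)"
    unfolding dual_complex_simps by simp_all
qed simp_all

lemma modQ: "left_module T (dual_module T M)"
  by (rule left_module_dual[OF modM])

lemma \<kappa>_facts:
  assumes "x \<in> cocycles Q d"
  shows \<kappa>_closed: "\<kappa> x \<in> carrier A"
    and \<kappa>_add: "y \<in> cocycles Q d \<Longrightarrow> \<kappa> (x \<oplus>\<^bsub>dual_module T M\<^esub> y) = \<kappa> x \<oplus>\<^bsub>A\<^esub> \<kappa> y"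
    and \<kappa>_smult: "r \<in> carrier T \<Longrightarrow> \<kappa> (r \<odot>\<^bsub>dual_module T M\<^esub> x) = r \<odot>\<^bsub>U\<^esub> \<kappa> x"
  using mod_hom_closed[OF \<kappa>, of x] mod_hom_add[OF \<kappa>, of x y] mod_hom_smult[OF \<kappa>, of x r] assms
  by (simp_all del: dual_module_simps)

lemma cocycle_dual: "x \<in> cocycles Q d \<Longrightarrow> x \<in> carrier (dual_module T M)"
  using cocycles_carrier[of x Q d] unfolding Q_simps(1) .

lemma \<kappa>_eq_imp:
  assumes x: "x \<in> cocycles Q d" and y: "y \<in> cocycles Q d" and eq: "\<kappa> x = \<kappa> y"
  obtains w where "w \<in> carrier (dual_module T N)" "\<And>m. m \<in> carrier M \<Longrightarrow> x m = y m \<oplus>\<^bsub>T\<^esub> w (dM m)"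
proof -
  interpret Qd: left_module T "dual_module T M" by (rule modQ)
  let ?n = "\<ominus>\<^bsub>dual_module T M\<^esub> y"
  let ?x = "x \<oplus>\<^bsub>dual_module T M\<^esub> ?n"
  have n: "?n \<in> cocycles Q d" using cocycles_minus[OF Q y] unfolding Q_simps(1) .
  have xn: "?x \<in> cocycles Q d" using cocycles_add[OF Q x n] unfolding Q_simps(1) .
  have "\<kappa> y \<oplus>\<^bsub>A\<^esub> \<kappa> ?n = \<kappa> \<zero>\<^bsub>dual_module T M\<^esub>"
    using \<kappa>_add[OF y n] cocycle_dual[OF y] Qd.M.r_neg by simp
  moreover have "\<kappa> \<zero>\<^bsub>dual_module T M\<^esub> = \<zero>\<^bsub>A\<^esub>"
    using \<kappa>_ker[of "\<zero>\<^bsub>dual_module T M\<^esub>"] cocycles_zero[OF Q, of d] coboundaries_zero[OF Q, of d]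
    unfolding Q_simps(1) by simp
  ultimately have "\<kappa> ?x = \<zero>\<^bsub>A\<^esub>" using \<kappa>_add[OF x n] by (simp add: eq)
  then have "?x \<in> coboundaries Q d" using \<kappa>_ker[OF xn] by simp
  then obtain w where w: "w \<in> carrier (dual_module T N)" "?x = diff Q (d - 1) w"
    unfolding coboundaries_def Q_simps(2) by blast
  have xe: "x = y \<oplus>\<^bsub>dual_module T M\<^esub> ?x"
    by (rule Qd.M.eq_add_minus[OF cocycle_dual[OF x] cocycle_dual[OF y]])
  have "x m = y m \<oplus>\<^bsub>T\<^esub> w (dM m)" if m: "m \<in> carrier M" for m
  proof -
    have "x m = (y \<oplus>\<^bsub>dual_module T M\<^esub> ?x) m" using xe by simp
    also have "\<dots> = y m \<oplus>\<^bsub>T\<^esub> ?x m" using m by simp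
    also have "?x m = w (dM m)" unfolding w(2) by (rule Q_simps(4)[OF m])
    finally show ?thesis .
  qed
  then show ?thesis using that w(1) by blast
qed

text \<open>The coboundaries of Hom(X, A^e) in degree zero, as functions on \<open>M\<close> whose
  values elsewhere are disregarded.\<close>

definition cob :: "('p \<Rightarrow> ('a \<times> 'a) list set) \<Rightarrow> bool" where
  "cob f \<longleftrightarrow> (\<exists>k\<in>tlin N. \<forall>m\<in>carrier M. f m = k (dM m))"

text \<open>The functional \<open>q\<close> turns a twisted scalar into a right factor, which acts
  last on \<open>p\<close>, and \<open>h\<close> releases it as a left factor. Composed with
  \<open>dM\<close> this converts coboundaries of \<open>Q\<close> into coboundaries of Hom(X,
  A^e).\<close>

lemma tlin_dual:
  assumes h: "h \<in> tlin M'" and q: "q \<in> carrier (dual_module T N')" and M': "left_module (opp T) M'"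
    and N': "left_module (opp T) N'" and p: "p \<in> carrier M'"
  shows "(\<lambda>n. h (q n \<odot>\<^bsub>M'\<^esub> p)) \<in> tlin N'"
proof (rule tlinI)
  interpret M': left_module "opp T" M' by fact
  interpret N': left_module "opp T" N' by fact
  have sm: "add_hom T M' (\<lambda>r. r \<odot>\<^bsub>M'\<^esub> p)" using M'.add_hom_smult_left[OF p] by (simp add: add_hom_def)
  show "add_hom N' T (\<lambda>n. h (q n \<odot>\<^bsub>M'\<^esub> p))"
    by (rule add_hom_comp[OF dual_module_add_hom[OF q] add_hom_comp[OF sm tlin_hom[OF h]]])
  fix r n assume r: "r \<in> carrier T" and n: "n \<in> carrier N'"
  have qn: "q n \<in> carrier T" by (rule dual_module_value[OF q n])
  have "q (twist \<phi> r \<odot>\<^bsub>N'\<^esub> n) \<odot>\<^bsub>M'\<^esub> p = twist \<phi> r \<odot>\<^bsub>M'\<^esub> (q n \<odot>\<^bsub>M'\<^esub> p)"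
    using dual_module_smult[OF q n twist_closed[OF r]] smult_smult_opp[OF M' twist_closed[OF r] qn p] by simp
  then show "h (q (twist \<phi> r \<odot>\<^bsub>N'\<^esub> n) \<odot>\<^bsub>M'\<^esub> p) = r \<otimes>\<^bsub>T\<^esub> h (q n \<odot>\<^bsub>M'\<^esub> p)"
    using tlin_smult[OF h, of "q n \<odot>\<^bsub>M'\<^esub> p" r] r qn p M'.smult_closed by simp
qed

section \<open>Coboundaries of Hom(X, A^e) in degree zero\<close>

lemma tlin_plus: "k \<in> tlin N' \<Longrightarrow> k' \<in> tlin N' \<Longrightarrow> (\<lambda>n. k n \<oplus>\<^bsub>T\<^esub> k' n) \<in> tlin N'"
  using mod_hom_plus[OF left_module_regular[OF T_ring], of k _ k'] by simp

lemma tlin_mult_right: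
  assumes k: "k \<in> tlin N'" and s: "s \<in> carrier T"
  shows "(\<lambda>n. k n \<otimes>\<^bsub>T\<^esub> s) \<in> tlin N'"
proof (rule tlinI)
  show "add_hom N' T (\<lambda>n. k n \<otimes>\<^bsub>T\<^esub> s)" by (rule add_hom_comp[OF tlin_hom[OF k] T_mult_hom_left[OF s]])
  show "k (twist \<phi> r \<odot>\<^bsub>N'\<^esub> x) \<otimes>\<^bsub>T\<^esub> s = r \<otimes>\<^bsub>T\<^esub> (k x \<otimes>\<^bsub>T\<^esub> s)" if "r \<in> carrier T" "x \<in> carrier N'" for r x
    using that tlin_smult[OF k that(2,1)] tlin_closed[OF k] s by (simp add: E.m_assoc)
qed

lemma cob_cong: "cob f \<Longrightarrow> (\<And>m. m \<in> carrier M \<Longrightarrow> g m = f m) \<Longrightarrow> cob g"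
  unfolding cob_def by fastforce

lemma cob_plus: "cob f \<Longrightarrow> cob g \<Longrightarrow> cob (\<lambda>m. f m \<oplus>\<^bsub>T\<^esub> g m)"
  unfolding cob_def by (fastforce intro: tlin_plus)

lemma cob_mult_right: "cob f \<Longrightarrow> s \<in> carrier T \<Longrightarrow> cob (\<lambda>m. f m \<otimes>\<^bsub>T\<^esub> s)"
  unfolding cob_def by (fastforce intro: tlin_mult_right)

lemma cob_closed: "cob f \<Longrightarrow> m \<in> carrier M \<Longrightarrow> f m \<in> carrier T"
  unfolding cob_def using tlin_closed dM_closed by fastforce

lemma cob_zero: "cob (\<lambda>m. \<zero>\<^bsub>T\<^esub>)"
  unfolding cob_def using mod_hom_const_zero[OF left_module_regular[OF T_ring], of "restrict_scalars (twist \<phi>) N"]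
  by (intro bexI[of _ "\<lambda>m. \<zero>\<^bsub>T\<^esub>"]) simp_all

lemma cob_finsum:
  assumes "finite S" "\<And>s. s \<in> S \<Longrightarrow> cob (f s)"
  shows "cob (\<lambda>m. \<Oplus>\<^bsub>T\<^esub>s\<in>S. f s m)"
  using assms
proof (induction S)
  case empty
  then show ?case by (simp add: cob_zero)
next
  case (insert s S)
  have "cob (\<lambda>m. f s m \<oplus>\<^bsub>T\<^esub> (\<Oplus>\<^bsub>T\<^esub>s\<in>S. f s m))" using insert by (intro cob_plus) simp_all
  then show ?case
    by (rule cob_cong) (use insert cob_closed in \<open>simp add: Pi_iff\<close>)
qed

lemma cob_uminus: "cob f \<Longrightarrow> cob (\<lambda>m. \<ominus>\<^bsub>T\<^esub> f m)"
proof (rule cob_cong[of "\<lambda>m. f m \<otimes>\<^bsub>T\<^esub> (\<ominus>\<^bsub>T\<^esub> \<one>\<^bsub>T\<^esub>)"])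
  assume f: "cob f"
  show "cob (\<lambda>m. f m \<otimes>\<^bsub>T\<^esub> (\<ominus>\<^bsub>T\<^esub> \<one>\<^bsub>T\<^esub>))" using f by (intro cob_mult_right) simp_all
  show "\<ominus>\<^bsub>T\<^esub> f m = f m \<otimes>\<^bsub>T\<^esub> (\<ominus>\<^bsub>T\<^esub> \<one>\<^bsub>T\<^esub>)" if "m \<in> carrier M" for m
    using cob_closed[OF f that] by (simp add: E.r_minus)
qed

lemma cob_dual: "h \<in> tlin M \<Longrightarrow> q \<in> carrier (dual_module T N) \<Longrightarrow> p \<in> carrier M \<Longrightarrow> cob (\<lambda>m. h (q (dM m) \<odot>\<^bsub>M\<^esub> p))"
  unfolding cob_def by (intro bexI[OF _ tlin_dual[OF _ _ modM modN]]) simp_all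

lemma cob_hat:
  assumes f: "semi f" and q: "q \<in> carrier (dual_module T N)" shows "cob (\<lambda>m. hat f (q (dM m)))"
proof -
  have reg: "left_module (opp T) (regular_module (opp T))" by (rule left_module_regular) (simp add: T_ring)
  have "cob (\<lambda>m. hat f (q (dM m) \<odot>\<^bsub>regular_module (opp T)\<^esub> \<one>\<^bsub>T\<^esub>))"
    unfolding cob_def by (intro bexI[OF _ tlin_dual[OF hat_tlin[OF f] q reg modN, of "\<one>\<^bsub>T\<^esub>"]]) simp_all
  then show ?thesis
    by (rule cob_cong) (use dual_module_value[OF q dM_closed] in simp)
qed

text \<open>The cocycle class map of \<open>Hom(P, A\<^sup>e)\<close> in degree \<open>d\<close> extends to the whole module of cochains,
  since the complex is homotopy equivalent to its truncation.\<close>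

lemma split:
  obtains s k where "chain_map T Q (truncation d Q) s" "homotopy T Q Q s (\<lambda>i x. x) k"
  using lift_through_qis[OF pQ qT chain_map_ident] by blast

end

text \<open>The class of \<open>h\<^sub>0\<close> corresponds to \<open>1\<close> under \<open>H\<^sup>0 Hom(X, A\<^sup>e) \<cong> A\<close>; the assumptions \<open>gen\<close>, \<open>cen\<close> and \<open>inj\<close>
  are what is left of this isomorphism of bimodules. The lemma \<open>generator\<close> provides \<open>h\<^sub>0\<close>.\<close>

locale resolved_env = smooth_env K A \<phi> J u v P I e c \<epsilon> d \<kappa>
  for K :: "('k, 'y) ring_scheme" and A :: "('k, 'a) module" and \<phi> :: "'a \<Rightarrow> 'a"
    and J :: "'j set" and u :: "'j \<Rightarrow> 'a" and v :: "'j \<Rightarrow> 'a \<Rightarrow> 'a"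
    and P :: "(('a \<times> 'a) list set, 'p) cochain" and I :: "int \<Rightarrow> 'i set" and e :: "int \<Rightarrow> 'i \<Rightarrow> 'p"
    and c :: "int \<Rightarrow> 'i \<Rightarrow> 'p \<Rightarrow> ('a \<times> 'a) list set" and \<epsilon> :: "int \<Rightarrow> 'p \<Rightarrow> 'a"
    and d :: int and \<kappa> :: "('p \<Rightarrow> ('a \<times> 'a) list set) \<Rightarrow> 'a" +
  fixes \<sigma> :: "int \<Rightarrow> ('p \<Rightarrow> ('a \<times> 'a) list set) \<Rightarrow> 'p \<Rightarrow> ('a \<times> 'a) list set"
    and \<eta> :: "int \<Rightarrow> ('p \<Rightarrow> ('a \<times> 'a) list set) \<Rightarrow> 'p \<Rightarrow> ('a \<times> 'a) list set"
    and q\<^sub>0 :: "'p \<Rightarrow> ('a \<times> 'a) list set" and h\<^sub>0 :: "'p \<Rightarrow> ('a \<times> 'a) list set"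
  assumes \<sigma>: "chain_map T Q (truncation d Q) \<sigma>"
    and \<eta>: "homotopy T Q Q \<sigma> (\<lambda>i x. x) \<eta>"
    and q0: "q\<^sub>0 \<in> cocycles Q d" "\<kappa> q\<^sub>0 = \<one>\<^bsub>A\<^esub>"
    and h0: "h\<^sub>0 \<in> tlin M"
    and h0L: "\<And>l. l \<in> carrier L \<Longrightarrow> h\<^sub>0 (dL l) = \<zero>\<^bsub>T\<^esub>"
    and gen: "\<And>h. h \<in> tlin M \<Longrightarrow> (\<And>l. l \<in> carrier L \<Longrightarrow> h (dL l) = \<zero>\<^bsub>T\<^esub>) \<Longrightarrow>
      \<exists>a\<in>carrier A. \<exists>k\<in>tlin N. \<forall>m\<in>carrier M. h m = h\<^sub>0 m \<otimes>\<^bsub>T\<^esub> t \<one>\<^bsub>A\<^esub> a \<oplus>\<^bsub>T\<^esub> k (dM m)"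
    and cen: "\<And>a. a \<in> carrier A \<Longrightarrow> \<exists>k\<in>tlin N. \<forall>m\<in>carrier M.
      h\<^sub>0 m \<otimes>\<^bsub>T\<^esub> t a \<one>\<^bsub>A\<^esub> = h\<^sub>0 m \<otimes>\<^bsub>T\<^esub> t \<one>\<^bsub>A\<^esub> a \<oplus>\<^bsub>T\<^esub> k (dM m)"
    and inj: "\<And>a k. \<lbrakk>a \<in> carrier A; k \<in> tlin N; \<And>m. m \<in> carrier M \<Longrightarrow>
      h\<^sub>0 m \<otimes>\<^bsub>T\<^esub> t a \<one>\<^bsub>A\<^esub> = k (dM m)\<rbrakk> \<Longrightarrow> a = \<zero>\<^bsub>A\<^esub>"
begin

interpretation M: left_module "opp T" M by (rule modM)
interpretation N: left_module "opp T" N by (rule modN)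
interpretation L: left_module "opp T" L by (rule modL)
interpretation Qd: left_module T "dual_module T M" by (rule modQ)

abbreviation "ql l \<equiv> restrict (c (- d) l) (carrier M)"

lemmas \<sigma>_hom = chain_map_hom[OF \<sigma>]

section \<open>The class map extended to all cochains\<close>

lemma sigma_cocycle:
  assumes "q \<in> carrier (dual_module T M)"
  shows "\<sigma> d q \<in> cocycles Q d"
  using chain_map_closed[OF \<sigma>, of q d] assms unfolding Q_simps(1) truncation_simps by simp

lemma sigma_add:
  assumes "q \<in> carrier (dual_module T M)" "q' \<in> carrier (dual_module T M)"
  shows "\<sigma> d (q \<oplus>\<^bsub>dual_module T M\<^esub> q') = \<sigma> d q \<oplus>\<^bsub>dual_module T M\<^esub> \<sigma> d q'"
  using mod_hom_add[OF \<sigma>_hom, of q d q'] assms unfolding Q_simps(1) truncation_simps by simp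

lemma sigma_smult:
  assumes "r \<in> carrier T" "q \<in> carrier (dual_module T M)"
  shows "\<sigma> d (r \<odot>\<^bsub>dual_module T M\<^esub> q) = r \<odot>\<^bsub>dual_module T M\<^esub> \<sigma> d q"
  using mod_hom_smult[OF \<sigma>_hom, of q d r] assms unfolding Q_simps(1) truncation_simps by simp

definition \<rho> where
  "\<rho> q = \<kappa> (\<sigma> d q)"

lemma \<rho>_hom: "add_hom (dual_module T M) A \<rho>"
  unfolding \<rho>_def by (intro add_homI) (simp_all only: \<kappa>_closed sigma_cocycle sigma_add \<kappa>_add)

lemma \<rho>_closed:
  assumes "q \<in> carrier (dual_module T M)"
  shows "\<rho> q \<in> carrier A"
  by (rule add_hom_closed[OF \<rho>_hom assms])

lemma \<rho>_smult:
  assumes "r \<in> carrier T" "q \<in> carrier (dual_module T M)"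
  shows "\<rho> (r \<odot>\<^bsub>dual_module T M\<^esub> q) = r \<odot>\<^bsub>U\<^esub> \<rho> q"
  unfolding \<rho>_def using assms by (simp only: sigma_smult \<kappa>_smult sigma_cocycle)

text \<open>As a chain map \<sigma> sends a coboundary to a coboundary, and there \<kappa>
  vanishes.\<close>

lemma \<rho>_boundary:
  assumes q: "q \<in> carrier (dual_module T N)"
  shows "\<rho> (diff Q (d - 1) q) = \<zero>\<^bsub>A\<^esub>"
proof -
  have qc: "q \<in> carrier (obj Q (d - 1))" using q unfolding Q_simps .
  have sc: "\<sigma> (d - 1) q \<in> carrier (obj Q (d - 1))"
    using chain_map_closed[OF \<sigma> qc] by (rule truncation_carrier_subset[OF Q])
  have "\<sigma> d (diff Q (d - 1) q) = diff Q (d - 1) (\<sigma> (d - 1) q)"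
    using chain_map_comm'[OF \<sigma> qc] unfolding truncation_simps .
  then have "\<sigma> d (diff Q (d - 1) q) \<in> coboundaries Q d"
    using coboundariesI[OF sc] by (simp only:)
  then show ?thesis
    unfolding \<rho>_def using \<kappa>_ker coboundaries_subset_cocycles[OF Q] by blast
qed

lemma sigma_eq:
  assumes "q \<in> carrier (dual_module T M)"
  shows "\<sigma> d q = q \<oplus>\<^bsub>dual_module T M\<^esub> (diff Q (d - 1) (\<eta> d q) \<oplus>\<^bsub>dual_module T M\<^esub> \<eta> (d + 1) (diff Q d q))"
  using homotopy_eq[OF \<eta>, of q d] assms unfolding Q_simps(1) .

lemma eta_closed:
  assumes "q \<in> carrier (dual_module T M)"
  shows "\<eta> d q \<in> carrier (dual_module T N)"
  using homotopy_closed[OF \<eta>, of q d] assms unfolding Q_simps by simp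

lemma eta_hom: "\<eta> (d + 1) \<in> mod_hom T (dual_module T L) (dual_module T M)"
  using homotopy_hom_next[OF \<eta>, of d] unfolding Q_simps .

lemma dQd:
  assumes "q \<in> carrier (dual_module T N)"
  shows "diff Q (d - 1) q \<in> carrier (dual_module T M)"
  using complex_diff'[OF Q, of q d] assms unfolding Q_simps by simp

lemma dQd1:
  assumes "q \<in> carrier (dual_module T M)"
  shows "diff Q d q \<in> carrier (dual_module T L)"
  using complex_diff[OF Q, of q d] assms unfolding Q_simps by simp

text \<open>On a cocycle only one term of the homotopy survives, the differential of \<eta>, so
  \<sigma> changes the cocycle by a coboundary.\<close>

lemma \<rho>_cocycle:
  assumes z: "z \<in> cocycles Q d"
  shows "\<rho> z = \<kappa> z"
proof -
  have zc: "z \<in> carrier (dual_module T M)" by (rule cocycle_dual[OF z])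
  have k0: "\<eta> (d + 1) (diff Q d z) = \<zero>\<^bsub>dual_module T M\<^esub>"
    using mod_hom_zero[OF left_module_group[OF left_module_dual[OF modL]] Qd.M.abelian_group_axioms eta_hom]
      cocycles_diff[OF z] unfolding Q_simps by simp
  have eq: "\<sigma> d z = z \<oplus>\<^bsub>dual_module T M\<^esub> diff Q (d - 1) (\<eta> d z)"
    using sigma_eq[OF zc] unfolding k0 Qd.M.r_zero[OF dQd[OF eta_closed[OF zc]]] .
  have b: "diff Q (d - 1) (\<eta> d z) \<in> coboundaries Q d"
    using coboundariesI[of "\<eta> d z" Q d] eta_closed[OF zc] unfolding Q_simps .
  then have bZ: "diff Q (d - 1) (\<eta> d z) \<in> cocycles Q d" using coboundaries_subset_cocycles[OF Q] by blast
  show ?thesis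
    unfolding \<rho>_def eq using \<kappa>_add[OF z bZ] \<kappa>_ker[OF bZ] b \<kappa>_closed[OF z] by simp
qed

section \<open>The element at which cocycles are evaluated\<close>

definition \<xi> where
  "\<xi> l = \<rho> (ql l)"

lemma e_closed:
  assumes "l \<in> I (- d)"
  shows "e (- d) l \<in> carrier M"
  using db[of "- d"] assms by (auto simp: dual_basis_def)

lemma ql_expand:
  assumes "m \<in> carrier M"
  shows "m = (\<Oplus>\<^bsub>M\<^esub>l\<in>I (- d). ql l m \<odot>\<^bsub>M\<^esub> e (- d) l)"
  using db[of "- d"] assms unfolding finite_dual_basis_iff[OF modM fin] by simp

lemmas dbQ = dual_basis_dual_module[OF modM fin db, unfolded finite_dual_basis_iff[OF modQ fin]]

lemma ql_dual:
  assumes "l \<in> I (- d)"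
  shows "ql l \<in> carrier (dual_module T M)"
  using dbQ assms by blast

lemma ql_value:
  assumes "l \<in> I (- d)" "m \<in> carrier M"
  shows "ql l m \<in> carrier T"
  by (rule dual_module_value[OF ql_dual[OF assms(1)] assms(2)])

lemma xi_closed:
  assumes "l \<in> I (- d)"
  shows "\<xi> l \<in> carrier A"
  unfolding \<xi>_def by (rule \<rho>_closed[OF ql_dual[OF assms]])

text \<open>Linear maps from the dual of \<open>M\<close> to A_\<phi> correspond to elements of M
  \<otimes> A_\<phi>. The map \<rho> corresponds to the sum of the e l \<otimes> \<xi> l, and since
  \<xi> l is \<xi> l \<otimes> 1 applied to the unit, it can be moved across to give this element
  tensored with the unit.\<close>

definition p\<^sub>1 where
  "p\<^sub>1 = (\<Oplus>\<^bsub>M\<^esub>l\<in>I (- d). t (\<xi> l) \<one>\<^bsub>A\<^esub> \<odot>\<^bsub>M\<^esub> e (- d) l)"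

lemma xi_smult_closed:
  assumes "l \<in> I (- d)"
  shows "t (\<xi> l) \<one>\<^bsub>A\<^esub> \<odot>\<^bsub>M\<^esub> e (- d) l \<in> carrier M"
  using assms xi_closed e_closed by (intro M.smult_closed) simp_all

lemma p\<^sub>1: "p\<^sub>1 \<in> carrier M"
  unfolding p\<^sub>1_def using xi_smult_closed by (intro M.M.finsum_closed) simp

text \<open>Every \<open>q\<close> is the combination of the \<open>ql l\<close> with coefficients
  q(e l), and \<rho> is linear; the right factor \<xi> l \<otimes> 1 sends the unit to \<xi> l,
  which is the value of \<rho> at \<open>ql l\<close>.\<close>

lemma act_p1:
  assumes q: "q \<in> carrier (dual_module T M)"
  shows "act (q p\<^sub>1) = \<rho> q"
proof -
  have "q p\<^sub>1 = (\<Oplus>\<^bsub>T\<^esub>l\<in>I (- d). q (t (\<xi> l) \<one>\<^bsub>A\<^esub> \<odot>\<^bsub>M\<^esub> e (- d) l))"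
    unfolding p\<^sub>1_def using xi_smult_closed
    by (intro add_hom_finsum[OF M.M.abelian_group_axioms T_group dual_module_add_hom[OF q]]) simp
  also have "\<dots> = (\<Oplus>\<^bsub>T\<^esub>l\<in>I (- d). q (e (- d) l) \<otimes>\<^bsub>T\<^esub> t (\<xi> l) \<one>\<^bsub>A\<^esub>)"
    using dual_module_smult[OF q e_closed] dual_module_value[OF q e_closed] xi_closed
    by (intro T.finsum_cong' HOL.refl) (simp_all add: T_mult_closed)
  finally have "act (q p\<^sub>1) = (\<Oplus>\<^bsub>A\<^esub>l\<in>I (- d). act (q (e (- d) l) \<otimes>\<^bsub>T\<^esub> t (\<xi> l) \<one>\<^bsub>A\<^esub>))"
    using dual_module_value[OF q e_closed] xi_closed
      add_hom_finsum[OF T_group A_group twisted_add_hom[OF \<phi> A.A.one_closed], of "\<lambda>l. q (e (- d) l) \<otimes>\<^bsub>T\<^esub> t (\<xi> l) \<one>\<^bsub>A\<^esub>" "I (- d)"]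
    by (simp add: T_mult_closed)
  also have "\<dots> = (\<Oplus>\<^bsub>A\<^esub>l\<in>I (- d). \<rho> (q (e (- d) l) \<odot>\<^bsub>dual_module T M\<^esub> ql l))"
  proof (rule A.M.finsum_cong'[OF HOL.refl])
    fix l assume l: "l \<in> I (- d)"
    interpret U: left_module T U by (rule U)
    have "act (q (e (- d) l) \<otimes>\<^bsub>T\<^esub> t (\<xi> l) \<one>\<^bsub>A\<^esub>) = q (e (- d) l) \<odot>\<^bsub>U\<^esub> (t (\<xi> l) \<one>\<^bsub>A\<^esub> \<odot>\<^bsub>U\<^esub> \<one>\<^bsub>A\<^esub>)"
      using dual_module_value[OF q e_closed[OF l]] xi_closed[OF l] by (intro U.smult_assoc) simp_all
    also have "t (\<xi> l) \<one>\<^bsub>A\<^esub> \<odot>\<^bsub>U\<^esub> \<one>\<^bsub>A\<^esub> = \<xi> l" using xi_closed[OF l] by (simp add: twisted_t[OF \<phi>])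
    also have "q (e (- d) l) \<odot>\<^bsub>U\<^esub> \<xi> l = \<rho> (q (e (- d) l) \<odot>\<^bsub>dual_module T M\<^esub> ql l)"
      unfolding \<xi>_def by (rule \<rho>_smult[OF dual_module_value[OF q e_closed[OF l]] ql_dual[OF l], symmetric])
    finally show "act (q (e (- d) l) \<otimes>\<^bsub>T\<^esub> t (\<xi> l) \<one>\<^bsub>A\<^esub>) = \<rho> (q (e (- d) l) \<odot>\<^bsub>dual_module T M\<^esub> ql l)" .
  next
    show "(\<lambda>l. \<rho> (q (e (- d) l) \<odot>\<^bsub>dual_module T M\<^esub> ql l)) \<in> I (- d) \<rightarrow> carrier A"
      using \<rho>_closed Qd.smult_closed[OF dual_module_value[OF q e_closed] ql_dual] by blast
  qed
  also have "\<dots> = \<rho> (\<Oplus>\<^bsub>dual_module T M\<^esub>l\<in>I (- d). q (e (- d) l) \<odot>\<^bsub>dual_module T M\<^esub> ql l)"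
    using Qd.smult_closed[OF dual_module_value[OF q e_closed] ql_dual]
    by (intro add_hom_finsum[OF Qd.M.abelian_group_axioms A_group \<rho>_hom, symmetric]) blast
  also have "\<dots> = \<rho> q" using dbQ q by simp
  finally show ?thesis .
qed

text \<open>As \<rho> kills coboundaries, each coordinate of \<open>dM p\<^sub>1\<close> acts as
  zero on the unit of A_\<phi>: tensored with the unit, \<open>p\<^sub>1\<close> is a cycle in P
  \<otimes> A_\<phi>. By \<open>\<nu>_reduce\<close> the coordinates enter \<nu> only through this
  action.\<close>

lemma \<nu>_boundary:
  assumes z: "z \<in> carrier A" and h: "h \<in> tlin N"
  shows "\<nu> N z h (dM p\<^sub>1) = \<zero>\<^bsub>A\<^esub>"
proof -
  let ?J = "I (1 - d)" and ?e' = "e (1 - d)" and ?c' = "c (1 - d)"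
  have e': "?e' i \<in> carrier N" and c': "?c' i \<in> mod_hom (opp T) N (regular_module (opp T))" if "i \<in> ?J" for i
    using db[of "1 - d"] that by (auto simp: dual_basis_def)
  have dN: "dM p\<^sub>1 \<in> carrier N" by (rule dM_closed[OF p\<^sub>1])
  have cT: "?c' i (dM p\<^sub>1) \<in> carrier T" if "i \<in> ?J" for i using mod_hom_closed[OF c'[OF that] dN] by simp
  note h\<nu> = \<nu>_hom[OF modN h z]
  have cl: "?c' i (dM p\<^sub>1) \<odot>\<^bsub>N\<^esub> ?e' i \<in> carrier N" if "i \<in> ?J" for i
    using that e' cT by (intro N.smult_closed) simp_all
  have zero: "\<nu> N z h (?c' i (dM p\<^sub>1) \<odot>\<^bsub>N\<^esub> ?e' i) = \<zero>\<^bsub>A\<^esub>" if i: "i \<in> ?J" for i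
  proof -
    let ?q' = "restrict (?c' i) (carrier N)"
    have q': "?q' \<in> carrier (dual_module T N)" using mod_hom_restrict[OF modN c'[OF i]] by simp
    have "?c' i (dM p\<^sub>1) = diff Q (d - 1) ?q' p\<^sub>1" unfolding Q_simps(4)[OF p\<^sub>1] using dN by simp
    then have "act (?c' i (dM p\<^sub>1)) = \<zero>\<^bsub>A\<^esub>" using act_p1[OF dQd[OF q']] \<rho>_boundary[OF q'] by simp
    then have "\<nu> N z h (?c' i (dM p\<^sub>1) \<odot>\<^bsub>N\<^esub> ?e' i) = \<nu> N z h (\<zero>\<^bsub>T\<^esub> \<odot>\<^bsub>N\<^esub> ?e' i)"
      using \<nu>_reduce[OF modN h z cT[OF i] e'[OF i]] by (simp add: t_zero_left)
    also have "\<dots> = \<zero>\<^bsub>A\<^esub>"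
      using N.smult_l_null[OF e'[OF i]] add_hom_zero[OF N.M.abelian_group_axioms A_group h\<nu>] by simp
    finally show ?thesis .
  qed
  have "\<nu> N z h (dM p\<^sub>1) = \<nu> N z h (\<Oplus>\<^bsub>N\<^esub>i\<in>?J. ?c' i (dM p\<^sub>1) \<odot>\<^bsub>N\<^esub> ?e' i)"
    using db[of "1 - d"] dN unfolding finite_dual_basis_iff[OF modN fin] by simp
  also have "\<dots> = (\<Oplus>\<^bsub>A\<^esub>i\<in>?J. \<nu> N z h (?c' i (dM p\<^sub>1) \<odot>\<^bsub>N\<^esub> ?e' i))"
    using cl by (intro add_hom_finsum[OF N.M.abelian_group_axioms A_group h\<nu>]) simp
  also have "\<dots> = (\<Oplus>\<^bsub>A\<^esub>i\<in>?J. \<zero>\<^bsub>A\<^esub>)" by (intro A.M.finsum_cong' HOL.refl zero) simp_all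
  finally show ?thesis by simp
qed

text \<open>The coboundary contributes the value of \<nu> at \<open>dM p\<^sub>1\<close>, because
  \<open>dM\<close> commutes with the action of the \<open>u j\<close>. So evaluation at
  \<open>p\<^sub>1\<close> sees classes only.\<close>

lemma \<nu>_cob:
  assumes z: "z \<in> carrier A" and f: "f \<in> tlin M" and g: "g \<in> tlin M"
    and k: "k \<in> tlin N" and eq: "\<And>m. m \<in> carrier M \<Longrightarrow> f m = g m \<oplus>\<^bsub>T\<^esub> k (dM m)"
  shows "\<nu> M z f p\<^sub>1 = \<nu> M z g p\<^sub>1"
proof -
  have um: "t (u j) \<one>\<^bsub>A\<^esub> \<odot>\<^bsub>M\<^esub> p\<^sub>1 \<in> carrier M" if "j \<in> J" for j
    using that p\<^sub>1 by (intro M.smult_closed) simp_all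
  have un: "t (u j) \<one>\<^bsub>A\<^esub> \<odot>\<^bsub>N\<^esub> dM p\<^sub>1 \<in> carrier N" if "j \<in> J" for j
    using that dM_closed[OF p\<^sub>1] by (intro N.smult_closed) simp_all
  have d: "dM (t (u j) \<one>\<^bsub>A\<^esub> \<odot>\<^bsub>M\<^esub> p\<^sub>1) = t (u j) \<one>\<^bsub>A\<^esub> \<odot>\<^bsub>N\<^esub> dM p\<^sub>1" if "j \<in> J" for j
    using mod_hom_smult[OF dM p\<^sub>1, of "t (u j) \<one>\<^bsub>A\<^esub>"] that by simp
  have "\<nu> M z f p\<^sub>1 = (\<Oplus>\<^bsub>A\<^esub>j\<in>J. \<mu> j z (g (t (u j) \<one>\<^bsub>A\<^esub> \<odot>\<^bsub>M\<^esub> p\<^sub>1)) \<oplus>\<^bsub>A\<^esub> \<mu> j z (k (t (u j) \<one>\<^bsub>A\<^esub> \<odot>\<^bsub>N\<^esub> dM p\<^sub>1)))"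
    unfolding \<nu>_def
  proof (rule A.M.finsum_cong'[OF HOL.refl])
    fix j assume j: "j \<in> J"
    show "\<mu> j z (f (t (u j) \<one>\<^bsub>A\<^esub> \<odot>\<^bsub>M\<^esub> p\<^sub>1))
        = \<mu> j z (g (t (u j) \<one>\<^bsub>A\<^esub> \<odot>\<^bsub>M\<^esub> p\<^sub>1)) \<oplus>\<^bsub>A\<^esub> \<mu> j z (k (t (u j) \<one>\<^bsub>A\<^esub> \<odot>\<^bsub>N\<^esub> dM p\<^sub>1))"
      unfolding eq[OF um[OF j]] d[OF j]
      by (rule add_hom_add[OF \<mu>_hom[OF j z] tlin_closed[OF g um[OF j]] tlin_closed[OF k un[OF j]]])
  next
    show "(\<lambda>j. \<mu> j z (g (t (u j) \<one>\<^bsub>A\<^esub> \<odot>\<^bsub>M\<^esub> p\<^sub>1)) \<oplus>\<^bsub>A\<^esub> \<mu> j z (k (t (u j) \<one>\<^bsub>A\<^esub> \<odot>\<^bsub>N\<^esub> dM p\<^sub>1))) \<in> J \<rightarrow> carrier A"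
      using z tlin_closed[OF g um] tlin_closed[OF k un] by (simp add: \<mu>_closed)
  qed
  also have "\<dots> = \<nu> M z g p\<^sub>1 \<oplus>\<^bsub>A\<^esub> \<nu> N z k (dM p\<^sub>1)"
    unfolding \<nu>_def using z tlin_closed[OF g um] tlin_closed[OF k un]
    by (intro A.M.finsum_addf) (simp_all add: \<mu>_closed)
  finally show ?thesis using \<nu>_boundary[OF z k] add_hom_closed[OF \<nu>_hom[OF modM g z] p\<^sub>1] by simp
qed

section \<open>The form of the generating cocycle\<close>

lemmas q0c = cocycle_dual[OF q0(1)]

lemma q0L:
  assumes "l \<in> carrier L"
  shows "q\<^sub>0 (dL l) = \<zero>\<^bsub>T\<^esub>"
proof -
  have "diff Q d q\<^sub>0 = \<zero>\<^bsub>dual_module T L\<^esub>" using cocycles_diff[OF q0(1)] unfolding Q_simps .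
  then show ?thesis using Q_simps(5)[OF assms, of q\<^sub>0] assms by simp
qed

definition g where
  "g z = \<nu> M z h\<^sub>0 p\<^sub>1"

lemma g: "semi g"
  unfolding g_def by (rule \<nu>_semi[OF modM h0 p\<^sub>1])

lemma h0m:
  assumes "m \<in> carrier M"
  shows "h\<^sub>0 m \<in> carrier T"
  by (rule tlin_closed[OF h0 assms])

text \<open>Composed with \<open>q\<^sub>0\<close>, the map \<open>hat f\<close> becomes a cocycle
  of Hom(X, A^e), hence a multiple of \<open>h\<^sub>0\<close> up to a coboundary. Reading it at
  \<open>p\<^sub>1\<close> returns \<open>f\<close>, because \<open>q\<^sub>0 p\<^sub>1\<close> acts
  on the unit as \<open>\<rho> q\<^sub>0\<close>, which is 1.\<close>

lemma all_g:
  assumes f: "semi f"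
  shows "\<exists>a\<in>carrier A. \<forall>z\<in>carrier A. f z = a \<otimes>\<^bsub>A\<^esub> g z"
proof -
  have reg: "left_module (opp T) (regular_module (opp T))" by (rule left_module_regular) (simp add: T_ring)
  have fq: "(\<lambda>m. hat f (q\<^sub>0 m)) \<in> tlin M"
  proof (rule tlinI)
    show "add_hom M T (\<lambda>m. hat f (q\<^sub>0 m))" by (rule add_hom_comp[OF dual_module_add_hom[OF q0c] hat_hom[OF f]])
    show "hat f (q\<^sub>0 (twist \<phi> r \<odot>\<^bsub>M\<^esub> m)) = r \<otimes>\<^bsub>T\<^esub> hat f (q\<^sub>0 m)" if "r \<in> carrier T" "m \<in> carrier M" for r m
      using dual_module_smult[OF q0c that(2) twist_closed[OF that(1)]]
        hat_twist[OF f that(1) dual_module_value[OF q0c that(2)]] by simp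
  qed
  obtain a k where a: "a \<in> carrier A" and k: "k \<in> tlin N"
    and eq: "\<And>m. m \<in> carrier M \<Longrightarrow> hat f (q\<^sub>0 m) = h\<^sub>0 m \<otimes>\<^bsub>T\<^esub> t \<one>\<^bsub>A\<^esub> a \<oplus>\<^bsub>T\<^esub> k (dM m)"
    using gen[OF fq] q0L add_hom_zero[OF T_group T_group hat_hom[OF f]] by auto
  have ha: "(\<lambda>m. h\<^sub>0 m \<otimes>\<^bsub>T\<^esub> t \<one>\<^bsub>A\<^esub> a) \<in> tlin M" using a by (intro tlin_mult_right[OF h0]) simp
  have "f z = a \<otimes>\<^bsub>A\<^esub> g z" if z: "z \<in> carrier A" for z
  proof -
    have "act (q\<^sub>0 p\<^sub>1) = \<one>\<^bsub>A\<^esub>" using act_p1[OF q0c] \<rho>_cocycle[OF q0(1)] q0(2) by simp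
    then have "f z = \<nu> (regular_module (opp T)) z (hat f) (q\<^sub>0 p\<^sub>1)"
      using \<nu>_hat[OF f z dual_module_value[OF q0c p\<^sub>1]] by simp
    also have "\<dots> = \<nu> M z (\<lambda>m. hat f (q\<^sub>0 m)) p\<^sub>1"
      unfolding \<nu>_def
    proof (rule A.M.finsum_cong'[OF HOL.refl])
      have um: "t (u j) \<one>\<^bsub>A\<^esub> \<odot>\<^bsub>M\<^esub> p\<^sub>1 \<in> carrier M" if "j \<in> J" for j
        using that p\<^sub>1 by (intro M.smult_closed) simp_all
      show "(\<lambda>j. \<mu> j z (hat f (q\<^sub>0 (t (u j) \<one>\<^bsub>A\<^esub> \<odot>\<^bsub>M\<^esub> p\<^sub>1)))) \<in> J \<rightarrow> carrier A"
        using z tlin_closed[OF fq um] by (simp add: \<mu>_closed)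
      show "\<mu> j z (hat f (t (u j) \<one>\<^bsub>A\<^esub> \<odot>\<^bsub>regular_module (opp T)\<^esub> q\<^sub>0 p\<^sub>1))
          = \<mu> j z (hat f (q\<^sub>0 (t (u j) \<one>\<^bsub>A\<^esub> \<odot>\<^bsub>M\<^esub> p\<^sub>1)))" if "j \<in> J" for j
        using dual_module_smult[OF q0c p\<^sub>1, of "t (u j) \<one>\<^bsub>A\<^esub>"] that by simp
    qed
    also have "\<dots> = \<nu> M z (\<lambda>m. h\<^sub>0 m \<otimes>\<^bsub>T\<^esub> t \<one>\<^bsub>A\<^esub> a) p\<^sub>1" by (rule \<nu>_cob[OF z fq ha k eq])
    also have "\<dots> = a \<otimes>\<^bsub>A\<^esub> g z" unfolding g_def by (rule \<nu>_mult_left[OF modM h0 p\<^sub>1 a z])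
    finally show ?thesis .
  qed
  then show ?thesis using a by blast
qed

text \<open>On \<open>h\<^sub>0\<close> the two right multiplications agree up to a coboundary; read
  at \<open>p\<^sub>1\<close> they are the two sides of the equation.\<close>

lemma g_\<phi>:
  assumes a: "a \<in> carrier A" and z: "z \<in> carrier A"
  shows "g (\<phi> a \<otimes>\<^bsub>A\<^esub> z) = a \<otimes>\<^bsub>A\<^esub> g z"
proof -
  obtain k where k: "k \<in> tlin N"
    and eq: "\<And>m. m \<in> carrier M \<Longrightarrow> h\<^sub>0 m \<otimes>\<^bsub>T\<^esub> t a \<one>\<^bsub>A\<^esub> = h\<^sub>0 m \<otimes>\<^bsub>T\<^esub> t \<one>\<^bsub>A\<^esub> a \<oplus>\<^bsub>T\<^esub> k (dM m)"
    using cen[OF a] by blast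
  have "g (\<phi> a \<otimes>\<^bsub>A\<^esub> z) = \<nu> M z (\<lambda>m. h\<^sub>0 m \<otimes>\<^bsub>T\<^esub> t a \<one>\<^bsub>A\<^esub>) p\<^sub>1"
    unfolding g_def by (rule \<nu>_mult_right[OF modM h0 p\<^sub>1 a z, symmetric])
  also have "\<dots> = \<nu> M z (\<lambda>m. h\<^sub>0 m \<otimes>\<^bsub>T\<^esub> t \<one>\<^bsub>A\<^esub> a) p\<^sub>1"
    using a by (intro \<nu>_cob[OF z _ _ k eq] tlin_mult_right[OF h0]) simp_all
  also have "\<dots> = a \<otimes>\<^bsub>A\<^esub> g z" unfolding g_def by (rule \<nu>_mult_left[OF modM h0 p\<^sub>1 a z])
  finally show ?thesis .
qed

lemma surj:
  assumes y: "y \<in> carrier A"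
  shows "\<exists>a\<in>carrier A. \<phi> a = y"
proof -
  note gc = semi_closed[OF g]
  have "semi (\<lambda>z. g (y \<otimes>\<^bsub>A\<^esub> z))"
    unfolding semi_def
  proof (intro conjI ballI)
    show "add_hom A A (\<lambda>z. g (y \<otimes>\<^bsub>A\<^esub> z))" by (rule add_hom_comp[OF add_mult_A(1)[OF y] semi_hom[OF g]])
    show "g (y \<otimes>\<^bsub>A\<^esub> (z \<otimes>\<^bsub>A\<^esub> \<phi> b)) = g (y \<otimes>\<^bsub>A\<^esub> z) \<otimes>\<^bsub>A\<^esub> b" if "z \<in> carrier A" "b \<in> carrier A" for z b
      using semi_right[OF g, of "y \<otimes>\<^bsub>A\<^esub> z" b] that y by (simp add: A.A.m_assoc)
  qed
  then obtain r where r: "r \<in> carrier A" and rg: "\<And>z. z \<in> carrier A \<Longrightarrow> g (y \<otimes>\<^bsub>A\<^esub> z) = r \<otimes>\<^bsub>A\<^esub> g z"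
    using all_g by blast
  \<comment> \<open>Both \<open>g y\<close> and \<open>g (\<phi> r)\<close> equal r g(1). As
    \<open>v j\<close> is a left multiple of \<open>g\<close>, it takes the same value at
    \<open>y\<close> and at \<phi>(r).\<close>
  have same: "v j y = v j (\<phi> r)" if j: "j \<in> J" for j
  proof -
    obtain a where a: "a \<in> carrier A" "\<And>z. z \<in> carrier A \<Longrightarrow> v j z = a \<otimes>\<^bsub>A\<^esub> g z"
      using all_g[OF semi_v[OF j]] by blast
    have "g y = g (\<phi> r)" using rg[of "\<one>\<^bsub>A\<^esub>"] g_\<phi>[OF r, of "\<one>\<^bsub>A\<^esub>"] y r by simp
    then show ?thesis using a y r by simp
  qed
  have "y = (\<Oplus>\<^bsub>A\<^esub>j\<in>J. u j \<otimes>\<^bsub>A\<^esub> \<phi> (v j y))" using uv[OF y] by simp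
  also have "\<dots> = (\<Oplus>\<^bsub>A\<^esub>j\<in>J. u j \<otimes>\<^bsub>A\<^esub> \<phi> (v j (\<phi> r)))"
    using r semi_closed[OF semi_v] by (intro A.M.finsum_cong' HOL.refl) (simp_all add: same)
  also have "\<dots> = \<phi> r" using r by (intro uv) simp
  finally show ?thesis using r by auto
qed

lemma kernel:
  assumes b: "b \<in> carrier A" and \<phi>b: "\<phi> b = \<zero>\<^bsub>A\<^esub>"
  shows "b = \<zero>\<^bsub>A\<^esub>"
proof -
  let ?b = "t b \<one>\<^bsub>A\<^esub>"
  have bT: "?b \<in> carrier T" using b by simp
  \<comment> \<open>These maps are the summands into which \<open>h\<^sub>0\<close> will decompose,
    already multiplied by b \<otimes> 1. The claim is additive in \<open>n\<close>, so pure tensors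
    suffice.\<close>
  have key: "cob (\<lambda>m. hat f (q\<^sub>0 m) \<otimes>\<^bsub>T\<^esub> n \<otimes>\<^bsub>T\<^esub> ?b)" if f: "semi f" and n: "n \<in> carrier T" for f n
    using n
  proof (induction rule: T_induct)
    case zero
    show ?case
      by (rule cob_cong[OF cob_zero]) (use bT hat_closed[OF f dual_module_value[OF q0c]] in simp)
  next
    case (add n n')
    show ?case
      by (rule cob_cong[OF cob_plus[OF add(3,4)]])
        (use add(1,2) bT hat_closed[OF f dual_module_value[OF q0c]] in \<open>simp add: E.l_distr E.r_distr T_mult_closed\<close>)
  next
    case (generator a a')
    then have a: "a \<in> carrier A" "a' \<in> carrier A" by simp_all
    \<comment> \<open>In (a \<otimes> a')(b \<otimes> 1) = (a b \<otimes> 1)(1 \<otimes> a') the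
      factor a b \<otimes> 1 passes through \<open>hat f\<close> and becomes 1 \<otimes> a b on the
      left of \<open>q\<^sub>0\<close>. There it multiplies the class 1 by \<phi>(a) \<phi>(b) = 0,
      so a coboundary of \<open>Q\<close> results.\<close>
    let ?c = "t \<one>\<^bsub>A\<^esub> (a \<otimes>\<^bsub>A\<^esub> b)"
    have cT: "?c \<in> carrier T" using a b by simp
    have cZ: "?c \<odot>\<^bsub>dual_module T M\<^esub> q\<^sub>0 \<in> cocycles Q d"
      using cocycles_smult[OF Q cT q0(1)] unfolding Q_simps .
    have zZ: "\<zero>\<^bsub>dual_module T M\<^esub> \<in> cocycles Q d" using cocycles_zero[OF Q, of d] unfolding Q_simps .
    have "\<kappa> (?c \<odot>\<^bsub>dual_module T M\<^esub> q\<^sub>0) = \<zero>\<^bsub>A\<^esub>"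
      using \<kappa>_smult[OF q0(1) cT] a b by (simp add: q0(2) twisted_t[OF \<phi>] \<phi>b del: dual_module_simps)
    also have "\<dots> = \<kappa> \<zero>\<^bsub>dual_module T M\<^esub>"
      using \<kappa>_ker[OF zZ] coboundaries_zero[OF Q, of d] unfolding Q_simps by simp
    finally obtain w where w: "w \<in> carrier (dual_module T N)"
      and wm: "\<And>m. m \<in> carrier M \<Longrightarrow> (?c \<odot>\<^bsub>dual_module T M\<^esub> q\<^sub>0) m = \<zero>\<^bsub>dual_module T M\<^esub> m \<oplus>\<^bsub>T\<^esub> w (dM m)"
      using \<kappa>_eq_imp[OF cZ zZ] by blast
    have hat_mult: "hat f r \<otimes>\<^bsub>T\<^esub> t (a \<otimes>\<^bsub>A\<^esub> b) \<one>\<^bsub>A\<^esub> = hat f (?c \<otimes>\<^bsub>T\<^esub> r)" if r: "r \<in> carrier T" for r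
    proof (rule add_hom_eq_on_generators[OF T_group _ _ r])
      show "add_hom T T (\<lambda>r. hat f r \<otimes>\<^bsub>T\<^esub> t (a \<otimes>\<^bsub>A\<^esub> b) \<one>\<^bsub>A\<^esub>)"
        using a b by (intro add_hom_comp[OF hat_hom[OF f] T_mult_hom_left]) simp
      show "add_hom T T (\<lambda>r. hat f (?c \<otimes>\<^bsub>T\<^esub> r))"
        by (rule add_hom_comp[OF T_mult_hom_right[OF cT] hat_hom[OF f]])
    qed (use a b semi_closed[OF f] in \<open>simp add: hat_t[OF f] t_mult_env\<close>)
    have split: "t a a' \<otimes>\<^bsub>T\<^esub> ?b = t (a \<otimes>\<^bsub>A\<^esub> b) \<one>\<^bsub>A\<^esub> \<otimes>\<^bsub>T\<^esub> t \<one>\<^bsub>A\<^esub> a'"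
      using a b by (simp add: t_mult_env)
    have a'T: "t \<one>\<^bsub>A\<^esub> a' \<in> carrier T" using a by simp
    show ?case
    proof (rule cob_cong[OF cob_mult_right[OF cob_hat[OF f w] a'T]])
      fix m assume m: "m \<in> carrier M"
      have qm: "q\<^sub>0 m \<in> carrier T" by (rule dual_module_value[OF q0c m])
      have wT: "w (dM m) \<in> carrier T" by (rule dual_module_value[OF w dM_closed[OF m]])
      have "?c \<otimes>\<^bsub>T\<^esub> q\<^sub>0 m = w (dM m)" using wm[OF m] m wT by simp
      then have "hat f (q\<^sub>0 m) \<otimes>\<^bsub>T\<^esub> t (a \<otimes>\<^bsub>A\<^esub> b) \<one>\<^bsub>A\<^esub> = hat f (w (dM m))"
        using hat_mult[OF qm] by simp
      moreover have "hat f (q\<^sub>0 m) \<otimes>\<^bsub>T\<^esub> t a a' \<otimes>\<^bsub>T\<^esub> ?b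
          = hat f (q\<^sub>0 m) \<otimes>\<^bsub>T\<^esub> t (a \<otimes>\<^bsub>A\<^esub> b) \<one>\<^bsub>A\<^esub> \<otimes>\<^bsub>T\<^esub> t \<one>\<^bsub>A\<^esub> a'"
        using a b hat_closed[OF f qm] split by (simp add: E.m_assoc)
      ultimately show "hat f (q\<^sub>0 m) \<otimes>\<^bsub>T\<^esub> t a a' \<otimes>\<^bsub>T\<^esub> ?b = hat f (w (dM m)) \<otimes>\<^bsub>T\<^esub> t \<one>\<^bsub>A\<^esub> a'" by simp
    qed
  qed
  have um: "t (u j) \<one>\<^bsub>A\<^esub> \<odot>\<^bsub>M\<^esub> p\<^sub>1 \<in> carrier M" if "j \<in> J" for j
    using that p\<^sub>1 by (intro M.smult_closed) simp_all
  let ?n = "\<lambda>j. h\<^sub>0 (t (u j) \<one>\<^bsub>A\<^esub> \<odot>\<^bsub>M\<^esub> p\<^sub>1)"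
  have nT: "?n j \<in> carrier T" if "j \<in> J" for j by (rule h0m[OF um[OF that]])
  \<comment> \<open>The expansion of \<open>r\<close> in the twisted dual basis of A^e; linearity of
    \<open>h\<^sub>0\<close> releases the coefficients \<open>hat (v j) r\<close> on the
    left.\<close>
  have expand: "h\<^sub>0 (r \<odot>\<^bsub>M\<^esub> p\<^sub>1) = (\<Oplus>\<^bsub>T\<^esub>j\<in>J. hat (v j) r \<otimes>\<^bsub>T\<^esub> ?n j)" if r: "r \<in> carrier T" for r
  proof -
    have hr: "hat (v j) r \<in> carrier T" if "j \<in> J" for j by (rule hat_closed[OF semi_v[OF that] r])
    have cl: "twist \<phi> (hat (v j) r) \<odot>\<^bsub>M\<^esub> (t (u j) \<one>\<^bsub>A\<^esub> \<odot>\<^bsub>M\<^esub> p\<^sub>1) \<in> carrier M" if "j \<in> J" for j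
      using twist_closed[OF hr[OF that]] by (intro M.smult_closed[OF _ um[OF that]]) simp
    have "h\<^sub>0 (r \<odot>\<^bsub>M\<^esub> p\<^sub>1) = h\<^sub>0 (\<Oplus>\<^bsub>M\<^esub>j\<in>J. twist \<phi> (hat (v j) r) \<odot>\<^bsub>M\<^esub> (t (u j) \<one>\<^bsub>A\<^esub> \<odot>\<^bsub>M\<^esub> p\<^sub>1))"
      using hat_expand_smult[OF modM r p\<^sub>1] by simp
    also have "\<dots> = (\<Oplus>\<^bsub>T\<^esub>j\<in>J. h\<^sub>0 (twist \<phi> (hat (v j) r) \<odot>\<^bsub>M\<^esub> (t (u j) \<one>\<^bsub>A\<^esub> \<odot>\<^bsub>M\<^esub> p\<^sub>1)))"
      using cl by (intro add_hom_finsum[OF M.M.abelian_group_axioms T_group tlin_hom[OF h0]]) simp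
    also have "\<dots> = (\<Oplus>\<^bsub>T\<^esub>j\<in>J. hat (v j) r \<otimes>\<^bsub>T\<^esub> ?n j)"
      using tlin_smult[OF h0 um hr] hr nT by (intro T.finsum_cong' HOL.refl) (simp_all add: T_mult_closed)
    finally show ?thesis .
  qed
  have cob1: "cob (\<lambda>m. h\<^sub>0 (q\<^sub>0 m \<odot>\<^bsub>M\<^esub> p\<^sub>1) \<otimes>\<^bsub>T\<^esub> ?b)"
  proof (rule cob_cong[OF cob_finsum[OF J key[OF semi_v nT]]])
    fix m assume m: "m \<in> carrier M"
    have qm: "q\<^sub>0 m \<in> carrier T" by (rule dual_module_value[OF q0c m])
    have cl: "hat (v j) (q\<^sub>0 m) \<otimes>\<^bsub>T\<^esub> ?n j \<in> carrier T" if "j \<in> J" for j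
      using hat_closed[OF semi_v[OF that] qm] nT[OF that] by (rule T_mult_closed)
    show "h\<^sub>0 (q\<^sub>0 m \<odot>\<^bsub>M\<^esub> p\<^sub>1) \<otimes>\<^bsub>T\<^esub> ?b = (\<Oplus>\<^bsub>T\<^esub>j\<in>J. hat (v j) (q\<^sub>0 m) \<otimes>\<^bsub>T\<^esub> ?n j \<otimes>\<^bsub>T\<^esub> ?b)"
      unfolding expand[OF qm] using cl by (intro add_hom_finsum[OF T_group T_group T_mult_hom_left[OF bT]]) simp
  qed simp_all
  \<comment> \<open>The cocycle \<open>\<sigma> d (ql l)\<close> has class \<xi> l, and so has the
    multiple of \<open>q\<^sub>0\<close> by \<xi> l \<otimes> 1; \<open>w\<close> records their
    difference.\<close>
  have "\<forall>l\<in>I (- d). \<exists>w\<in>carrier (dual_module T N). \<forall>m\<in>carrier M. \<sigma> d (ql l) m = t (\<xi> l) \<one>\<^bsub>A\<^esub> \<otimes>\<^bsub>T\<^esub> q\<^sub>0 m \<oplus>\<^bsub>T\<^esub> w (dM m)"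
  proof
    fix l assume l: "l \<in> I (- d)"
    have xT: "t (\<xi> l) \<one>\<^bsub>A\<^esub> \<in> carrier T" using xi_closed[OF l] by simp
    have Z: "t (\<xi> l) \<one>\<^bsub>A\<^esub> \<odot>\<^bsub>dual_module T M\<^esub> q\<^sub>0 \<in> cocycles Q d"
      using cocycles_smult[OF Q xT q0(1)] unfolding Q_simps .
    have "\<kappa> (\<sigma> d (ql l)) = \<kappa> (t (\<xi> l) \<one>\<^bsub>A\<^esub> \<odot>\<^bsub>dual_module T M\<^esub> q\<^sub>0)"
      using \<kappa>_smult[OF q0(1) xT] xi_closed[OF l]
      by (simp add: q0(2) twisted_t[OF \<phi>] \<xi>_def \<rho>_def del: dual_module_simps)
    then obtain w where w: "w \<in> carrier (dual_module T N)"
      "\<And>m. m \<in> carrier M \<Longrightarrow> \<sigma> d (ql l) m = (t (\<xi> l) \<one>\<^bsub>A\<^esub> \<odot>\<^bsub>dual_module T M\<^esub> q\<^sub>0) m \<oplus>\<^bsub>T\<^esub> w (dM m)"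
      using \<kappa>_eq_imp[OF sigma_cocycle[OF ql_dual[OF l]] Z] by blast
    then show "\<exists>w\<in>carrier (dual_module T N). \<forall>m\<in>carrier M. \<sigma> d (ql l) m = t (\<xi> l) \<one>\<^bsub>A\<^esub> \<otimes>\<^bsub>T\<^esub> q\<^sub>0 m \<oplus>\<^bsub>T\<^esub> w (dM m)"
      by (intro bexI[OF _ w(1)] ballI) simp
  qed
  then obtain w where w: "\<And>l. l \<in> I (- d) \<Longrightarrow> w l \<in> carrier (dual_module T N)"
    and sw: "\<And>l m. l \<in> I (- d) \<Longrightarrow> m \<in> carrier M \<Longrightarrow> \<sigma> d (ql l) m = t (\<xi> l) \<one>\<^bsub>A\<^esub> \<otimes>\<^bsub>T\<^esub> q\<^sub>0 m \<oplus>\<^bsub>T\<^esub> w l (dM m)"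
    by metis
  let ?k1 = "\<lambda>m. \<Oplus>\<^bsub>T\<^esub>l\<in>I (- d). h\<^sub>0 (w l (dM m) \<odot>\<^bsub>M\<^esub> e (- d) l)"
  let ?k2 = "\<lambda>m. \<Oplus>\<^bsub>T\<^esub>l\<in>I (- d). h\<^sub>0 (\<eta> d (ql l) (dM m) \<odot>\<^bsub>M\<^esub> e (- d) l)"
  have cob_k: "cob ?k1" "cob ?k2"
    by (rule cob_finsum[OF fin cob_dual[OF h0 w e_closed]], assumption+)
      (rule cob_finsum[OF fin cob_dual[OF h0 eta_closed[OF ql_dual] e_closed]], assumption+)
  have compare: "h\<^sub>0 (q\<^sub>0 m \<odot>\<^bsub>M\<^esub> p\<^sub>1) \<oplus>\<^bsub>T\<^esub> ?k1 m = h\<^sub>0 m \<oplus>\<^bsub>T\<^esub> ?k2 m" if m: "m \<in> carrier M" for m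
  proof -
    have dm: "dM m \<in> carrier N" by (rule dM_closed[OF m])
    have qm: "q\<^sub>0 m \<in> carrier T" by (rule dual_module_value[OF q0c m])
    have hom: "add_hom T T (\<lambda>r. h\<^sub>0 (r \<odot>\<^bsub>M\<^esub> p))" if "p \<in> carrier M" for p
      using M.add_hom_smult_left[OF that] by (intro add_hom_comp[OF _ tlin_hom[OF h0]]) (simp add: add_hom_def)
    have hT: "h\<^sub>0 (r \<odot>\<^bsub>M\<^esub> p) \<in> carrier T" if "r \<in> carrier T" "p \<in> carrier M" for r p
      by (rule add_hom_closed[OF hom[OF that(2)] that(1)])
    have cl: "w l (dM m) \<in> carrier T" "\<eta> d (ql l) (dM m) \<in> carrier T" "ql l m \<in> carrier T"
      "t (\<xi> l) \<one>\<^bsub>A\<^esub> \<in> carrier T" "\<eta> (d + 1) (diff Q d (ql l)) m \<in> carrier T" if "l \<in> I (- d)" for l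
      using dual_module_value[OF w[OF that] dm] dual_module_value[OF eta_closed[OF ql_dual[OF that]] dm] ql_value[OF that m] xi_closed[OF that]
        dual_module_value[OF mod_hom_closed[OF eta_hom dQd1[OF ql_dual[OF that]]] m] by simp_all
    \<comment> \<open>The sum of the \<open>e (- d) l\<close> with coefficients
      \<open>\<sigma> d (ql l) m\<close> is the transpose of \<sigma> applied to \<open>m\<close>.
      Computed through classes, \<open>h\<^sub>0\<close> of it gives the term with
      \<open>p\<^sub>1\<close>; computed through the homotopy to the identity, it gives
      \<open>h\<^sub>0 m\<close>.\<close>
    let ?S = "\<Oplus>\<^bsub>T\<^esub>l\<in>I (- d). h\<^sub>0 (\<sigma> d (ql l) m \<odot>\<^bsub>M\<^esub> e (- d) l)"
    have "?S = (\<Oplus>\<^bsub>T\<^esub>l\<in>I (- d). h\<^sub>0 (q\<^sub>0 m \<odot>\<^bsub>M\<^esub> (t (\<xi> l) \<one>\<^bsub>A\<^esub> \<odot>\<^bsub>M\<^esub> e (- d) l)) \<oplus>\<^bsub>T\<^esub> h\<^sub>0 (w l (dM m) \<odot>\<^bsub>M\<^esub> e (- d) l))"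
      using cl qm e_closed xi_smult_closed by (intro T.finsum_cong' HOL.refl)
        (simp_all add: hT sw[OF _ m] add_hom_add[OF hom] smult_smult_opp[OF modM] T_mult_closed)
    also have "\<dots> = (\<Oplus>\<^bsub>T\<^esub>l\<in>I (- d). h\<^sub>0 (q\<^sub>0 m \<odot>\<^bsub>M\<^esub> (t (\<xi> l) \<one>\<^bsub>A\<^esub> \<odot>\<^bsub>M\<^esub> e (- d) l))) \<oplus>\<^bsub>T\<^esub> ?k1 m"
      using cl qm e_closed xi_smult_closed by (intro T.finsum_addf) (simp_all add: hT)
    also have "(\<Oplus>\<^bsub>T\<^esub>l\<in>I (- d). h\<^sub>0 (q\<^sub>0 m \<odot>\<^bsub>M\<^esub> (t (\<xi> l) \<one>\<^bsub>A\<^esub> \<odot>\<^bsub>M\<^esub> e (- d) l))) = h\<^sub>0 (q\<^sub>0 m \<odot>\<^bsub>M\<^esub> p\<^sub>1)"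
      unfolding p\<^sub>1_def using qm xi_smult_closed
      by (intro add_hom_finsum[OF M.M.abelian_group_axioms T_group
            add_hom_comp[OF M.add_hom_smult_right tlin_hom[OF h0]], symmetric]) simp_all
    finally have S1: "?S = h\<^sub>0 (q\<^sub>0 m \<odot>\<^bsub>M\<^esub> p\<^sub>1) \<oplus>\<^bsub>T\<^esub> ?k1 m" .
    have seq: "\<sigma> d (ql l) m = ql l m \<oplus>\<^bsub>T\<^esub> (\<eta> d (ql l) (dM m) \<oplus>\<^bsub>T\<^esub> \<eta> (d + 1) (diff Q d (ql l)) m)"
      if l: "l \<in> I (- d)" for l
    proof -
      have "\<sigma> d (ql l) m = ql l m \<oplus>\<^bsub>T\<^esub> (diff Q (d - 1) (\<eta> d (ql l)) m \<oplus>\<^bsub>T\<^esub> \<eta> (d + 1) (diff Q d (ql l)) m)"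
        using fun_cong[OF sigma_eq[OF ql_dual[OF l]], of m] m unfolding dual_module_simps by simp
      then show ?thesis unfolding Q_simps(4)[OF m] .
    qed
    have third: "(\<Oplus>\<^bsub>T\<^esub>l\<in>I (- d). h\<^sub>0 (\<eta> (d + 1) (diff Q d (ql l)) m \<odot>\<^bsub>M\<^esub> e (- d) l)) = \<zero>\<^bsub>T\<^esub>"
    proof -
      \<comment> \<open>For fixed \<open>m\<close>, sending \<open>q\<close> to
        \<open>\<eta> (d + 1) q m\<close> is a functional on the dual of \<open>L\<close>, hence
        evaluation at some \<open>y\<close>. The sum is then \<open>h\<^sub>0\<close> at the
        boundary \<open>dL y\<close>, which is zero.\<close>
      obtain y where y: "y \<in> carrier L" and ky: "\<And>q. q \<in> carrier (dual_module T L) \<Longrightarrow> \<eta> (d + 1) q m = q y"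
        by (rule dual_module_bidual[OF modL fin db mod_hom_comp[OF eta_hom eval_hom[OF m]]]) (rule that)
      have dy: "dL y \<in> carrier M" by (rule dL_closed[OF y])
      have "\<eta> (d + 1) (diff Q d (ql l)) m = ql l (dL y)" if l: "l \<in> I (- d)" for l
        using ky[OF dQd1[OF ql_dual[OF l]]] Q_simps(5)[OF y] by simp
      then have "(\<Oplus>\<^bsub>T\<^esub>l\<in>I (- d). h\<^sub>0 (\<eta> (d + 1) (diff Q d (ql l)) m \<odot>\<^bsub>M\<^esub> e (- d) l))
          = (\<Oplus>\<^bsub>T\<^esub>l\<in>I (- d). h\<^sub>0 (ql l (dL y) \<odot>\<^bsub>M\<^esub> e (- d) l))"
        using hT[OF ql_value[OF _ dy] e_closed] by (intro T.finsum_cong' HOL.refl) (simp_all add: dy)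
      also have "\<dots> = h\<^sub>0 (\<Oplus>\<^bsub>M\<^esub>l\<in>I (- d). ql l (dL y) \<odot>\<^bsub>M\<^esub> e (- d) l)"
        using M.smult_closed[OF _ e_closed] ql_value[OF _ dy]
        by (intro add_hom_finsum[OF M.M.abelian_group_axioms T_group tlin_hom[OF h0], symmetric]) (simp add: dy)
      also have "\<dots> = \<zero>\<^bsub>T\<^esub>" using ql_expand[OF dy] h0L[OF y] by simp
      finally show ?thesis .
    qed
    have first: "(\<Oplus>\<^bsub>T\<^esub>l\<in>I (- d). h\<^sub>0 (ql l m \<odot>\<^bsub>M\<^esub> e (- d) l)) = h\<^sub>0 m"
    proof -
      have "(\<Oplus>\<^bsub>T\<^esub>l\<in>I (- d). h\<^sub>0 (ql l m \<odot>\<^bsub>M\<^esub> e (- d) l)) = h\<^sub>0 (\<Oplus>\<^bsub>M\<^esub>l\<in>I (- d). ql l m \<odot>\<^bsub>M\<^esub> e (- d) l)"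
        using M.smult_closed[OF _ e_closed] ql_value[OF _ m]
        by (intro add_hom_finsum[OF M.M.abelian_group_axioms T_group tlin_hom[OF h0], symmetric]) (simp add: m)
      then show ?thesis using ql_expand[OF m] by simp
    qed
    have "?S = (\<Oplus>\<^bsub>T\<^esub>l\<in>I (- d). h\<^sub>0 (ql l m \<odot>\<^bsub>M\<^esub> e (- d) l) \<oplus>\<^bsub>T\<^esub> (h\<^sub>0 (\<eta> d (ql l) (dM m) \<odot>\<^bsub>M\<^esub> e (- d) l) \<oplus>\<^bsub>T\<^esub>
        h\<^sub>0 (\<eta> (d + 1) (diff Q d (ql l)) m \<odot>\<^bsub>M\<^esub> e (- d) l)))"
      using cl e_closed by (intro T.finsum_cong' HOL.refl) (simp_all add: seq hT add_hom_add[OF hom] del: restrict_apply)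
    also have "\<dots> = (\<Oplus>\<^bsub>T\<^esub>l\<in>I (- d). h\<^sub>0 (ql l m \<odot>\<^bsub>M\<^esub> e (- d) l)) \<oplus>\<^bsub>T\<^esub> (?k2 m \<oplus>\<^bsub>T\<^esub>
        (\<Oplus>\<^bsub>T\<^esub>l\<in>I (- d). h\<^sub>0 (\<eta> (d + 1) (diff Q d (ql l)) m \<odot>\<^bsub>M\<^esub> e (- d) l)))"
      using cl e_closed by (simp add: T.finsum_addf hT Pi_iff T.finsum_closed del: restrict_apply)
    also have "\<dots> = h\<^sub>0 m \<oplus>\<^bsub>T\<^esub> ?k2 m"
      unfolding first third using cob_closed[OF cob_k(2) m] by simp
    finally show ?thesis using S1 by simp
  qed
  \<comment> \<open>The comparison solved for \<open>h\<^sub>0 m\<close> and multiplied by b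
    \<otimes> 1: the first summand is a coboundary by the decomposition, the others were
    coboundaries before the multiplication.\<close>
  have "cob (\<lambda>m. h\<^sub>0 (q\<^sub>0 m \<odot>\<^bsub>M\<^esub> p\<^sub>1) \<otimes>\<^bsub>T\<^esub> ?b \<oplus>\<^bsub>T\<^esub> (?k1 m \<oplus>\<^bsub>T\<^esub> \<ominus>\<^bsub>T\<^esub> ?k2 m) \<otimes>\<^bsub>T\<^esub> ?b)"
    by (intro cob_plus cob1 cob_mult_right cob_uminus cob_k bT)
  then have "cob (\<lambda>m. h\<^sub>0 m \<otimes>\<^bsub>T\<^esub> ?b)"
  proof (rule cob_cong)
    fix m assume m: "m \<in> carrier M"
    have cl: "?k1 m \<in> carrier T" "?k2 m \<in> carrier T" using cob_closed[OF cob_k(1) m] cob_closed[OF cob_k(2) m] .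
    have cl': "h\<^sub>0 (q\<^sub>0 m \<odot>\<^bsub>M\<^esub> p\<^sub>1) \<in> carrier T"
      using dual_module_value[OF q0c m] p\<^sub>1 by (intro h0m M.smult_closed) simp_all
    have "h\<^sub>0 m = h\<^sub>0 (q\<^sub>0 m \<odot>\<^bsub>M\<^esub> p\<^sub>1) \<oplus>\<^bsub>T\<^esub> ?k1 m \<oplus>\<^bsub>T\<^esub> \<ominus>\<^bsub>T\<^esub> ?k2 m"
      unfolding compare[OF m] by (rule T.add_minus_cancel[OF h0m[OF m] cl(2), symmetric])
    also have "\<dots> = h\<^sub>0 (q\<^sub>0 m \<odot>\<^bsub>M\<^esub> p\<^sub>1) \<oplus>\<^bsub>T\<^esub> (?k1 m \<oplus>\<^bsub>T\<^esub> \<ominus>\<^bsub>T\<^esub> ?k2 m)"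
      using cl cl' by (intro T.a_assoc T.a_inv_closed)
    finally show "h\<^sub>0 m \<otimes>\<^bsub>T\<^esub> ?b = h\<^sub>0 (q\<^sub>0 m \<odot>\<^bsub>M\<^esub> p\<^sub>1) \<otimes>\<^bsub>T\<^esub> ?b \<oplus>\<^bsub>T\<^esub> (?k1 m \<oplus>\<^bsub>T\<^esub> \<ominus>\<^bsub>T\<^esub> ?k2 m) \<otimes>\<^bsub>T\<^esub> ?b"
      using E.l_distr[OF cl' T.a_closed[OF cl(1) T.a_inv_closed[OF cl(2)]] bT] by simp
  qed
  then show ?thesis unfolding cob_def using inj[OF b] by blast
qed

lemma bijective: "bij_betw \<phi> (carrier A) (carrier A)"
proof -
  have "inj_on \<phi> (carrier A)"
  proof (rule inj_onI)
    fix a b assume ab: "a \<in> carrier A" "b \<in> carrier A" "\<phi> a = \<phi> b"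
    have hom: "add_hom A A \<phi>" by (intro add_homI) simp_all
    have "a \<oplus>\<^bsub>A\<^esub> \<ominus>\<^bsub>A\<^esub> b = \<zero>\<^bsub>A\<^esub>"
      by (rule kernel) (use ab in \<open>simp_all add: add_hom_minus[OF A_group A_group hom] A.M.r_neg\<close>)
    then show "a = b" using A.M.eq_add_minus[OF ab(1,2)] ab(2) by simp
  qed
  moreover have "\<phi> ` carrier A = carrier A" using surj by auto
  ultimately show ?thesis by (simp add: bij_betw_def)
qed

end

context smooth_env
begin

theorem twist_bijective: "bij_betw \<phi> (carrier A) (carrier A)"
proof (rule generator[unfolded X_tlin])
  obtain \<sigma> \<eta> where \<sigma>: "chain_map T Q (truncation d Q) \<sigma>" and \<eta>: "homotopy T Q Q \<sigma> (\<lambda>i x. x) \<eta>"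
    by (rule split)
  obtain q\<^sub>0 where q0: "q\<^sub>0 \<in> cocycles Q d" "\<kappa> q\<^sub>0 = \<one>\<^bsub>A\<^esub>"
    using imageE[OF subsetD[OF \<kappa>_surj A.A.one_closed]] by (metis (no_types))
  fix h\<^sub>0
  assume h0: "h\<^sub>0 \<in> tlin M"
    and h0L: "\<And>l. l \<in> carrier L \<Longrightarrow> h\<^sub>0 (dL l) = \<zero>\<^bsub>T\<^esub>"
    and gen: "\<And>h. h \<in> tlin M \<Longrightarrow> (\<And>l. l \<in> carrier L \<Longrightarrow> h (dL l) = \<zero>\<^bsub>T\<^esub>) \<Longrightarrow>
      \<exists>a\<in>carrier A. \<exists>k\<in>tlin N. \<forall>m\<in>carrier M. h m = h\<^sub>0 m \<otimes>\<^bsub>T\<^esub> t \<one>\<^bsub>A\<^esub> a \<oplus>\<^bsub>T\<^esub> k (dM m)"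
    and cen: "\<And>a. a \<in> carrier A \<Longrightarrow> \<exists>k\<in>tlin N. \<forall>m\<in>carrier M.
      h\<^sub>0 m \<otimes>\<^bsub>T\<^esub> t a \<one>\<^bsub>A\<^esub> = h\<^sub>0 m \<otimes>\<^bsub>T\<^esub> t \<one>\<^bsub>A\<^esub> a \<oplus>\<^bsub>T\<^esub> k (dM m)"
    and inj: "\<And>a k. \<lbrakk>a \<in> carrier A; k \<in> tlin N; \<And>m. m \<in> carrier M \<Longrightarrow>
      h\<^sub>0 m \<otimes>\<^bsub>T\<^esub> t a \<one>\<^bsub>A\<^esub> = k (dM m)\<rbrakk> \<Longrightarrow> a = \<zero>\<^bsub>A\<^esub>"
  have "resolved_env K A \<phi> J u v P I e c \<epsilon> d \<kappa> \<sigma> \<eta> q\<^sub>0 h\<^sub>0"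
    by (intro resolved_env.intro smooth_env_axioms resolved_env_axioms.intro \<sigma> \<eta> q0 h0 h0L gen cen inj)
  then show ?thesis by (rule resolved_env.bijective)
qed

end

section \<open>The dualizing bimodule\<close>

lemma cohomology_simps [simp]:
  "zero (cohomology C i) = coboundaries C i"
  "add (cohomology C i) = set_add ((obj C i)\<lparr>carrier := cocycles C i\<rparr>)"
  by (simp_all add: cohomology_def quot_module_def)

lemma set_add_eq: "X <+>\<^bsub>G\<^esub> Y = {x \<oplus>\<^bsub>G\<^esub> y | x y. x \<in> X \<and> y \<in> Y}"
  by (auto simp: set_add_def set_mult_def)

lemma cohomology_add:
  assumes C: "cochain_complex R C" and x: "x \<in> cocycles C i" and y: "y \<in> cocycles C i"
  shows "(coboundaries C i +>\<^bsub>obj C i\<^esub> x) \<oplus>\<^bsub>cohomology C i\<^esub> (coboundaries C i +>\<^bsub>obj C i\<^esub> y)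
    = coboundaries C i +>\<^bsub>obj C i\<^esub> (x \<oplus>\<^bsub>obj C i\<^esub> y)"
proof -
  interpret M: abelian_group "obj C i" by (rule complex_group[OF C])
  note cl = cocycles_carrier[OF x] cocycles_carrier[OF y]
  have ac: "(b \<oplus>\<^bsub>obj C i\<^esub> x) \<oplus>\<^bsub>obj C i\<^esub> (b' \<oplus>\<^bsub>obj C i\<^esub> y) = (b \<oplus>\<^bsub>obj C i\<^esub> b') \<oplus>\<^bsub>obj C i\<^esub> (x \<oplus>\<^bsub>obj C i\<^esub> y)"
    if "b \<in> coboundaries C i" "b' \<in> coboundaries C i" for b b'
    using that[THEN coboundaries_carrier[OF C]] cl by (simp add: M.a_ac)
  show ?thesis
  proof (rule subset_antisym)
    show "(coboundaries C i +>\<^bsub>obj C i\<^esub> x) \<oplus>\<^bsub>cohomology C i\<^esub> (coboundaries C i +>\<^bsub>obj C i\<^esub> y)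
      \<subseteq> coboundaries C i +>\<^bsub>obj C i\<^esub> (x \<oplus>\<^bsub>obj C i\<^esub> y)"
      using coboundaries_add[OF C, of _ i] ac by (fastforce simp: set_add_eq a_r_coset_eq)
    have "b \<oplus>\<^bsub>obj C i\<^esub> (x \<oplus>\<^bsub>obj C i\<^esub> y) = (b \<oplus>\<^bsub>obj C i\<^esub> x) \<oplus>\<^bsub>obj C i\<^esub> (\<zero>\<^bsub>obj C i\<^esub> \<oplus>\<^bsub>obj C i\<^esub> y)"
      if "b \<in> coboundaries C i" for b
      using coboundaries_carrier[OF C that] cl by (simp add: M.a_assoc)
    then show "coboundaries C i +>\<^bsub>obj C i\<^esub> (x \<oplus>\<^bsub>obj C i\<^esub> y)
      \<subseteq> (coboundaries C i +>\<^bsub>obj C i\<^esub> x) \<oplus>\<^bsub>cohomology C i\<^esub> (coboundaries C i +>\<^bsub>obj C i\<^esub> y)"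
      using coboundaries_zero[OF C, of i] by (simp add: set_add_eq a_r_coset_eq) blast
  qed
qed

lemma cohomology_smult:
  assumes C: "cochain_complex R C" and x: "x \<in> cocycles C i" and r: "r \<in> carrier R"
  shows "r \<odot>\<^bsub>cohomology C i\<^esub> (coboundaries C i +>\<^bsub>obj C i\<^esub> x) = coboundaries C i +>\<^bsub>obj C i\<^esub> (r \<odot>\<^bsub>obj C i\<^esub> x)"
proof -
  interpret M: left_module R "obj C i" by (rule complex_module[OF C])
  note xc = cocycles_carrier[OF x]
  have "coboundaries C i +>\<^bsub>obj C i\<^esub> (r \<odot>\<^bsub>obj C i\<^esub> y) = coboundaries C i +>\<^bsub>obj C i\<^esub> (r \<odot>\<^bsub>obj C i\<^esub> x)"
    if y: "y \<in> coboundaries C i +>\<^bsub>obj C i\<^esub> x" for y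
  proof -
    obtain b where b: "b \<in> coboundaries C i" "y = b \<oplus>\<^bsub>obj C i\<^esub> x" using y by (auto simp: a_r_coset_eq)
    have bc: "b \<in> carrier (obj C i)" by (rule coboundaries_carrier[OF C b(1)])
    have "r \<odot>\<^bsub>obj C i\<^esub> y = r \<odot>\<^bsub>obj C i\<^esub> x \<oplus>\<^bsub>obj C i\<^esub> r \<odot>\<^bsub>obj C i\<^esub> b"
      using bc xc r by (simp add: b(2) M.smult_r_distr M.smult_closed M.M.a_comm)
    then show ?thesis
      using coboundary_coset_eq_iff[OF C, of "r \<odot>\<^bsub>obj C i\<^esub> y" i "r \<odot>\<^bsub>obj C i\<^esub> x"]
        coboundaries_smult[OF C r b(1)] bc xc r by (auto simp: b(2) M.smult_closed)
  qed
  moreover have "x \<in> coboundaries C i +>\<^bsub>obj C i\<^esub> x"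
    using coboundaries_zero[OF C, of i] xc by (force simp: a_r_coset_eq)
  moreover have "r \<odot>\<^bsub>cohomology C i\<^esub> Y = (\<Union>y\<in>Y. coboundaries C i +>\<^bsub>obj C i\<^esub> (r \<odot>\<^bsub>obj C i\<^esub> y))" for Y
    by (simp add: cohomology_def quot_module_def a_r_coset_eq)
  ultimately show ?thesis by blast
qed

lemma coset_eq_coboundaries_iff:
  assumes C: "cochain_complex R C" and x: "x \<in> cocycles C i"
  shows "coboundaries C i +>\<^bsub>obj C i\<^esub> x = coboundaries C i \<longleftrightarrow> x \<in> coboundaries C i"
proof -
  interpret M: abelian_group "obj C i" by (rule complex_group[OF C])
  have z: "coboundaries C i +>\<^bsub>obj C i\<^esub> \<zero>\<^bsub>obj C i\<^esub> = coboundaries C i"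
    using coboundaries_carrier[OF C, of _ i] by (force simp: a_r_coset_eq)
  have "(\<exists>b\<in>coboundaries C i. x = \<zero>\<^bsub>obj C i\<^esub> \<oplus>\<^bsub>obj C i\<^esub> b) \<longleftrightarrow> x \<in> coboundaries C i"
    using coboundaries_carrier[OF C, of _ i] by force
  then show ?thesis
    using coboundary_coset_eq_iff[OF C cocycles_carrier[OF x] M.zero_closed] unfolding z by simp
qed

lemma cohomology_trivial_imp:
  assumes C: "cochain_complex R C" and triv: "carrier (cohomology C i) = {\<zero>\<^bsub>cohomology C i\<^esub>}"
  shows "cocycles C i \<subseteq> coboundaries C i"
proof
  fix x assume x: "x \<in> cocycles C i"
  then have "coboundaries C i +>\<^bsub>obj C i\<^esub> x \<in> {coboundaries C i}"
    using triv unfolding cohomology_carrier by auto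
  then show "x \<in> coboundaries C i" using coset_eq_coboundaries_iff[OF C x] by simp
qed

section \<open>Resolutions provided by smoothness\<close>

lemma proj_complexI:
  fixes C :: "('r, 'm) cochain"
  assumes C: "cochain_complex R C" and b: "bounded_above C" and pr: "\<And>i. projective R (obj C i)"
  obtains I :: "int \<Rightarrow> 'm set" and e :: "int \<Rightarrow> 'm \<Rightarrow> 'm" and c where "proj_complex R C I e c"
proof -
  have "\<exists>Iec :: 'm set \<times> ('m \<Rightarrow> 'm) \<times> ('m \<Rightarrow> 'm \<Rightarrow> 'r). dual_basis R (obj C i) (fst Iec) (fst (snd Iec)) (snd (snd Iec))" for i
  proof -
    obtain I :: "'m set" and e c where "dual_basis R (obj C i) I e c" by (rule projective_imp_dual_basis[OF pr])
    then show ?thesis by (intro exI[of _ "(I, e, c)"]) simp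
  qed
  then obtain F :: "int \<Rightarrow> 'm set \<times> ('m \<Rightarrow> 'm) \<times> ('m \<Rightarrow> 'm \<Rightarrow> 'r)"
    where "\<And>i. dual_basis R (obj C i) (fst (F i)) (fst (snd (F i))) (snd (snd (F i)))" by metis
  then have "proj_complex R C (\<lambda>i. fst (F i)) (\<lambda>i. fst (snd (F i))) (\<lambda>i. snd (snd (F i)))"
    using C b by (simp add: proj_complex_def)
  then show ?thesis by (rule that)
qed

context env_algebra
begin

abbreviation "diag \<equiv> concentrated 0 (diagonal_bimodule A)"

text \<open>Perfectness provides only a roof between \<open>P\<close> and the diagonal bimodule.
  Projectivity of \<open>P\<close> splits the leg that ends in \<open>P\<close> up to homotopy, and
  composing with the other leg gives a quasi-isomorphism out of \<open>P\<close> itself. Finite dual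
  bases are then chosen anew in each degree.\<close>

lemma perfect_resolution:
  assumes "homologically_smooth K A"
  obtains P :: "(('a \<times> 'a) list set, nat \<Rightarrow> ('a \<times> 'a) list set) cochain" and \<epsilon>
    and I :: "int \<Rightarrow> (nat \<Rightarrow> ('a \<times> 'a) list set) set" and e c
  where "qis (opp T) P diag \<epsilon>" "\<And>i. finite (I i)" "\<And>i. dual_basis (opp T) (obj P i) (I i) (e i) (c i)"
    "\<exists>lo hi. \<forall>i. i < lo \<or> hi < i \<longrightarrow> carrier (obj P i) = {\<zero>\<^bsub>obj P i\<^esub>}" "\<And>i. projective (opp T) (obj P i)"
proof -
  obtain P :: "(('a \<times> 'a) list set, nat \<Rightarrow> ('a \<times> 'a) list set) cochain" where P: "cochain_complex (opp T) P"
    and b: "\<exists>lo hi. \<forall>i. i < lo \<or> hi < i \<longrightarrow> carrier (obj P i) = {\<zero>\<^bsub>obj P i\<^esub>}"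
    and fg: "\<And>i. finitely_generated (opp T) (obj P i)" and pr: "\<And>i. projective (opp T) (obj P i)"
    and di: "derived_isomorphic (opp T) P diag"
    using assms unfolding homologically_smooth_def perfect_def env_def by blast
  have ba: "bounded_above P" using b unfolding bounded_above_def by blast
  obtain I :: "int \<Rightarrow> (nat \<Rightarrow> ('a \<times> 'a) list set) set" and e :: "int \<Rightarrow> (nat \<Rightarrow> ('a \<times> 'a) list set) \<Rightarrow> (nat \<Rightarrow> ('a \<times> 'a) list set)" and c
    where pc: "proj_complex (opp T) P I e c" by (rule proj_complexI[OF P ba pr])
  obtain Z :: "(('a \<times> 'a) list set, nat \<Rightarrow> ('a \<times> 'a) list set \<times> (nat \<Rightarrow> ('a \<times> 'a) list set) \<times> 'a) cochain" and f g
    where f: "qis (opp T) Z P f" and g: "qis (opp T) Z diag g"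
    using di unfolding derived_isomorphic_def quasi_iso_iff_qis by blast
  obtain s where s: "qis (opp T) P Z s" using qis_lift[OF pc f qis_ident[OF P]] by blast
  have "\<exists>Iec :: (nat \<Rightarrow> ('a \<times> 'a) list set) set \<times> ((nat \<Rightarrow> ('a \<times> 'a) list set) \<Rightarrow> (nat \<Rightarrow> ('a \<times> 'a) list set)) \<times> ((nat \<Rightarrow> ('a \<times> 'a) list set) \<Rightarrow> (nat \<Rightarrow> ('a \<times> 'a) list set) \<Rightarrow> ('a \<times> 'a) list set). finite (fst Iec) \<and> dual_basis (opp T) (obj P i) (fst Iec) (fst (snd Iec)) (snd (snd Iec))" for i
  proof -
    obtain I :: "(nat \<Rightarrow> ('a \<times> 'a) list set) set" and e c
      where "finite I" "dual_basis (opp T) (obj P i) I e c" by (rule finite_dual_basis[OF fg pr])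
    then show ?thesis by (intro exI[of _ "(I, e, c)"]) simp
  qed
  then obtain F :: "int \<Rightarrow> (nat \<Rightarrow> ('a \<times> 'a) list set) set \<times> ((nat \<Rightarrow> ('a \<times> 'a) list set) \<Rightarrow> (nat \<Rightarrow> ('a \<times> 'a) list set)) \<times> ((nat \<Rightarrow> ('a \<times> 'a) list set) \<Rightarrow> (nat \<Rightarrow> ('a \<times> 'a) list set) \<Rightarrow> ('a \<times> 'a) list set)"
    where F: "\<And>i. finite (fst (F i))"
    "\<And>i. dual_basis (opp T) (obj P i) (fst (F i)) (fst (snd (F i))) (snd (snd (F i)))" by metis
  show ?thesis by (rule that[OF qis_compose[OF s g] F b pr])
qed

text \<open>RHom is formed with a resolution picked by the choice operator, about which nothing can
  be said unless one exists in the prescribed type. The resolution from smoothness is moved there by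
  adding a constant second component.\<close>

lemma resolution_exists:
  assumes "homologically_smooth K A"
  shows "\<exists>P :: (('a \<times> 'a) list set, nat \<Rightarrow> ('a \<times> 'a) list set \<times> 'a) cochain. projective_resolution (opp T) P diag"
proof -
  obtain P :: "(('a \<times> 'a) list set, nat \<Rightarrow> ('a \<times> 'a) list set) cochain" and \<epsilon>
    where \<epsilon>: "qis (opp T) P diag \<epsilon>"
    and b: "\<exists>lo hi. \<forall>i. i < lo \<or> hi < i \<longrightarrow> carrier (obj P i) = {\<zero>\<^bsub>obj P i\<^esub>}"
    and pr: "\<And>i. projective (opp T) (obj P i)"
    by (rule perfect_resolution[OF assms]) (rule that)
  let ?\<iota> = "\<lambda>x n. (x n, undefined) :: ('a \<times> 'a) list set \<times> 'a"
  have \<iota>: "inj ?\<iota>" by (auto simp: inj_def fun_eq_iff)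
  have "projective_resolution (opp T) (embed_complex ?\<iota> P) diag"
    unfolding projective_resolution_def quasi_iso_iff_qis
  proof (intro conjI allI)
    show "\<exists>hi. \<forall>i>hi. carrier (obj (embed_complex ?\<iota> P) i) = {\<zero>\<^bsub>obj (embed_complex ?\<iota> P) i\<^esub>}"
    proof -
      obtain hi where "\<And>i. hi < i \<Longrightarrow> carrier (obj P i) = {\<zero>\<^bsub>obj P i\<^esub>}" using b by blast
      then show ?thesis by (intro exI[of _ hi]) simp
    qed
    show "projective (opp T) (obj (embed_complex ?\<iota> P) i)" for i
      using projective_embed[OF pr \<iota>] by simp
    show "\<exists>f. qis (opp T) (embed_complex ?\<iota> P) diag f"
      using qis_compose[OF qis_embed[OF qis_source[OF \<epsilon>] \<iota>] \<epsilon>] by blast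
  qed
  then show ?thesis by blast
qed

text \<open>The endomorphism \<open>\<phi>\<close> describes the right action on the left generator of the cohomology.\<close>

lemma twisted_cohomology:
  assumes C: "cochain_complex T C"
    and \<theta>: "\<theta> \<in> mod_hom A (left_part K A (cohomology C d)) (regular_module A)"
    and bij: "bij_betw \<theta> (carrier (left_part K A (cohomology C d))) (carrier (regular_module A))"
  obtains \<phi> where "linear_endo \<phi>"
    "(\<lambda>x. \<theta> (coboundaries C d +>\<^bsub>obj C d\<^esub> x)) \<in> mod_hom T ((obj C d)\<lparr>carrier := cocycles C d\<rparr>) (twisted_bimodule A \<phi>)"
    "\<forall>x\<in>cocycles C d. \<theta> (coboundaries C d +>\<^bsub>obj C d\<^esub> x) = \<zero>\<^bsub>A\<^esub> \<longleftrightarrow> x \<in> coboundaries C d"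
    "carrier A \<subseteq> (\<lambda>x. \<theta> (coboundaries C d +>\<^bsub>obj C d\<^esub> x)) ` cocycles C d"
proof -
  interpret M: left_module T "obj C d" by (rule complex_module[OF C])
  let ?H = "cohomology C d" and ?c = "\<lambda>x. coboundaries C d +>\<^bsub>obj C d\<^esub> x"
  define \<kappa> where "\<kappa> x = \<theta> (?c x)" for x
  have cH: "?c x \<in> carrier ?H" if "x \<in> cocycles C d" for x
    using that unfolding cohomology_carrier by blast
  have lp: "carrier (left_part K A ?H) = carrier ?H" "add (left_part K A ?H) = add ?H"
    "a \<odot>\<^bsub>left_part K A ?H\<^esub> y = t a \<one>\<^bsub>A\<^esub> \<odot>\<^bsub>?H\<^esub> y" for a y
    by (simp_all add: left_part_def)
  have \<kappa>_closed: "\<kappa> x \<in> carrier A" if "x \<in> cocycles C d" for x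
    using mod_hom_closed[OF \<theta>, unfolded lp, OF cH[OF that]] by (simp add: \<kappa>_def)
  have \<kappa>_add: "\<kappa> (x \<oplus>\<^bsub>obj C d\<^esub> y) = \<kappa> x \<oplus>\<^bsub>A\<^esub> \<kappa> y" if "x \<in> cocycles C d" "y \<in> cocycles C d" for x y
    using mod_hom_add[OF \<theta>, unfolded lp, OF cH[OF that(1)] cH[OF that(2)]]
    unfolding \<kappa>_def cohomology_add[OF C that] by simp
  have \<kappa>_left: "\<kappa> (t a \<one>\<^bsub>A\<^esub> \<odot>\<^bsub>obj C d\<^esub> x) = a \<otimes>\<^bsub>A\<^esub> \<kappa> x" if a: "a \<in> carrier A" and x: "x \<in> cocycles C d" for a x
    using mod_hom_smult[OF \<theta>, unfolded lp, OF cH[OF x] a]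
      cohomology_smult[OF C x, of "t a \<one>\<^bsub>A\<^esub>"] a unfolding \<kappa>_def by simp
  have \<kappa>_eq: "\<kappa> x = \<kappa> y \<longleftrightarrow> ?c x = ?c y" if "x \<in> cocycles C d" "y \<in> cocycles C d" for x y
    using inj_on_eq_iff[OF bij_betw_imp_inj_on[OF bij[unfolded lp]] cH[OF that(1)] cH[OF that(2)]] by (simp add: \<kappa>_def)
  have surj: "carrier A \<subseteq> \<kappa> ` cocycles C d"
    using bij_betw_imp_surj_on[OF bij[unfolded lp]] unfolding cohomology_carrier \<kappa>_def by (simp add: image_image)
  then obtain x\<^sub>1 where x1: "x\<^sub>1 \<in> cocycles C d" "\<kappa> x\<^sub>1 = \<one>\<^bsub>A\<^esub>"
    using imageE[OF subsetD[OF surj A.A.one_closed]] by (metis (no_types))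
  note Z = cocycles_smult[OF C _ , of _ _ d] and xc = cocycles_carrier[OF x1(1)]
  define \<phi> where "\<phi> b = \<kappa> (t \<one>\<^bsub>A\<^esub> b \<odot>\<^bsub>obj C d\<^esub> x\<^sub>1)" for b
  have \<phi>_closed: "\<phi> b \<in> carrier A" if "b \<in> carrier A" for b
    unfolding \<phi>_def using that x1 by (intro \<kappa>_closed Z) simp_all
  have \<kappa>_class: "\<kappa> (r \<odot>\<^bsub>obj C d\<^esub> x) = \<kappa> (r \<odot>\<^bsub>obj C d\<^esub> y)"
    if "r \<in> carrier T" "x \<in> cocycles C d" "y \<in> cocycles C d" "\<kappa> x = \<kappa> y" for r x y
    using cohomology_smult[OF C that(2,1)] cohomology_smult[OF C that(3,1)] that \<kappa>_eq[OF that(2,3)]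
    by (simp add: \<kappa>_def)
  have \<kappa>_t: "\<kappa> (t a b \<odot>\<^bsub>obj C d\<^esub> x) = a \<otimes>\<^bsub>A\<^esub> \<kappa> x \<otimes>\<^bsub>A\<^esub> \<phi> b"
    if a: "a \<in> carrier A" and b: "b \<in> carrier A" and x: "x \<in> cocycles C d" for a b x
  proof -
    let ?k = "\<kappa> x"
    have k: "?k \<in> carrier A" by (rule \<kappa>_closed[OF x])
    have bx: "t \<one>\<^bsub>A\<^esub> b \<odot>\<^bsub>obj C d\<^esub> x\<^sub>1 \<in> cocycles C d" using b x1 by (intro Z) simp_all
    have kx: "t ?k \<one>\<^bsub>A\<^esub> \<odot>\<^bsub>obj C d\<^esub> x\<^sub>1 \<in> cocycles C d" using k x1 by (intro Z) simp_all
    \<comment> \<open>\<open>x\<close> and the multiple of the generator by k \<otimes> 1, with k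
      its own value, have the same class; so the computation is made on \<open>x\<^sub>1\<close>,
      where k and \<open>a\<close> multiply from the left and \<open>b\<close> yields
      \<phi>(b).\<close>
    have "\<kappa> x = \<kappa> (t ?k \<one>\<^bsub>A\<^esub> \<odot>\<^bsub>obj C d\<^esub> x\<^sub>1)" using \<kappa>_left[OF k x1(1)] x1(2) k by simp
    then have "\<kappa> (t a b \<odot>\<^bsub>obj C d\<^esub> x) = \<kappa> (t a b \<odot>\<^bsub>obj C d\<^esub> (t ?k \<one>\<^bsub>A\<^esub> \<odot>\<^bsub>obj C d\<^esub> x\<^sub>1))"
      using a b by (intro \<kappa>_class[OF _ x kx]) simp_all
    also have "t a b \<odot>\<^bsub>obj C d\<^esub> (t ?k \<one>\<^bsub>A\<^esub> \<odot>\<^bsub>obj C d\<^esub> x\<^sub>1) = t (a \<otimes>\<^bsub>A\<^esub> ?k) b \<odot>\<^bsub>obj C d\<^esub> x\<^sub>1"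
      using a b k xc M.smult_assoc[of "t a b" "t ?k \<one>\<^bsub>A\<^esub>" x\<^sub>1] by (simp add: t_mult_env)
    also have "\<dots> = t (a \<otimes>\<^bsub>A\<^esub> ?k) \<one>\<^bsub>A\<^esub> \<odot>\<^bsub>obj C d\<^esub> (t \<one>\<^bsub>A\<^esub> b \<odot>\<^bsub>obj C d\<^esub> x\<^sub>1)"
      using a b k xc M.smult_assoc[of "t (a \<otimes>\<^bsub>A\<^esub> ?k) \<one>\<^bsub>A\<^esub>" "t \<one>\<^bsub>A\<^esub> b" x\<^sub>1] by (simp add: t_mult_env)
    also have "\<kappa> \<dots> = a \<otimes>\<^bsub>A\<^esub> ?k \<otimes>\<^bsub>A\<^esub> \<phi> b"
      using a k by (simp add: \<kappa>_left[OF _ bx] \<phi>_def)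
    finally show ?thesis .
  qed
  have \<kappa>_smult_hom: "add_hom T A (\<lambda>r. \<kappa> (r \<odot>\<^bsub>obj C d\<^esub> x))" if x: "x \<in> cocycles C d" for x
    using x cocycles_carrier[OF x]
    by (intro add_homI) (simp_all add: \<kappa>_closed Z \<kappa>_add M.smult_l_distr)
  have \<phi>: "linear_endo \<phi>"
    unfolding linear_endo_def
  proof (intro conjI ballI ring_hom_memI)
    show "\<phi> (b \<oplus>\<^bsub>A\<^esub> b') = \<phi> b \<oplus>\<^bsub>A\<^esub> \<phi> b'" if "b \<in> carrier A" "b' \<in> carrier A" for b b'
      unfolding \<phi>_def using add_hom_add[OF add_hom_comp[OF add_hom_t_right \<kappa>_smult_hom[OF x1(1)]]] that by simp
    show "\<phi> (b \<otimes>\<^bsub>A\<^esub> b') = \<phi> b \<otimes>\<^bsub>A\<^esub> \<phi> b'" if b: "b \<in> carrier A" "b' \<in> carrier A" for b b'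
    proof -
      \<comment> \<open>The second factor of A^e has the opposite product, so 1 \<otimes> b b' acts
        by 1 \<otimes> b first and by 1 \<otimes> b' afterwards. This order makes \<phi>
        multiplicative rather than antimultiplicative.\<close>
      have "t \<one>\<^bsub>A\<^esub> (b \<otimes>\<^bsub>A\<^esub> b') \<odot>\<^bsub>obj C d\<^esub> x\<^sub>1 = t \<one>\<^bsub>A\<^esub> b' \<odot>\<^bsub>obj C d\<^esub> (t \<one>\<^bsub>A\<^esub> b \<odot>\<^bsub>obj C d\<^esub> x\<^sub>1)"
        using b xc M.smult_assoc[of "t \<one>\<^bsub>A\<^esub> b'" "t \<one>\<^bsub>A\<^esub> b" x\<^sub>1] by (simp add: t_mult_env)
      moreover have "t \<one>\<^bsub>A\<^esub> b \<odot>\<^bsub>obj C d\<^esub> x\<^sub>1 \<in> cocycles C d" using b x1 by (intro Z) simp_all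
      ultimately have "\<phi> (b \<otimes>\<^bsub>A\<^esub> b') = \<one>\<^bsub>A\<^esub> \<otimes>\<^bsub>A\<^esub> \<phi> b \<otimes>\<^bsub>A\<^esub> \<phi> b'"
        using \<kappa>_t[OF A.A.one_closed b(2)] unfolding \<phi>_def by simp
      then show ?thesis using \<phi>_closed[OF b(1)] by simp
    qed
    show "\<phi> \<one>\<^bsub>A\<^esub> = \<one>\<^bsub>A\<^esub>"
      unfolding \<phi>_def T_one_env[symmetric] using M.smult_one[OF xc] x1(2) by simp
    show "\<phi> (k \<odot>\<^bsub>A\<^esub> b) = k \<odot>\<^bsub>A\<^esub> \<phi> b" if "k \<in> carrier K" "b \<in> carrier A" for k b
    proof -
      have "t \<one>\<^bsub>A\<^esub> (k \<odot>\<^bsub>A\<^esub> b) = t (k \<odot>\<^bsub>A\<^esub> \<one>\<^bsub>A\<^esub>) b" using t_smult[of k "\<one>\<^bsub>A\<^esub>" b] that by simp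
      then have "\<phi> (k \<odot>\<^bsub>A\<^esub> b) = (k \<odot>\<^bsub>A\<^esub> \<one>\<^bsub>A\<^esub>) \<otimes>\<^bsub>A\<^esub> \<one>\<^bsub>A\<^esub> \<otimes>\<^bsub>A\<^esub> \<phi> b"
        using \<kappa>_t[of "k \<odot>\<^bsub>A\<^esub> \<one>\<^bsub>A\<^esub>" b x\<^sub>1] that x1 unfolding \<phi>_def by simp
      then show ?thesis using that \<phi>_closed by (simp add: A.smult_mult_left)
    qed
  qed (fact \<phi>_closed)
  have "(\<lambda>x. \<kappa> x) \<in> mod_hom T ((obj C d)\<lparr>carrier := cocycles C d\<rparr>) (twisted_bimodule A \<phi>)"
  proof (rule mod_homI)
    fix r x assume r: "r \<in> carrier T" and "x \<in> carrier ((obj C d)\<lparr>carrier := cocycles C d\<rparr>)"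
    then have x: "x \<in> cocycles C d" by simp
    have "\<kappa> (r \<odot>\<^bsub>obj C d\<^esub> x) = r \<odot>\<^bsub>twisted_bimodule A \<phi>\<^esub> \<kappa> x"
      by (rule add_hom_eq_on_generators[OF A_group \<kappa>_smult_hom[OF x] twisted_add_hom[OF \<phi> \<kappa>_closed[OF x]] r])
        (simp add: \<kappa>_t x twisted_t[OF \<phi>] \<kappa>_closed)
    then show "\<kappa> (r \<odot>\<^bsub>(obj C d)\<lparr>carrier := cocycles C d\<rparr>\<^esub> x) = r \<odot>\<^bsub>twisted_bimodule A \<phi>\<^esub> \<kappa> x" by simp
  qed (simp_all add: \<kappa>_closed \<kappa>_add)
  moreover have "\<kappa> x = \<zero>\<^bsub>A\<^esub> \<longleftrightarrow> x \<in> coboundaries C d" if x: "x \<in> cocycles C d" for x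
  proof -
    have z: "\<zero>\<^bsub>obj C d\<^esub> \<in> cocycles C d" by (rule cocycles_zero[OF C])
    have "\<kappa> \<zero>\<^bsub>obj C d\<^esub> \<oplus>\<^bsub>A\<^esub> \<kappa> \<zero>\<^bsub>obj C d\<^esub> = \<kappa> \<zero>\<^bsub>obj C d\<^esub>" using \<kappa>_add[OF z z] by simp
    then have "\<kappa> \<zero>\<^bsub>obj C d\<^esub> = \<zero>\<^bsub>A\<^esub>" by (rule A.M.double_eq_self[OF \<kappa>_closed[OF z]])
    moreover have "?c \<zero>\<^bsub>obj C d\<^esub> = coboundaries C d"
      using coset_eq_coboundaries_iff[OF C z] coboundaries_zero[OF C] by simp
    ultimately show ?thesis using \<kappa>_eq[OF x z] coset_eq_coboundaries_iff[OF C x] by simp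
  qed
  ultimately show ?thesis using that[OF \<phi>] surj unfolding \<kappa>_def by blast
qed

text \<open>The finite dual basis of the right module is carried to \<open>A\<close> along \<theta>,
  which turns the right action of \<open>b\<close> into right multiplication by \<phi>(b). Linear
  forms over the opposite ring thereby become semilinear maps.\<close>

lemma twisted_dual_basis:
  fixes C :: "(('a \<times> 'a) list set, 'm) cochain"
  assumes C: "cochain_complex T C"
    and \<theta>: "\<theta> \<in> mod_hom A (left_part K A (cohomology C d)) (regular_module A)"
    and bij: "bij_betw \<theta> (carrier (left_part K A (cohomology C d))) (carrier (regular_module A))"
    and \<phi>: "linear_endo \<phi>"
    and \<kappa>: "(\<lambda>x. \<theta> (coboundaries C d +>\<^bsub>obj C d\<^esub> x)) \<in> mod_hom T ((obj C d)\<lparr>carrier := cocycles C d\<rparr>) (twisted_bimodule A \<phi>)"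
    and fg: "finitely_generated (opp A) (right_part K A (cohomology C d))"
    and pr: "projective (opp A) (right_part K A (cohomology C d))"
  obtains J :: "'m set set" and u v where "twisted_env K A \<phi> J u v"
proof -
  let ?H = "cohomology C d" and ?R = "right_part K A (cohomology C d)"
  obtain J :: "'m set set" and u' and v' :: "'m set \<Rightarrow> 'm set \<Rightarrow> 'a" where J: "finite J" and db: "dual_basis (opp A) ?R J u' v'"
    by (rule finite_dual_basis[OF fg pr])
  have R: "left_module (opp A) ?R" using fg by (simp add: finitely_generated_def)
  interpret R: left_module "opp A" ?R by fact
  have rp: "carrier ?R = carrier ?H" "add ?R = add ?H" "b \<odot>\<^bsub>?R\<^esub> y = t \<one>\<^bsub>A\<^esub> b \<odot>\<^bsub>?H\<^esub> y" for b y
    by (simp_all add: right_part_def)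
  have lp: "carrier (left_part K A ?H) = carrier ?H" "add (left_part K A ?H) = add ?H"
    by (simp_all add: left_part_def)
  have \<theta>_hom: "add_hom ?R A \<theta>"
    using mod_hom_add_hom[OF \<theta>] by (simp add: add_hom_def lp rp)
  have \<theta>_right: "\<theta> (b \<odot>\<^bsub>?R\<^esub> y) = \<theta> y \<otimes>\<^bsub>A\<^esub> \<phi> b" if b: "b \<in> carrier A" and y: "y \<in> carrier ?R" for b y
  proof -
    obtain x where x: "x \<in> cocycles C d" "y = coboundaries C d +>\<^bsub>obj C d\<^esub> x"
      using y unfolding rp cohomology_carrier by blast
    have \<theta>x: "\<theta> y \<in> carrier A" by (rule add_hom_closed[OF \<theta>_hom y])
    have "\<theta> (b \<odot>\<^bsub>?R\<^esub> y) = \<theta> (coboundaries C d +>\<^bsub>obj C d\<^esub> (t \<one>\<^bsub>A\<^esub> b \<odot>\<^bsub>obj C d\<^esub> x))"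
      unfolding rp x(2) using cohomology_smult[OF C x(1), of "t \<one>\<^bsub>A\<^esub> b"] b by simp
    also have "\<dots> = t \<one>\<^bsub>A\<^esub> b \<odot>\<^bsub>twisted_bimodule A \<phi>\<^esub> \<theta> y"
      using mod_hom_smult[OF \<kappa>, of x "t \<one>\<^bsub>A\<^esub> b"] x b by simp
    finally show ?thesis using b \<theta>x by (simp add: twisted_t[OF \<phi>])
  qed
  have bij': "bij_betw \<theta> (carrier ?R) (carrier A)" using bij by (simp add: lp rp)
  define \<psi> where "\<psi> = inv_into (carrier ?R) \<theta>"
  have \<psi>: "\<psi> a \<in> carrier ?R" "\<theta> (\<psi> a) = a" if "a \<in> carrier A" for a
    using that bij' f_inv_into_f[of a \<theta> "carrier ?R"] inv_into_into[of a \<theta> "carrier ?R"]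
    by (auto simp: \<psi>_def bij_betw_def)
  have \<psi>_eqI: "\<psi> a = y" if "y \<in> carrier ?R" "\<theta> y = a" for a y
    using that bij' by (auto simp: \<psi>_def bij_betw_def)
  have u': "u' j \<in> carrier ?R" and v': "v' j \<in> mod_hom (opp A) ?R (regular_module (opp A))" if "j \<in> J" for j
    using db that by (auto simp: dual_basis_def)
  have v'_closed: "v' j y \<in> carrier A" if "j \<in> J" "y \<in> carrier ?R" for j y
    using mod_hom_closed[OF v'[OF that(1)] that(2)] by simp
  have "twisted_env K A \<phi> J (\<lambda>j. \<theta> (u' j)) (\<lambda>j a. v' j (\<psi> a))"
  proof (intro twisted_env.intro twisted_env_axioms.intro env_algebra_axioms \<phi> J)
    show "\<theta> (u' j) \<in> carrier A" if "j \<in> J" for j by (rule add_hom_closed[OF \<theta>_hom u'[OF that]])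
    show "add_hom A A (\<lambda>a. v' j (\<psi> a))" if j: "j \<in> J" for j
    proof (rule add_homI)
      show "v' j (\<psi> a) \<in> carrier A" if "a \<in> carrier A" for a using v'_closed[OF j \<psi>(1)[OF that]] .
      fix a b assume ab: "a \<in> carrier A" "b \<in> carrier A"
      have "\<psi> (a \<oplus>\<^bsub>A\<^esub> b) = \<psi> a \<oplus>\<^bsub>?R\<^esub> \<psi> b"
        using \<psi>[OF ab(1)] \<psi>[OF ab(2)] by (intro \<psi>_eqI) (simp_all add: add_hom_add[OF \<theta>_hom])
      then show "v' j (\<psi> (a \<oplus>\<^bsub>A\<^esub> b)) = v' j (\<psi> a) \<oplus>\<^bsub>A\<^esub> v' j (\<psi> b)"
        using mod_hom_add[OF v'[OF j] \<psi>(1)[OF ab(1)] \<psi>(1)[OF ab(2)]] by simp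
    qed
    show "v' j (\<psi> (x \<otimes>\<^bsub>A\<^esub> \<phi> b)) = v' j (\<psi> x) \<otimes>\<^bsub>A\<^esub> b" if j: "j \<in> J" and x: "x \<in> carrier A" and b: "b \<in> carrier A" for j x b
    proof -
      have "\<psi> (x \<otimes>\<^bsub>A\<^esub> \<phi> b) = b \<odot>\<^bsub>?R\<^esub> \<psi> x"
        using \<psi>[OF x] b \<theta>_right[OF b \<psi>(1)[OF x]] R.smult_closed[of b "\<psi> x"] by (intro \<psi>_eqI) simp_all
      then show ?thesis using mod_hom_smult[OF v'[OF j] \<psi>(1)[OF x], of b] b by simp
    qed
    show "(\<Oplus>\<^bsub>A\<^esub>j\<in>J. \<theta> (u' j) \<otimes>\<^bsub>A\<^esub> \<phi> (v' j (\<psi> x))) = x" if x: "x \<in> carrier A" for x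
    proof -
      have cl: "v' j (\<psi> x) \<odot>\<^bsub>?R\<^esub> u' j \<in> carrier ?R" if "j \<in> J" for j
        using v'_closed[OF that \<psi>(1)[OF x]] u'[OF that] by (intro R.smult_closed) simp_all
      have "x = \<theta> (\<Oplus>\<^bsub>?R\<^esub>j\<in>J. v' j (\<psi> x) \<odot>\<^bsub>?R\<^esub> u' j)"
        using db \<psi>[OF x] unfolding finite_dual_basis_iff[OF R J] by auto
      also have "\<dots> = (\<Oplus>\<^bsub>A\<^esub>j\<in>J. \<theta> (v' j (\<psi> x) \<odot>\<^bsub>?R\<^esub> u' j))"
        using cl by (intro add_hom_finsum[OF R.M.abelian_group_axioms A_group \<theta>_hom]) simp
      also have "\<dots> = (\<Oplus>\<^bsub>A\<^esub>j\<in>J. \<theta> (u' j) \<otimes>\<^bsub>A\<^esub> \<phi> (v' j (\<psi> x)))"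
        using v'_closed[OF _ \<psi>(1)[OF x]] u' add_hom_closed[OF \<theta>_hom u'] linear_endo_simps(1)[OF \<phi>]
        by (intro A.M.finsum_cong' HOL.refl) (simp_all add: \<theta>_right)
      finally show ?thesis by simp
    qed
  qed
  then show ?thesis by (rule that)
qed

end

theorem proposition0p1:
  fixes K :: "('k, 'y) ring_scheme" and A :: "('k, 'a) module" and d :: nat
  assumes "assoc_algebra K A"
    and "homologically_smooth K A"
    and "\<And>i :: int. i \<noteq> int d \<Longrightarrow> carrier (Ext_env K A i) = {\<zero>\<^bsub>Ext_env K A i\<^esub>}"
    and "finitely_generated (opp A) (right_part K A (Ext_env K A (int d)))"
    and "projective (opp A) (right_part K A (Ext_env K A (int d)))"
    and "mod_isomorphic A (left_part K A (Ext_env K A (int d))) (regular_module A)"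
  shows "skew_Calabi_Yau K A d"
proof -
  interpret env_algebra K A by (rule env_algebra.intro[OF assms(1)])
  \<comment> \<open>The very resolution inside \<open>RHom_env\<close>. It is known to be projective
    and bounded above, but not to be finite.\<close>
  define P\<^sub>0 :: "(('a \<times> 'a) list set, nat \<Rightarrow> ('a \<times> 'a) list set \<times> 'a) cochain"
    where "P\<^sub>0 = (SOME P. projective_resolution (opp T) P diag)"
  let ?C = "dual_complex T P\<^sub>0"
  have RHom: "RHom_env K A = ?C" by (simp add: RHom_env_def RHom_dual_def env_def P\<^sub>0_def)
  have Ext: "Ext_env K A i = cohomology ?C i" for i by (simp add: Ext_env_def RHom)
  have res: "projective_resolution (opp T) P\<^sub>0 diag"
    unfolding P\<^sub>0_def by (rule someI_ex[OF resolution_exists[OF assms(2)]])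
  obtain f where f: "qis (opp T) P\<^sub>0 diag f"
    using res unfolding projective_resolution_def quasi_iso_iff_qis by blast
  note P0 = qis_source[OF f]
  have "bounded_above P\<^sub>0" and pr0: "\<And>i. projective (opp T) (obj P\<^sub>0 i)"
    using res unfolding projective_resolution_def bounded_above_def by blast+
  then obtain I\<^sub>0 :: "int \<Rightarrow> (nat \<Rightarrow> ('a \<times> 'a) list set \<times> 'a) set" and e\<^sub>0 :: "int \<Rightarrow> (nat \<Rightarrow> ('a \<times> 'a) list set \<times> 'a) \<Rightarrow> (nat \<Rightarrow> ('a \<times> 'a) list set \<times> 'a)" and c\<^sub>0
    where pc0: "proj_complex (opp T) P\<^sub>0 I\<^sub>0 e\<^sub>0 c\<^sub>0"
    by (rule proj_complexI[OF P0])
  have C: "cochain_complex T ?C" by (rule cochain_complex_dual[OF P0])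
  have exC: "cocycles ?C i \<subseteq> coboundaries ?C i" if "i \<noteq> int d" for i
    using cohomology_trivial_imp[OF C] assms(3)[OF that] unfolding Ext by simp
  obtain \<theta> where \<theta>: "\<theta> \<in> mod_hom A (left_part K A (cohomology ?C (int d))) (regular_module A)"
    and bij: "bij_betw \<theta> (carrier (left_part K A (cohomology ?C (int d)))) (carrier (regular_module A))"
    using assms(6) unfolding mod_isomorphic_def Ext by blast
  define \<kappa>\<^sub>0 where "\<kappa>\<^sub>0 x = \<theta> (coboundaries ?C (int d) +>\<^bsub>obj ?C (int d)\<^esub> x)" for x
  obtain \<phi> where \<phi>: "linear_endo \<phi>"
    and \<kappa>0: "\<kappa>\<^sub>0 \<in> mod_hom T ((obj ?C (int d))\<lparr>carrier := cocycles ?C (int d)\<rparr>) (twisted_bimodule A \<phi>)"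
    and ker0: "\<forall>x\<in>cocycles ?C (int d). \<kappa>\<^sub>0 x = \<zero>\<^bsub>A\<^esub> \<longleftrightarrow> x \<in> coboundaries ?C (int d)"
    and surj0: "carrier A \<subseteq> \<kappa>\<^sub>0 ` cocycles ?C (int d)"
    by (rule twisted_cohomology[OF C \<theta> bij, folded \<kappa>\<^sub>0_def]) (rule that)
  obtain J :: "((nat \<Rightarrow> ('a \<times> 'a) list set \<times> 'a) \<Rightarrow> ('a \<times> 'a) list set) set set" and u v where te: "twisted_env K A \<phi> J u v"
    using twisted_dual_basis[OF C \<theta> bij \<phi> \<kappa>0[unfolded \<kappa>\<^sub>0_def]] assms(4,5) unfolding Ext by blast
  obtain P :: "(('a \<times> 'a) list set, nat \<Rightarrow> ('a \<times> 'a) list set) cochain" and \<epsilon>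
    and I :: "int \<Rightarrow> (nat \<Rightarrow> ('a \<times> 'a) list set) set" and e c
    where \<epsilon>: "qis (opp T) P diag \<epsilon>" and fin: "\<And>i. finite (I i)"
      and db: "\<And>i. dual_basis (opp T) (obj P i) (I i) (e i) (c i)"
      and bounded: "\<exists>lo hi. \<forall>i. i < lo \<or> hi < i \<longrightarrow> carrier (obj P i) = {\<zero>\<^bsub>obj P i\<^esub>}"
    by (rule perfect_resolution[OF assms(2)]) (rule that)
  note P = qis_source[OF \<epsilon>]
  have pcP: "proj_complex (opp T) P I e c"
    using P db bounded unfolding proj_complex_def bounded_above_def by blast
  let ?Q = "dual_complex T P"
  have Q: "cochain_complex T ?Q" by (rule cochain_complex_dual[OF P])
  \<comment> \<open>Both complexes resolve \<open>A\<close>, so the chosen resolution maps to the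
    finite one. Dualizing reverses the direction, and composition with \<open>?S\<close> carries the
    class map to the dual of the finite resolution.\<close>
  obtain s where s: "qis (opp T) P\<^sub>0 P s" using qis_lift[OF pc0 \<epsilon> f] by blast
  let ?S = "dual_map P\<^sub>0 s"
  have S: "qis T ?Q ?C ?S" by (rule qis_dual[OF pc0 pcP s])
  note Sc = qis_chain_map[OF S]
  note SZ = chain_map_cocycles[OF Q C Sc] and SB = chain_map_coboundaries[OF Q C Sc]
  have \<kappa>0c: "\<kappa>\<^sub>0 x \<in> carrier A" if "x \<in> cocycles ?C (int d)" for x
    using mod_hom_closed[OF \<kappa>0, of x] that by simp
  have \<kappa>0a: "\<kappa>\<^sub>0 (x \<oplus>\<^bsub>obj ?C (int d)\<^esub> y) = \<kappa>\<^sub>0 x \<oplus>\<^bsub>A\<^esub> \<kappa>\<^sub>0 y"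
    if "x \<in> cocycles ?C (int d)" "y \<in> cocycles ?C (int d)" for x y
    using mod_hom_add[OF \<kappa>0, of x y] that by (simp del: dual_complex_simps)
  have \<kappa>0s: "\<kappa>\<^sub>0 (r \<odot>\<^bsub>obj ?C (int d)\<^esub> x) = r \<odot>\<^bsub>twisted_bimodule A \<phi>\<^esub> \<kappa>\<^sub>0 x"
    if "r \<in> carrier T" "x \<in> cocycles ?C (int d)" for r x
    using mod_hom_smult[OF \<kappa>0, of x r] that by (simp del: dual_complex_simps)
  have "smooth_env K A \<phi> J u v P I e c \<epsilon> (int d) (\<lambda>x. \<kappa>\<^sub>0 (?S (int d) x))"
  proof (intro smooth_env.intro te smooth_env_axioms.intro P fin db bounded \<epsilon>)
    show "cocycles ?Q i \<subseteq> coboundaries ?Q i" if "i \<noteq> int d" for i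
      using exC[OF that] SZ[of _ i] qis_inj[OF S, of _ i] by blast
    show "(\<lambda>x. \<kappa>\<^sub>0 (?S (int d) x)) \<in> mod_hom T ((obj ?Q (int d))\<lparr>carrier := cocycles ?Q (int d)\<rparr>) (twisted_bimodule A \<phi>)"
    proof (rule mod_homI)
      fix x assume "x \<in> carrier ((obj ?Q (int d))\<lparr>carrier := cocycles ?Q (int d)\<rparr>)"
      then have x: "x \<in> cocycles ?Q (int d)" by simp
      note xc = cocycles_carrier[OF x]
      show "\<kappa>\<^sub>0 (?S (int d) x) \<in> carrier (twisted_bimodule A \<phi>)" using \<kappa>0c[OF SZ[OF x]] by simp
      show "\<kappa>\<^sub>0 (?S (int d) (x \<oplus>\<^bsub>(obj ?Q (int d))\<lparr>carrier := cocycles ?Q (int d)\<rparr>\<^esub> y))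
          = \<kappa>\<^sub>0 (?S (int d) x) \<oplus>\<^bsub>twisted_bimodule A \<phi>\<^esub> \<kappa>\<^sub>0 (?S (int d) y)"
        if y: "y \<in> carrier ((obj ?Q (int d))\<lparr>carrier := cocycles ?Q (int d)\<rparr>)" for y
      proof -
        have y': "y \<in> cocycles ?Q (int d)" using y by simp
        show ?thesis
          using mod_hom_add[OF chain_map_hom[OF Sc] xc cocycles_carrier[OF y']] \<kappa>0a[OF SZ[OF x] SZ[OF y']]
          by (simp del: dual_complex_simps)
      qed
      show "\<kappa>\<^sub>0 (?S (int d) (r \<odot>\<^bsub>(obj ?Q (int d))\<lparr>carrier := cocycles ?Q (int d)\<rparr>\<^esub> x))
          = r \<odot>\<^bsub>twisted_bimodule A \<phi>\<^esub> \<kappa>\<^sub>0 (?S (int d) x)" if r: "r \<in> carrier T" for r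
        using mod_hom_smult[OF chain_map_hom[OF Sc] xc r] \<kappa>0s[OF r SZ[OF x]] by (simp del: dual_complex_simps)
    qed
    \<comment> \<open>The map \<open>?S\<close> preserves coboundaries and, being a
      quasi-isomorphism, detects them among cocycles.\<close>
    show "\<kappa>\<^sub>0 (?S (int d) x) = \<zero>\<^bsub>A\<^esub> \<longleftrightarrow> x \<in> coboundaries ?Q (int d)" if x: "x \<in> cocycles ?Q (int d)" for x
      using bspec[OF ker0 SZ[OF x]] qis_inj[OF S x] SB[of x "int d"] by blast
    show "carrier A \<subseteq> (\<lambda>x. \<kappa>\<^sub>0 (?S (int d) x)) ` cocycles ?Q (int d)"
    proof
      fix a assume a: "a \<in> carrier A"
      then obtain z where z: "z \<in> cocycles ?C (int d)" "\<kappa>\<^sub>0 z = a" using surj0 by blast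
      obtain x b where x: "x \<in> cocycles ?Q (int d)" and b: "b \<in> coboundaries ?C (int d)"
        and eq: "?S (int d) x = z \<oplus>\<^bsub>obj ?C (int d)\<^esub> b" by (rule qis_surj[OF S z(1)])
      have bZ: "b \<in> cocycles ?C (int d)" using b coboundaries_subset_cocycles[OF C] by blast
      have "\<kappa>\<^sub>0 (?S (int d) x) = a" unfolding eq \<kappa>0a[OF z(1) bZ] using bspec[OF ker0 bZ] b z(2) a by simp
      then show "a \<in> (\<lambda>x. \<kappa>\<^sub>0 (?S (int d) x)) ` cocycles ?Q (int d)" using x by blast
    qed
  qed
  then have bij\<phi>: "bij_betw \<phi> (carrier A) (carrier A)" by (rule smooth_env.twist_bijective)
  \<comment> \<open>The isomorphism is formed with the complex that defines RHom and its class map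
    \<open>\<kappa>\<^sub>0\<close>; the finite resolution served to show that \<phi> is
    bijective.\<close>
  have "derived_isomorphic T ?C (concentrated (int d) (twisted_bimodule A \<phi>))"
    using \<kappa>0 ker0 surj0 exC
    by (intro derived_isomorphic_concentrated[OF C left_module_twisted[OF \<phi>], where h = \<kappa>\<^sub>0]) simp_all
  moreover have "algebra_automorphism K A \<phi>"
    using \<phi> bij\<phi> by (simp add: algebra_automorphism_def linear_endo_def)
  ultimately show ?thesis
    using assms(2) unfolding skew_Calabi_Yau_def RHom env_def by blast
qed

end
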